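(* Let $\Omega$ be a rank-$(m+1)$ pre-calibration on $\bar M=\mathbb R^{m+n}$. Assume that $\bar\nabla\Omega=0$ (or $C_\Omega=0$), and that $\phi:M^m\to\mathbb R^{m+n}$ is a closed immersed oriented submanifold with parallel mean curvature and $\Omega$-calibrated extended tangent space. Consider the height functions $$h=\bar g(\phi,\nu),\qquad S=\sum_{ij}\bar g\big(\phi,(B(e_i,e_j))^F\big)\,B^\nu(e_i,e_j).$$ If $\phi:M\to\bar M$ is $\Omega$-stable and $\int_M S\,(2+h\|H\|)\,dM\le 0$, then $\phi$ is pseudo-umbilical and a minimal calibrated extension $M'$ of $M$ exists with $R'=-\|B^{M'}(\nu,\nu)\|^2=0$ and $S=0$. Furthermore, if $NM$ is a trivial bundle, then $M'=\mathbb R^{m+1}$, $M$ is a Euclidean sphere, and $\Omega$ satisfies the following: for a fixed global parallel orthonormal basis $W_\alpha$ ($1\le\alpha\le n-1$) of $TM'^\perp=\mathbb R^{n-1}$, the $1$-forms $\xi(W_\alpha,W_\beta)$ on $M$ are co-exact, that is, $\xi(W_\alpha,W_\beta)=\delta\omega_{\alpha\beta}$ for some $2$-forms $\omega_{\alpha\beta}$ on $M$, and $$\sum_{\alpha<\beta}-2m\|H\|\int_M\langle\omega_{\alpha\beta},df_\alpha\wedge df_\beta\rangle\,dM\le\sum_\alpha\int_M\|df_\alpha\|^2\,dM\qquad\text{for all } f_\alpha,f_\beta\in C^\infty(M);$$ in this case, for each $\alpha,\beta$ and any smooth functions $f,k$ on $M$, $$2m\|H\|\left|\int_M\langle\omega_{\alpha\beta},df\wedge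 dk\rangle dM\right|\le\int_M(\|df\|^2+\|dk\|^2)dM,$$ $$m\|H\|\left|\int_M\omega_{\alpha\beta}(\nabla f,\nabla k)dM\right|\le\sqrt{\int_M\|\nabla f\|^2dM}\,\sqrt{\int_M\|\nabla k\|^2dM}.$$
   Context: A rank-$(m+1)$ pre-calibration on $\bar M$ is a smooth $(m+1)$-form $\Omega$ with $|\Omega(u_1,\dots,u_{m+1})|\le1$ for all orthonormal systems, with equality for some orthonormal system at each point; the span of such a system is called $\Omega$-calibrated, and an $(m+1)$-dimensional submanifold with $\Omega$-calibrated tangent spaces is $\Omega$-calibrated. $\bar g,\bar\nabla$ are the Euclidean metric and connection of $\mathbb R^{m+n}$. Closed means compact without boundary. $g=\phi^*\bar g$, $NM$ is the normal bundle, $\perp$ the projection onto it, $\nabla^\perp$ the normal connection, $B$ the second fundamental form, $H=\frac1m\mathrm{trace}_gB$, $e_i$ a local direct (positively oriented) orthonormal frame of $M$, identified with $d\phi(e_i)$. Parallel mean curvature: $\nabla^\perp H=0$. $\Omega$-calibrated extended tangent space: there is a smooth global unit section $\nu$ of $NM$ with $\bar g(H,\nu)=\|H\|$ and $\Omega(\nu,d\phi(e_1),\dots,d\phi(e_m))=1$; $EM=\mathbb R\nu\oplus TM$. $B^\nu=\bar g(B,\nu)$. The normal bundle splits orthogonally as $NM=\mathbb R\nu\oplus F$, and $(\cdot)^F$ is the projection onto $F$. $\phi$ is pseudo-umbilical if $\bar g(B(\cdot,\cdot),H)=\|H\|^2g$. A calibrated extension of $M$ is an $\Omega$-calibrated $(m+1)$-dimensional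 submanifold $M'$ of $\bar M$ containing $M$ with $TM'=EM$ along $M$; minimal means zero mean curvature in $\bar M$. $B^{M'}$ is the second fundamental form of $M'$ in $\bar M$ and $R'=\mathrm{Ricci}'(\nu,\nu)$, with $\mathrm{Ricci}'$ the Ricci tensor of $M'$. $C_\Omega$ is the first-order self-adjoint differential operator, with values in $C^\infty(NM)$ and depending only on $W^\perp$, defined by: for all sections $W,W'$ of $\phi^{-1}T\bar M$, $$\int_M\bar g(C_\Omega(W),W')dM=\int_M\Big(\sum_i\tfrac12\big[\Omega(W^\perp,e_1,\dots,\nabla^\perp_{e_i}W'^\perp,\dots,e_m)+\Omega(W'^\perp,e_1,\dots,\nabla^\perp_{e_i}W^\perp,\dots,e_m)\big]+\tfrac12\big[(\bar\nabla_{W^\perp}\Omega)(W'^\perp,e_1,\dots,e_m)+(\bar\nabla_{W'^\perp}\Omega)(W^\perp,e_1,\dots,e_m)\big]\Big)dM,$$ where the derivative term is in the position of $e_i$. $\Omega$-stability (on the closed manifold $M$): let $\mathcal F_M=\{f\in C^\infty(M):\int_Mf\,dM=0\}$, $\mathcal F_{M,\Omega}=\{f(\nu+N): f\in\mathcal F_M,\ N\in C^\infty(F)\}$, and $H^1_{0,T}(NM)$ the $H^1$-completion of the vector space spanned by $\mathcal F_{M,\Omega}$. $\phi$ is $\Omega$-stable if for all $W\in H^1_{0,T}(NM)$ $$I_\Omega(W,W)=\int_M\Big(\|\nabla^\perp W\|^2-\sum_{ij}\bar g(W,B(e_i,e_j))^2+m\|H\|\,\bar g(C_\Omega(W),W)\Big)dM\ge0$$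 (the ambient curvature term vanishes since $\bar M$ is flat). $\xi:\wedge^2NM\to T^*M$ is defined by $\xi(W,W')(u)=\Omega(W,W',*u)$ with $*$ the star operator on $M$, $*e_i=(-1)^{i-1}e_1\wedge\dots\wedge\hat e_i\wedge\dots\wedge e_m$. $\delta$ is the codifferential on $M$ and $\langle\ ,\ \rangle$ the Hilbert-Schmidt inner product of $2$-forms, with $\langle\omega,df\wedge dk\rangle=\omega(\nabla f,\nabla k)$.
   Formalization: "NM trivial" means NM has a global parallel orthonormal frame; co-exactness of ξ(W_α,W_β) is claimed only for m≥2; if only C_Ω=0 (not ∇̄Ω=0), M' is claimed Ω-calibrated only along M. Each claim fails as printed otherwise. *)

theory Defs
  imports "HOL-Analysis.Analysis"
begin

section \<open>Linear algebra\<close>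

definition orthonormal :: "'e::real_inner list \<Rightarrow> bool" where
  "orthonormal us \<longleftrightarrow>
     (\<forall>i<length us. \<forall>j<length us. (us ! i) \<bullet> (us ! j) = (if i = j then 1 else 0))"

definition proj :: "'e::euclidean_space set \<Rightarrow> 'e \<Rightarrow> 'e" where
  "proj V w = (THE u. u \<in> V \<and> (\<forall>v\<in>V. (w - u) \<bullet> v = 0))"


section \<open>Differential forms on Euclidean space and calibrations\<close>

text \<open>A \<open>k\<close>-covector is a function on lists; only its values on lists of length \<open>k\<close> matter.\<close>

definition covector :: "nat \<Rightarrow> ('e::real_vector list \<Rightarrow> real) \<Rightarrow> bool" where
  "covector k \<theta> \<longleftrightarrow>
     (\<forall>us i. length us = k \<longrightarrow> i < k \<longrightarrow> linear (\<lambda>v. \<theta> (us[i := v]))) \<and>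
     (\<forall>us i j. length us = k \<longrightarrow> i < j \<longrightarrow> j < k \<longrightarrow> us ! i = us ! j \<longrightarrow> \<theta> us = 0)"

text \<open>\<open>C\<^sup>k\<close> and smooth maps; meant for open \<open>S\<close>.\<close>

primrec Ck_on :: "nat \<Rightarrow> 'a::euclidean_space set \<Rightarrow> ('a \<Rightarrow> 'b::real_normed_vector) \<Rightarrow> bool" where
  "Ck_on 0 S f \<longleftrightarrow> continuous_on S f"
| "Ck_on (Suc k) S f \<longleftrightarrow>
     f differentiable_on S \<and> (\<forall>v. Ck_on k S (\<lambda>x. frechet_derivative f (at x) v))"

definition smooth_on :: "'a::euclidean_space set \<Rightarrow> ('a \<Rightarrow> 'b::real_normed_vector) \<Rightarrow> bool" where
  "smooth_on S f \<longleftrightarrow> (\<forall>k. Ck_on k S f)"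

definition smooth_form :: "nat \<Rightarrow> ('e::euclidean_space \<Rightarrow> 'e list \<Rightarrow> real) \<Rightarrow> bool" where
  "smooth_form k \<Omega> \<longleftrightarrow>
     (\<forall>x. covector k (\<Omega> x)) \<and> (\<forall>us. length us = k \<longrightarrow> smooth_on UNIV (\<lambda>x. \<Omega> x us))"

definition pre_calibration :: "nat \<Rightarrow> ('e::euclidean_space \<Rightarrow> 'e list \<Rightarrow> real) \<Rightarrow> bool" where
  "pre_calibration k \<Omega> \<longleftrightarrow> smooth_form k \<Omega> \<and>
     (\<forall>x us. length us = k \<longrightarrow> orthonormal us \<longrightarrow> \<bar>\<Omega> x us\<bar> \<le> 1) \<and>
     (\<forall>x. \<exists>us. length us = k \<and> orthonormal us \<and> \<bar>\<Omega> x us\<bar> = 1)"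

definition calibrated_plane :: "nat \<Rightarrow> ('e::euclidean_space list \<Rightarrow> real) \<Rightarrow> 'e set \<Rightarrow> bool" where
  "calibrated_plane k \<theta> T \<longleftrightarrow>
     (\<exists>us. length us = k \<and> orthonormal us \<and> \<bar>\<theta> us\<bar> = 1 \<and> span (set us) = T)"

text \<open>\<open>nabla_form \<Omega> x w us\<close> is the covariant derivative of \<open>\<Omega>\<close> at \<open>x\<close> in direction \<open>w\<close>,
  evaluated on \<open>us\<close>, for the flat connection.\<close>

definition nabla_form :: "('e::euclidean_space \<Rightarrow> 'e list \<Rightarrow> real) \<Rightarrow> 'e \<Rightarrow> 'e \<Rightarrow> 'e list \<Rightarrow> real" where
  "nabla_form \<Omega> x w us = frechet_derivative (\<lambda>y. \<Omega> y us) (at x) w"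

definition parallel_form :: "nat \<Rightarrow> ('e::euclidean_space \<Rightarrow> 'e list \<Rightarrow> real) \<Rightarrow> bool" where
  "parallel_form k \<Omega> \<longleftrightarrow> (\<forall>x w us. length us = k \<longrightarrow> nabla_form \<Omega> x w us = 0)"


section \<open>Smooth manifolds\<close>

text \<open>A chart is a pair of its domain and its coordinate map into the model space.\<close>

type_synonym ('p, 'b) chart = "'p set \<times> ('p \<Rightarrow> 'b)"

definition in_chart :: "('p, 'b) chart \<Rightarrow> ('p \<Rightarrow> 'c) \<Rightarrow> 'b \<Rightarrow> 'c" where
  "in_chart c f = f \<circ> inv_into (fst c) (snd c)"

definition smooth_manifold ::
  "'p::t2_space set \<Rightarrow> ('p, 'b::euclidean_space) chart set \<Rightarrow> bool" where
  "smooth_manifold M A \<longleftrightarrow> M \<noteq> {} \<and> second_countable (top_of_set M) \<and> \<Union> (fst ` A) = M \<and>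
     (\<forall>c\<in>A. openin (top_of_set M) (fst c) \<and> open (snd c ` fst c) \<and>
        homeomorphism (fst c) (snd c ` fst c) (snd c) (inv_into (fst c) (snd c))) \<and>
     (\<forall>c\<in>A. \<forall>d\<in>A. smooth_on (snd c ` (fst c \<inter> fst d)) (in_chart c (snd d)))"

definition closed_manifold ::
  "'p::t2_space set \<Rightarrow> ('p, 'b::euclidean_space) chart set \<Rightarrow> bool" where
  "closed_manifold M A \<longleftrightarrow> smooth_manifold M A \<and> compact M"

definition oriented_atlas :: "('p, real ^ 'm) chart set \<Rightarrow> bool" where
  "oriented_atlas A \<longleftrightarrow> (\<forall>c\<in>A. \<forall>d\<in>A. \<forall>p \<in> fst c \<inter> fst d.
     0 < det (matrix (frechet_derivative (in_chart c (snd d)) (at (snd c p)))))"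

definition chart_at :: "('p, 'b) chart set \<Rightarrow> 'p \<Rightarrow> ('p, 'b) chart" where
  "chart_at A p = (SOME c. c \<in> A \<and> p \<in> fst c)"

definition coord :: "('p, 'b) chart set \<Rightarrow> 'p \<Rightarrow> 'b" where
  "coord A p = snd (chart_at A p) p"

definition smooth_fun ::
  "('p, 'b::euclidean_space) chart set \<Rightarrow> ('p \<Rightarrow> 'c::real_normed_vector) \<Rightarrow> bool" where
  "smooth_fun A f \<longleftrightarrow> (\<forall>c\<in>A. smooth_on (snd c ` fst c) (in_chart c f))"

definition smooth_map ::
  "'p::t2_space set \<Rightarrow> ('p, 'b::euclidean_space) chart set \<Rightarrow>
   'q::t2_space set \<Rightarrow> ('q, 'd::euclidean_space) chart set \<Rightarrow> ('p \<Rightarrow> 'q) \<Rightarrow> bool" where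
  "smooth_map M A N A' f \<longleftrightarrow> continuous_on M f \<and> f ` M \<subseteq> N \<and>
     (\<forall>c\<in>A. \<forall>d\<in>A'. smooth_on (snd c ` (fst c \<inter> f -` fst d)) (in_chart c (snd d \<circ> f)))"


section \<open>Immersed submanifolds of Euclidean space\<close>

text \<open>Throughout, \<open>\<phi>\<close> is an immersion into a Euclidean space; tangent vectors are identified with
  their images under its differential, so tangent spaces are subspaces of the ambient space.\<close>

definition immersion ::
  "('p, 'b::euclidean_space) chart set \<Rightarrow> ('p \<Rightarrow> 'e::euclidean_space) \<Rightarrow> bool" where
  "immersion A \<phi> \<longleftrightarrow> smooth_fun A \<phi> \<and>
     (\<forall>c\<in>A. \<forall>p\<in>fst c. inj (frechet_derivative (in_chart c \<phi>) (at (snd c p))))"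

definition dmap ::
  "('p, 'b::euclidean_space) chart set \<Rightarrow> ('p \<Rightarrow> 'e::euclidean_space) \<Rightarrow> 'p \<Rightarrow> 'b \<Rightarrow> 'e" where
  "dmap A \<phi> p = frechet_derivative (in_chart (chart_at A p) \<phi>) (at (coord A p))"

definition Tan ::
  "('p, 'b::euclidean_space) chart set \<Rightarrow> ('p \<Rightarrow> 'e::euclidean_space) \<Rightarrow> 'p \<Rightarrow> 'e set" where
  "Tan A \<phi> p = range (dmap A \<phi> p)"

definition components ::
  "('p, 'b::euclidean_space) chart set \<Rightarrow> ('p \<Rightarrow> 'e::euclidean_space) \<Rightarrow> 'p \<Rightarrow> 'e \<Rightarrow> 'b" where
  "components A \<phi> p u = inv (dmap A \<phi> p) u"

definition perp ::
  "('p, 'b::euclidean_space) chart set \<Rightarrow> ('p \<Rightarrow> 'e::euclidean_space) \<Rightarrow> 'p \<Rightarrow> 'e \<Rightarrow> 'e" where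
  "perp A \<phi> p = proj {w. \<forall>v\<in>Tan A \<phi> p. w \<bullet> v = 0}"

text \<open>Derivative of a function on the manifold along a tangent vector \<open>u\<close>. For vector-valued \<open>f\<close>,
  i.e. a section of the pulled back tangent bundle of the ambient space, this is the ambient
  (pull-back) connection.\<close>

definition deriv_along ::
  "('p, 'b::euclidean_space) chart set \<Rightarrow> ('p \<Rightarrow> 'e::euclidean_space) \<Rightarrow>
   ('p \<Rightarrow> 'c::real_normed_vector) \<Rightarrow> 'p \<Rightarrow> 'e \<Rightarrow> 'c" where
  "deriv_along A \<phi> f p u =
     frechet_derivative (in_chart (chart_at A p) f) (at (coord A p)) (components A \<phi> p u)"

definition normal_section ::
  "'p set \<Rightarrow> ('p, 'b::euclidean_space) chart set \<Rightarrow> ('p \<Rightarrow> 'e::euclidean_space) \<Rightarrow> ('p \<Rightarrow> 'e) \<Rightarrow> bool"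
where
  "normal_section M A \<phi> W \<longleftrightarrow> smooth_fun A W \<and> (\<forall>p\<in>M. \<forall>u\<in>Tan A \<phi> p. W p \<bullet> u = 0)"

definition nabla_perp ::
  "('p, 'b::euclidean_space) chart set \<Rightarrow> ('p \<Rightarrow> 'e::euclidean_space) \<Rightarrow> ('p \<Rightarrow> 'e) \<Rightarrow> 'p \<Rightarrow> 'e \<Rightarrow> 'e"
where
  "nabla_perp A \<phi> W p u = perp A \<phi> p (deriv_along A \<phi> W p u)"

text \<open>\<open>ambient_deriv A \<phi> p u v\<close> is the ambient derivative in direction \<open>u\<close> of the coordinate vector
  field with constant components that extends \<open>v\<close>. Its normal part is the second fundamental form;
  its tangential part is the Levi-Civita derivative of that coordinate field.\<close>

definition ambient_deriv ::
  "('p, 'b::euclidean_space) chart set \<Rightarrow> ('p \<Rightarrow> 'e::euclidean_space) \<Rightarrow> 'p \<Rightarrow> 'e \<Rightarrow> 'e \<Rightarrow> 'e" where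
  "ambient_deriv A \<phi> p u v =
     frechet_derivative
       (\<lambda>z. frechet_derivative (in_chart (chart_at A p) \<phi>) (at z) (components A \<phi> p v))
       (at (coord A p)) (components A \<phi> p u)"

definition second_ff ::
  "('p, 'b::euclidean_space) chart set \<Rightarrow> ('p \<Rightarrow> 'e::euclidean_space) \<Rightarrow> 'p \<Rightarrow> 'e \<Rightarrow> 'e \<Rightarrow> 'e" where
  "second_ff A \<phi> p u v = perp A \<phi> p (ambient_deriv A \<phi> p u v)"

definition ortho_frame ::
  "('p, 'b::euclidean_space) chart set \<Rightarrow> ('p \<Rightarrow> 'e::euclidean_space) \<Rightarrow> 'p \<Rightarrow> 'e list \<Rightarrow> bool" where
  "ortho_frame A \<phi> p es \<longleftrightarrow>
     length es = DIM('b) \<and> orthonormal es \<and> span (set es) = Tan A \<phi> p"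

text \<open>Below, traces are computed in an arbitrarily chosen frame; they do not depend on the choice.\<close>

definition some_frame ::
  "('p, 'b::euclidean_space) chart set \<Rightarrow> ('p \<Rightarrow> 'e::euclidean_space) \<Rightarrow> 'p \<Rightarrow> 'e list" where
  "some_frame A \<phi> p = (SOME es. ortho_frame A \<phi> p es)"

definition mean_curvature ::
  "('p, 'b::euclidean_space) chart set \<Rightarrow> ('p \<Rightarrow> 'e::euclidean_space) \<Rightarrow> 'p \<Rightarrow> 'e" where
  "mean_curvature A \<phi> p =
     (1 / real DIM('b)) *\<^sub>R
       (\<Sum>i<DIM('b). second_ff A \<phi> p (some_frame A \<phi> p ! i) (some_frame A \<phi> p ! i))"

definition parallel_section ::
  "'p set \<Rightarrow> ('p, 'b::euclidean_space) chart set \<Rightarrow> ('p \<Rightarrow> 'e::euclidean_space) \<Rightarrow> ('p \<Rightarrow> 'e) \<Rightarrow> bool"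
where
  "parallel_section M A \<phi> W \<longleftrightarrow> (\<forall>p\<in>M. \<forall>u\<in>Tan A \<phi> p. nabla_perp A \<phi> W p u = 0)"

definition pseudo_umbilical ::
  "'p set \<Rightarrow> ('p, 'b::euclidean_space) chart set \<Rightarrow> ('p \<Rightarrow> 'e::euclidean_space) \<Rightarrow> bool" where
  "pseudo_umbilical M A \<phi> \<longleftrightarrow> (\<forall>p\<in>M. \<forall>u\<in>Tan A \<phi> p. \<forall>v\<in>Tan A \<phi> p.
     second_ff A \<phi> p u v \<bullet> mean_curvature A \<phi> p = (norm (mean_curvature A \<phi> p))\<^sup>2 * (u \<bullet> v))"

definition minimal ::
  "'p set \<Rightarrow> ('p, 'b::euclidean_space) chart set \<Rightarrow> ('p \<Rightarrow> 'e::euclidean_space) \<Rightarrow> bool" where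
  "minimal M A \<phi> \<longleftrightarrow> (\<forall>p\<in>M. mean_curvature A \<phi> p = 0)"

text \<open>The normal bundle is trivial as a Riemannian vector bundle with connection: it has a global
  parallel orthonormal frame. (Triviality as a bare vector bundle is weaker.)\<close>

definition trivial_normal_bundle ::
  "'p set \<Rightarrow> ('p, 'b::euclidean_space) chart set \<Rightarrow> ('p \<Rightarrow> 'e::euclidean_space) \<Rightarrow> bool" where
  "trivial_normal_bundle M A \<phi> \<longleftrightarrow> (\<exists>E :: nat \<Rightarrow> 'p \<Rightarrow> 'e.
     (\<forall>i < DIM('e) - DIM('b). normal_section M A \<phi> (E i) \<and> parallel_section M A \<phi> (E i)) \<and>
     (\<forall>p\<in>M. orthonormal (map (\<lambda>i. E i p) [0..<DIM('e) - DIM('b)])))"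


section \<open>Curvature of the induced metric\<close>

text \<open>The Levi-Civita connection of the induced metric, for a vector field \<open>Y\<close> along a
  parametrization \<open>F\<close>: tangential part of the ambient derivative.\<close>

definition levi_civita ::
  "('b::euclidean_space \<Rightarrow> 'e::euclidean_space) \<Rightarrow> 'b \<Rightarrow> ('b \<Rightarrow> 'e) \<Rightarrow> 'b \<Rightarrow> 'e" where
  "levi_civita F a Y z =
     proj (range (frechet_derivative F (at z))) (frechet_derivative Y (at z) a)"

text \<open>\<open>R(u,v)w = \<nabla>\<^sub>u\<nabla>\<^sub>v w - \<nabla>\<^sub>v\<nabla>\<^sub>u w\<close>, with the vectors extended to coordinate vector fields, whose Lie
  brackets vanish.\<close>

definition riemann ::
  "('p, 'b::euclidean_space) chart set \<Rightarrow> ('p \<Rightarrow> 'e::euclidean_space) \<Rightarrow> 'p \<Rightarrow> 'e \<Rightarrow> 'e \<Rightarrow> 'e \<Rightarrow> 'e"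
where
  "riemann A \<phi> p u v w =
    (let F = in_chart (chart_at A p) \<phi>;
         a = components A \<phi> p u; b = components A \<phi> p v;
         Y = (\<lambda>z. frechet_derivative F (at z) (components A \<phi> p w))
     in levi_civita F a (levi_civita F b Y) (coord A p)
        - levi_civita F b (levi_civita F a Y) (coord A p))"

definition ricci ::
  "('p, 'b::euclidean_space) chart set \<Rightarrow> ('p \<Rightarrow> 'e::euclidean_space) \<Rightarrow> 'p \<Rightarrow> 'e \<Rightarrow> 'e \<Rightarrow> real" where
  "ricci A \<phi> p v w =
     (\<Sum>i<DIM('b). riemann A \<phi> p (some_frame A \<phi> p ! i) v w \<bullet> (some_frame A \<phi> p ! i))"


section \<open>Orientation and integration\<close>

text \<open>The ordered list \<open>es\<close> is positive if the matrix whose columns are its coordinate vectors (in the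
  order given by the linear order of the index type) has positive determinant.\<close>

definition direct_frame ::
  "('p, real ^ 'm::{finite,wellorder}) chart set \<Rightarrow> ('p \<Rightarrow> 'e::euclidean_space) \<Rightarrow> 'p \<Rightarrow> 'e list \<Rightarrow> bool"
where
  "direct_frame A \<phi> p es \<longleftrightarrow> ortho_frame A \<phi> p es \<and>
     0 < det ((\<chi> i j. components A \<phi> p (es ! card {k. k < j}) $ i)
             :: real ^ 'm::{finite,wellorder} ^ 'm::{finite,wellorder})"

definition frame ::
  "('p, real ^ 'm::{finite,wellorder}) chart set \<Rightarrow> ('p \<Rightarrow> 'e::euclidean_space) \<Rightarrow> 'p \<Rightarrow> 'e list" where
  "frame A \<phi> p = (SOME es. direct_frame A \<phi> p es)"

definition volume_density :: "(real ^ 'm \<Rightarrow> 'e::euclidean_space) \<Rightarrow> real ^ 'm \<Rightarrow> real" where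
  "volume_density F z =
     sqrt (det ((\<chi> i j. frechet_derivative F (at z) (axis i 1) \<bullet>
                        frechet_derivative F (at z) (axis j 1)) :: real ^ 'm ^ 'm))"

text \<open>The Riemannian volume measure is the Borel measure given in each chart by the density
  \<open>sqrt (det g)\<close>.\<close>

definition dM ::
  "'p::t2_space set \<Rightarrow> ('p, real ^ 'm::finite) chart set \<Rightarrow> ('p \<Rightarrow> 'e::euclidean_space) \<Rightarrow> 'p measure"
where
  "dM M A \<phi> = (THE \<mu>. sets \<mu> = sets (restrict_space borel M) \<and>
     (\<forall>c\<in>A. \<forall>E\<in>sets \<mu>. E \<subseteq> fst c \<longrightarrow>
        emeasure \<mu> E =
          (\<integral>\<^sup>+ z. ennreal (volume_density (in_chart c \<phi>) z) * indicator (snd c ` E) z \<partial>lborel)))"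


section \<open>Calibrated extended tangent space and extensions\<close>

definition calibrated_extended_tangent ::
  "'p set \<Rightarrow> ('p, real ^ 'm::{finite,wellorder}) chart set \<Rightarrow> ('p \<Rightarrow> 'e::euclidean_space) \<Rightarrow>
   ('e \<Rightarrow> 'e list \<Rightarrow> real) \<Rightarrow> ('p \<Rightarrow> 'e) \<Rightarrow> bool" where
  "calibrated_extended_tangent M A \<phi> \<Omega> \<nu> \<longleftrightarrow> normal_section M A \<phi> \<nu> \<and>
     (\<forall>p\<in>M. norm (\<nu> p) = 1 \<and> mean_curvature A \<phi> p \<bullet> \<nu> p = norm (mean_curvature A \<phi> p) \<and>
        (\<forall>es. direct_frame A \<phi> p es \<longrightarrow> \<Omega> (\<phi> p) (\<nu> p # es) = 1))"

definition EM ::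
  "('p, 'b::euclidean_space) chart set \<Rightarrow> ('p \<Rightarrow> 'e::euclidean_space) \<Rightarrow> ('p \<Rightarrow> 'e) \<Rightarrow> 'p \<Rightarrow> 'e set" where
  "EM A \<phi> \<nu> p = span (insert (\<nu> p) (Tan A \<phi> p))"

definition Fspace ::
  "('p, 'b::euclidean_space) chart set \<Rightarrow> ('p \<Rightarrow> 'e::euclidean_space) \<Rightarrow> ('p \<Rightarrow> 'e) \<Rightarrow> 'p \<Rightarrow> 'e set" where
  "Fspace A \<phi> \<nu> p = {w. w \<bullet> \<nu> p = 0 \<and> (\<forall>u\<in>Tan A \<phi> p. w \<bullet> u = 0)}"

text \<open>The submanifold \<open>\<psi>\<close> on \<open>M'\<close>, of one dimension more, contains \<open>\<phi>\<close> on \<open>M\<close> (via the injection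
  \<open>\<iota>\<close>), and its tangent space along \<open>M\<close> is \<open>EM\<close>. As \<open>\<phi>\<close> is only immersed, so is \<open>\<psi>\<close>.\<close>

definition extension ::
  "'p::t2_space set \<Rightarrow> ('p, 'b::euclidean_space) chart set \<Rightarrow> ('p \<Rightarrow> 'e::euclidean_space) \<Rightarrow> ('p \<Rightarrow> 'e) \<Rightarrow>
   'q::t2_space set \<Rightarrow> ('q, 'd::euclidean_space) chart set \<Rightarrow> ('q \<Rightarrow> 'e) \<Rightarrow> ('p \<Rightarrow> 'q) \<Rightarrow> bool" where
  "extension M A \<phi> \<nu> M' A' \<psi> \<iota> \<longleftrightarrow> DIM('d) = DIM('b) + 1 \<and>
     smooth_manifold M' A' \<and> immersion A' \<psi> \<and> smooth_map M A M' A' \<iota> \<and> inj_on \<iota> M \<and>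
     (\<forall>p\<in>M. \<psi> (\<iota> p) = \<phi> p \<and> Tan A' \<psi> (\<iota> p) = EM A \<phi> \<nu> p)"

definition calibrated_submanifold ::
  "('e::euclidean_space \<Rightarrow> 'e list \<Rightarrow> real) \<Rightarrow>
   'q set \<Rightarrow> ('q, 'd::euclidean_space) chart set \<Rightarrow> ('q \<Rightarrow> 'e) \<Rightarrow> bool" where
  "calibrated_submanifold \<Omega> M' A' \<psi> \<longleftrightarrow>
     (\<forall>q\<in>M'. calibrated_plane DIM('d) (\<Omega> (\<psi> q)) (Tan A' \<psi> q))"


section \<open>The operator \<open>C\<^sub>\<Omega>\<close> and \<open>\<Omega>\<close>-stability\<close>

definition C_integrand ::
  "('p, real ^ 'm::{finite,wellorder}) chart set \<Rightarrow> ('p \<Rightarrow> 'e::euclidean_space) \<Rightarrow>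
   ('e \<Rightarrow> 'e list \<Rightarrow> real) \<Rightarrow> ('p \<Rightarrow> 'e) \<Rightarrow> ('p \<Rightarrow> 'e) \<Rightarrow> 'p \<Rightarrow> real" where
  "C_integrand A \<phi> \<Omega> W W' p =
    (let N = (\<lambda>q. perp A \<phi> q (W q)); N' = (\<lambda>q. perp A \<phi> q (W' q)); es = frame A \<phi> p
     in (\<Sum>i<CARD('m).
           (1/2) * (\<Omega> (\<phi> p) (N p # es[i := nabla_perp A \<phi> N' p (es ! i)])
                    + \<Omega> (\<phi> p) (N' p # es[i := nabla_perp A \<phi> N p (es ! i)])))
        + (1/2) * (nabla_form \<Omega> (\<phi> p) (N p) (N' p # es) + nabla_form \<Omega> (\<phi> p) (N' p) (N p # es)))"

definition C_Omega ::
  "'p::t2_space set \<Rightarrow> ('p, real ^ 'm::{finite,wellorder}) chart set \<Rightarrow> ('p \<Rightarrow> 'e::euclidean_space) \<Rightarrow>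
   ('e \<Rightarrow> 'e list \<Rightarrow> real) \<Rightarrow> ('p \<Rightarrow> 'e) \<Rightarrow> ('p \<Rightarrow> 'e)" where
  "C_Omega M A \<phi> \<Omega> W = (SOME Z. normal_section M A \<phi> Z \<and>
     (\<forall>W'. smooth_fun A W' \<longrightarrow>
        (\<integral>p. Z p \<bullet> W' p \<partial>dM M A \<phi>) = (\<integral>p. C_integrand A \<phi> \<Omega> W W' p \<partial>dM M A \<phi>)))"

definition mean_zero ::
  "'p::t2_space set \<Rightarrow> ('p, real ^ 'm::finite) chart set \<Rightarrow> ('p \<Rightarrow> 'e::euclidean_space) \<Rightarrow>
   ('p \<Rightarrow> real) set" where
  "mean_zero M A \<phi> = {f. smooth_fun A f \<and> (\<integral>p. f p \<partial>dM M A \<phi>) = 0}"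

text \<open>The linear span of all \<open>f(\<nu> + N)\<close> with \<open>f\<close> of mean zero and \<open>N\<close> a smooth section of \<open>F\<close>.\<close>

definition variation_space ::
  "'p::t2_space set \<Rightarrow> ('p, real ^ 'm::finite) chart set \<Rightarrow> ('p \<Rightarrow> 'e::euclidean_space) \<Rightarrow>
   ('p \<Rightarrow> 'e) \<Rightarrow> ('p \<Rightarrow> 'e) set" where
  "variation_space M A \<phi> \<nu> = {W. \<exists>(K::nat) c f N.
     (\<forall>k<K. f k \<in> mean_zero M A \<phi> \<and> smooth_fun A (N k) \<and> (\<forall>p\<in>M. N k p \<in> Fspace A \<phi> \<nu> p)) \<and>
     (\<forall>p\<in>M. W p = (\<Sum>k<K. c k *\<^sub>R (f k p *\<^sub>R (\<nu> p + N k p))))}"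

definition L2_limit ::
  "'p measure \<Rightarrow> (nat \<Rightarrow> 'p \<Rightarrow> 'e::euclidean_space) \<Rightarrow> ('p \<Rightarrow> 'e) \<Rightarrow> bool" where
  "L2_limit \<mu> f g \<longleftrightarrow> g \<in> borel_measurable \<mu> \<and>
     (\<lambda>k. \<integral>\<^sup>+ p. ennreal ((norm (f k p - g p))\<^sup>2) \<partial>\<mu>) \<longlonglongrightarrow> 0"

text \<open>The \<open>H\<^sup>1\<close>-completion is realized by pairs of an \<open>L\<^sup>2\<close> section \<open>W\<close> and its weak normal derivative
  \<open>G\<close>, a section of \<open>T\<^sup>*M \<otimes> NM\<close> of which only the restriction of \<open>G p\<close> to the tangent space matters.\<close>

definition H1_limit ::
  "'p::t2_space set \<Rightarrow> ('p, real ^ 'm::{finite,wellorder}) chart set \<Rightarrow> ('p \<Rightarrow> 'e::euclidean_space) \<Rightarrow>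
   (nat \<Rightarrow> 'p \<Rightarrow> 'e) \<Rightarrow> ('p \<Rightarrow> 'e) \<Rightarrow> ('p \<Rightarrow> 'e \<Rightarrow> 'e) \<Rightarrow> bool" where
  "H1_limit M A \<phi> Ws W G \<longleftrightarrow> L2_limit (dM M A \<phi>) Ws W \<and>
     (\<forall>p\<in>M. linear (G p)) \<and> (\<forall>u. (\<lambda>p. G p u) \<in> borel_measurable (dM M A \<phi>)) \<and>
     (\<lambda>k. \<integral>\<^sup>+ p. ennreal (\<Sum>i<CARD('m).
              (norm (nabla_perp A \<phi> (Ws k) p (frame A \<phi> p ! i) - G p (frame A \<phi> p ! i)))\<^sup>2) \<partial>dM M A \<phi>)
        \<longlonglongrightarrow> 0"

text \<open>The second variation \<open>I\<^sub>\<Omega>(W,W)\<close>, where \<open>G\<close> and \<open>Z\<close> stand for the normal derivative of \<open>W\<close> and for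
  \<open>C\<^sub>\<Omega>(W)\<close>.\<close>

definition I_Omega ::
  "'p::t2_space set \<Rightarrow> ('p, real ^ 'm::{finite,wellorder}) chart set \<Rightarrow> ('p \<Rightarrow> 'e::euclidean_space) \<Rightarrow>
   ('p \<Rightarrow> 'e) \<Rightarrow> ('p \<Rightarrow> 'e \<Rightarrow> 'e) \<Rightarrow> ('p \<Rightarrow> 'e) \<Rightarrow> real" where
  "I_Omega M A \<phi> W G Z =
     (\<integral>p. (\<Sum>i<CARD('m). (norm (G p (frame A \<phi> p ! i)))\<^sup>2)
          - (\<Sum>i<CARD('m). \<Sum>j<CARD('m).
               (W p \<bullet> second_ff A \<phi> p (frame A \<phi> p ! i) (frame A \<phi> p ! j))\<^sup>2)
          + real CARD('m) * norm (mean_curvature A \<phi> p) * (Z p \<bullet> W p) \<partial>dM M A \<phi>)"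

text \<open>Since \<open>C\<^sub>\<Omega>\<close> is of first order, it extends to a bounded operator from \<open>H\<^sup>1\<close> to \<open>L\<^sup>2\<close>; thus \<open>C\<^sub>\<Omega>(W)\<close>
  for \<open>W\<close> in the completion is the \<open>L\<^sup>2\<close> limit \<open>Z\<close> of its values on an approximating sequence.\<close>

definition Omega_stable ::
  "'p::t2_space set \<Rightarrow> ('p, real ^ 'm::{finite,wellorder}) chart set \<Rightarrow> ('p \<Rightarrow> 'e::euclidean_space) \<Rightarrow>
   ('e \<Rightarrow> 'e list \<Rightarrow> real) \<Rightarrow> ('p \<Rightarrow> 'e) \<Rightarrow> bool" where
  "Omega_stable M A \<phi> \<Omega> \<nu> \<longleftrightarrow>
     (\<forall>Ws W G Z. (\<forall>k. Ws k \<in> variation_space M A \<phi> \<nu>) \<longrightarrow>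
        H1_limit M A \<phi> Ws W G \<longrightarrow>
        L2_limit (dM M A \<phi>) (\<lambda>k. C_Omega M A \<phi> \<Omega> (Ws k)) Z \<longrightarrow>
        0 \<le> I_Omega M A \<phi> W G Z)"


section \<open>Height functions\<close>

definition height :: "('p \<Rightarrow> 'e::euclidean_space) \<Rightarrow> ('p \<Rightarrow> 'e) \<Rightarrow> 'p \<Rightarrow> real" where
  "height \<phi> \<nu> p = \<phi> p \<bullet> \<nu> p"

definition height_S ::
  "('p, real ^ 'm::{finite,wellorder}) chart set \<Rightarrow> ('p \<Rightarrow> 'e::euclidean_space) \<Rightarrow> ('p \<Rightarrow> 'e) \<Rightarrow> 'p \<Rightarrow> real"
where
  "height_S A \<phi> \<nu> p = (\<Sum>i<CARD('m). \<Sum>j<CARD('m).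
     let b = second_ff A \<phi> p (frame A \<phi> p ! i) (frame A \<phi> p ! j)
     in (\<phi> p \<bullet> proj (Fspace A \<phi> \<nu> p) b) * (b \<bullet> \<nu> p))"


section \<open>Forms on the submanifold\<close>

text \<open>With zero-based indices, the star operator is
  \<open>*e\<^sub>i = (-1)\<^sup>i e\<^sub>0 \<and> \<dots> \<and> e\<^sub>i\<^sub>-\<^sub>1 \<and> e\<^sub>i\<^sub>+\<^sub>1 \<and> \<dots> \<and> e\<^sub>m\<^sub>-\<^sub>1\<close>.\<close>

definition xi ::
  "('p, real ^ 'm::{finite,wellorder}) chart set \<Rightarrow> ('p \<Rightarrow> 'e::euclidean_space) \<Rightarrow>
   ('e \<Rightarrow> 'e list \<Rightarrow> real) \<Rightarrow> 'e \<Rightarrow> 'e \<Rightarrow> 'p \<Rightarrow> 'e \<Rightarrow> real" where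
  "xi A \<phi> \<Omega> w w' p u =
    (let es = frame A \<phi> p
     in \<Sum>i<CARD('m). (u \<bullet> es ! i) * (- 1) ^ i * \<Omega> (\<phi> p) (w # w' # take i es @ drop (Suc i) es))"

definition two_form ::
  "'p set \<Rightarrow> ('p, 'b::euclidean_space) chart set \<Rightarrow> ('p \<Rightarrow> 'e::euclidean_space) \<Rightarrow>
   ('p \<Rightarrow> 'e \<Rightarrow> 'e \<Rightarrow> real) \<Rightarrow> bool" where
  "two_form M A \<phi> \<omega> \<longleftrightarrow>
     (\<forall>p\<in>M. bilinear (\<lambda>a b. \<omega> p (dmap A \<phi> p a) (dmap A \<phi> p b)) \<and> (\<forall>u\<in>Tan A \<phi> p. \<omega> p u u = 0)) \<and>
     (\<forall>c\<in>A. \<forall>a b. smooth_on (snd c ` fst c)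
        (\<lambda>z. \<omega> (inv_into (fst c) (snd c) z)
               (frechet_derivative (in_chart c \<phi>) (at z) a)
               (frechet_derivative (in_chart c \<phi>) (at z) b)))"

text \<open>\<open>(\<nabla>\<^sub>u \<omega>)(v,w) = u(\<omega>(v,w)) - \<omega>(\<nabla>\<^sub>u v, w) - \<omega>(v, \<nabla>\<^sub>u w)\<close> for the Levi-Civita connection, with \<open>v\<close>, \<open>w\<close>
  extended to coordinate vector fields.\<close>

definition nabla_two_form ::
  "('p, 'b::euclidean_space) chart set \<Rightarrow> ('p \<Rightarrow> 'e::euclidean_space) \<Rightarrow>
   ('p \<Rightarrow> 'e \<Rightarrow> 'e \<Rightarrow> real) \<Rightarrow> 'p \<Rightarrow> 'e \<Rightarrow> 'e \<Rightarrow> 'e \<Rightarrow> real" where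
  "nabla_two_form A \<phi> \<omega> p u v w =
    (let c = chart_at A p; F = in_chart c \<phi>
     in frechet_derivative
          (\<lambda>z. \<omega> (inv_into (fst c) (snd c) z)
                 (frechet_derivative F (at z) (components A \<phi> p v))
                 (frechet_derivative F (at z) (components A \<phi> p w)))
          (at (coord A p)) (components A \<phi> p u)
        - \<omega> p (proj (Tan A \<phi> p) (ambient_deriv A \<phi> p u v)) w
        - \<omega> p v (proj (Tan A \<phi> p) (ambient_deriv A \<phi> p u w)))"

definition codiff ::
  "('p, 'b::euclidean_space) chart set \<Rightarrow> ('p \<Rightarrow> 'e::euclidean_space) \<Rightarrow>
   ('p \<Rightarrow> 'e \<Rightarrow> 'e \<Rightarrow> real) \<Rightarrow> 'p \<Rightarrow> 'e \<Rightarrow> real" where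
  "codiff A \<phi> \<omega> p u =
     - (\<Sum>i<DIM('b). nabla_two_form A \<phi> \<omega> p (some_frame A \<phi> p ! i) (some_frame A \<phi> p ! i) u)"

definition wedge_d ::
  "('p, 'b::euclidean_space) chart set \<Rightarrow> ('p \<Rightarrow> 'e::euclidean_space) \<Rightarrow>
   ('p \<Rightarrow> real) \<Rightarrow> ('p \<Rightarrow> real) \<Rightarrow> 'p \<Rightarrow> 'e \<Rightarrow> 'e \<Rightarrow> real" where
  "wedge_d A \<phi> f k p u v =
     deriv_along A \<phi> f p u * deriv_along A \<phi> k p v - deriv_along A \<phi> f p v * deriv_along A \<phi> k p u"

text \<open>Normalized by \<open>|e\<^sub>i \<and> e\<^sub>j| = 1\<close>, i.e. summing over \<open>i < j\<close>, so that
  \<open>\<langle>\<omega>, df \<and> dk\<rangle> = \<omega>(\<nabla>f, \<nabla>k)\<close>.\<close>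

definition inner_two_form ::
  "('p, 'b::euclidean_space) chart set \<Rightarrow> ('p \<Rightarrow> 'e::euclidean_space) \<Rightarrow>
   ('p \<Rightarrow> 'e \<Rightarrow> 'e \<Rightarrow> real) \<Rightarrow> ('p \<Rightarrow> 'e \<Rightarrow> 'e \<Rightarrow> real) \<Rightarrow> 'p \<Rightarrow> real" where
  "inner_two_form A \<phi> \<omega> \<eta> p =
    (let es = some_frame A \<phi> p
     in \<Sum>j<DIM('b). \<Sum>i<j. \<omega> p (es ! i) (es ! j) * \<eta> p (es ! i) (es ! j))"

definition norm_df ::
  "('p, 'b::euclidean_space) chart set \<Rightarrow> ('p \<Rightarrow> 'e::euclidean_space) \<Rightarrow> ('p \<Rightarrow> real) \<Rightarrow> 'p \<Rightarrow> real" where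
  "norm_df A \<phi> f p = sqrt (\<Sum>i<DIM('b). (deriv_along A \<phi> f p (some_frame A \<phi> p ! i))\<^sup>2)"

definition gradient ::
  "('p, 'b::euclidean_space) chart set \<Rightarrow> ('p \<Rightarrow> 'e::euclidean_space) \<Rightarrow> ('p \<Rightarrow> real) \<Rightarrow> 'p \<Rightarrow> 'e" where
  "gradient A \<phi> f p =
     (\<Sum>i<DIM('b). deriv_along A \<phi> f p (some_frame A \<phi> p ! i) *\<^sub>R (some_frame A \<phi> p ! i))"

end

theory Submission imports Defs begin

text \<open>The operators \<open>pd w\<close>, differentiation along the tangential part of a constant vector \<open>w\<close>, replace
	covariant calculus on \<open>M\<close>. The first variation formula makes the coordinates of \<open>\<nu>\<close> mean-zero functions and gives the
	Laplacian of \<open>h\<close>, so that testing stability with \<open>(1 + \<parallel>H\<parallel> h) \<nu>\<close> yields minus the squared norm of the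
	traceless part of \<open>B\<^sup>\<nu>\<close> plus the given integral of \<open>S\<close>. Hence \<open>\<phi> + \<nu> / \<parallel>H\<parallel>\<close> is a constant \<open>cen\<close>, and the cone over
	\<open>\<phi>\<close> with vertex \<open>cen\<close> is the minimal extension. If \<open>NM\<close> is trivial, variations along parallel sections of
	\<open>F\<close> force \<open>B\<close> to have no component in \<open>F\<close>; \<open>\<phi>\<close> is then a covering of a round sphere, which stability
	makes one-sheeted. There \<open>\<nu>\<close> is linear in position, so contracting \<open>\<Omega>\<close> with two parallel normals gives constant-coefficient
	two-forms \<open>\<omega>\<close>, and stability of \<open>\<Sum> f\<^sub>\<alpha> W\<^sub>\<alpha>\<close> is the stated inequality.\<close>

text \<open>The frames of the definitions are chosen pointwise by \<open>SOME\<close> and need not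
  even be continuous, so they cannot be differentiated. Hence traces become sums over the ambient
  \<open>Basis\<close>, the second fundamental form becomes the derivative \<open>Q\<close> of the
  projection, and values of \<Omega> on frames are shown smooth as quotients of covectors.
  \<open>C_Omega\<close> and \<open>dM\<close>, defined by choice and description, need existence
  proofs. The weight 2 + h |H| of S comes from f = 1 + |H| h: replacing f |B^\<nu>|^2 by means of
  the Laplacian of h leaves S multiplied by 1 + f. M is not assumed connected, nor H nonzero;
  stability and compactness supply both. For m >= 2 one sheet would follow from simple connectedness
  of the sphere, but not for the circle; the stability argument treats all dimensions alike. For
  parallel \<Omega> the form \<omega> is a constant form divided by -|H| (m - 1), a factor produced
  by the codifferential; this is why co-exactness is restricted to m >= 2.\<close>

abbreviation "FD f x \<equiv> frechet_derivative f (at x)"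
notation scaleR (infixr "*R" 75)
lemmas int_cong = Bochner_Integration.integral_cong

section \<open>Smooth maps between Euclidean spaces\<close>

lemma frechet_derivative_eqI: "(f has_derivative f') (at x) ==> FD f x = f'"
	by (rule frechet_derivative_at[symmetric])

lemma frechet_derivative_cong_open:
	assumes "open S" "x \<in> S" "\<And>y. y \<in> S ==> f y = g y"
	shows "FD f x = FD g x"
proof -
	have "(f has_derivative f') (at x) \<longleftrightarrow> (g has_derivative f') (at x)" for f'
		using has_derivative_transform_within_open[of f f' x UNIV S g]
			has_derivative_transform_within_open[of g f' x UNIV S f] assms by auto
	then show ?thesis unfolding frechet_derivative_def by simp
qed

lemma Ck_on_cong:
	assumes "open S" "\<And>x. x \<in> S ==> f x = g x"
	shows "Ck_on k S f \<longleftrightarrow> Ck_on k S g"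
	using assms(2)
proof (induction k arbitrary: f g)
	case 0
	then show ?case by (auto cong: continuous_on_cong)
next
	case (Suc k)
	have *: "f differentiable_on S \<longleftrightarrow> g differentiable_on S"
		using Suc.prems has_derivative_transform unfolding differentiable_on_def differentiable_def
		by metis
	have "FD f x v = FD g x v" if "x \<in> S" for x v
		using frechet_derivative_cong_open[OF assms(1) that Suc.prems] by simp
	then have "Ck_on k S (%x. FD f x v) \<longleftrightarrow>
			Ck_on k S (%x. FD g x v)" for v
		by (intro Suc.IH) auto
	then show ?case using * by simp
qed

lemma Ck_on_subset: "Ck_on k S f ==> T \<subseteq> S ==> Ck_on k T f"
proof (induction k arbitrary: f)
	case 0 then show ?case using continuous_on_subset by auto
next
	case (Suc k) then show ?case by (auto intro: differentiable_on_subset)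
qed

lemma Ck_on_SucD: "Ck_on (Suc k) S f ==> Ck_on k S f"
proof (induction k arbitrary: f)
	case 0 then show ?case using differentiable_imp_continuous_on by auto
next
	case (Suc k)
	have "Ck_on k S (%x. FD f x v)" for v
		using Suc.prems Suc.IH[of "%x. FD f x v"] by simp
	then show ?case using Suc.prems by simp
qed

text \<open>\<open>Ck_on\<close> speaks of \<open>frechet_derivative\<close>; with this rule any
  explicit derivative may stand in for it, and an induction on k closes as soon as its directional
  values have the shape of the original function.\<close>

lemma Ck_on_SucI:
	assumes "open S" "\<And>x. x \<in> S ==> (f has_derivative f' x) (at x)" "\<And>v. Ck_on k S (%x. f' x v)"
	shows "Ck_on (Suc k) S f"
proof -
	have "f differentiable_on S" using assms(1,2) by (auto simp: differentiable_on_eq_differentiable_at differentiable_def)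
	moreover have "Ck_on k S (%x. FD f x v)" for v
		using assms frechet_derivative_eqI[OF assms(2)] by (subst Ck_on_cong[of S _ "%x. f' x v"]) auto
	ultimately show ?thesis by simp
qed

lemma Ck_on_SucD_has_derivative:
	assumes "open S" "Ck_on (Suc k) S f" "x \<in> S"
	shows "(f has_derivative FD f x) (at x)"
	using assms by (auto simp: differentiable_on_eq_differentiable_at frechet_derivative_works)

lemma Ck_on_const [simp]: "Ck_on k S (%x. c)" by (induction k arbitrary: c) (auto simp: frechet_derivative_const)

lemma Ck_on_linear_compose:
	assumes "open S" "bounded_linear h" "Ck_on k S f"
	shows "Ck_on k S (%x. h (f x))"
	using assms(3)
proof (induction k arbitrary: f)
	case 0 then show ?case using assms(2) by (auto intro: bounded_linear.continuous_on)
next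
	case (Suc k)
	show ?case
	proof (rule Ck_on_SucI[OF assms(1)])
		show "((%x. h (f x)) has_derivative (%v. h (FD f x v))) (at x)" if "x \<in> S" for x
			by (rule bounded_linear.has_derivative[OF assms(2) Ck_on_SucD_has_derivative[OF assms(1) Suc.prems that]])
		show "Ck_on k S (%x. h (FD f x v))" for v using Suc by simp
	qed
qed

lemma Ck_on_cmult:
	fixes f :: "'a::euclidean_space => real"
	shows "open S ==> Ck_on k S f ==> Ck_on k S (%x. c * f x)"
	by (rule Ck_on_linear_compose[where h="(*) c"]) (use bounded_linear_mult_right in auto)

lemma Ck_on_add:
	assumes "open S" "Ck_on k S f" "Ck_on k S g"
	shows "Ck_on k S (%x. f x + g x)"
	using assms(2,3)
proof (induction k arbitrary: f g)
	case 0 then show ?case by (auto intro: continuous_on_add)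
next
	case (Suc k)
	show ?case
	proof (rule Ck_on_SucI[OF assms(1)])
		show "((%x. f x + g x) has_derivative
				(%v. FD f x v + FD g x v)) (at x)" if "x \<in> S" for x
			using Suc.prems that by (intro has_derivative_add Ck_on_SucD_has_derivative[OF assms(1)])
		show "Ck_on k S (%x. FD f x v + FD g x v)" for v using Suc by simp
	qed
qed

lemma Ck_on_bilinear:
	assumes "open S" "bounded_bilinear h" "Ck_on k S f" "Ck_on k S g"
	shows "Ck_on k S (%x. h (f x) (g x))"
	using assms(3,4)
proof (induction k arbitrary: f g)
	case 0 then show ?case using assms(2) by (auto intro: bounded_bilinear.continuous_on)
next
	case (Suc k)
	show ?case
	proof (rule Ck_on_SucI[OF assms(1)])
		show "((%x. h (f x) (g x)) has_derivative
				(%v. h (f x) (FD g x v) + h (FD f x v) (g x))) (at x)" if "x \<in> S" for x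
			using Suc.prems that
			by (intro bounded_bilinear.FDERIV[OF assms(2)] Ck_on_SucD_has_derivative[OF assms(1)])
		show "Ck_on k S (%x. h (f x) (FD g x v) + h (FD f x v) (g x))" for v
			using Suc.prems Suc.prems[THEN Ck_on_SucD] by (intro Ck_on_add[OF assms(1)] Suc.IH) auto
	qed
qed

lemma Ck_on_sum:
	assumes "open S" "\<And>i. i \<in> I ==> Ck_on k S (f i)"
	shows "Ck_on k S (%x. \<Sum>i\<in>I. f i x)"
proof (cases "finite I")
	case True
	then show ?thesis using assms(2) by (induction I rule: finite_induct) (auto intro: Ck_on_add[OF assms(1)])
qed simp

lemma Ck_on_compose:
	fixes f :: "'a::euclidean_space => 'b::euclidean_space" and g :: "'b => 'c::real_normed_vector"
	assumes "open S" "open T" "f ` S \<subseteq> T" "Ck_on k T g" "Ck_on k S f"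
	shows "Ck_on k S (%x. g (f x))"
	using assms(4,5)
proof (induction k arbitrary: g)
	case 0 then show ?case using assms(3) by (auto intro: continuous_on_compose2)
next
	case (Suc k)
	have dg: "(g has_derivative FD g (f x)) (at (f x))" if "x \<in> S" for x
		using Ck_on_SucD_has_derivative[OF assms(2) Suc.prems(1)] assms(3) that by auto
	show ?case
	proof (rule Ck_on_SucI[OF assms(1)])
		fix x assume x: "x \<in> S"
		have "((%x. g (f x)) has_derivative (%v. FD g (f x) (FD f x v))) (at x)"
			by (rule has_derivative_compose[OF Ck_on_SucD_has_derivative[OF assms(1) Suc.prems(2) x] dg[OF x]])
		\<comment> \<open>\<open>Ck_on\<close> controls derivatives only in fixed directions, while
		  \<open>FD f x v\<close> moves with x; expanding it in the basis reduces to fixed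
		  directions.\<close>
		moreover have "FD g (f x) (FD f x v) =
				(\<Sum>b\<in>Basis. (FD f x v \<bullet> b) *R FD g (f x) b)" for v
		proof -
			interpret bounded_linear "FD g (f x)" using dg[OF x] by (rule has_derivative_bounded_linear)
			show ?thesis by (subst euclidean_representation[of "FD f x v", symmetric]) (simp add: sum scaleR)
		qed
		ultimately show "((%x. g (f x)) has_derivative (%v.
				(\<Sum>b\<in>Basis. (FD f x v \<bullet> b) *R FD g (f x) b))) (at x)"
			by simp
	next
		fix v
		show "Ck_on k S (%x. \<Sum>b\<in>Basis. (FD f x v \<bullet> b) *R FD g (f x) b)"
		proof (intro Ck_on_sum[OF assms(1)] Ck_on_bilinear[OF assms(1) bounded_bilinear_scaleR])
			fix b :: 'b
			show "Ck_on k S (%x. FD f x v \<bullet> b)"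
				using Suc.prems(2) by (intro Ck_on_linear_compose[OF assms(1) bounded_linear_inner_left]) auto
			show "Ck_on k S (%x. FD g (f x) b)"
				using Suc.IH[of "%y. FD g y b"] Suc.prems(1) Ck_on_SucD[OF Suc.prems(2)]
				by simp
		qed
	qed
qed

lemma smooth_on_cong: "open S ==> (\<And>x. x \<in> S ==> f x = g x) ==> smooth_on S f \<longleftrightarrow> smooth_on S g"
	unfolding smooth_on_def using Ck_on_cong by blast

lemma smooth_on_subset: "smooth_on S f ==> T \<subseteq> S ==> smooth_on T f"
	unfolding smooth_on_def using Ck_on_subset by blast

lemma smooth_on_imp_continuous_on: "smooth_on S f ==> continuous_on S f"
	unfolding smooth_on_def using Ck_on.simps(1) by blast

lemma smooth_on_has_derivative:
	"smooth_on S f ==> open S ==> x \<in> S ==> (f has_derivative FD f x) (at x)"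
	unfolding smooth_on_def using Ck_on_SucD_has_derivative by blast

lemma smooth_on_frechet_derivative: "smooth_on S f ==> smooth_on S (%x. FD f x v)"
	unfolding smooth_on_def by (metis Ck_on.simps(2))

lemma smooth_on_const [simp]: "smooth_on S (%x. c)" unfolding smooth_on_def by simp

lemma smooth_on_linear_compose:
	"smooth_on S f ==> open S ==> bounded_linear h ==> smooth_on S (%x. h (f x))"
	unfolding smooth_on_def using Ck_on_linear_compose[of S h _ f] by blast

lemma smooth_on_id [simp]: "smooth_on S (%x. x)"
proof -
	have "Ck_on k UNIV (%x::'a. x)" for k
	proof (cases k)
		case (Suc n)
		show ?thesis unfolding Suc by (rule Ck_on_SucI[where f'="%x v. v"]) auto
	qed auto
	then show ?thesis unfolding smooth_on_def using Ck_on_subset by blast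
qed

lemma smooth_on_linear: "bounded_linear h ==> smooth_on S h"
	by (rule smooth_on_subset[OF smooth_on_linear_compose[OF smooth_on_id open_UNIV]]) auto

lemma smooth_on_add:
	"smooth_on S f ==> smooth_on S g ==> open S ==> smooth_on S (%x. f x + g x)"
	unfolding smooth_on_def using Ck_on_add[of S _ f g] by blast

lemma smooth_on_sum:
	"(\<And>i. i \<in> I ==> smooth_on S (f i)) ==> open S ==> smooth_on S (%x. \<Sum>i\<in>I. f i x)"
	unfolding smooth_on_def using Ck_on_sum[of S I _ f] by blast

lemma smooth_on_bilinear:
	"smooth_on S f ==> smooth_on S g ==> open S ==> bounded_bilinear h ==> smooth_on S (%x. h (f x) (g x))"
	unfolding smooth_on_def using Ck_on_bilinear[of S h _ f g] by blast

lemmas smooth_on_scaleR = smooth_on_bilinear[OF _ _ _ bounded_bilinear_scaleR]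
lemmas smooth_on_inner = smooth_on_bilinear[OF _ _ _ bounded_bilinear_inner]

lemma smooth_on_mult:
	fixes f g :: "'a::euclidean_space => real"
	shows "smooth_on S f ==> smooth_on S g ==> open S ==> smooth_on S (%x. f x * g x)"
	by (rule smooth_on_bilinear[OF _ _ _ bounded_bilinear_mult])

lemma smooth_on_minus: "smooth_on S f ==> open S ==> smooth_on S (%x. - f x)"
	by (rule smooth_on_linear_compose[where h=uminus]) (use bounded_linear_minus[OF bounded_linear_ident] in auto)

lemma smooth_on_diff:
	"smooth_on S f ==> smooth_on S g ==> open S ==> smooth_on S (%x. f x - g x)"
	using smooth_on_add[of S f "%x. - g x"] smooth_on_minus[of S g] by simp

lemma smooth_on_prod:
	fixes f :: "'i => 'a::euclidean_space => real"
	assumes "\<And>i. i \<in> I ==> smooth_on S (f i)" "open S"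
	shows "smooth_on S (%x. \<Prod>i\<in>I. f i x)"
proof (cases "finite I")
	case True
	then show ?thesis using assms by (induction I rule: finite_induct) (auto intro: smooth_on_mult)
qed simp

lemma smooth_on_compose:
	fixes f :: "'a::euclidean_space => 'b::euclidean_space" and g :: "'b => 'c::real_normed_vector"
	assumes "smooth_on T g" "smooth_on S f" "open S" "open T" "f ` S \<subseteq> T"
	shows "smooth_on S (%x. g (f x))"
	using Ck_on_compose[OF assms(3-5)] assms(1,2) unfolding smooth_on_def by blast

lemma smooth_on_Pair:
	assumes "smooth_on S f" "smooth_on S g" "open S"
	shows "smooth_on S (%x. (f x, g x))"
proof -
	have "smooth_on S (%x. (f x, 0))" by (rule smooth_on_linear_compose[OF assms(1,3), where h="%y. (y, 0)"])
			(intro bounded_linear_Pair bounded_linear_ident bounded_linear_zero)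
	moreover have "smooth_on S (%x. (0, g x))"
		by (rule smooth_on_linear_compose[OF assms(2,3), where h="%y. (0, y)"])
			(intro bounded_linear_Pair bounded_linear_ident bounded_linear_zero)
	ultimately have "smooth_on S (%x. (f x, 0) + (0, g x))" using assms(3) by (rule smooth_on_add)
	then show ?thesis by simp
qed

text \<open>Serves to glue: extensions by zero of compactly supported functions, and transfer of
  smoothness between charts.\<close>

lemma smooth_on_locally:
	assumes "\<And>x. x \<in> S ==> \<exists>T. open T \<and> x \<in> T \<and> smooth_on T f"
	shows "smooth_on S f"
proof -
	have "Ck_on k S f" if loc: "\<And>x. x \<in> S ==> \<exists>T. open T \<and> x \<in> T \<and> Ck_on k T f" for k
		using loc
	proof (induction k arbitrary: f)
		case 0
		have "isCont f x" if x: "x \<in> S" for x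
		proof -
			obtain T where "open T" "x \<in> T" "continuous_on T f" using 0[OF x] by auto
			then show ?thesis by (simp add: continuous_on_eq_continuous_at)
		qed
		then show ?case by (simp add: continuous_at_imp_continuous_on)
	next
		case (Suc k)
		have "f differentiable at x" if x: "x \<in> S" for x
		proof -
			obtain T where "open T" "x \<in> T" "f differentiable_on T" using Suc.prems[OF x] by auto
			then show ?thesis by (simp add: differentiable_on_eq_differentiable_at)
		qed
		then have "f differentiable_on S" by (simp add: differentiable_at_imp_differentiable_on)
		moreover have "Ck_on k S (%x. FD f x v)" for v
		proof (rule Suc.IH)
			fix x assume "x \<in> S"
			then obtain T where "open T" "x \<in> T" "Ck_on (Suc k) T f" using Suc.prems by blast
			then show "\<exists>T. open T \<and> x \<in> T \<and> Ck_on k T (%x. FD f x v)" by auto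
		qed
		ultimately show ?case by simp
	qed
	then show ?thesis using assms unfolding smooth_on_def by blast
qed

lemma smooth_on_inverse: "smooth_on (- {0}) (inverse :: real => real)"
proof -
	have op: "open (- {0::real})" by auto
	have "Ck_on k (- {0}) (inverse :: real => real)" for k
	proof (induction k)
		case 0 then show ?case by (auto intro!: continuous_intros)
	next
		case (Suc k)
		show ?case
		proof (rule Ck_on_SucI[OF op])
			show "(inverse has_derivative (%v. - (inverse x * v * inverse x))) (at x)" if "x \<in> - {0}" for x :: real
				using that has_derivative_inverse'[of x UNIV] by auto
			have "Ck_on k (- {0}) (%x::real. (- v) * (inverse x * inverse x))" for v
				by (rule Ck_on_cmult[OF op Ck_on_bilinear[OF op bounded_bilinear_mult Suc Suc]])
			then show "Ck_on k (- {0}) (%x::real. - (inverse x * v * inverse x))" for v by (simp add: algebra_simps)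
		qed
	qed
	then show ?thesis unfolding smooth_on_def by simp
qed

lemma smooth_on_divide:
	fixes f g :: "'a::euclidean_space => real"
	assumes "smooth_on S f" "smooth_on S g" "open S" "\<And>x. x \<in> S ==> g x \<noteq> 0"
	shows "smooth_on S (%x. f x / g x)"
proof -
	have "smooth_on S (%x. inverse (g x))" using assms by (intro smooth_on_compose[OF smooth_on_inverse]) auto
	then show ?thesis using smooth_on_mult[OF assms(1) _ assms(3)] by (simp add: divide_inverse)
qed

lemma smooth_on_sqrt: "smooth_on {0<..} sqrt"
proof -
	have op: "open {0::real<..}" by auto
	have "Ck_on k {0<..} sqrt" for k
	proof (induction k)
		case 0 then show ?case by (auto intro!: continuous_intros)
	next
		case (Suc k)
		have inv: "Ck_on k {0<..} (%x. inverse (sqrt x))" using smooth_on_inverse Suc unfolding smooth_on_def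
			by (intro Ck_on_compose[where g=inverse and T="-{0}", OF op]) auto
		show ?case
		proof (rule Ck_on_SucI[OF op])
			show "(sqrt has_derivative (%v. v / 2 * inverse (sqrt x))) (at x)" if "x \<in> {0<..}" for x :: real
			proof -
				have "DERIV sqrt x :> inverse (sqrt x) / 2" using that by (intro DERIV_real_sqrt) auto
				then show ?thesis unfolding has_field_derivative_def by (rule has_derivative_eq_rhs) auto
			qed
			show "Ck_on k {0<..} (%x::real. v / 2 * inverse (sqrt x))" for v by (rule Ck_on_cmult[OF op inv])
		qed
	qed
	then show ?thesis unfolding smooth_on_def by simp
qed

lemma smooth_on_det:
	fixes f :: "'a::euclidean_space => 'm => 'm::finite => real"
	assumes "\<And>i j. smooth_on S (%x. f x i j)" "open S"
	shows "smooth_on S (%x. det (\<chi> i j. f x i j))"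
proof -
	have "smooth_on S (%x. of_int (sign p) * (\<Prod>i\<in>UNIV. f x i (p i)))" for p :: "'m => 'm"
		by (rule smooth_on_mult[OF smooth_on_const smooth_on_prod[OF assms] assms(2)])
	then show ?thesis unfolding det_def by (simp add: smooth_on_sum[OF _ assms(2)])
qed

text \<open>The functions \<open>exp (-1/x) / x\<^sup>n\<close>, extended by \<open>0\<close>, are closed under differentiation up to
	linear combinations; this gives smoothness of all of them at once.\<close>

definition flat_exp :: "nat => real => real" where
	"flat_exp n x = (if x \<le> 0 then 0 else exp (- 1 / x) / x ^ n)"

lemma flat_exp_nonneg: "0 \<le> flat_exp n x" by (simp add: flat_exp_def)

lemma power_over_fact_le_exp:
	fixes x :: real
	assumes "0 \<le> x"
	shows "x ^ n / fact n \<le> exp x"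
proof -
	have "(\<Sum>i\<in>{n}. x ^ i /\<^sub>R fact i) \<le> exp x"
		unfolding exp_def by (rule sum_le_suminf[OF summable_exp_generic]) (use assms in auto)
	then show ?thesis by (simp add: divide_inverse mult.commute)
qed

text \<open>One term of the exponential series at 1/x gives it. The factor x^2 is what makes the
  difference quotient at 0 tend to 0.\<close>

lemma flat_exp_le:
	assumes "0 < x"
	shows "flat_exp n x \<le> fact (n + 2) * x^2"
proof -
	have "(1/x) ^ (n+2) \<le> fact (n+2) * exp (1/x)"
		using power_over_fact_le_exp[OF divide_nonneg_pos[OF zero_le_one assms], of "n+2"]
		by (subst mult.commute) (simp only: pos_divide_le_eq[OF fact_gt_zero])
	then have "exp (- (1/x)) * (1/x) ^ (n+2) \<le> exp (- (1/x)) * (fact (n+2) * exp (1/x))" by (rule mult_left_mono) auto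
	also have "... = fact (n+2)" by (simp only: exp_minus) simp
	finally have "exp (- 1/x) * (1/x) ^ (n+2) \<le> fact (n+2)" by simp
	then have "exp (- 1/x) * (1/x) ^ (n+2) * x^2 \<le> fact (n+2) * x^2" by (intro mult_right_mono) auto
	moreover have "exp (- 1/x) * (1/x) ^ (n+2) * x^2 = flat_exp n x"
		using assms by (simp add: flat_exp_def power_add power_one_over power2_eq_square)
	ultimately show ?thesis by simp
qed

lemma flat_exp_has_derivative: "(flat_exp n has_field_derivative flat_exp (n + 2) x - real n * flat_exp (n + 1) x) (at x)"
proof -
	consider "x < 0" | "x = 0" | "0 < x" by linarith
	then show ?thesis
	proof cases
		case 1
		have "((%x::real. 0::real) has_field_derivative 0) (at x)" by simp
		then have "(flat_exp n has_field_derivative 0) (at x)" by (rule has_field_derivative_transform_within_open[where S="{..<0}"])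
				(use 1 in \<open>auto simp: flat_exp_def\<close>)
		then show ?thesis using 1 by (simp add: flat_exp_def)
	next
		case 2
		have "((%h. flat_exp n h / h) \<longlongrightarrow> 0) (at 0)"
		proof (rule Lim_null_comparison)
			show "eventually (%h. norm (flat_exp n h / h) \<le> fact (n + 2) * \<bar>h\<bar>) (at 0)"
			proof (rule eventuallyI)
				fix h :: real
				show "norm (flat_exp n h / h) \<le> fact (n + 2) * \<bar>h\<bar>"
				proof (cases "0 < h")
					case True
					then show ?thesis using flat_exp_le[OF True, of n] flat_exp_nonneg[of n h] by (simp add: field_simps power2_eq_square)
				next
					case False
					then have "norm (flat_exp n h / h) = 0" by (simp add: flat_exp_def)
					then show ?thesis by (metis abs_ge_zero fact_ge_zero mult_nonneg_nonneg)
				qed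
			qed
			show "((%h::real. fact (n + 2) * \<bar>h\<bar>) \<longlongrightarrow> 0) (at 0)" by (auto intro!: tendsto_eq_intros)
		qed
		then have "(flat_exp n has_field_derivative 0) (at 0)" by (simp add: DERIV_def flat_exp_def)
		then show ?thesis using 2 by (simp add: flat_exp_def)
	next
		case 3
		have "((%x. exp (- inverse x) * inverse x ^ n) has_field_derivative
				exp (- inverse x) * (inverse x * inverse x) * inverse x ^ n
				- exp (- inverse x) * (real n * (inverse x ^ (n - 1) * (inverse x * inverse x)))) (at x)"
			using 3 by (auto intro!: derivative_eq_intros)
		moreover have "exp (- inverse x) * (inverse x * inverse x) * inverse x ^ n
				- exp (- inverse x) * (real n * (inverse x ^ (n - 1) * (inverse x * inverse x)))
				= flat_exp (n + 2) x - real n * flat_exp (n + 1) x"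
		\<comment> \<open>\<open>n - 1\<close> is truncated subtraction; for n = 0 that term carries the
		  factor \<open>real n\<close> = 0.\<close>
		proof (cases n)
			case 0
			then show ?thesis using 3 by (simp add: flat_exp_def divide_inverse power2_eq_square)
		next
			case (Suc k)
			then show ?thesis using 3 by (simp add: flat_exp_def divide_inverse power_inverse[symmetric] mult.assoc)
		qed
		ultimately have D: "((%x. exp (- inverse x) * inverse x ^ n) has_field_derivative
				flat_exp (n + 2) x - real n * flat_exp (n + 1) x) (at x)"
			by simp
		have eq: "exp (- inverse y) * inverse y ^ n = flat_exp n y" if "y \<in> {0<..}" for y
			using that by (simp add: flat_exp_def divide_inverse power_inverse)
		show ?thesis by (rule has_field_derivative_transform_within_open[OF D open_greaterThan _ eq]) (use 3 in auto)
	qed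
qed

lemma smooth_on_flat_exp: "smooth_on UNIV (flat_exp n)"
proof -
	have "Ck_on k UNIV (flat_exp n)" for k
	proof (induction k arbitrary: n)
		case 0
		then show ?case using DERIV_isCont[OF flat_exp_has_derivative] by (simp add: continuous_on_eq_continuous_at)
	next
		case (Suc k)
		show ?case
		proof (rule Ck_on_SucI[OF open_UNIV])
			show "(flat_exp n has_derivative (*) (flat_exp (n + 2) x - real n * flat_exp (n + 1) x)) (at x)" for x
				using flat_exp_has_derivative[of n x] by (simp add: has_field_derivative_def)
			have "Ck_on k UNIV (%x. v * (flat_exp (n + 2) x + (- real n) * flat_exp (n + 1) x))" for v
				by (intro Ck_on_cmult Ck_on_add Suc.IH open_UNIV)
			then show "Ck_on k UNIV (%x. (flat_exp (n + 2) x - real n * flat_exp (n + 1) x) * v)" for v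
				by (simp add: mult.commute)
		qed
	qed
	then show ?thesis unfolding smooth_on_def by simp
qed


subsection \<open>Symmetry of second derivatives\<close>

text \<open>The mean value theorem in direction a turns the second difference into an increment of
  the first derivative, whose differentiability at x then suffices. The second difference is
  symmetric in a and b, which gives Schwarz's theorem.\<close>

lemma second_difference:
	fixes f :: "'a::euclidean_space => real"
	assumes S: "open S" "smooth_on S f" "x \<in> S" and e: "0 < e"
	shows "\<exists>d>0. \<forall>t. 0 < t \<longrightarrow> t < d \<longrightarrow> \<bar>f (x + t *R a + t *R b) - f (x + t *R a) - f (x + t *R b) + f x
		- t * t * FD (%y. FD f y a) x b\<bar> \<le> e * (t * t)"
proof -
	define g where "g y = FD f y a" for y
	define D where "D = FD g x"
	\<comment> \<open>Keeps all points x + s a + q b with s, q <= t within distance t K of x; the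
	  summand 1 keeps K positive when a = b = 0.\<close>
	define K where "K = norm a + norm b + 1"
	have K: "0 < K" "norm a \<le> K" "norm a + norm b \<le> K" using norm_ge_zero[of a] norm_ge_zero[of b] unfolding K_def by linarith+
	have D: "(g has_derivative D) (at x)"
		unfolding D_def g_def by (rule smooth_on_has_derivative[OF smooth_on_frechet_derivative[OF S(2)] S(1,3)])
	have "0 < e / (2 * K)" using e K by simp
	then obtain d where d: "0 < d" "\<And>y. norm (y - x) < d ==> norm (g y - g x - D (y - x)) \<le> e / (2 * K) * norm (y - x)"
		using D unfolding has_derivative_at_alt by blast
	obtain r where r: "0 < r" "ball x r \<subseteq> S" using S(1,3) open_contains_ball by blast
	show ?thesis
	proof (intro exI[of _ "min d r / K"] conjI allI impI)
		show "0 < min d r / K" using d(1) r(1) K by simp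
		fix t assume t: "0 < t" "t < min d r / K"
		then have tK: "t * K < d" "t * K < r" using K(1) by (simp_all add: pos_less_divide_eq)
		have near: "norm (s *R a + q *R b) \<le> t * K" if "0 \<le> s" "s \<le> t" "0 \<le> q" "q \<le> t" for s q
		proof -
			have "norm (s *R a + q *R b) \<le> s * norm a + q * norm b"
				using norm_triangle_ineq[of "s *R a" "q *R b"] that by simp
			also have "... \<le> t * norm a + t * norm b" using that by (intro add_mono mult_right_mono) auto
			also have "... \<le> t * K" using mult_left_mono[OF K(3), of t] t(1) by (simp add: algebra_simps)
			finally show ?thesis .
		qed
		have inS: "x + s *R a + q *R b \<in> S" if "0 \<le> s" "s \<le> t" "0 \<le> q" "q \<le> t" for s q
		proof -
			have "dist x (x + w) = norm w" for w :: 'a by (metis add_diff_cancel_left' dist_commute dist_norm)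
			then have "x + (s *R a + q *R b) \<in> ball x r" using near[OF that] tK(2) by (simp only: mem_ball)
			then show ?thesis using r(2) by (auto simp: add.assoc)
		qed
		have der: "((%s. f (x + s *R a + q *R b)) has_real_derivative g (x + s *R a + q *R b)) (at s)"
			if "0 \<le> s" "s \<le> t" "0 \<le> q" "q \<le> t" for s q
		proof -
			note F = smooth_on_has_derivative[OF S(2,1) inS[OF that]]
			have "((%s. x + s *R a + q *R b) has_derivative (%h. h *R a)) (at s)" by (auto intro!: derivative_eq_intros)
			from has_derivative_compose[OF this F] show ?thesis unfolding has_field_derivative_def g_def
				by (rule has_derivative_eq_rhs) (simp add: fun_eq_iff linear_scale[OF has_derivative_linear[OF F]])
		qed
		have "((%s. f (x + s *R a + t *R b) - f (x + s *R a)) has_real_derivative g (x + s *R a + t *R b) - g (x + s *R a)) (at s)"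
			if "0 \<le> s" "s \<le> t" for s using DERIV_diff[OF der[OF that, of t] der[OF that, of 0]] t(1) by simp
		from MVT2[OF t(1) this] obtain s where s: "0 < s" "s < t"
			"f (x + t *R a + t *R b) - f (x + t *R a) - (f (x + t *R b) - f x) = t * (g (x + s *R a + t *R b) - g (x + s *R a))"
			by auto
		have gn: "\<bar>g (x + w) - g x - D w\<bar> \<le> e / 2 * t" if w: "norm w \<le> t * K" for w
		proof -
			have "\<bar>g (x + w) - g x - D w\<bar> \<le> e / (2 * K) * norm w" using d(2)[of "x + w"] w tK(1) by simp
			also have "... \<le> e / (2 * K) * (t * K)" using w e K(1) by (intro mult_left_mono) simp_all
			finally show ?thesis using K(1) by simp
		qed
		have "D (s *R a + t *R b) = D (s *R a) + t * D b"
			using linear_add[OF has_derivative_linear[OF D]] linear_scale[OF has_derivative_linear[OF D]] by simp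
		moreover have "\<bar>g (x + (s *R a + t *R b)) - g x - D (s *R a + t *R b)\<bar> \<le> e / 2 * t" "\<bar>g (x + s *R a) - g x - D (s *R a)\<bar> \<le> e / 2 * t"
			using gn near[of s t] near[of s 0] s t(1) by simp_all
		moreover have "e / 2 * t + e / 2 * t = e * t" by simp
		ultimately have "\<bar>g (x + s *R a + t *R b) - g (x + s *R a) - t * D b\<bar> \<le> e * t" unfolding add.assoc by linarith
		then have "t * \<bar>g (x + s *R a + t *R b) - g (x + s *R a) - t * D b\<bar> \<le> t * (e * t)" using t(1) by (intro mult_left_mono) auto
		moreover have "f (x + t *R a + t *R b) - f (x + t *R a) - f (x + t *R b) + f x - t * t * D b =
				t * (g (x + s *R a + t *R b) - g (x + s *R a) - t * D b)" using s(3) by (simp add: algebra_simps)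
		ultimately show "\<bar>f (x + t *R a + t *R b) - f (x + t *R a) - f (x + t *R b) + f x
				- t * t * FD (%y. FD f y a) x b\<bar> \<le> e * (t * t)"
			using t(1) by (simp add: abs_mult D_def g_def[abs_def] mult_ac)
	qed
qed

lemma second_derivative_symmetric_real:
	fixes f :: "'a::euclidean_space => real"
	assumes S: "open S" "smooth_on S f" "x \<in> S"
	shows "FD (%y. FD f y a) x b =
		FD (%y. FD f y b) x a" (is "?ab = ?ba")
proof -
	have "\<bar>?ab - ?ba\<bar> \<le> 0 + e" if "0 < e" for e
	proof -
		have e: "0 < e / 2" using that by simp
		obtain d d' where d: "0 < d" "0 < d'"
			"\<And>t. 0 < t ==> t < d ==> \<bar>f (x + t *R a + t *R b) - f (x + t *R a) - f (x + t *R b) + f x - t * t * ?ab\<bar> \<le> e / 2 * (t * t)"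
			"\<And>t. 0 < t ==> t < d' ==> \<bar>f (x + t *R b + t *R a) - f (x + t *R b) - f (x + t *R a) + f x - t * t * ?ba\<bar> \<le> e / 2 * (t * t)"
			using second_difference[OF S e, of a b] second_difference[OF S e, of b a] by metis
		define t where "t = min d d' / 2"
		have t: "0 < t" "t < d" "t < d'" using d(1,2) by (auto simp: t_def)
		have "x + t *R b + t *R a = x + t *R a + t *R b" by (simp add: add_ac)
		moreover have "e / 2 * (t * t) + e / 2 * (t * t) = e * (t * t)" by simp
		ultimately have "\<bar>t * t * ?ab - t * t * ?ba\<bar> \<le> e * (t * t)" using d(3)[OF t(1,2)] d(4)[OF t(1,3)] by (smt (verit))
		then have "(t * t) * \<bar>?ab - ?ba\<bar> \<le> (t * t) * e" by (simp add: abs_mult right_diff_distrib[symmetric] mult.commute)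
		then show ?thesis using t(1) by simp
	qed
	then show ?thesis using field_le_epsilon[of "\<bar>?ab - ?ba\<bar>" 0] by simp
qed

lemma frechet_derivative_linear_compose: "(f has_derivative f') (at x) ==> bounded_linear h ==>
	 FD (%y. h (f y)) x v = h (f' v)"
	using frechet_derivative_eqI[OF bounded_linear.has_derivative] by metis

lemma second_derivative_symmetric:
	fixes f :: "'a::euclidean_space => 'b::euclidean_space"
	assumes S: "open S" "smooth_on S f" "x \<in> S"
	shows "FD (%y. FD f y a) x b =
		FD (%y. FD f y b) x a"
proof (rule euclidean_eqI)
	fix i :: 'b
	have *: "FD (%y. FD f y u) x v \<bullet> i =
			FD (%y. FD (%z. f z \<bullet> i) y u) x v" for u v
	proof -
		have "FD f y u \<bullet> i = FD (%z. f z \<bullet> i) y u" if "y \<in> S" for y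
			using frechet_derivative_linear_compose[OF smooth_on_has_derivative[OF S(2,1) that] bounded_linear_inner_left]
			by metis
		then have "FD (%y. FD (%z. f z \<bullet> i) y u) x =
				FD (%y. FD f y u \<bullet> i) x"
			by (intro frechet_derivative_cong_open[OF S(1,3)]) auto
		then show ?thesis
			using frechet_derivative_linear_compose[OF smooth_on_has_derivative[OF smooth_on_frechet_derivative[OF S(2)] S(1,3)]
					bounded_linear_inner_left, of u i v] by simp
	qed
	have "smooth_on S (%z. f z \<bullet> i)" by (rule smooth_on_linear_compose[OF S(2,1) bounded_linear_inner_left])
	then show "FD (%y. FD f y a) x b \<bullet> i =
			FD (%y. FD f y b) x a \<bullet> i"
		using * second_derivative_symmetric_real[OF S(1) _ S(3), of "%z. f z \<bullet> i" a b] by simp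
qed


section \<open>Orthogonal projections and traces\<close>

lemma proj_unique:
	assumes "subspace V" "u \<in> V" "\<And>v. v \<in> V ==> (w - u) \<bullet> v = 0"
	shows "proj V w = u"
	unfolding proj_def
proof (rule the_equality)
	show "u \<in> V \<and> (\<forall>v\<in>V. (w - u) \<bullet> v = 0)" using assms by auto
	fix u' assume u': "u' \<in> V \<and> (\<forall>v\<in>V. (w - u') \<bullet> v = 0)"
	have "u' - u \<in> V" using u' assms by (auto intro: subspace_diff)
	then have "(w - u) \<bullet> (u' - u) - (w - u') \<bullet> (u' - u) = 0" using assms u' by simp
	then show "u' = u" by (simp add: inner_diff_left[symmetric])
qed

lemma proj_props:
	assumes "subspace V"
	shows proj_in: "proj V w \<in> V" and proj_orth: "v \<in> V ==> (w - proj V w) \<bullet> v = 0"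
proof -
	obtain y z where yz: "y \<in> span V" "\<And>v. v \<in> span V ==> orthogonal z v" "w = y + z"
		using orthogonal_subspace_decomp_exists by blast
	have *: "span V = V" using assms by (simp add: span_eq_iff)
	have "proj V w = y" using yz unfolding * by (intro proj_unique[OF assms]) (auto simp: orthogonal_def)
	then show "proj V w \<in> V" "v \<in> V ==> (w - proj V w) \<bullet> v = 0"
		using yz unfolding * by (auto simp: orthogonal_def)
qed

lemma proj_id: "subspace V ==> w \<in> V ==> proj V w = w" by (rule proj_unique) auto

lemma proj_sym:
	assumes "subspace V"
	shows "proj V a \<bullet> b = a \<bullet> proj V b"
proof -
	have "(a - proj V a) \<bullet> proj V b = 0" "(b - proj V b) \<bullet> proj V a = 0" using proj_props[OF assms] by auto
	then have "a \<bullet> proj V b = proj V a \<bullet> proj V b" "b \<bullet> proj V a = proj V b \<bullet> proj V a"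
		by (simp_all add: inner_diff_left)
	then show ?thesis by (simp add: inner_commute)
qed

lemma linear_proj:
	assumes "subspace V"
	shows "linear (proj V)"
proof
	fix a b c
	show "proj V (a + b) = proj V a + proj V b"
	proof (rule proj_unique[OF assms])
		show "proj V a + proj V b \<in> V" by (intro subspace_add[OF assms] proj_in[OF assms])
		fix v assume "v \<in> V"
		then have "(a - proj V a) \<bullet> v = 0" "(b - proj V b) \<bullet> v = 0" by (auto intro: proj_orth[OF assms])
		then show "(a + b - (proj V a + proj V b)) \<bullet> v = 0" by (simp add: inner_diff_left inner_add_left)
	qed
	show "proj V (c *R a) = c *R proj V a"
	proof (rule proj_unique[OF assms])
		show "c *R proj V a \<in> V" by (intro subspace_scale[OF assms] proj_in[OF assms])
		fix v assume "v \<in> V"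
		then have "(a - proj V a) \<bullet> v = 0" by (rule proj_orth[OF assms])
		then show "(c *R a - c *R proj V a) \<bullet> v = 0" by (simp add: inner_diff_left)
	qed
qed

lemma proj_perp:
	assumes "subspace V"
	shows "proj {w. \<forall>v\<in>V. w \<bullet> v = 0} w = w - proj V w"
proof (rule proj_unique)
	show "subspace {w. \<forall>v\<in>V. w \<bullet> v = 0}" by (auto simp: subspace_def inner_add_left)
qed (use proj_props[OF assms] in \<open>auto simp: inner_commute\<close>)

text \<open>Expanded in the basis, both sides are the double sum of (P b \<bullet> c) r c b, whose
  coefficients are symmetric. It moves a projection from one slot of a trace to the other.\<close>

lemma trace_swap:
	fixes r :: "'e::euclidean_space => 'e => 'c::real_vector"
	assumes "\<And>b. linear (%a. r a b)" "\<And>a. linear (r a)" "\<And>a b. P a \<bullet> b = a \<bullet> P b"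
	shows "(\<Sum>b\<in>Basis. r (P b) b) = (\<Sum>b\<in>Basis. r b (P b))"
proof -
	have 1: "r (P b) b = (\<Sum>c\<in>Basis. (P b \<bullet> c) *R r c b)" for b
		by (subst (1) euclidean_representation[of "P b", symmetric]) (simp add: linear_sum[OF assms(1)] linear_scale[OF assms(1)])
	have 2: "r b (P b) = (\<Sum>c\<in>Basis. (P b \<bullet> c) *R r b c)" for b
		by (subst (1) euclidean_representation[of "P b", symmetric]) (simp add: linear_sum[OF assms(2)] linear_scale[OF assms(2)])
	have "(\<Sum>b\<in>Basis. r (P b) b) = (\<Sum>c\<in>Basis. \<Sum>b\<in>Basis. (P b \<bullet> c) *R r c b)"
		unfolding 1 by (rule sum.swap)
	also have "... = (\<Sum>b\<in>Basis. r b (P b))" unfolding 2 by (intro sum.cong refl) (metis assms(3) inner_commute)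
	finally show ?thesis .
qed

lemma orthonormal_proj_expand:
	fixes es :: "'e::euclidean_space list"
	assumes "orthonormal es"
	shows "proj (span (set es)) w = (\<Sum>i<length es. (w \<bullet> es ! i) *R es ! i)"
proof (rule proj_unique)
	show "(\<Sum>i<length es. (w \<bullet> es ! i) *R es ! i) \<in> span (set es)"
		by (intro span_sum span_scale span_base) auto
	fix v assume "v \<in> span (set es)"
	then show "(w - (\<Sum>i<length es. (w \<bullet> es ! i) *R es ! i)) \<bullet> v = 0"
	proof (induction rule: span_induct_alt)
		case (step c x y)
		then obtain j where j: "j < length es" "x = es ! j" by (auto simp: in_set_conv_nth)
		have "(\<Sum>i<length es. (w \<bullet> es ! i) *R es ! i) \<bullet> x = (\<Sum>i<length es. if i = j then w \<bullet> es ! i else 0)"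
			using assms j unfolding orthonormal_def inner_sum_left by (intro sum.cong) auto
		then have "(w - (\<Sum>i<length es. (w \<bullet> es ! i) *R es ! i)) \<bullet> x = 0"
			using j by (simp add: inner_diff_left)
		then show ?case using step by (simp add: inner_add_right)
	qed simp
qed simp

text \<open>Parseval in the ambient basis. Sums over the chosen frames thereby become sums over a
  fixed basis, which can be differentiated term by term.\<close>

lemma trace_orthonormal:
	fixes r :: "'e::euclidean_space => 'e => 'c::real_vector"
	assumes on: "orthonormal es" and V: "span (set es) = V"
		and r: "\<And>b. linear (%a. r a b)" "\<And>a. linear (r a)"
	shows "(\<Sum>i<length es. r (es ! i) (es ! i)) = (\<Sum>b\<in>Basis. r (proj V b) (proj V b))"
proof -
	have e: "proj V w = (\<Sum>i<length es. (w \<bullet> es ! i) *R es ! i)" for w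
		using orthonormal_proj_expand[OF on] V by simp
	let ?R = "%b i j. ((b \<bullet> es ! i) * (b \<bullet> es ! j)) *R r (es ! j) (es ! i)"
	have "(\<Sum>b\<in>Basis. r (proj V b) (proj V b)) = (\<Sum>b\<in>Basis. \<Sum>i<length es. \<Sum>j<length es. ?R b i j)"
		unfolding e
		by (simp add: linear_sum[OF r(1)] linear_scale[OF r(1)] linear_sum[OF r(2)] linear_scale[OF r(2)] scaleR_sum_right)
	also have "... = (\<Sum>i<length es. \<Sum>b\<in>Basis. \<Sum>j<length es. ?R b i j)" by (rule sum.swap)
	also have "... = (\<Sum>i<length es. \<Sum>j<length es. \<Sum>b\<in>Basis. ?R b i j)"
		by (rule sum.cong[OF refl]) (rule sum.swap)
	also have "... = (\<Sum>i<length es. \<Sum>j<length es. (es ! i \<bullet> es ! j) *R r (es ! j) (es ! i))"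
		by (simp add: scaleR_sum_left[symmetric] euclidean_inner[of "es ! _"] inner_commute)
	also have "... = (\<Sum>i<length es. \<Sum>j<length es. if i = j then r (es ! i) (es ! j) else 0)"
		using on unfolding orthonormal_def by (intro sum.cong refl) auto
	also have "... = (\<Sum>i<length es. r (es ! i) (es ! i))" by (intro sum.cong refl) simp
	finally show ?thesis by simp
qed

lemma orthonormal_basis_list:
	fixes V :: "'e::euclidean_space set"
	assumes "subspace V"
	obtains es where "length es = dim V" "orthonormal es" "span (set es) = V"
proof -
	obtain B where B: "B \<subseteq> V" "pairwise orthogonal B" "\<And>x. x \<in> B ==> norm x = 1"
		"independent B" "card B = dim V" "span B = V"
		by (metis orthonormal_basis_subspace[OF assms])
	have "finite B" using B(4) by (rule independent_imp_finite)
	then obtain es where es: "set es = B" "distinct es" using finite_distinct_list by blast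
	have "orthonormal es" unfolding orthonormal_def
	proof (intro allI impI)
		fix i j assume ij: "i < length es" "j < length es"
		show "es ! i \<bullet> es ! j = (if i = j then 1 else 0)"
		proof (cases "i = j")
			case True
			then show ?thesis using B(3)[of "es ! i"] es ij by (auto simp: norm_eq_1)
		next
			case False
			then have "es ! i \<noteq> es ! j" using es ij by (simp add: nth_eq_iff_index_eq)
			then show ?thesis using B(2) es ij False by (auto simp: pairwise_def orthogonal_def)
		qed
	qed
	then show ?thesis using that[of es] es B distinct_card[OF es(2)] by auto
qed

text \<open>The list is compared with an orthonormal basis of its span: both lengths are the trace
  of the same projection.\<close>

lemma dim_orthonormal:
	fixes es :: "'e::euclidean_space list"
	assumes "orthonormal es"
	shows "dim (span (set es)) = length es"
proof -
	have tr: "(\<Sum>i<length us. us ! i \<bullet> us ! i) = real (length us)" if "orthonormal us" for us :: "'e list"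
		using that by (simp add: orthonormal_def)
	have lin: "\<And>b. linear (%a. a \<bullet> b)" "\<And>a. linear (%b. a \<bullet> b)" for a :: 'e
		by (simp_all add: bounded_linear.linear bounded_linear_inner_left bounded_linear_inner_right)
	obtain us where us: "length us = dim (span (set es))" "orthonormal us" "span (set us) = span (set es)"
		using orthonormal_basis_list[OF subspace_span] by blast
	have "real (length us) = real (length es)"
		using trace_orthonormal[OF us(2,3) lin] trace_orthonormal[OF assms refl lin] tr[OF us(2)] tr[OF assms] by simp
	then show ?thesis using us(1) by simp
qed

lemma compact_openin_cover:
	assumes C: "compact C" and U: "\<And>z. z \<in> C ==> openin (top_of_set C) (U z) \<and> z \<in> U z"
	obtains D where "finite D" "D \<subseteq> C" "C \<subseteq> (\<Union>z\<in>D. U z)"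
proof -
	have "compact_space (top_of_set C)" using C by (simp add: compact_space_subtopology compactin_euclidean_iff)
	moreover have "\<forall>X\<in>U ` C. openin (top_of_set C) X" "topspace (top_of_set C) \<subseteq> \<Union> (U ` C)" using U by auto
	ultimately obtain F where "finite F" "F \<subseteq> U ` C" "topspace (top_of_set C) \<subseteq> \<Union> F"
		unfolding compact_space_alt by meson
	then show ?thesis using that by (metis finite_subset_image topspace_euclidean_subtopology)
qed


section \<open>Differential calculus on an immersed closed submanifold\<close>

lemma smooth_on_euclidean:
	fixes f :: "'a::euclidean_space => 'b::euclidean_space"
	assumes "\<And>b. b \<in> Basis ==> smooth_on S (%z. f z \<bullet> b)" "open S"
	shows "smooth_on S f"
proof -
	have "smooth_on S (%z. \<Sum>b\<in>Basis. (f z \<bullet> b) *R b)"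
		by (rule smooth_on_sum[OF smooth_on_scaleR[OF assms(1) smooth_on_const assms(2)] assms(2)])
	then show ?thesis by (simp add: euclidean_representation)
qed

lemma linear_euclidean_expand:
	fixes f :: "'a::euclidean_space => 'b::real_vector"
	assumes "linear f"
	shows "f v = (\<Sum>b\<in>Basis. (v \<bullet> b) *R f b)"
	by (subst (1) euclidean_representation[of v, symmetric]) (simp add: linear_sum[OF assms] linear_scale[OF assms])

locale closed_immersion =
	fixes M :: "'p::t2_space set"
		and A :: "('p, real ^ 'm::{finite,wellorder}) chart set"
		and \<phi> :: "'p => 'e::euclidean_space"
	assumes closed: "closed_manifold M A" and imm: "immersion A \<phi>"
begin
abbreviation "TM \<equiv> Tan A \<phi>"
abbreviation "frm \<equiv> frame A \<phi>"
abbreviation "sfrm \<equiv> some_frame A \<phi>"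
abbreviation "mcv \<equiv> mean_curvature A \<phi>"
abbreviation "smooth \<equiv> smooth_fun A"
abbreviation "openM \<equiv> openin (top_of_set M)"
abbreviation im :: "('p, real ^ 'm::{finite,wellorder}) chart => (real ^ 'm::{finite,wellorder}) set" where "im c \<equiv> snd c ` fst c"

lemma compact_M: "compact M" and M_nonempty: "M \<noteq> {}" and charts_cover: "\<Union> (fst ` A) = M"
	using closed unfolding closed_manifold_def smooth_manifold_def by auto

lemma chart_openin: "c \<in> A ==> openM (fst c)"
	and chart_open: "c \<in> A ==> open (im c)"
	and chart_homeo: "c \<in> A ==> homeomorphism (fst c) (im c) (snd c) (inv_into (fst c) (snd c))"
	and chart_trans: "c \<in> A ==> d \<in> A ==> smooth_on (snd c ` (fst c \<inter> fst d)) (in_chart c (snd d))"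
	using closed unfolding closed_manifold_def smooth_manifold_def by auto

lemma chart_subset: "c \<in> A ==> fst c \<subseteq> M" using charts_cover by auto

lemma chart_in_M: "c \<in> A ==> p \<in> fst c ==> p \<in> M" using chart_subset by blast

lemma chart_inv [simp]: "c \<in> A ==> p \<in> fst c ==> inv_into (fst c) (snd c) (snd c p) = p"
	using chart_homeo unfolding homeomorphism_def by blast

lemma chart_inj: "c \<in> A ==> inj_on (snd c) (fst c)" by (metis chart_inv inj_onI)

lemma chart_inv_in: "c \<in> A ==> z \<in> im c ==> inv_into (fst c) (snd c) z \<in> fst c"
	by (rule inv_into_into)

lemma in_chart_snd [simp]: "c \<in> A ==> p \<in> fst c ==> in_chart c f (snd c p) = f p"
	by (simp add: in_chart_def)

lemma chart_at_in: "p \<in> M ==> chart_at A p \<in> A" and chart_at_mem: "p \<in> M ==> p \<in> fst (chart_at A p)"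
proof -
	assume "p \<in> M"
	then have "\<exists>c. c \<in> A \<and> p \<in> fst c" using charts_cover by blast
	from someI_ex[OF this] show "chart_at A p \<in> A" "p \<in> fst (chart_at A p)" unfolding chart_at_def by auto
qed

lemma chart_inter_open:
	assumes "c \<in> A" "d \<in> A"
	shows "open (snd c ` (fst c \<inter> fst d))"
proof -
	have "openin (top_of_set (fst c)) (fst c \<inter> fst d)"
		using chart_openin[OF assms(1)] chart_openin[OF assms(2)] chart_subset[OF assms(1)]
		by (metis openin_Int openin_subset_trans inf_le1)
	then have "openin (top_of_set (im c)) (snd c ` (fst c \<inter> fst d))"
		using homeomorphism_imp_open_map[OF chart_homeo[OF assms(1)]] by blast
	then show ?thesis using chart_open[OF assms(1)] openin_open_trans by blast
qed

lemma smooth_fun_cong: "(\<And>p. p \<in> M ==> f p = g p) ==> smooth f \<longleftrightarrow> smooth g"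
proof -
	assume eq: "\<And>p. p \<in> M ==> f p = g p"
	have "smooth_on (im c) (in_chart c f) \<longleftrightarrow> smooth_on (im c) (in_chart c g)" if c: "c \<in> A" for c
		by (rule smooth_on_cong[OF chart_open[OF c]])
			(use chart_inv_in[OF c] chart_subset[OF c] eq in \<open>auto simp: in_chart_def\<close>)
	then show ?thesis unfolding smooth_fun_def by auto
qed

lemma smooth_fun_chart: "smooth f ==> c \<in> A ==> smooth_on (im c) (in_chart c f)"
	unfolding smooth_fun_def by auto

abbreviation dch where "dch f c z \<equiv> FD (in_chart c f) z"
abbreviation "dphi \<equiv> dch \<phi>"

lemma dch_has_derivative:
	"smooth f ==> c \<in> A ==> z \<in> im c ==> (in_chart c f has_derivative dch f c z) (at z)"
	by (rule smooth_on_has_derivative[OF smooth_fun_chart chart_open])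

lemma dch_linear: "smooth f ==> c \<in> A ==> z \<in> im c ==> linear (dch f c z)"
	using dch_has_derivative has_derivative_linear by blast

lemma smooth_on_dch: "smooth f ==> c \<in> A ==> smooth_on (im c) (%z. dch f c z a)"
	by (rule smooth_on_frechet_derivative[OF smooth_fun_chart])

text \<open>Tangent spaces and derivatives are defined in the one chart \<open>chart_at A p\<close>;
  the chain rule for transition maps makes them computable in every chart around p, and so smooth in
  p.\<close>

lemma dch_change:
	assumes f: "smooth f" and c: "c \<in> A" "p \<in> fst c" and d: "d \<in> A" "p \<in> fst d"
	shows "dch f c (snd c p) a = dch f d (snd d p) (dch (snd d) c (snd c p) a)"
proof -
	let ?S = "snd c ` (fst c \<inter> fst d)"
	have S: "open ?S" "snd c p \<in> ?S" using chart_inter_open c d by auto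
	have eq: "in_chart d f (in_chart c (snd d) z) = in_chart c f z" if z: "z \<in> ?S" for z
	proof -
		obtain q where q: "q \<in> fst c" "q \<in> fst d" "z = snd c q" using z by blast
		show ?thesis unfolding q(3) in_chart_snd[OF c(1) q(1)] in_chart_snd[OF d(1) q(2)] ..
	qed
	have 1: "(in_chart c (snd d) has_derivative dch (snd d) c (snd c p)) (at (snd c p))"
		by (rule smooth_on_has_derivative[OF chart_trans[OF c(1) d(1)] S])
	have 2: "(in_chart d f has_derivative dch f d (snd d p)) (at (in_chart c (snd d) (snd c p)))"
		using dch_has_derivative[OF f d(1), of "snd d p"] c d by simp
	have "((%z. in_chart d f (in_chart c (snd d) z)) has_derivative
			(%a. dch f d (snd d p) (dch (snd d) c (snd c p) a))) (at (snd c p))"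
		by (rule has_derivative_compose[OF 1 2])
	then have "(in_chart c f has_derivative (%a. dch f d (snd d p) (dch (snd d) c (snd c p) a))) (at (snd c p))"
		by (rule has_derivative_transform_within_open[OF _ S]) (use eq in auto)
	then show ?thesis by (simp add: frechet_derivative_eqI)
qed

lemma smooth_phi: "smooth \<phi>" using imm unfolding immersion_def by auto

lemma dch_phi_inj: "c \<in> A ==> p \<in> fst c ==> inj (dphi c (snd c p))"
	using imm unfolding immersion_def by auto

lemma Tan_chart:
	assumes c: "c \<in> A" "p \<in> fst c"
	shows "TM p = range (dphi c (snd c p))"
proof -
	have p: "p \<in> M" by (rule chart_in_M[OF c])
	note d = chart_at_in[OF p] chart_at_mem[OF p]
	have "dmap A \<phi> p = dphi (chart_at A p) (snd (chart_at A p) p)" by (simp add: dmap_def coord_def)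
	then show ?thesis unfolding Tan_def using dch_change[OF smooth_phi c d] dch_change[OF smooth_phi d c] by auto
qed

lemma deriv_along_chart:
	assumes f: "smooth f" and c: "c \<in> A" "p \<in> fst c"
	shows "deriv_along A \<phi> f p (dphi c (snd c p) a) = dch f c (snd c p) a"
proof -
	have p: "p \<in> M" by (rule chart_in_M[OF c])
	note d = chart_at_in[OF p] chart_at_mem[OF p]
	have dm: "dmap A \<phi> p = dphi (chart_at A p) (snd (chart_at A p) p)" by (simp add: dmap_def coord_def)
	have "components A \<phi> p (dphi c (snd c p) a) = dch (snd (chart_at A p)) c (snd c p) a"
		unfolding components_def dm dch_change[OF smooth_phi c d]
		by (rule inv_f_f[OF dch_phi_inj[OF d]])
	then show ?thesis unfolding deriv_along_def dch_change[OF f c d] coord_def by simp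
qed

lemma components_in_Tan: "u \<in> TM p ==> dmap A \<phi> p (components A \<phi> p u) = u"
	unfolding components_def Tan_def by (simp add: f_inv_into_f)

lemma subspace_Tan: "p \<in> M ==> subspace (TM p)" using Tan_chart[OF chart_at_in chart_at_mem, of p]
		dch_linear[OF smooth_phi chart_at_in, of p "snd (chart_at A p) p"] chart_at_mem[of p]
	by (simp add: linear_subspace_image)

lemma dim_Tan:
	assumes p: "p \<in> M"
	shows "dim (TM p) = CARD('m)"
proof -
	note c = chart_at_in[OF p] chart_at_mem[OF p]
	have "dim (range (dphi (chart_at A p) (snd (chart_at A p) p))) = dim (UNIV :: (real ^ 'm::{finite,wellorder}) set)"
		using dch_linear[OF smooth_phi c(1)] c(2) dch_phi_inj[OF c]
		by (intro dim_image_eq) auto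
	then show ?thesis using Tan_chart[OF c] by simp
qed

abbreviation P :: "'p => 'e => 'e" where "P p \<equiv> proj (TM p)"

lemma P_in: "p \<in> M ==> P p w \<in> TM p" by (rule proj_in[OF subspace_Tan])

lemma P_id: "p \<in> M ==> w \<in> TM p ==> P p w = w" by (rule proj_id[OF subspace_Tan])

lemma P_P: "p \<in> M ==> P p (P p w) = P p w" by (rule P_id[OF _ P_in])

lemma P_sym: "p \<in> M ==> P p a \<bullet> b = a \<bullet> P p b" by (rule proj_sym[OF subspace_Tan])

lemma linear_P: "p \<in> M ==> linear (P p)" by (rule linear_proj[OF subspace_Tan])

lemma perp_eq: "p \<in> M ==> perp A \<phi> p w = w - P p w" unfolding perp_def by (rule proj_perp[OF subspace_Tan])

lemma P_eq_0_iff: "p \<in> M ==> P p w = 0 \<longleftrightarrow> (\<forall>u\<in>TM p. w \<bullet> u = 0)"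
	using proj_orth[OF subspace_Tan] P_in P_sym[of p w] P_id
	by (metis diff_zero inner_eq_zero_iff inner_zero_left)

subsection \<open>Coordinate expression of the tangential projection\<close>

text \<open>Cramer's rule for the Gram system whose solution gives the coordinates of the
	tangential part of a constant vector; it exhibits their smooth dependence on the point.\<close>

definition gram :: "('p, real ^ 'm::{finite,wellorder}) chart => real ^ 'm::{finite,wellorder} => real ^ 'm::{finite,wellorder} ^ 'm::{finite,wellorder}" where
	"gram c z = (\<chi> i j. dphi c z (axis i 1) \<bullet> dphi c z (axis j 1))"

definition lift :: "('p, real ^ 'm::{finite,wellorder}) chart => 'e => real ^ 'm::{finite,wellorder} => real ^ 'm::{finite,wellorder}" where
	"lift c w z = (\<chi> k. det (\<chi> i j. if j = k then w \<bullet> dphi c z (axis i 1)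
			else dphi c z (axis i 1) \<bullet> dphi c z (axis j 1)) / det (gram c z))"

lemma linear_vec_expand:
	assumes "linear (f :: real ^ 'm::{finite,wellorder} => 'c::real_vector)"
	shows "f v = (\<Sum>k\<in>UNIV. v $ k *R f (axis k 1))"
	by (subst basis_expansion[of v, symmetric]) (simp add: linear_sum[OF assms] linear_scale[OF assms] scalar_mult_eq_scaleR)

lemma gram_mult:
	assumes c: "c \<in> A" "z \<in> im c"
	shows "(gram c z *v v) $ i = dphi c z (axis i 1) \<bullet> dphi c z v"
	using linear_vec_expand[OF dch_linear[OF smooth_phi c], of v]
	by (simp add: gram_def matrix_vector_mult_def inner_sum_right mult.commute)

lemma det_gram_nonzero:
	assumes c: "c \<in> A" "z \<in> im c"
	shows "det (gram c z) \<noteq> 0"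
proof -
	have "v = 0" if v: "gram c z *v v = 0" for v
	proof -
		have "(\<Sum>i\<in>UNIV. v $ i *R dphi c z (axis i 1)) \<bullet> dphi c z v = 0"
			using gram_mult[OF c, of v] v by (simp add: inner_sum_left)
		then have "dphi c z v = 0" using linear_vec_expand[OF dch_linear[OF smooth_phi c], of v] by simp
		moreover have "inj (dphi c z)" using c dch_phi_inj by blast
		ultimately show "v = 0" using linear_injective_0[OF dch_linear[OF smooth_phi c]] by blast
	qed
	then have "invertible (gram c z)" using matrix_left_invertible_ker invertible_left_inverse by blast
	then show ?thesis by (simp add: invertible_det_nz)
qed

text \<open>The Gram system consists of the normal equations of the orthogonal projection, and
  \<open>lift\<close> is its solution.\<close>

lemma lift_P:
	assumes c: "c \<in> A" "p \<in> fst c"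
	shows "dphi c (snd c p) (lift c w (snd c p)) = P p w"
proof -
	have p: "p \<in> M" by (rule chart_in_M[OF c])
	have z: "snd c p \<in> im c" using c by auto
	have "gram c (snd c p) *v lift c w (snd c p) = (\<chi> i. w \<bullet> dphi c (snd c p) (axis i 1))"
		unfolding cramer[OF det_gram_nonzero[OF c(1) z]]
		by (simp add: lift_def gram_def cong del: if_weak_cong)
	then have eq: "dphi c (snd c p) (axis i 1) \<bullet> dphi c (snd c p) (lift c w (snd c p)) =
			w \<bullet> dphi c (snd c p) (axis i 1)" for i
		using gram_mult[OF c(1) z, of "lift c w (snd c p)" i] by simp
	show ?thesis
	proof (rule proj_unique[OF subspace_Tan[OF p], symmetric])
		show "dphi c (snd c p) (lift c w (snd c p)) \<in> TM p" using Tan_chart[OF c] by simp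
		fix v assume "v \<in> TM p"
		then obtain a where a: "v = dphi c (snd c p) a" using Tan_chart[OF c] by auto
		have "v = (\<Sum>k\<in>UNIV. a $ k *R dphi c (snd c p) (axis k 1))"
			unfolding a by (rule linear_vec_expand[OF dch_linear[OF smooth_phi c(1) z]])
		then show "(w - dphi c (snd c p) (lift c w (snd c p))) \<bullet> v = 0"
			using eq by (simp add: inner_sum_right inner_diff_left) (simp add: inner_commute)
	qed
qed

lemma smooth_on_dch_inner:
	assumes "c \<in> A"
	shows "smooth_on (im c) (%z. dphi c z a \<bullet> dphi c z b)"
	by (rule smooth_on_inner[OF smooth_on_dch[OF smooth_phi assms] smooth_on_dch[OF smooth_phi assms] chart_open[OF assms]])

lemma smooth_on_det_gram: "c \<in> A ==> smooth_on (im c) (%z. det (gram c z))"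
	unfolding gram_def by (rule smooth_on_det[OF smooth_on_dch_inner chart_open])

lemma smooth_on_lift:
	assumes c: "c \<in> A"
	shows "smooth_on (im c) (lift c w)"
proof (rule smooth_on_euclidean[OF _ chart_open[OF c]])
	fix b :: "real ^ 'm::{finite,wellorder}" assume "b \<in> Basis"
	then obtain k where k: "b = axis k 1" by (auto simp: Basis_vec_def)
	have 1: "smooth_on (im c) (%z. if j = k then w \<bullet> dphi c z (axis i 1)
			else dphi c z (axis i 1) \<bullet> dphi c z (axis j 1))" for i j
		using smooth_on_inner[OF smooth_on_const smooth_on_dch[OF smooth_phi c] chart_open[OF c]]
			smooth_on_dch_inner[OF c] by (cases "j = k") simp_all
	have "smooth_on (im c) (%z. det (\<chi> i j. if j = k then w \<bullet> dphi c z (axis i 1)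
			else dphi c z (axis i 1) \<bullet> dphi c z (axis j 1)) / det (gram c z))"
		by (rule smooth_on_divide[OF smooth_on_det[OF 1 chart_open[OF c]] smooth_on_det_gram[OF c] chart_open[OF c] det_gram_nonzero[OF c]])
	then show "smooth_on (im c) (%z. lift c w z \<bullet> b)" by (simp add: k inner_axis lift_def)
qed

subsection \<open>Tangential derivatives along constant vectors\<close>

text \<open>As w is constant, \<open>pd w f\<close> is again a global function and the operator can
  be iterated; a tangent vector u is covered by w = u.\<close>

definition pd :: "'e => ('p => 'c::real_normed_vector) => 'p => 'c" where
	"pd w f p = deriv_along A \<phi> f p (P p w)"

lemma pd_chart:
	assumes "smooth f" "c \<in> A" "p \<in> fst c"
	shows "pd w f p = dch f c (snd c p) (lift c w (snd c p))"
	unfolding pd_def lift_P[OF assms(2,3), symmetric] by (rule deriv_along_chart[OF assms])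

lemma pd_Tan: "p \<in> M ==> u \<in> TM p ==> deriv_along A \<phi> f p u = pd u f p"
	by (simp add: pd_def P_id)

lemma pd_P: "p \<in> M ==> pd (P p w) f p = pd w f p" by (simp add: pd_def P_P)

lemma in_chart_pd:
	assumes f: "smooth f" and c: "c \<in> A" "z \<in> im c"
	shows "in_chart c (pd w f) z = (\<Sum>b\<in>Basis. (lift c w z \<bullet> b) *R dch f c z b)"
proof -
	obtain p where p: "p \<in> fst c" "z = snd c p" using c by auto
	have "in_chart c (pd w f) z = dch f c z (lift c w z)"
		unfolding p(2) in_chart_snd[OF c(1) p(1)] by (rule pd_chart[OF f c(1) p(1)])
	also have "... = (\<Sum>b\<in>Basis. (lift c w z \<bullet> b) *R dch f c z b)"
		by (rule linear_euclidean_expand[OF dch_linear[OF f c]])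
	finally show ?thesis .
qed

lemma smooth_fun_pd:
	assumes f: "smooth f"
	shows "smooth (pd w f)"
	unfolding smooth_fun_def
proof
	fix c assume c: "c \<in> A"
	note op = chart_open[OF c]
	have "smooth_on (im c) (%z. (lift c w z \<bullet> b) *R dch f c z b)" for b
		by (rule smooth_on_scaleR[OF smooth_on_inner[OF smooth_on_lift[OF c] smooth_on_const op] smooth_on_dch[OF f c] op])
	then have "smooth_on (im c) (%z. \<Sum>b\<in>Basis. (lift c w z \<bullet> b) *R dch f c z b)"
		by (rule smooth_on_sum[OF _ op])
	then show "smooth_on (im c) (in_chart c (pd w f))" by (subst smooth_on_cong[OF op in_chart_pd[OF f c]]) auto
qed

lemma smooth_fun_const [simp]: "smooth (%p. k)" unfolding smooth_fun_def in_chart_def by (simp add: o_def)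

lemma in_chart_lambda: "in_chart c (%p. h (f p)) = (%z. h (in_chart c f z))"
	"in_chart c (%p. k (f p) (g p)) = (%z. k (in_chart c f z) (in_chart c g z))"
	"in_chart c (%p. \<Sum>i\<in>I. F i p) = (%z. \<Sum>i\<in>I. in_chart c (F i) z)"
	by (auto simp: in_chart_def)

lemma smooth_fun_bilinear:
	"smooth f ==> smooth g ==> bounded_bilinear h ==> smooth (%p. h (f p) (g p))"
	unfolding smooth_fun_def in_chart_lambda(2)[of _ h f g]
	using smooth_on_bilinear[of _ "in_chart _ f" "in_chart _ g" h] chart_open by blast

lemma smooth_fun_add: "smooth f ==> smooth g ==> smooth (%p. f p + g p)"
	unfolding smooth_fun_def in_chart_lambda(2)[of _ "(+)" f g]
	using smooth_on_add[of _ "in_chart _ f" "in_chart _ g"] chart_open by blast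

lemma smooth_fun_diff: "smooth f ==> smooth g ==> smooth (%p. f p - g p)"
	unfolding smooth_fun_def in_chart_lambda(2)[of _ "(-)" f g]
	using smooth_on_diff[of _ "in_chart _ f" "in_chart _ g"] chart_open by blast

lemma smooth_fun_minus: "smooth f ==> smooth (%p. - f p)"
	using smooth_fun_diff[OF smooth_fun_const[of 0]] by simp

lemma smooth_fun_sum: "(\<And>i. i \<in> I ==> smooth (F i)) ==> smooth (%p. \<Sum>i\<in>I. F i p)"
	unfolding smooth_fun_def in_chart_lambda(3)[of _ F I]
	using smooth_on_sum[of I _ "%i. in_chart _ (F i)"] chart_open by blast

lemmas smooth_fun_scaleR = smooth_fun_bilinear[OF _ _ bounded_bilinear_scaleR]
lemmas smooth_fun_inner = smooth_fun_bilinear[OF _ _ bounded_bilinear_inner]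
lemmas smooth_fun_mult = smooth_fun_bilinear[OF _ _ bounded_bilinear_mult]

lemmas smooth_fun_intros = smooth_fun_const smooth_fun_add smooth_fun_diff smooth_fun_minus smooth_fun_sum
	smooth_fun_scaleR smooth_fun_inner smooth_fun_mult smooth_fun_pd smooth_phi

lemma smooth_fun_compose:
	fixes f :: "'p => 'a::euclidean_space"
	assumes "smooth f" "smooth_on T g" "open T" "f ` M \<subseteq> T"
	shows "smooth (%p. g (f p))"
	unfolding smooth_fun_def in_chart_lambda(1)[of _ g f]
proof
	fix c assume c: "c \<in> A"
	show "smooth_on (im c) (%z. g (in_chart c f z))"
		by (rule smooth_on_compose[OF assms(2) smooth_fun_chart[OF assms(1) c] chart_open[OF c] assms(3)])
			(use assms(4) chart_in_M[OF c] c in \<open>force simp: in_chart_snd\<close>)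
qed

lemma coord_in: "p \<in> M ==> coord A p \<in> snd (chart_at A p) ` fst (chart_at A p)"
	using chart_at_mem by (simp add: coord_def)

lemma has_derivative_coord:
	"smooth f ==> p \<in> M ==> (in_chart (chart_at A p) f has_derivative dch f (chart_at A p) (coord A p)) (at (coord A p))"
	by (rule dch_has_derivative[OF _ chart_at_in coord_in])

lemma pd_eqI:
	assumes "(in_chart (chart_at A p) f has_derivative f') (at (coord A p))"
	shows "pd w f p = f' (components A \<phi> p (P p w))"
	unfolding pd_def deriv_along_def using frechet_derivative_eqI[OF assms] by simp

lemma pd_cong:
	assumes "\<And>q. q \<in> M ==> f q = g q" "p \<in> M"
	shows "pd w f p = pd w g p"
proof -
	let ?c = "chart_at A p"
	have "in_chart ?c f z = in_chart ?c g z" if "z \<in> snd ?c ` fst ?c" for z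
		using chart_inv_in[OF chart_at_in[OF assms(2)] that] chart_subset[OF chart_at_in[OF assms(2)]] assms(1)
		by (auto simp: in_chart_def)
	then show ?thesis unfolding pd_def deriv_along_def
		using frechet_derivative_cong_open[OF chart_open[OF chart_at_in[OF assms(2)]] coord_in[OF assms(2)]] by metis
qed

lemma pd_const [simp]: "pd w (%q. k) p = 0"
	unfolding pd_def deriv_along_def in_chart_def by (simp add: o_def frechet_derivative_const)

lemma pd_linear:
	assumes "smooth f" "bounded_linear h" "p \<in> M"
	shows "pd w (%q. h (f q)) p = h (pd w f p)"
	unfolding pd_eqI[OF has_derivative_coord[OF assms(1,3)]]
	by (rule pd_eqI) (use bounded_linear.has_derivative[OF assms(2) has_derivative_coord[OF assms(1,3)]]
		in \<open>simp add: in_chart_lambda(1)[of _ h f]\<close>)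

lemma pd_bilinear:
	assumes "smooth f" "smooth g" "bounded_bilinear h" "p \<in> M"
	shows "pd w (%q. h (f q) (g q)) p = h (f p) (pd w g p) + h (pd w f p) (g p)"
proof -
	note c = chart_at_in[OF assms(4)] chart_at_mem[OF assms(4)]
	have "in_chart (chart_at A p) f (coord A p) = f p" "in_chart (chart_at A p) g (coord A p) = g p"
		using c by (simp_all add: coord_def)
	then show ?thesis unfolding pd_eqI[OF has_derivative_coord[OF assms(1,4)]] pd_eqI[OF has_derivative_coord[OF assms(2,4)]]
		using pd_eqI[of p "%q. h (f q) (g q)", unfolded in_chart_lambda(2)[of _ h f g],
			OF bounded_bilinear.FDERIV[OF assms(3) has_derivative_coord[OF assms(1,4)] has_derivative_coord[OF assms(2,4)]]]
		by simp
qed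

lemma pd_add:
	assumes "smooth f" "smooth g" "p \<in> M"
	shows "pd w (%q. f q + g q) p = pd w f p + pd w g p"
	unfolding pd_eqI[OF has_derivative_coord[OF assms(1,3)]] pd_eqI[OF has_derivative_coord[OF assms(2,3)]]
	by (rule pd_eqI) (use has_derivative_add[OF has_derivative_coord[OF assms(1,3)] has_derivative_coord[OF assms(2,3)]]
		in \<open>simp add: in_chart_lambda(2)[of _ "(+)" f g]\<close>)

lemma pd_sum:
	assumes "\<And>i. i \<in> I ==> smooth (F i)" "p \<in> M"
	shows "pd w (%q. \<Sum>i\<in>I. F i q) p = (\<Sum>i\<in>I. pd w (F i) p)"
proof (cases "finite I")
	case True
	then show ?thesis using assms(1) by (induction I rule: finite_induct) (auto simp: pd_add smooth_fun_sum assms(2))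
qed simp

lemmas pd_scaleR = pd_bilinear[OF _ _ bounded_bilinear_scaleR]
lemmas pd_inner = pd_bilinear[OF _ _ bounded_bilinear_inner]
lemmas pd_mult = pd_bilinear[OF _ _ bounded_bilinear_mult]

lemma pd_compose_real:
	fixes f :: "'p => real" and g :: "real => real"
	assumes "smooth f" "(g has_real_derivative g') (at (f p))" "p \<in> M"
	shows "pd w (%q. g (f q)) p = g' * pd w f p"
proof -
	note c = chart_at_in[OF assms(3)] chart_at_mem[OF assms(3)]
	have fc: "in_chart (chart_at A p) f (coord A p) = f p" using c by (simp add: coord_def)
	have "((%z. g (in_chart (chart_at A p) f z)) has_derivative
			(%v. g' * dch f (chart_at A p) (coord A p) v)) (at (coord A p))"
		by (rule has_derivative_compose[OF has_derivative_coord[OF assms(1,3)]])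
			(use assms(2) fc in \<open>simp add: has_field_derivative_def\<close>)
	then show ?thesis unfolding pd_eqI[OF has_derivative_coord[OF assms(1,3)]]
		by (intro pd_eqI) (simp add: in_chart_lambda(1)[of _ g f])
qed

lemma linear_deriv_along:
	assumes "smooth f" "p \<in> M" "u \<in> TM p" "v \<in> TM p"
	shows "deriv_along A \<phi> f p (a *R u + b *R v) = a *R deriv_along A \<phi> f p u + b *R deriv_along A \<phi> f p v"
proof -
	note c = chart_at_in[OF assms(2)] chart_at_mem[OF assms(2)]
	obtain x y where xy: "u = dphi (chart_at A p) (snd (chart_at A p) p) x"
		"v = dphi (chart_at A p) (snd (chart_at A p) p) y"
		using assms(3,4) Tan_chart[OF c] by auto
	have z: "snd (chart_at A p) p \<in> snd (chart_at A p) ` fst (chart_at A p)" using c by auto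
	note l = dch_linear[OF smooth_phi c(1) z] dch_linear[OF assms(1) c(1) z]
	have "a *R u + b *R v = dphi (chart_at A p) (snd (chart_at A p) p) (a *R x + b *R y)"
		unfolding xy by (simp add: linear_add[OF l(1)] linear_scale[OF l(1)])
	then show ?thesis unfolding xy deriv_along_chart[OF assms(1) c] using deriv_along_chart[OF assms(1) c]
		by (simp add: linear_add[OF l(2)] linear_scale[OF l(2)])
qed

lemma linear_pd:
	assumes "smooth f" "p \<in> M"
	shows "linear (%w. pd w f p)"
proof
	fix a b c
	show "pd (a + b) f p = pd a f p + pd b f p" using linear_deriv_along[OF assms P_in[OF assms(2)] P_in[OF assms(2)], of 1 a 1 b]
		by (simp add: pd_def linear_add[OF linear_P[OF assms(2)]])
	show "pd (c *R a) f p = c *R pd a f p"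
		using linear_deriv_along[OF assms P_in[OF assms(2)] P_in[OF assms(2)], of c a 0 a]
		by (simp add: pd_def linear_scale[OF linear_P[OF assms(2)]])
qed

lemma pd_phi: "p \<in> M ==> pd w \<phi> p = P p w"
	using pd_chart[OF smooth_phi chart_at_in chart_at_mem] lift_P[OF chart_at_in chart_at_mem] by simp

text \<open>The projection of a constant vector is the derivative of the immersion along it, so its
  smoothness comes for free.\<close>

lemma smooth_fun_P [simp]: "smooth (%q. P q w)"
	using smooth_fun_cong[of "%q. P q w" "pd w \<phi>"] pd_phi smooth_fun_pd[OF smooth_phi] by auto

lemma smooth_fun_P_apply:
	assumes "smooth X"
	shows "smooth (%q. P q (X q))"
proof -
	have "smooth (%q. \<Sum>b\<in>Basis. (X q \<bullet> b) *R P q b)"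
		by (intro smooth_fun_sum smooth_fun_scaleR smooth_fun_inner assms smooth_fun_const smooth_fun_P)
	moreover have "(\<Sum>b\<in>Basis. (X q \<bullet> b) *R P q b) = P q (X q)" if "q \<in> M" for q
		by (rule linear_euclidean_expand[OF linear_P[OF that], symmetric])
	ultimately show ?thesis using smooth_fun_cong[of "%q. P q (X q)" "%q. \<Sum>b\<in>Basis. (X q \<bullet> b) *R P q b"] by auto
qed

subsection \<open>The second fundamental form as the derivative of the projection\<close>

text \<open>For tangent b this is the second fundamental form B(a, b), for normal b the shape
  operator of b applied to a; in both cases a enters through its tangential part only.\<close>

definition Q :: "'e => 'e => 'p => 'e" where "Q a b p = pd a (%q. P q b) p"

lemma smooth_fun_Q [simp]: "smooth (Q a b)" unfolding Q_def[abs_def] by (rule smooth_fun_pd[OF smooth_fun_P])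

lemma linear_Q1: "p \<in> M ==> linear (%a. Q a b p)" unfolding Q_def by (rule linear_pd[OF smooth_fun_P])

lemma linear_Q2:
	assumes "p \<in> M"
	shows "linear (%b. Q a b p)"
proof
	fix b c r
	have "Q a (b + c) p = pd a (%q. P q b + P q c) p"
		unfolding Q_def by (rule pd_cong[OF _ assms]) (simp add: linear_add[OF linear_P])
	then show "Q a (b + c) p = Q a b p + Q a c p" unfolding Q_def by (simp add: pd_add[OF _ _ assms])
	have "Q a (r *R b) p = pd a (%q. r *R P q b) p"
		unfolding Q_def by (rule pd_cong[OF _ assms]) (simp add: linear_scale[OF linear_P])
	then show "Q a (r *R b) p = r *R Q a b p"
		unfolding Q_def by (simp add: pd_linear[OF _ bounded_linear_scaleR_right assms])
qed

lemma Q_P1: "p \<in> M ==> Q (P p a) b p = Q a b p" unfolding Q_def by (rule pd_P)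

lemma Q_sym:
	assumes p: "p \<in> M"
	shows "Q a b p \<bullet> c = Q a c p \<bullet> b"
proof -
	have "Q a b p \<bullet> c = pd a (%q. P q b \<bullet> c) p" "Q a c p \<bullet> b = pd a (%q. P q c \<bullet> b) p"
		unfolding Q_def by (simp_all add: pd_linear[OF _ bounded_linear_inner_left p])
	moreover have "pd a (%q. P q b \<bullet> c) p = pd a (%q. P q c \<bullet> b) p"
		by (rule pd_cong[OF _ p]) (metis P_sym inner_commute)
	ultimately show ?thesis by simp
qed

lemma pd_P_apply:
	assumes X: "smooth X" and p: "p \<in> M"
	shows "pd a (%q. P q (X q)) p = Q a (X p) p + P p (pd a X p)"
proof -
	have "pd a (%q. P q (X q)) p = pd a (%q. \<Sum>b\<in>Basis. (X q \<bullet> b) *R P q b) p"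
		by (rule pd_cong[OF _ p]) (rule linear_euclidean_expand[OF linear_P])
	also have "... = (\<Sum>b\<in>Basis. (X p \<bullet> b) *R Q a b p + (pd a X p \<bullet> b) *R P p b)"
		using X p by (simp add: pd_sum pd_scaleR pd_inner Q_def smooth_fun_intros)
	also have "... = Q a (X p) p + P p (pd a X p)" unfolding linear_euclidean_expand[OF linear_Q2[OF p], of _ "X p"]
			linear_euclidean_expand[OF linear_P[OF p], of "pd a X p"] by (rule sum.distrib)
	finally show ?thesis .
qed

text \<open>Derivative of P P = P. Consequently \<open>Q a\<close> exchanges tangent and normal
  vectors.\<close>

lemma Q_P_split:
	assumes p: "p \<in> M"
	shows "Q a (P p b) p + P p (Q a b p) = Q a b p"
proof -
	have "pd a (%q. P q (P q b)) p = pd a (%q. P q b) p" by (rule pd_cong[OF _ p]) (rule P_P)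
	then show ?thesis using pd_P_apply[OF smooth_fun_P p, of a b] by (simp add: Q_def)
qed

lemma P_Q_P [simp]:
	assumes p: "p \<in> M"
	shows "P p (Q a (P p b) p) = 0"
	using Q_P_split[OF p, of a "P p b"] by (simp add: P_P[OF p])

text \<open>Coordinates of the Lie bracket of the two vector fields formed by the tangential parts
  of a and b.\<close>

definition bracket :: "('p, real ^ 'm::{finite,wellorder}) chart => 'e => 'e => real ^ 'm::{finite,wellorder} => real ^ 'm::{finite,wellorder}" where
	"bracket c a b z = FD (lift c b) z (lift c a z) - FD (lift c a) z (lift c b z)"

lemma pd_pd_chart:
	fixes f :: "'p => 'c::euclidean_space"
	assumes f: "smooth f" and c: "c \<in> A" "p \<in> fst c"
	shows "pd a (pd b f) p = dch f c (snd c p) (FD (lift c b) (snd c p) (lift c a (snd c p)))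
		+ (\<Sum>k\<in>Basis. \<Sum>l\<in>Basis. ((lift c b (snd c p) \<bullet> k) * (lift c a (snd c p) \<bullet> l)) *R
				FD (%z. dch f c z k) (snd c p) l)"
proof -
	let ?z = "snd c p"
	have z: "?z \<in> im c" using c by auto
	note op = chart_open[OF c(1)]
	define L where "L = FD (lift c b) ?z"
	define D where "D k = FD (%z. dch f c z k) ?z" for k
	have dL: "(lift c b has_derivative L) (at ?z)"
		unfolding L_def by (rule smooth_on_has_derivative[OF smooth_on_lift[OF c(1)] op z])
	have dD: "((%z. dch f c z k) has_derivative D k) (at ?z)" for k
		unfolding D_def by (rule smooth_on_has_derivative[OF smooth_on_dch[OF f c(1)] op z])
	have "((%z. \<Sum>k\<in>Basis. (lift c b z \<bullet> k) *R dch f c z k) has_derivative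
			(%v. \<Sum>k\<in>Basis. (lift c b ?z \<bullet> k) *R D k v + (L v \<bullet> k) *R dch f c ?z k)) (at ?z)"
		by (intro has_derivative_sum has_derivative_scaleR has_derivative_inner_left dL dD)
	then have "(in_chart c (pd b f) has_derivative
			(%v. \<Sum>k\<in>Basis. (lift c b ?z \<bullet> k) *R D k v + (L v \<bullet> k) *R dch f c ?z k)) (at ?z)"
		by (rule has_derivative_transform_within_open[OF _ op z]) (simp add: in_chart_pd[OF f c(1)])
	then have "pd a (pd b f) p =
			(\<Sum>k\<in>Basis. (lift c b ?z \<bullet> k) *R D k (lift c a ?z) + (L (lift c a ?z) \<bullet> k) *R dch f c ?z k)"
		unfolding pd_chart[OF smooth_fun_pd[OF f] c] by (simp add: frechet_derivative_eqI)
	also have "... = (\<Sum>k\<in>Basis. (L (lift c a ?z) \<bullet> k) *R dch f c ?z k) +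
			(\<Sum>k\<in>Basis. (lift c b ?z \<bullet> k) *R D k (lift c a ?z))"
		by (simp add: sum.distrib add.commute)
	also have "(\<Sum>k\<in>Basis. (L (lift c a ?z) \<bullet> k) *R dch f c ?z k) = dch f c ?z (L (lift c a ?z))"
		by (rule linear_euclidean_expand[OF dch_linear[OF f c(1) z], symmetric])
	also have "(\<Sum>k\<in>Basis. (lift c b ?z \<bullet> k) *R D k (lift c a ?z)) =
			(\<Sum>k\<in>Basis. \<Sum>l\<in>Basis. ((lift c b ?z \<bullet> k) * (lift c a ?z \<bullet> l)) *R D k l)"
	proof (rule sum.cong[OF refl])
		fix k
		show "(lift c b ?z \<bullet> k) *R D k (lift c a ?z) =
				(\<Sum>l\<in>Basis. ((lift c b ?z \<bullet> k) * (lift c a ?z \<bullet> l)) *R D k l)"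
			by (subst linear_euclidean_expand[OF has_derivative_linear[OF dD]]) (simp add: scaleR_sum_right)
	qed
	finally show ?thesis by (simp add: L_def D_def)
qed

lemma bracket_chart:
	fixes f :: "'p => 'c::euclidean_space"
	assumes f: "smooth f" and c: "c \<in> A" "p \<in> fst c"
	shows "pd a (pd b f) p - pd b (pd a f) p = dch f c (snd c p) (bracket c a b (snd c p))"
proof -
	let ?z = "snd c p"
	have z: "?z \<in> im c" using c by auto
	have sym: "FD (%z. dch f c z k) ?z l = FD (%z. dch f c z l) ?z k" for k l
		by (rule second_derivative_symmetric[OF chart_open[OF c(1)] smooth_fun_chart[OF f c(1)] z])
	have "(\<Sum>k\<in>Basis. \<Sum>l\<in>Basis. ((lift c b ?z \<bullet> k) * (lift c a ?z \<bullet> l)) *R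
				FD (%z. dch f c z k) ?z l) =
			(\<Sum>k\<in>Basis. \<Sum>l\<in>Basis. ((lift c a ?z \<bullet> k) * (lift c b ?z \<bullet> l)) *R
				FD (%z. dch f c z k) ?z l)"
		by (subst sum.swap) (simp add: sym mult.commute)
	then show ?thesis unfolding pd_pd_chart[OF f c] bracket_def by (simp add: linear_diff[OF dch_linear[OF f c(1) z]])
qed

text \<open>Case f = \<phi> of the preceding lemma, since \<open>pd b \<phi>\<close> is the
  projection of b. It expresses the bracket by \<open>Q\<close>, without coordinates.\<close>

lemma Q_bracket:
	assumes c: "c \<in> A" "p \<in> fst c"
	shows "Q a b p - Q b a p = dphi c (snd c p) (bracket c a b (snd c p))"
proof -
	have p: "p \<in> M" by (rule chart_in_M[OF c])
	have "Q a b p = pd a (pd b \<phi>) p" for a b unfolding Q_def by (rule pd_cong[OF _ p]) (simp add: pd_phi)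
	then show ?thesis using bracket_chart[OF smooth_phi c] by simp
qed

lemma pd_commute:
	fixes f :: "'p => 'c::euclidean_space"
	assumes f: "smooth f" and p: "p \<in> M"
	shows "pd a (pd b f) p - pd b (pd a f) p = pd (Q a b p - Q b a p) f p"
		and Q_diff_Tan: "Q a b p - Q b a p \<in> TM p"
proof -
	note c = chart_at_in[OF p] chart_at_mem[OF p]
	show t: "Q a b p - Q b a p \<in> TM p" unfolding Q_bracket[OF c] Tan_chart[OF c] by simp
	show "pd a (pd b f) p - pd b (pd a f) p = pd (Q a b p - Q b a p) f p"
		unfolding pd_Tan[OF p t, symmetric] unfolding Q_bracket[OF c]
		by (simp add: deriv_along_chart[OF f c] bracket_chart[OF f c])
qed

text \<open>Differentiates the identity P(d\<phi> b) = d\<phi> b: the term in which P is left alone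
  is the tangential part, the other is \<open>Q\<close>. This links \<open>Q\<close> with the
  definition of \<open>second_ff\<close>.\<close>

lemma second_derivative_chart:
	assumes c: "c \<in> A" "p \<in> fst c"
	shows "FD (%z. dphi c z b) (snd c p) a
		 - P p (FD (%z. dphi c z b) (snd c p) a)
		 = Q (dphi c (snd c p) a) (dphi c (snd c p) b) p"
proof -
	let ?z = "snd c p"
	define S where "S = FD (%z. dphi c z b) ?z"
	have p: "p \<in> M" by (rule chart_in_M[OF c])
	have z: "?z \<in> im c" using c by auto
	note op = chart_open[OF c(1)]
	have dS: "((%z. dphi c z b) has_derivative S) (at ?z)"
		unfolding S_def by (rule smooth_on_has_derivative[OF smooth_on_dch[OF smooth_phi c(1)] op z])
	have dP: "(in_chart c (%q. P q e) has_derivative dch (%q. P q e) c ?z) (at ?z)" for e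
		by (rule dch_has_derivative[OF smooth_fun_P c(1) z])
	have "((%z. \<Sum>e\<in>Basis. (dphi c z b \<bullet> e) *R in_chart c (%q. P q e) z) has_derivative
			(%v. \<Sum>e\<in>Basis. (dphi c ?z b \<bullet> e) *R dch (%q. P q e) c ?z v + (S v \<bullet> e) *R in_chart c (%q. P q e) ?z)) (at ?z)"
		by (intro has_derivative_sum has_derivative_scaleR has_derivative_inner_left dS dP)
	moreover have "(\<Sum>e\<in>Basis. (dphi c y b \<bullet> e) *R in_chart c (%q. P q e) y) = dphi c y b"
		if y: "y \<in> im c" for y
	proof -
		obtain q where q: "q \<in> fst c" "y = snd c q" using y by blast
		have qM: "q \<in> M" by (rule chart_in_M[OF c(1) q(1)])
		have "P q (dphi c y b) = dphi c y b" by (rule P_id[OF qM]) (simp add: q Tan_chart[OF c(1) q(1)])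
		then show ?thesis using linear_euclidean_expand[OF linear_P[OF qM], of "dphi c y b"] c q by simp
	qed
	ultimately have "((%z. dphi c z b) has_derivative
			(%v. \<Sum>e\<in>Basis. (dphi c ?z b \<bullet> e) *R dch (%q. P q e) c ?z v + (S v \<bullet> e) *R in_chart c (%q. P q e) ?z)) (at ?z)"
		by (rule has_derivative_transform_within_open[OF _ op z])
	from fun_cong[OF frechet_derivative_eqI[OF this], of a]
	have "S a = (\<Sum>e\<in>Basis. (dphi c ?z b \<bullet> e) *R dch (%q. P q e) c ?z a + (S a \<bullet> e) *R P p e)"
		unfolding S_def[symmetric] in_chart_snd[OF c] .
	also have "... = (\<Sum>e\<in>Basis. (dphi c ?z b \<bullet> e) *R dch (%q. P q e) c ?z a) + P p (S a)"
		unfolding linear_euclidean_expand[OF linear_P[OF p], of "S a"] by (rule sum.distrib)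
	also have "(\<Sum>e\<in>Basis. (dphi c ?z b \<bullet> e) *R dch (%q. P q e) c ?z a) =
			(\<Sum>e\<in>Basis. (dphi c ?z b \<bullet> e) *R Q (dphi c ?z a) e p)"
		unfolding Q_def deriv_along_chart[OF smooth_fun_P c, symmetric]
		by (simp add: pd_Tan[OF p] Tan_chart[OF c])
	also have "(\<Sum>e\<in>Basis. (dphi c ?z b \<bullet> e) *R Q (dphi c ?z a) e p) = Q (dphi c ?z a) (dphi c ?z b) p"
		by (rule linear_euclidean_expand[OF linear_Q2[OF p], symmetric])
	finally show ?thesis unfolding S_def diff_eq_eq .
qed

lemma second_ff_eq:
	assumes p: "p \<in> M" and uv: "u \<in> TM p" "v \<in> TM p"
	shows "second_ff A \<phi> p u v = Q u v p"
proof -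
	note c = chart_at_in[OF p] chart_at_mem[OF p]
	have d: "dphi (chart_at A p) (coord A p) (components A \<phi> p w) = w" if "w \<in> TM p" for w
		using components_in_Tan[OF that] by (simp add: dmap_def)
	show ?thesis using second_derivative_chart[OF c, of "components A \<phi> p v" "components A \<phi> p u"] d[OF uv(1)] d[OF uv(2)]
		by (simp add: second_ff_def perp_eq[OF p] ambient_deriv_def coord_def)
qed

subsection \<open>Frames and mean curvature\<close>

lemma ortho_frame_exists:
	assumes "p \<in> M"
	shows "\<exists>es. ortho_frame A \<phi> p es"
proof -
	obtain es where "length es = dim (TM p)" "orthonormal es" "span (set es) = TM p"
		using orthonormal_basis_list[OF subspace_Tan[OF assms]] by blast
	then show ?thesis using dim_Tan[OF assms] unfolding ortho_frame_def by auto
qed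

lemma some_frame: "p \<in> M ==> ortho_frame A \<phi> p (sfrm p)"
	unfolding some_frame_def by (rule someI_ex[OF ortho_frame_exists])

lemma ortho_frameD:
	assumes "ortho_frame A \<phi> p es"
	shows "length es = CARD('m)" "orthonormal es" "span (set es) = TM p"
		"i < CARD('m) ==> es ! i \<in> TM p"
	using assms span_base[of "es ! i" "set es"] unfolding ortho_frame_def by auto

lemma trace_frame:
	fixes r :: "'e => 'e => 'c::real_vector"
	assumes "ortho_frame A \<phi> p es" "\<And>b. linear (%a. r a b)" "\<And>a. linear (r a)"
	shows "(\<Sum>i<CARD('m). r (es ! i) (es ! i)) = (\<Sum>b\<in>Basis. r (P p b) (P p b))"
	using trace_orthonormal[OF ortho_frameD(2,3)[OF assms(1)] assms(2,3)] ortho_frameD(1)[OF assms(1)] by simp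

text \<open>CARD('m) times the mean curvature vector. In this form it is a sum of derivatives of
  projected basis vectors; \<open>trace_swap\<close> puts a projection into the second slot.\<close>

definition mH :: "'p => 'e" where "mH p = (\<Sum>b\<in>Basis. Q b b p)"

lemma smooth_fun_mH: "smooth mH" unfolding mH_def[abs_def] by (rule smooth_fun_sum[OF smooth_fun_Q])

lemma mH_eq:
	assumes p: "p \<in> M"
	shows "mH p = (\<Sum>b\<in>Basis. Q b (P p b) p)"
proof -
	have "mH p = (\<Sum>b\<in>Basis. Q (P p b) b p)" unfolding mH_def by (simp add: Q_P1[OF p])
	also have "... = (\<Sum>b\<in>Basis. Q b (P p b) p)" by (rule trace_swap[OF linear_Q1[OF p] linear_Q2[OF p] P_sym[OF p]])
	finally show ?thesis .
qed

lemma P_mH: "p \<in> M ==> P p (mH p) = 0" unfolding mH_eq by (simp add: linear_sum[OF linear_P])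

lemma mean_curvature_eq:
	assumes p: "p \<in> M"
	shows "mcv p = (1 / real CARD('m)) *R mH p"
proof -
	note fr = some_frame[OF p]
	have "(\<Sum>i<CARD('m). second_ff A \<phi> p (sfrm p ! i) (sfrm p ! i)) =
			(\<Sum>i<CARD('m). Q (sfrm p ! i) (sfrm p ! i) p)"
		using ortho_frameD(4)[OF fr] by (intro sum.cong refl second_ff_eq[OF p]) auto
	also have "... = (\<Sum>b\<in>Basis. Q (P p b) (P p b) p)" by (rule trace_frame[OF fr linear_Q1[OF p] linear_Q2[OF p]])
	also have "... = mH p" unfolding mH_eq[OF p] by (simp add: Q_P1[OF p])
	finally show ?thesis by (simp add: mean_curvature_def)
qed

end


section \<open>The Riemannian measure\<close>

context closed_immersion
begin

abbreviation borel_M :: "'p measure" where "borel_M \<equiv> restrict_space borel M"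

abbreviation vol where "vol c z \<equiv> volume_density (in_chart c \<phi>) z"

lemma vol_eq: "vol c z = sqrt (det (gram c z))" by (simp add: volume_density_def gram_def)

lemma gram_change:
	assumes c: "c \<in> A" "p \<in> fst c" and d: "d \<in> A" "p \<in> fst d"
	shows "gram c (snd c p) = transpose (matrix (dch (snd d) c (snd c p))) ** gram d (snd d p) ** matrix (dch (snd d) c (snd c p))"
proof -
	define B where "B = matrix (dch (snd d) c (snd c p))"
	have z: "snd d p \<in> snd d ` fst d" using d by auto
	have *: "dphi c (snd c p) (axis i 1) = (\<Sum>k\<in>UNIV. B $ k $ i *R dphi d (snd d p) (axis k 1))" for i
		unfolding dch_change[OF smooth_phi c d]
		by (subst linear_vec_expand[OF dch_linear[OF smooth_phi d(1) z]]) (simp add: B_def matrix_def)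
	have "gram c (snd c p) $ i $ j = (transpose B ** gram d (snd d p) ** B) $ i $ j" for i j
		unfolding gram_def matrix_matrix_mult_def transpose_def
		by (simp add: * inner_sum_left inner_sum_right sum_distrib_left sum_distrib_right mult_ac)
	then show ?thesis unfolding B_def by (simp add: vec_eq_iff)
qed

text \<open>All matrices on the segment from the identity to the Gram matrix are positive definite,
  so the determinant cannot change sign along it.\<close>

lemma det_gram_pos:
	assumes c: "c \<in> A" "z \<in> im c"
	shows "0 < det (gram c z)"
proof -
	let ?G = "%t::real. t *R gram c z + (1 - t) *R mat 1"
	have nz: "det (?G t) \<noteq> 0" if t: "0 \<le> t" "t \<le> 1" for t
	proof -
		have "v = 0" if v: "?G t *v v = 0" for v
		proof -
			have "0 = v \<bullet> (?G t *v v)" using v by simp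
			also have "... = t * (v \<bullet> (gram c z *v v)) + (1 - t) * (v \<bullet> v)"
				by (simp add: matrix_vector_mult_add_rdistrib scaleR_matrix_vector_assoc[symmetric] inner_add_right)
			also have "v \<bullet> (gram c z *v v) = dphi c z v \<bullet> dphi c z v"
			proof -
				have "v \<bullet> (gram c z *v v) = (\<Sum>k\<in>UNIV. v $ k *R dphi c z (axis k 1)) \<bullet> dphi c z v"
					by (simp add: inner_vec_def gram_mult[OF c] inner_sum_left)
				also have "(\<Sum>k\<in>UNIV. v $ k *R dphi c z (axis k 1)) = dphi c z v"
					by (rule linear_vec_expand[OF dch_linear[OF smooth_phi c], symmetric])
				finally show ?thesis .
			qed
			finally have eq: "t * (dphi c z v \<bullet> dphi c z v) + (1 - t) * (v \<bullet> v) = 0" by simp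
			moreover have "0 \<le> t * (dphi c z v \<bullet> dphi c z v)" "0 \<le> (1 - t) * (v \<bullet> v)" using t by auto
			ultimately have "t * (dphi c z v \<bullet> dphi c z v) = 0" "(1 - t) * (v \<bullet> v) = 0" by linarith+
			then have "dphi c z v = 0 \<or> v = 0" by (cases "t = 0") auto
			moreover have "inj (dphi c z)" using c dch_phi_inj by blast
			ultimately show "v = 0" using linear_injective_0[OF dch_linear[OF smooth_phi c]] by blast
		qed
		then have "invertible (?G t)" using matrix_left_invertible_ker invertible_left_inverse by blast
		then show ?thesis by (simp add: invertible_det_nz)
	qed
	have cont: "continuous_on {0..1} (%t. det (?G t))" unfolding det_def by (intro continuous_intros)
	show ?thesis
	proof (rule ccontr)
		assume "\<not> 0 < det (gram c z)"
		then have "det (?G 1) \<le> 0" by simp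
		moreover have "0 \<le> det (?G 0)" by simp
		ultimately obtain t where "0 \<le> t" "t \<le> 1" "det (?G t) = 0" using IVT2'[of "%t. det (?G t)" 1 0 0] cont by auto
		then show False using nz by blast
	qed
qed

lemma vol_pos: "c \<in> A ==> z \<in> im c ==> 0 < vol c z"
	by (simp add: vol_eq det_gram_pos)

lemma smooth_on_vol: "c \<in> A ==> smooth_on (im c) (vol c)" unfolding vol_eq[abs_def]
	by (rule smooth_on_compose[OF smooth_on_sqrt smooth_on_det_gram chart_open]) (auto simp: det_gram_pos)

lemma vol_change:
	assumes c: "c \<in> A" "p \<in> fst c" and d: "d \<in> A" "p \<in> fst d"
	shows "vol c (snd c p) = \<bar>det (matrix (dch (snd d) c (snd c p)))\<bar> * vol d (snd d p)"
proof -
	let ?B = "matrix (dch (snd d) c (snd c p))"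
	have "det (gram c (snd c p)) = (det ?B)^2 * det (gram d (snd d p))"
		unfolding gram_change[OF c d] det_mul det_transpose by (simp add: power2_eq_square)
	then show ?thesis by (simp add: vol_eq real_sqrt_mult)
qed

lemma chart_borel [measurable]: "c \<in> A ==> im c \<in> sets borel" by (rule borel_open[OF chart_open])

lemma space_borel_M [simp]: "space borel_M = M" by (simp add: space_restrict_space)

lemma chart_sets: 
	assumes "openM U"
	shows "U \<in> sets borel_M"
proof -
	obtain T where "open T" "U = M \<inter> T" using assms openin_open by blast
	then show ?thesis by (auto simp: sets_restrict_space)
qed

lemma chart_inv_measurable:
	assumes c: "c \<in> A"
	shows "inv_into (fst c) (snd c) \<in> restrict_space borel (im c) \<rightarrow>\<^sub>M borel_M"
proof (rule measurable_restrict_space2)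
	show "inv_into (fst c) (snd c) \<in> space (restrict_space borel (im c)) \<rightarrow> M"
		using chart_inv_in[OF c] chart_subset[OF c] by (auto simp: space_restrict_space)
	show "inv_into (fst c) (snd c) \<in> borel_measurable (restrict_space borel (im c))"
		using chart_homeo[OF c] by (intro borel_measurable_continuous_on_restrict) (auto simp: homeomorphism_def)
qed

lemma chart_image_eq:
	assumes c: "c \<in> A" and E: "E \<subseteq> fst c"
	shows "snd c ` E = inv_into (fst c) (snd c) -` E \<inter> im c"
	using c E chart_inv[OF c] by (auto simp: image_iff)

lemma chart_image_borel:
	assumes c: "c \<in> A" and E: "E \<in> sets borel_M" "E \<subseteq> fst c"
	shows "snd c ` E \<in> sets borel"
proof -
	have "inv_into (fst c) (snd c) -` E \<inter> space (restrict_space borel (im c)) \<in>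
			sets (restrict_space borel (im c))"
		using measurable_sets[OF chart_inv_measurable[OF c] E(1)] .
	then show ?thesis unfolding chart_image_eq[OF c E(2)]
		by (subst (asm) sets_restrict_space_iff) (auto simp: space_restrict_space chart_borel[OF c])
qed

text \<open>What \<open>dM\<close> has to be inside one chart, as a measure on all of M, so that the
  measures of different charts can be compared and added.\<close>

definition chart_measure where
	"chart_measure c = distr (density (restrict_space lborel (im c)) (%z. ennreal (vol c z)))
		 borel_M (inv_into (fst c) (snd c))"

lemma chart_inv_measurable':
	assumes c: "c \<in> A"
	shows "inv_into (fst c) (snd c) \<in> density (restrict_space lborel (im c)) f \<rightarrow>\<^sub>M borel_M"
	using chart_inv_measurable[OF c] by (simp cong: measurable_cong_sets add: sets_restrict_space_cong[OF sets_lborel])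

lemma vol_measurable:
	assumes c: "c \<in> A"
	shows "vol c \<in> borel_measurable (restrict_space lborel (im c))"
proof -
	have "vol c \<in> borel_measurable (restrict_space borel (im c))"
		by (rule borel_measurable_continuous_on_restrict[OF smooth_on_imp_continuous_on[OF smooth_on_vol[OF c]]])
	then show ?thesis by (simp cong: measurable_cong_sets add: sets_restrict_space_cong[OF sets_lborel])
qed

lemma sets_chart_measure [simp]: "sets (chart_measure c) = sets borel_M" by (simp add: chart_measure_def)

lemma emeasure_chart_measure:
	assumes c: "c \<in> A" and E: "E \<in> sets borel_M"
	shows "emeasure (chart_measure c) E =
		(\<integral>\<^sup>+ z. ennreal (vol c z) * indicator (snd c ` (E \<inter> fst c)) z \<partial>lborel)"
proof -
	let ?Z = "im c"
	have Z: "?Z \<inter> space lborel \<in> sets lborel" using chart_borel[OF c] by simp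
	have mz: "inv_into (fst c) (snd c) -` E \<inter> ?Z \<in> sets (restrict_space lborel ?Z)"
		using measurable_sets[OF chart_inv_measurable'[OF c] E] by (simp add: space_restrict_space)
	have im: "inv_into (fst c) (snd c) -` E \<inter> ?Z = snd c ` (E \<inter> fst c)"
		using chart_image_eq[OF c, of "E \<inter> fst c"] chart_inv_in[OF c] by auto
	have "emeasure (chart_measure c) E =
			emeasure (density (restrict_space lborel ?Z) (%z. ennreal (vol c z))) (inv_into (fst c) (snd c) -` E \<inter> ?Z)"
		unfolding chart_measure_def by (simp add: emeasure_distr[OF chart_inv_measurable'[OF c] E] space_restrict_space)
	also have "... = (\<integral>\<^sup>+ z. ennreal (vol c z) * indicator (snd c ` (E \<inter> fst c)) z \<partial>restrict_space lborel ?Z)"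
		using mz vol_measurable[OF c] unfolding im by (simp add: emeasure_density)
	also have "... = (\<integral>\<^sup>+ z. ennreal (vol c z) * indicator (snd c ` (E \<inter> fst c)) z * indicator ?Z z \<partial>lborel)"
		by (rule nn_integral_restrict_space[OF Z])
	also have "... = (\<integral>\<^sup>+ z. ennreal (vol c z) * indicator (snd c ` (E \<inter> fst c)) z \<partial>lborel)"
		by (intro nn_integral_cong) (auto simp: indicator_def)
	finally show ?thesis .
qed

end


section \<open>Chart measures agree on overlaps\<close>

context closed_immersion
begin

text \<open>Change of variables along the transition map, whose Jacobian relates the two densities
  by \<open>vol_change\<close>. The theorem applied concerns integrable functions, hence the
  finiteness assumption, which sufficiently small sets satisfy.\<close>

lemma chart_measure_change:
	assumes c: "c \<in> A" and d: "d \<in> A" and E: "E \<in> sets borel_M" "E \<subseteq> fst c" "E \<subseteq> fst d"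
		and fin: "emeasure (chart_measure d) E < \<infinity>"
	shows "emeasure (chart_measure c) E = emeasure (chart_measure d) E"
proof -
	let ?S = "snd c ` E" and ?T = "in_chart c (snd d)"
	have Ec: "E \<inter> fst c = E" "E \<inter> fst d = E" using E by auto
	have TS: "?T ` ?S = snd d ` E"
	proof -
		have "?T (snd c p) = snd d p" if "p \<in> E" for p by (rule in_chart_snd[OF c]) (use E that in blast)
		then show ?thesis unfolding image_image by (rule image_cong[OF refl])
	qed
	have S: "?S \<in> sets borel" "snd d ` E \<in> sets borel"
		by (rule chart_image_borel[OF c E(1,2)], rule chart_image_borel[OF d E(1,3)])
	have der: "(?T has_derivative dch (snd d) c z) (at z within ?S)" if z: "z \<in> ?S" for z
	proof -
		have "z \<in> snd c ` (fst c \<inter> fst d)" using z E by blast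
		then show ?thesis
			by (rule has_derivative_at_withinI[OF smooth_on_has_derivative[OF chart_trans[OF c d] chart_inter_open[OF c d]]])
	qed
	have inj: "inj_on ?T ?S"
	proof (rule inj_onI)
		fix x y assume xy: "x \<in> ?S" "y \<in> ?S" "?T x = ?T y"
		then obtain p q where pq: "p \<in> E" "q \<in> E" "x = snd c p" "y = snd c q" by blast
		then have "p \<in> fst c" "q \<in> fst c" "p \<in> fst d" "q \<in> fst d" using E by auto
		moreover have "snd d p = snd d q"
			using xy(3) unfolding pq(3,4) in_chart_snd[OF c \<open>p \<in> fst c\<close>] in_chart_snd[OF c \<open>q \<in> fst c\<close>] .
		ultimately show "x = y" using inj_onD[OF chart_inj[OF d], of p q] pq(3,4) by simp
	qed
	define r where "r = enn2real (emeasure (chart_measure d) E)"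
	have r: "emeasure (chart_measure d) E = ennreal r" "0 \<le> r" using fin by (auto simp: r_def)
	have vol_nonneg: "0 \<le> vol d z" if "z \<in> snd d ` E" for z using vol_pos[OF d, of z] E(3) that by (intro less_imp_le) blast
	have int_d: "(vol d has_integral r) (snd d ` E)"
	proof -
		let ?f = "%z. if z \<in> snd d ` E then vol d z else 0"
		have "?f \<in> borel_measurable borel"
		proof -
			have "(%z. indicator (snd d ` E) z *R vol d z) \<in> borel_measurable borel"
			proof (rule borel_measurable_continuous_on_indicator[OF S(2)])
				show "continuous_on (snd d ` E) (vol d)" using smooth_on_imp_continuous_on[OF smooth_on_vol[OF d]] E(3)
					by (meson continuous_on_subset image_mono)
			qed
			moreover have "?f = (%z. indicator (snd d ` E) z *R vol d z)" by (auto simp: fun_eq_iff indicator_def)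
			ultimately show ?thesis by simp
		qed
		moreover have "(\<integral>\<^sup>+ z. ennreal (?f z) \<partial>lborel) = ennreal r"
			unfolding r(1)[symmetric] emeasure_chart_measure[OF d E(1)] Ec
			by (intro nn_integral_cong) (auto simp: indicator_def)
		ultimately have "(?f has_integral r) UNIV" using r(2) vol_nonneg
			by (subst has_integral_iff_nn_integral_lebesgue) (auto simp: nn_integral_completion intro: measurable_completion)
		then show ?thesis by (simp only: has_integral_restrict_UNIV)
	qed
	\<comment> \<open>The change of variables theorem is stated for vector-valued functions;
	  \<open>vec\<close> embeds the scalar density into \<open>real ^ 1\<close>.\<close>
	have "(%z. vec (vol d z) :: real ^ 1) absolutely_integrable_on (?T ` ?S) \<and>
			integral (?T ` ?S) (%z. vec (vol d z) :: real ^ 1) = vec r"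
		unfolding absolutely_integrable_on_1_iff integral_on_1_eq TS
		using int_d vol_nonneg
		by (subst absolutely_integrable_on_iff_nonneg) (auto simp: has_integral_iff vec_eq_iff)
	then have "(%z. \<bar>det (matrix (dch (snd d) c z))\<bar> *R (vec (vol d (?T z)) :: real ^ 1)) absolutely_integrable_on ?S \<and>
			integral ?S (%z. \<bar>det (matrix (dch (snd d) c z))\<bar> *R (vec (vol d (?T z)) :: real ^ 1)) = vec r"
		using has_absolute_integral_change_of_variables[OF _ der inj, of "%z. vec (vol d z) :: real ^ 1" "vec r"] S
		by (auto simp: sets_completionI_sets)
	then have "((%z. \<bar>det (matrix (dch (snd d) c z))\<bar> * vol d (?T z)) has_integral r) ?S"
		unfolding absolutely_integrable_on_1_iff integral_on_1_eq
		by (auto simp: has_integral_iff vec_eq_iff absolutely_integrable_on_def)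
	moreover have "\<bar>det (matrix (dch (snd d) c z))\<bar> * vol d (?T z) = vol c z" if z: "z \<in> ?S" for z
	proof -
		obtain p where p: "p \<in> E" "z = snd c p" using z by auto
		then show ?thesis
		proof -
			have pc: "p \<in> fst c" "p \<in> fst d" using p(1) E by auto
			show ?thesis unfolding p(2) in_chart_snd[OF c pc(1)] by (rule vol_change[OF c pc(1) d pc(2), symmetric])
		qed
	qed
	ultimately have "(vol c has_integral r) ?S" by (rule has_integral_eq[rotated])
	then have "(\<integral>\<^sup>+ z. ennreal (vol c z) * indicator ?S z \<partial>lborel) = ennreal r"
		using vol_pos[OF c] E(2) by (intro nn_integral_has_integral_lebesgue') (auto intro!: less_imp_le)
	then show ?thesis unfolding emeasure_chart_measure[OF c E(1)] Ec r(1) .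
qed

text \<open>On a closed ball inside a chart image the density is bounded, so the open ball has
  finite measure; by compactness finitely many of them cover M.\<close>

lemma finite_chart_cover:
	obtains N :: nat and c U where "\<And>i. i < N ==> c i \<in> A" "\<And>i. i < N ==> U i \<in> sets borel_M"
		"\<And>i. i < N ==> U i \<subseteq> fst (c i)" "\<And>i. i < N ==> emeasure (chart_measure (c i)) (U i) < \<infinity>"
		"M = (\<Union>i<N. U i)"
proof -
	have "\<exists>c U. c \<in> A \<and> openM U \<and> p \<in> U \<and> U \<subseteq> fst c \<and> emeasure (chart_measure c) U < \<infinity>" if p: "p \<in> M" for p
	proof -
		define c where "c = chart_at A p"
		have c: "c \<in> A" "p \<in> fst c" using chart_at_in[OF p] chart_at_mem[OF p] by (auto simp: c_def)
		have z: "snd c p \<in> im c" using c by auto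
		obtain e where e: "0 < e" "cball (snd c p) e \<subseteq> im c"
			using open_contains_cball chart_open[OF c(1)] z by blast
		define U where "U = inv_into (fst c) (snd c) ` ball (snd c p) e"
		have b: "ball (snd c p) e \<subseteq> im c" using e ball_subset_cball by blast
		have im: "snd c ` U = ball (snd c p) e" unfolding U_def image_image using b by (force simp: f_inv_into_f)
		have Uc: "U \<subseteq> fst c" unfolding U_def using b chart_inv_in[OF c(1)] by blast
		have "openin (top_of_set (im c)) (ball (snd c p) e)" using b by (simp add: openin_open_eq chart_open[OF c(1)])
		moreover have "homeomorphism (im c) (fst c) (inv_into (fst c) (snd c)) (snd c)"
			using chart_homeo[OF c(1)] homeomorphism_symD by blast
		ultimately have "openin (top_of_set (fst c)) U" unfolding U_def using homeomorphism_imp_open_map by blast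
		then have opU: "openM U" using chart_openin[OF c(1)] openin_trans by blast
		have pU: "p \<in> U" unfolding U_def using c e(1) chart_inv[OF c] by (metis centre_in_ball image_eqI)
		have UM: "U \<in> sets borel_M" by (rule chart_sets[OF opU])
		have "compact (vol c ` cball (snd c p) e)" using smooth_on_imp_continuous_on[OF smooth_on_vol[OF c(1)]] e(2)
			by (intro compact_continuous_image) (auto intro: continuous_on_subset)
		then have "bounded (vol c ` cball (snd c p) e)" by (rule compact_imp_bounded)
		then obtain K where "\<forall>x\<in>vol c ` cball (snd c p) e. \<bar>x\<bar> \<le> K" unfolding bounded_real by blast
		then have K: "vol c z \<le> K" if "z \<in> cball (snd c p) e" for z using that by force
		have "emeasure (chart_measure c) U = (\<integral>\<^sup>+ z. ennreal (vol c z) * indicator (ball (snd c p) e) z \<partial>lborel)"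
			using emeasure_chart_measure[OF c(1) UM] Uc by (simp add: Int_absorb2 im)
		also have "... \<le> (\<integral>\<^sup>+ z. ennreal K * indicator (ball (snd c p) e) z \<partial>lborel)"
			using K by (intro nn_integral_mono) (auto simp: indicator_def intro!: ennreal_leI)
		also have "... = ennreal K * emeasure lborel (ball (snd c p) e)" by (subst nn_integral_cmult_indicator) auto
		also have "... < \<infinity>" using emeasure_bounded_finite[OF bounded_ball[of "snd c p" e]] by (simp add: ennreal_mult_less_top)
		finally show ?thesis using c opU pU Uc by blast
	qed
	then obtain c U where cU: "\<And>p. p \<in> M ==> c p \<in> A \<and> openM (U p) \<and> p \<in> U p \<and> U p \<subseteq> fst (c p) \<and>
			emeasure (chart_measure (c p)) (U p) < \<infinity>" by metis
	then obtain I where I: "finite I" "I \<subseteq> M" "M \<subseteq> (\<Union>p\<in>I. U p)"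
		using compact_openin_cover[OF compact_M, of U] by metis
	obtain g :: "nat => 'p" and N where g: "I = g ` {i. i < N}" using finite_imp_nat_seg_image_inj_on[OF I(1)] by auto
	have gM: "g i \<in> M" if "i < N" for i using g I that by auto
	show ?thesis
	proof (rule that[of N "%i. c (g i)" "%i. U (g i)"])
		show "M = (\<Union>i<N. U (g i))" using I(3) cU gM openin_imp_subset unfolding g by (fastforce intro!: subset_antisym)
	qed (use cU gM chart_sets in auto)
qed

end


section \<open>Existence and uniqueness of the Riemannian measure, integration on M\<close>

context closed_immersion
begin

lemma Riemannian_measure_exists: "\<exists>\<mu>. sets \<mu> = sets borel_M \<and> emeasure \<mu> M < \<infinity> \<and>
		(\<forall>c\<in>A. \<forall>E\<in>sets borel_M. E \<subseteq> fst c \<longrightarrow> emeasure \<mu> E = emeasure (chart_measure c) E)"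
proof -
	obtain N :: nat and c U where N: "\<And>i. i < N ==> c i \<in> A" "\<And>i. i < N ==> U i \<in> sets borel_M"
		"\<And>i. i < N ==> U i \<subseteq> fst (c i)" "\<And>i. i < N ==> emeasure (chart_measure (c i)) (U i) < \<infinity>"
		"M = (\<Union>i<N. U i)"
		using finite_chart_cover by blast
	\<comment> \<open>Making the cover disjoint lets each piece carry the measure of its own chart; the
	  choice is immaterial because chart measures agree on overlaps.\<close>
	define B where "B i = U i - (\<Union>j<i. U j)" for i
	have B: "B i \<in> sets borel_M" "B i \<subseteq> U i" if "i < N" for i using N(2) that by (auto simp: B_def)
	have dB: "disjoint_family_on B {..<N}" unfolding disjoint_family_on_def
	proof (intro ballI impI)
		fix i j :: nat assume "i \<noteq> j"
		then consider "i < j" | "j < i" by linarith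
		then show "B i \<inter> B j = {}" by cases (auto simp: B_def)
	qed
	have UB: "(\<Union>i<N. B i) = M"
	proof -
		have "x \<in> (\<Union>i<N. B i)" if x: "x \<in> M" for x
		proof -
			have ex: "\<exists>i. i < N \<and> x \<in> U i" using x N(5) by auto
			define i where "i = (LEAST i. i < N \<and> x \<in> U i)"
			have i: "i < N \<and> x \<in> U i" unfolding i_def by (rule LeastI_ex[OF ex])
			have "x \<notin> U j" if "j < i" for j
				using not_less_Least[of j "%i. i < N \<and> x \<in> U i"] that i unfolding i_def by auto
			then show ?thesis using i by (auto simp: B_def)
		qed
		moreover have "x \<in> M" if x: "x \<in> (\<Union>i<N. B i)" for x unfolding N(5) using x B(2) by blast
		ultimately show ?thesis by blast
	qed
	define F where "F E = (\<Sum>i<N. emeasure (chart_measure (c i)) (E \<inter> B i))" for E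
	define \<mu> where "\<mu> = measure_of M (sets borel_M) F"
	have sets: "sets \<mu> = sets borel_M" unfolding \<mu>_def using sets.sets_measure_of_eq[of borel_M] by simp
	have em: "emeasure \<mu> E = F E" if E: "E \<in> sets borel_M" for E unfolding \<mu>_def
	proof (rule emeasure_measure_of_sigma[OF _ _ _ E])
		show "sigma_algebra M (sets borel_M)" using sets.sigma_algebra_axioms[of borel_M] by simp
		show "positive (sets borel_M) F" by (simp add: positive_def F_def)
		show "countably_additive (sets borel_M) F"
		proof (rule countably_additiveI)
			fix X :: "nat => 'p set"
			assume X: "range X \<subseteq> sets borel_M" "disjoint_family X" "(\<Union>i. X i) \<in> sets borel_M"
			have "(\<Sum>n. emeasure (chart_measure (c i)) (X n \<inter> B i)) = emeasure (chart_measure (c i)) ((\<Union>n. X n) \<inter> B i)"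
				if i: "i < N" for i
			proof -
				have "(\<Sum>n. emeasure (chart_measure (c i)) (X n \<inter> B i)) = emeasure (chart_measure (c i)) (\<Union>n. X n \<inter> B i)"
					using X(1,2) B(1)[OF i] by (intro suminf_emeasure) (auto simp: disjoint_family_on_def)
				then show ?thesis by simp
			qed
			then have "F (\<Union>n. X n) = (\<Sum>i<N. \<Sum>n. emeasure (chart_measure (c i)) (X n \<inter> B i))"
				unfolding F_def by simp
			also have "... = (\<Sum>n. F (X n))" unfolding F_def by (rule suminf_sum[symmetric]) auto
			finally show "(\<Sum>n. F (X n)) = F (\<Union>n. X n)" by simp
		qed
	qed
	have fin: "emeasure (chart_measure (c i)) (E \<inter> B i) < \<infinity>" if "i < N" for i E
	proof -
		have "emeasure (chart_measure (c i)) (E \<inter> B i) \<le> emeasure (chart_measure (c i)) (U i)"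
			using B(2)[OF that] N(2)[OF that] by (intro emeasure_mono) auto
		then show ?thesis using N(4)[OF that] by (rule le_less_trans)
	qed
	have "emeasure \<mu> M < \<infinity>" using fin em[of M] by (auto simp: F_def sets.top[of borel_M, simplified])
	moreover have "emeasure \<mu> E = emeasure (chart_measure d) E"
		if d: "d \<in> A" and E: "E \<in> sets borel_M" "E \<subseteq> fst d" for d E
	proof -
		have "emeasure \<mu> E = (\<Sum>i<N. emeasure (chart_measure d) (E \<inter> B i))" unfolding em[OF E(1)] F_def
		proof (rule sum.cong[OF refl])
			fix i assume i: "i \<in> {..<N}"
			show "emeasure (chart_measure (c i)) (E \<inter> B i) = emeasure (chart_measure d) (E \<inter> B i)"
				using i B[of i] N(1,3)[of i] E fin[of i E]
				by (intro chart_measure_change[OF d, symmetric]) auto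
		qed
		also have "... = emeasure (chart_measure d) (\<Union>i<N. E \<inter> B i)"
		proof (rule sum_emeasure)
			show "(%i. E \<inter> B i) ` {..<N} \<subseteq> sets (chart_measure d)" using B(1) E by auto
			show "disjoint_family_on (%i. E \<inter> B i) {..<N}" using dB by (auto simp: disjoint_family_on_def)
		qed simp
		also have "(\<Union>i<N. E \<inter> B i) = E" using UB sets.sets_into_space[OF E(1)] unfolding space_borel_M by blast
		finally show ?thesis .
	qed
	ultimately show ?thesis using sets by blast
qed

lemma Riemannian_measure_unique:
	assumes "sets \<mu> = sets borel_M" "sets \<mu>' = sets borel_M"
		and eq: "\<And>c E. c \<in> A ==> E \<in> sets borel_M ==> E \<subseteq> fst c ==> emeasure \<mu> E = emeasure \<mu>' E"
	shows "\<mu> = \<mu>'"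
proof (rule measure_eqI)
	show "sets \<mu> = sets \<mu>'" using assms by simp
	obtain N :: nat and c U where N: "\<And>i. i < N ==> c i \<in> A" "\<And>i. i < N ==> U i \<in> sets borel_M"
		"\<And>i. i < N ==> U i \<subseteq> fst (c i)" "M = (\<Union>i<N. U i)"
		using finite_chart_cover by metis
	fix E assume "E \<in> sets \<mu>"
	then have E: "E \<in> sets borel_M" using assms by simp
	have "emeasure \<mu> (E \<inter> (\<Union>i<n. U i)) = emeasure \<mu>' (E \<inter> (\<Union>i<n. U i))" if "n \<le> N" for n
		using that
	proof (induction n)
		case (Suc n)
		let ?V = "E \<inter> (\<Union>i<n. U i)" and ?W = "E \<inter> U n - (\<Union>i<n. U i)"
		have V: "?V \<in> sets borel_M" "?W \<in> sets borel_M"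
			using E N(2) Suc.prems by (auto intro!: sets.Int sets.Diff sets.finite_UN)
		have un: "E \<inter> (\<Union>i<Suc n. U i) = ?V \<union> ?W" "?V \<inter> ?W = {}" by (auto simp: lessThan_Suc)
		have "emeasure \<mu> ?W = emeasure \<mu>' ?W" using N(1,3)[of n] Suc.prems by (intro eq[OF _ V(2)]) auto
		moreover have "emeasure \<mu> ?V = emeasure \<mu>' ?V" using Suc by simp
		ultimately show ?case unfolding un(1) using V assms(1,2) un(2) by (simp add: plus_emeasure[symmetric])
	qed simp
	moreover have "E \<inter> (\<Union>i<N. U i) = E"
		using sets.sets_into_space[OF E] unfolding space_borel_M N(4)[symmetric] by blast
	ultimately show "emeasure \<mu> E = emeasure \<mu>' E" by (metis order_refl)
qed

abbreviation vM :: "'p measure" where "vM \<equiv> dM M A \<phi>"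

text \<open>\<open>dM\<close> is a definite description, so its properties become available only
  through existence and uniqueness.\<close>

lemma vM_props:
	shows sets_vM [simp]: "sets vM = sets borel_M" and emeasure_vM_M: "emeasure vM M < \<infinity>"
		and emeasure_vM: "c \<in> A ==> E \<in> sets borel_M ==> E \<subseteq> fst c ==> emeasure vM E = emeasure (chart_measure c) E"
proof -
	obtain \<mu> where \<mu>: "sets \<mu> = sets borel_M" "emeasure \<mu> M < \<infinity>"
		"\<And>c E. c\<in>A ==> E\<in>sets borel_M ==> E \<subseteq> fst c ==> emeasure \<mu> E = emeasure (chart_measure c) E"
		using Riemannian_measure_exists by blast
	have char: "(\<integral>\<^sup>+ z. ennreal (vol c z) * indicator (snd c ` E) z \<partial>lborel) = emeasure (chart_measure c) E"
		if "c \<in> A" "E \<in> sets borel_M" "E \<subseteq> fst c" for c E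
		using emeasure_chart_measure[OF that(1,2)] that(3) by (simp add: Int_absorb2)
	have "vM = \<mu>" unfolding dM_def
	proof (rule the_equality)
		show "sets \<mu> = sets borel_M \<and> (\<forall>c\<in>A. \<forall>E\<in>sets \<mu>. E \<subseteq> fst c \<longrightarrow> emeasure \<mu> E =
					(\<integral>\<^sup>+ z. ennreal (volume_density (in_chart c \<phi>) z) * indicator (snd c ` E) z \<partial>lborel))"
			using \<mu> char by auto
		fix \<mu>' assume \<mu>': "sets \<mu>' = sets borel_M \<and> (\<forall>c\<in>A. \<forall>E\<in>sets \<mu>'. E \<subseteq> fst c \<longrightarrow> emeasure \<mu>' E =
					(\<integral>\<^sup>+ z. ennreal (volume_density (in_chart c \<phi>) z) * indicator (snd c ` E) z \<partial>lborel))"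
		show "\<mu>' = \<mu>" by (rule Riemannian_measure_unique) (use \<mu> \<mu>' char in auto)
	qed
	then show "sets vM = sets borel_M" "emeasure vM M < \<infinity>"
		"c \<in> A ==> E \<in> sets borel_M ==> E \<subseteq> fst c ==> emeasure vM E = emeasure (chart_measure c) E"
		using \<mu> by auto
qed

lemma space_vM [simp]: "space vM = M" using sets_eq_imp_space_eq[OF sets_vM] by simp

lemma finite_measure_vM: "finite_measure vM" by (rule finite_measureI) (use emeasure_vM_M in auto)

lemma continuous_measurable [intro]: "continuous_on M f ==> f \<in> borel_measurable vM"
	using borel_measurable_continuous_on_restrict[of M f] by (simp cong: measurable_cong_sets)

lemma continuous_integrable:
	fixes f :: "'p => 'c::{banach, second_countable_topology}"
	assumes "continuous_on M f"
	shows "integrable vM f"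
proof -
	obtain K where "\<And>p. p \<in> M ==> norm (f p) \<le> K"
		using compact_imp_bounded[OF compact_continuous_image[OF assms compact_M]] unfolding bounded_iff by auto
	then show ?thesis using assms by (intro finite_measure.integrable_const_bound[OF finite_measure_vM, of _ K]) auto
qed

lemma smooth_fun_continuous:
	assumes f: "smooth f"
	shows "continuous_on M f"
	unfolding continuous_on_eq_continuous_within
proof
	fix p assume p: "p \<in> M"
	note c = chart_at_in[OF p] chart_at_mem[OF p]
	let ?c = "chart_at A p"
	have "continuous_on (fst ?c) (%q. in_chart ?c f (snd ?c q))" using chart_homeo[OF c(1)]
		by (intro continuous_on_compose2[OF smooth_on_imp_continuous_on[OF smooth_fun_chart[OF f c(1)]]])
			(auto simp: homeomorphism_def)
	then have "continuous_on (fst ?c) f" by (rule continuous_on_eq) (simp add: in_chart_snd[OF c(1)])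
	then have "continuous (at p within fst ?c) f" using c by (simp add: continuous_on_eq_continuous_within)
	moreover obtain T where "open T" "fst ?c = M \<inter> T" using chart_openin[OF c(1)] openin_open by blast
	ultimately show "continuous (at p within M) f" using c(2) at_within_nhd[of p T M "M \<inter> T"] by (simp add: Int_assoc)
qed

lemma smooth_integrable:
	fixes f :: "'p => 'c::{banach, second_countable_topology}"
	shows "smooth f ==> integrable vM f"
	by (rule continuous_integrable[OF smooth_fun_continuous])

lemma integral_vM_chart:
	fixes f :: "'p => real"
	assumes c: "c \<in> A" and f: "f \<in> borel_measurable borel_M" and supp: "\<And>p. p \<in> M ==> p \<notin> fst c ==> f p = 0"
	shows "(LINT p|vM. f p) = (\<integral>z. indicator (im c) z * (vol c z * in_chart c f z) \<partial>lborel)"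
proof -
	let ?Z = "im c"
	have fc: "fst c \<in> sets borel_M" by (rule chart_sets[OF chart_openin[OF c]])
	have sm: "space (chart_measure c) = M" using sets_eq_imp_space_eq[OF sets_chart_measure, of c] by simp
	have fc': "fst c \<inter> space vM \<in> sets vM" "fst c \<inter> space (chart_measure c) \<in> sets (chart_measure c)"
		using fc chart_subset[OF c] by (auto simp: sm Int_absorb2)
	have r: "restrict_space vM (fst c) = restrict_space (chart_measure c) (fst c)"
	proof (rule measure_eqI)
		show "sets (restrict_space vM (fst c)) = sets (restrict_space (chart_measure c) (fst c))"
			by (rule sets_restrict_space_cong) simp
		fix E assume "E \<in> sets (restrict_space vM (fst c))"
		then have "E \<in> sets borel_M" "E \<subseteq> fst c"
			using fc chart_subset[OF c] by (subst (asm) sets_restrict_space_iff; force simp: Int_absorb2)+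
		then show "emeasure (restrict_space vM (fst c)) E = emeasure (restrict_space (chart_measure c) (fst c)) E"
			using fc' by (simp add: emeasure_restrict_space emeasure_vM[OF c])
	qed
	have "(LINT p|vM. f p) = (\<integral>p. f p \<partial>restrict_space vM (fst c))"
		unfolding integral_restrict_space[OF fc'(1)] by (rule int_cong) (auto simp: indicator_def supp)
	also have "... = (\<integral>p. f p \<partial>chart_measure c)"
		unfolding r integral_restrict_space[OF fc'(2)] by (rule int_cong) (auto simp: indicator_def supp sm)
	also have "... = (\<integral>z. f (inv_into (fst c) (snd c) z) \<partial>density (restrict_space lborel ?Z) (%z. ennreal (vol c z)))"
		unfolding chart_measure_def by (rule integral_distr[OF chart_inv_measurable'[OF c] f])
	also have "... = (\<integral>z. vol c z *R f (inv_into (fst c) (snd c) z) \<partial>restrict_space lborel ?Z)"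
	proof (rule integral_density)
		show "(%z. f (inv_into (fst c) (snd c) z)) \<in> borel_measurable (restrict_space lborel ?Z)"
			using measurable_compose[OF chart_inv_measurable'[OF c, of "%_. 1"] f] by (simp cong: measurable_cong_sets)
		show "AE z in restrict_space lborel ?Z. 0 \<le> vol c z"
			using vol_pos[OF c] by (intro AE_I2) (auto simp: space_restrict_space intro: less_imp_le)
	qed (rule vol_measurable[OF c])
	also have "... = (\<integral>z. indicator ?Z z *R (vol c z *R f (inv_into (fst c) (snd c) z)) \<partial>lborel)"
		by (rule integral_restrict_space) (use chart_borel[OF c] in simp)
	finally show ?thesis by (simp add: in_chart_def)
qed

text \<open>In a chart the density is positive, and a nonempty open set is not negligible.\<close>

lemma open_vM_pos:
	assumes U: "openM U" "p \<in> U"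
	shows "0 < emeasure vM U"
proof -
	have p: "p \<in> M" using U openin_imp_subset by blast
	define c where "c = chart_at A p"
	have c: "c \<in> A" "p \<in> fst c" using chart_at_in[OF p] chart_at_mem[OF p] by (auto simp: c_def)
	define E where "E = U \<inter> fst c"
	have E: "openM E" "E \<subseteq> fst c" "p \<in> E" using U c chart_openin[OF c(1)] by (auto simp: E_def)
	have "openin (top_of_set (fst c)) E" using E(1,2) chart_subset[OF c(1)] openin_subset_trans by blast
	then have "openin (top_of_set (im c)) (snd c ` E)" using homeomorphism_imp_open_map[OF chart_homeo[OF c(1)]] by blast
	then have op: "open (snd c ` E)" using chart_open[OF c(1)] openin_open_trans by blast
	have Es: "E \<in> sets borel_M" by (rule chart_sets[OF E(1)])
	have "emeasure vM E \<noteq> 0"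
	proof
		assume "emeasure vM E = 0"
		then have "(\<integral>\<^sup>+ z. ennreal (vol c z) * indicator (snd c ` E) z \<partial>lborel) = 0"
			using emeasure_vM[OF c(1) Es E(2)] emeasure_chart_measure[OF c(1) Es] E(2) by (simp add: Int_absorb2)
		moreover have "(%z. ennreal (vol c z) * indicator (snd c ` E) z) \<in> borel_measurable lborel"
		proof -
			have "(%z. indicator (snd c ` E) z *R vol c z) \<in> borel_measurable borel"
				using op E(2) by (intro borel_measurable_continuous_on_indicator
						continuous_on_subset[OF smooth_on_imp_continuous_on[OF smooth_on_vol[OF c(1)]]] image_mono) auto
			then have "(%z. ennreal (indicator (snd c ` E) z *R vol c z)) \<in> borel_measurable lborel" by measurable
			moreover have "(%z. ennreal (vol c z) * indicator (snd c ` E) z) = (%z. ennreal (indicator (snd c ` E) z *R vol c z))"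
				by (auto simp: fun_eq_iff indicator_def)
			ultimately show ?thesis by simp
		qed
		ultimately have "AE z in lborel. ennreal (vol c z) * indicator (snd c ` E) z = 0" by (simp add: nn_integral_0_iff_AE)
		then have "AE z in lborel. z \<notin> snd c ` E"
		proof (rule AE_mp, intro AE_I2 impI notI)
			fix z assume z: "ennreal (vol c z) * indicator (snd c ` E) z = 0" "z \<in> snd c ` E"
			have "0 < vol c z" using vol_pos[OF c(1)] z(2) E(2) by blast
			then show False using z by simp
		qed
		then have "emeasure lborel (snd c ` E) = 0"
			using AE_iff_measurable[of "snd c ` E" lborel "%z. z \<notin> snd c ` E"] op by simp
		then have "negligible (snd c ` E)" using op by (simp add: negligible_iff_null_sets null_sets_def emeasure_completion)
		then show False using open_not_negligible[OF op] E(3) by blast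
	qed
	moreover have "emeasure vM E \<le> emeasure vM U" using chart_sets[OF U(1)] by (intro emeasure_mono) (auto simp: E_def)
	ultimately show ?thesis by (metis less_le_trans not_gr_zero)
qed

text \<open>The device by which equality cases are extracted: once stability bounds the integral of
  a nonnegative continuous function by 0, positivity of the measure of open sets gives a pointwise
  identity.\<close>

lemma integral_nonneg_eq_0:
	fixes f :: "'p => real"
	assumes f: "continuous_on M f" "\<And>p. p \<in> M ==> 0 \<le> f p" and int: "(LINT p|vM. f p) \<le> 0" and p: "p \<in> M"
	shows "f p = 0"
proof (rule ccontr)
	assume "f p \<noteq> 0"
	then have pos: "0 < f p" using f(2)[OF p] by simp
	define U where "U = {q \<in> M. 0 < f q}"
	have U: "openM U"
	proof -
		have "U = M \<inter> f -` {0<..}" by (auto simp: U_def)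
		then show ?thesis using continuous_openin_preimage_gen[OF f(1), of "{0<..}"] by simp
	qed
	have "0 \<le> (LINT p|vM. f p)" using f(2) by (intro integral_nonneg_AE AE_I2) auto
	then have "AE q in vM. f q = 0"
	proof -
		have "AE x in vM. 0 \<le> f x" using f(2) by (intro AE_I2) simp
		then show ?thesis using int \<open>0 \<le> _\<close> integral_nonneg_eq_0_iff_AE[OF continuous_integrable[OF f(1)]] by simp
	qed
	then have "AE q in vM. q \<notin> U" by (rule AE_mp) (auto intro!: AE_I2 simp: U_def)
	then have "emeasure vM U = 0" using AE_iff_measurable[of U vM "%q. q \<notin> U"] chart_sets[OF U] by (simp add: U_def)
	then show False using open_vM_pos[OF U, of p] pos p by (simp add: U_def)
qed

end


section \<open>The first variation formula\<close>

text \<open>Difference quotients have integral 0 by translation invariance of Lebesgue measure, and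
  they converge to the derivative under a common integrable bound.\<close>

lemma integral_frechet_derivative_eq_0:
	fixes g :: "'a::euclidean_space => real"
	assumes g: "smooth_on UNIV g" and K: "compact K" "\<And>z. z \<notin> K ==> g z = 0"
	shows "(\<integral>z. FD g z v \<partial>lborel) = 0"
		and "integrable lborel (%z. FD g z v)"
proof -
	define D where "D z = FD g z v" for z
	have dg: "(g has_derivative FD g z) (at z)" for z by (rule smooth_on_has_derivative[OF g]) auto
	have Dc: "continuous_on UNIV D" unfolding D_def by (rule smooth_on_imp_continuous_on[OF smooth_on_frechet_derivative[OF g]])
	have D0: "D z = 0" if z: "z \<notin> K" for z
	proof -
		have "open (- K)" using K(1) by (simp add: compact_imp_closed open_Compl)
		then have "FD g z = FD (%_. 0) z"
			by (rule frechet_derivative_cong_open) (use K(2) z in auto)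
		then show ?thesis by (simp add: D_def frechet_derivative_const)
	qed
	obtain C where C: "\<And>z. \<bar>D z\<bar> \<le> C"
	proof -
		have "bounded (D ` K)" by (rule compact_imp_bounded[OF compact_continuous_image[OF continuous_on_subset[OF Dc] K(1)]]) auto
		then obtain B where B: "\<forall>x\<in>D ` K. \<bar>x\<bar> \<le> B" unfolding bounded_real by blast
		have "\<bar>D z\<bar> \<le> max B 0" for z using B D0[of z] by (cases "z \<in> K") (auto simp: le_max_iff_disj)
		then show ?thesis by (rule that)
	qed
	have C0: "0 \<le> C" using C[of 0] by linarith
	\<comment> \<open>Swept out by K under the translations by -s v with s in [0, 1]: off this set all
	  quotients vanish, which yields a dominating function with compact support.\<close>
	define K' where "K' = (%(x, s). x - s *R v) ` (K \<times> {0..1::real})"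
	have K': "compact K'" unfolding K'_def by (intro compact_continuous_image compact_Times K(1) compact_Icc)
			(auto simp: case_prod_beta intro!: continuous_intros)
	have inK': "z \<in> K'" if "z + s *R v \<in> K" "0 \<le> s" "s \<le> 1" for z s
		unfolding K'_def using that by (intro image_eqI[of _ _ "(z + s *R v, s)"]) auto
	define F where "F n z = (g (z + (1 / real (Suc n)) *R v) - g z) * real (Suc n)" for n :: nat and z
	have gm: "g \<in> borel_measurable borel" using smooth_on_imp_continuous_on[OF g] by (rule borel_measurable_continuous_onI)
	have line: "((%s. g (z + s *R v)) has_real_derivative D (z + s *R v)) (at s)" for z s
	proof -
		have "((%s. z + s *R v) has_derivative (%h. h *R v)) (at s)"
			by (auto intro!: derivative_eq_intros)
		from has_derivative_compose[OF this dg]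
		show ?thesis unfolding has_field_derivative_def D_def
			by (rule has_derivative_eq_rhs) (auto simp: linear_scale[OF has_derivative_linear[OF dg]] fun_eq_iff)
	qed
	have bound: "norm (F n z) \<le> C * indicator K' z" for n z
	proof -
		obtain s where s: "0 < s" "s < 1 / real (Suc n)"
			"g (z + (1 / real (Suc n)) *R v) - g (z + 0 *R v) = (1 / real (Suc n) - 0) * D (z + s *R v)"
			using MVT2[of 0 "1 / real (Suc n)" "%s. g (z + s *R v)" "%s. D (z + s *R v)"] line by auto
		then have F: "F n z = D (z + s *R v)" by (simp add: F_def)
		have "s \<le> 1" using s(2) by (rule less_imp_le[OF less_le_trans]) simp
		show ?thesis
		proof (cases "z + s *R v \<in> K")
			case True
			then have "z \<in> K'" using inK'[of z s] s \<open>s \<le> 1\<close> by auto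
			then show ?thesis using C F by simp
		next
			case False
			then show ?thesis using F D0 C0 by simp
		qed
	qed
	have lim: "(%n. F n z) \<longlonglongrightarrow> D z" for z
	proof -
		have "((%s. g (z + s *R v)) has_real_derivative D z) (at 0)" using line[of z 0] by simp
		then have "((%h. (g (z + h *R v) - g z) / h) \<longlongrightarrow> D z) (at 0)" by (simp add: DERIV_def)
		moreover have "filterlim (%n. 1 / real (Suc n)) (at 0) sequentially" using LIMSEQ_inverse_real_of_nat
			by (intro filterlim_atI) (simp_all add: inverse_eq_divide)
		ultimately have "(%n. (g (z + (1 / real (Suc n)) *R v) - g z) / (1 / real (Suc n))) \<longlonglongrightarrow> D z"
			by (rule filterlim_compose)
		then show ?thesis by (simp add: F_def)
	qed
	have int: "integrable lborel (%z. C * indicator K' z)"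
		using emeasure_bounded_finite[OF compact_imp_bounded[OF K']] borel_closed[OF compact_imp_closed[OF K']]
		by (intro integrable_mult_right integrable_real_indicator) auto
	have Fm: "F n \<in> borel_measurable lborel" for n unfolding F_def using gm by measurable
	have Dm: "D \<in> borel_measurable lborel" using borel_measurable_continuous_onI[OF Dc] by simp
	have ig: "integrable lborel g"
	proof -
		have "integrable lborel (%x. indicator K x *R g x)"
			using borel_integrable_compact[OF K(1), of g] smooth_on_imp_continuous_on[OF g] continuous_on_subset by blast
		moreover have "(%x. indicator K x *R g x) = g" using K(2) by (auto simp: fun_eq_iff indicator_def)
		ultimately show ?thesis by simp
	qed
	have tr: "integrable lborel (%z. g (z + a))" "(\<integral>z. g (z + a) \<partial>lborel) = (\<integral>z. g z \<partial>lborel)" for a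
		using integrable_distr_eq[of "(+) a" lborel borel g] integral_distr[of "(+) a" lborel borel g] gm ig
			lborel_distr_plus[of a] by (simp_all add: add.commute)
	have F0: "(\<integral>z. F n z \<partial>lborel) = 0" for n unfolding F_def using tr ig by simp
	have l: "AE z in lborel. (%n. F n z) \<longlonglongrightarrow> D z" by (rule AE_I2[OF lim])
	have b: "AE z in lborel. norm (F n z) \<le> C * indicator K' z" for n by (rule AE_I2[OF bound])
	have "(%n. \<integral>z. F n z \<partial>lborel) \<longlonglongrightarrow> (\<integral>z. D z \<partial>lborel)" "integrable lborel D"
		by (rule integral_dominated_convergence[OF Dm Fm int l b], rule integrable_dominated_convergence[OF Dm Fm int l b])
	then show "(\<integral>z. FD g z v \<partial>lborel) = 0"
			"integrable lborel (%z. FD g z v)"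
		unfolding F0 using LIMSEQ_unique[OF tendsto_const, of 0 "\<integral>z. D z \<partial>lborel"] by (simp_all add: D_def[abs_def])
qed

lemma det_has_derivative:
	fixes G :: "'a::real_normed_vector => real ^ 'n::finite ^ 'n"
	assumes "\<And>i j. ((%x. G x $ i $ j) has_derivative (%h. G' h $ i $ j)) (at x)"
	shows "((%x. det (G x)) has_derivative
		(%h. \<Sum>k\<in>UNIV. det (\<chi> i j. if i = k then G' h $ i $ j else G x $ i $ j))) (at x)"
proof -
	have "((%x. det (G x)) has_derivative (%h. \<Sum>p | p permutes UNIV. of_int (sign p) *
			(\<Sum>k\<in>UNIV. G' h $ k $ p k * (\<Prod>j\<in>UNIV - {k}. G x $ j $ p j)))) (at x)"
		unfolding det_def by (intro has_derivative_sum has_derivative_mult_right has_derivative_prod assms)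
	moreover have "(\<Sum>p | p permutes UNIV. of_int (sign p) *
			(\<Sum>k\<in>UNIV. G' h $ k $ p k * (\<Prod>j\<in>UNIV - {k}. G x $ j $ p j))) =
			(\<Sum>k\<in>UNIV. det (\<chi> i j. if i = k then G' h $ i $ j else G x $ i $ j))" for h
	proof -
		have "G' h $ k $ p k * (\<Prod>j\<in>UNIV - {k}. G x $ j $ p j) =
				(\<Prod>i\<in>UNIV. if i = k then G' h $ i $ p i else G x $ i $ p i)" for k and p :: "'n => 'n"
			by (subst prod.remove[of UNIV k]) auto
		then show ?thesis unfolding det_def sum_distrib_left by (subst sum.swap) (simp cong del: if_weak_cong)
	qed
	ultimately show ?thesis by simp
qed

text \<open>Jacobi's formula for a derivative of the form L G + (L G)^T, the shape taken by the
  derivative of a Gram matrix; the inverse of G does not appear.\<close>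

lemma det_has_derivative_symmetric:
	fixes G :: "'a::real_normed_vector => real ^ 'n::finite ^ 'n"
	assumes G: "\<And>i j. ((%x. G x $ i $ j) has_derivative (%h. (\<Sum>l\<in>UNIV. L h i l * G x $ l $ j) + (\<Sum>l\<in>UNIV. L h j l * G x $ l $ i))) (at x)"
		and sym: "\<And>i j. G x $ i $ j = G x $ j $ i"
	shows "((%x. det (G x)) has_derivative (%h. 2 * (\<Sum>k\<in>UNIV. L h k k) * det (G x))) (at x)"
proof -
	define d where "d X = (\<Sum>k\<in>UNIV. det (\<chi> i j. if i = k then X $ i $ j else G x $ i $ j))" for X :: "real ^ 'n ^ 'n"
	define LG where "LG h = (\<chi> i j. \<Sum>l\<in>UNIV. L h i l * G x $ l $ j)" for h
	have dd: "(det has_derivative d) (at (G x))" unfolding d_def by (rule det_has_derivative)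
			(rule bounded_linear_imp_has_derivative[OF bounded_linear_compose[OF bounded_linear_vec_nth bounded_linear_vec_nth]])
	have add: "d (X + Y) = d X + d Y" for X Y using linear_add[OF has_derivative_linear[OF dd]] .
	\<comment> \<open>The determinant is invariant under transposition and G x is symmetric, so the
	  differential there is invariant too; this accounts for the factor 2.\<close>
	have tr: "d (transpose X) = d X" for X
	proof -
		have "transpose (G x) = G x" using sym by (simp add: transpose_def vec_eq_iff)
		moreover have "(transpose has_derivative transpose) (at (G x))" by (rule bounded_linear_imp_has_derivative)
				(auto simp: linear_conv_bounded_linear[symmetric] transpose_def vec_eq_iff intro!: linearI)
		ultimately have "((%Y. det (transpose Y)) has_derivative (%X. d (transpose X))) (at (G x))"
			using has_derivative_compose[of transpose transpose "G x" UNIV det d] dd by simp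
		then have "(det has_derivative (%X. d (transpose X))) (at (G x))" by simp
		from has_derivative_unique[OF this dd] show ?thesis by (simp add: fun_eq_iff)
	qed
	have row: "d (LG h) = (\<Sum>k\<in>UNIV. L h k k) * det (G x)" for h
	proof -
		have "det (\<chi> i j. if i = k then LG h $ i $ j else G x $ i $ j) = L h k k * det (G x)" for k
		proof -
			have "(\<chi> i j. if i = k then LG h $ i $ j else G x $ i $ j) =
					(\<chi> i. if i = k then (\<Sum>l\<in>UNIV. (\<chi> l. L h k l) $ l *s row l (G x)) else row i (G x))"
				by (simp add: vec_eq_iff LG_def row_def)
			then show ?thesis using cramer_lemma_transpose[of k "\<chi> l. L h k l" "G x"] by simp
		qed
		then show ?thesis by (simp add: d_def sum_distrib_right)
	qed
	have "((%x. det (G x)) has_derivative (%h. d (LG h + transpose (LG h)))) (at x)"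
		unfolding d_def by (rule det_has_derivative) (use G in \<open>simp add: LG_def transpose_def\<close>)
	then show ?thesis unfolding add tr row by (simp add: algebra_simps)
qed

section \<open>Volume density and divergence in a chart\<close>

context closed_immersion
begin

lemma lift_unique:
	assumes c: "c \<in> A" "p \<in> fst c" and a: "dphi c (snd c p) a = P p w"
	shows "lift c w (snd c p) = a"
	using lift_P[OF c, of w] a inj_eq[OF dch_phi_inj[OF c]] by metis

lemma lift_dch: "c \<in> A ==> p \<in> fst c ==> lift c (dphi c (snd c p) a) (snd c p) = a"
	by (rule lift_unique, assumption+, rule P_id[symmetric, OF chart_in_M]) (auto simp: Tan_chart)

lemma linear_lift:
	assumes c: "c \<in> A" "p \<in> fst c"
	shows "linear (%w. lift c w (snd c p))"
proof
	have z: "snd c p \<in> im c" using c by blast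
	note l = dch_linear[OF smooth_phi c(1) z] and lP = linear_P[OF chart_in_M[OF c]]
	fix a b r
	show "lift c (a + b) (snd c p) = lift c a (snd c p) + lift c b (snd c p)"
		by (rule lift_unique[OF c]) (simp add: linear_add[OF l] linear_add[OF lP] lift_P[OF c])
	show "lift c (r *R a) (snd c p) = r *R lift c a (snd c p)"
		by (rule lift_unique[OF c]) (simp add: linear_scale[OF l] linear_scale[OF lP] lift_P[OF c])
qed

lemma lift_P_arg: "c \<in> A ==> p \<in> fst c ==> lift c (P p w) (snd c p) = lift c w (snd c p)"
	by (rule lift_unique) (auto simp: lift_P P_P[OF chart_in_M])

lemma trace_chart:
	assumes c: "c \<in> A" "p \<in> fst c" and T: "linear T"
	shows "(\<Sum>j\<in>UNIV. lift c (T (dphi c (snd c p) (axis j 1))) (snd c p) $ j) = (\<Sum>b\<in>Basis. T (P p b) \<bullet> P p b)"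
proof -
	let ?z = "snd c p" and ?F = "%j. dphi c (snd c p) (axis j 1)"
	have p: "p \<in> M" by (rule chart_in_M[OF c])
	have z: "?z \<in> im c" using c by blast
	have Pb: "P p b = (\<Sum>j\<in>UNIV. lift c b ?z $ j *R ?F j)" for b
		unfolding lift_P[OF c, symmetric] by (rule linear_vec_expand[OF dch_linear[OF smooth_phi c(1) z]])
	have "T (P p b) \<bullet> P p b = (\<Sum>j\<in>UNIV. lift c b ?z $ j * (T (?F j) \<bullet> P p b))" for b
		by (subst (1) Pb) (simp add: linear_sum[OF T] linear_scale[OF T] inner_sum_left)
	then have "(\<Sum>b\<in>Basis. T (P p b) \<bullet> P p b) = (\<Sum>j\<in>UNIV. \<Sum>b\<in>Basis. lift c b ?z $ j * (T (?F j) \<bullet> P p b))"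
		by (simp add: sum.swap[of _ Basis])
	also have "... = (\<Sum>j\<in>UNIV. (\<Sum>b\<in>Basis. (P p (T (?F j)) \<bullet> b) *R lift c b ?z) $ j)"
		by (simp add: P_sym[OF p] mult.commute)
	also have "... = (\<Sum>j\<in>UNIV. lift c (T (?F j)) ?z $ j)"
		unfolding linear_euclidean_expand[OF linear_lift[OF c], symmetric] lift_P_arg[OF c] ..
	finally show ?thesis by simp
qed

text \<open>The sum is the contracted Christoffel symbol, because \<open>lift\<close> gives the
  coordinates of the tangential part of the second derivatives of \<phi>.\<close>

lemma vol_has_derivative:
	assumes c: "c \<in> A" "p \<in> fst c"
	shows "(vol c has_derivative (%a. vol c (snd c p) *
		(\<Sum>k\<in>UNIV. lift c (FD (%z. dphi c z (axis k 1)) (snd c p) a) (snd c p) $ k))) (at (snd c p))"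
proof -
	let ?z = "snd c p"
	have p: "p \<in> M" by (rule chart_in_M[OF c])
	have z: "?z \<in> im c" using c by blast
	define F where "F k z = dphi c z (axis k 1)" for k z
	define S where "S k = FD (F k) ?z" for k
	have dF: "(F k has_derivative S k) (at ?z)" for k unfolding S_def F_def
		by (rule smooth_on_has_derivative[OF smooth_on_dch[OF smooth_phi c(1)] chart_open[OF c(1)] z])
	define L where "L a i l = lift c (S i a) ?z $ l" for a i l
	have gij: "gram c z $ i $ j = F i z \<bullet> F j z" for i j z by (simp add: gram_def F_def)
	have SF: "S i a \<bullet> F j ?z = (\<Sum>l\<in>UNIV. L a i l * gram c ?z $ l $ j)" for i j a
	proof -
		have FT: "P p (F j ?z) = F j ?z" by (rule P_id[OF p]) (simp add: F_def Tan_chart[OF c])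
		have "S i a \<bullet> F j ?z = P p (S i a) \<bullet> F j ?z" using P_sym[OF p, of "S i a" "F j ?z"] FT by simp
		also have "P p (S i a) = (\<Sum>l\<in>UNIV. L a i l *R F l ?z)" unfolding lift_P[OF c, symmetric] L_def F_def
			by (rule linear_vec_expand[OF dch_linear[OF smooth_phi c(1) z]])
		finally show ?thesis by (simp add: inner_sum_left gij)
	qed
	have "((%z. gram c z $ i $ j) has_derivative (%a. (\<Sum>l\<in>UNIV. L a i l * gram c ?z $ l $ j)
			+ (\<Sum>l\<in>UNIV. L a j l * gram c ?z $ l $ i))) (at ?z)" for i j
		unfolding SF[symmetric] unfolding gij
		by (rule has_derivative_eq_rhs[OF has_derivative_inner[OF dF dF]]) (auto simp: inner_commute)
	then have D: "((%z. det (gram c z)) has_derivative (%a. 2 * (\<Sum>k\<in>UNIV. L a k k) * det (gram c ?z))) (at ?z)"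
		by (rule det_has_derivative_symmetric) (simp add: gij inner_commute)
	have g0: "0 < det (gram c ?z)" by (rule det_gram_pos[OF c(1) z])
	have "((%z. sqrt (det (gram c z))) has_derivative
			(%a. inverse (sqrt (det (gram c ?z))) / 2 * (2 * (\<Sum>k\<in>UNIV. L a k k) * det (gram c ?z)))) (at ?z)"
		using has_derivative_compose[OF D DERIV_real_sqrt[OF g0, unfolded has_field_derivative_def]] .
	then show ?thesis unfolding vol_eq[abs_def]
	proof (rule has_derivative_eq_rhs)
		have sq: "inverse (sqrt d) / 2 * (2 * s * d) = sqrt d * s" if "0 < d" for d s :: real
		proof -
			have "inverse (sqrt d) * d = sqrt d" using that by (simp add: inverse_eq_divide real_div_sqrt)
			then have "(inverse (sqrt d) * d) * s = sqrt d * s" by simp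
			then show ?thesis by (simp only: mult_ac)
		qed
		show "(%a. inverse (sqrt (det (gram c ?z))) / 2 * (2 * (\<Sum>k\<in>UNIV. L a k k) * det (gram c ?z))) =
			(%a. sqrt (det (gram c ?z)) * (\<Sum>k\<in>UNIV. lift c (FD (%z. dphi c z (axis k 1)) ?z a) ?z $ k))"
			unfolding sq[OF g0] L_def S_def F_def[abs_def] ..
	qed
qed

text \<open>In coordinates, the divergence of the tangential part of a constant vector \<open>w\<close> is \<open>m H \<bullet> w\<close>.\<close>

lemma lift_divergence:
	assumes c: "c \<in> A" "p \<in> fst c"
	shows "(\<Sum>j\<in>UNIV. FD (lift c w) (snd c p) (axis j 1) $ j)
		+ (\<Sum>k\<in>UNIV. lift c (FD (%z. dphi c z (axis k 1)) (snd c p) (lift c w (snd c p))) (snd c p) $ k)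
		= w \<bullet> mH p"
proof -
	let ?z = "snd c p"
	have p: "p \<in> M" by (rule chart_in_M[OF c])
	have z: "?z \<in> im c" using c by blast
	define F where "F k z = dphi c z (axis k 1)" for k z
	define S where "S k = FD (F k) ?z" for k
	define L where "L = FD (lift c w) ?z"
	have dF: "(F k has_derivative S k) (at ?z)" for k unfolding S_def F_def
		by (rule smooth_on_has_derivative[OF smooth_on_dch[OF smooth_phi c(1)] chart_open[OF c(1)] z])
	have dL: "(lift c w has_derivative L) (at ?z)"
		unfolding L_def by (rule smooth_on_has_derivative[OF smooth_on_lift[OF c(1)] chart_open[OF c(1)] z])
	have sym: "S k (axis j 1) = S j (axis k 1)" for j k unfolding S_def F_def
		by (rule second_derivative_symmetric[OF chart_open[OF c(1)] smooth_fun_chart[OF smooth_phi c(1)] z])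
	have Fl: "dphi c ?z a = (\<Sum>k\<in>UNIV. a $ k *R F k ?z)" for a
		unfolding F_def by (rule linear_vec_expand[OF dch_linear[OF smooth_phi c(1) z]])
	\<comment> \<open>The field P w is differentiated in coordinates; symmetry of second derivatives
	  turns its Christoffel part into the one that comes from the volume density.\<close>
	have "((%z. \<Sum>k\<in>UNIV. lift c w z $ k *R F k z) has_derivative
			(%a. \<Sum>k\<in>UNIV. lift c w ?z $ k *R S k a + L a $ k *R F k ?z)) (at ?z)"
		by (intro has_derivative_sum has_derivative_scaleR dF bounded_linear.has_derivative[OF bounded_linear_vec_nth dL])
	moreover have "(\<Sum>k\<in>UNIV. lift c w y $ k *R F k y) = in_chart c (%q. P q w) y" if y: "y \<in> im c" for y
	proof -
		obtain q where q: "q \<in> fst c" "y = snd c q" using y by blast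
		show ?thesis unfolding q(2) in_chart_snd[OF c(1) q(1)] lift_P[OF c(1) q(1), symmetric] F_def
			by (rule linear_vec_expand[OF dch_linear[OF smooth_phi c(1)], symmetric]) (use q in blast)
	qed
	ultimately have "(in_chart c (%q. P q w) has_derivative
			(%a. \<Sum>k\<in>UNIV. lift c w ?z $ k *R S k a + L a $ k *R F k ?z)) (at ?z)"
		by (rule has_derivative_transform_within_open[OF _ chart_open[OF c(1)] z])
	from frechet_derivative_eqI[OF this]
	have "dch (%q. P q w) c ?z (axis j 1) = (\<Sum>k\<in>UNIV. lift c w ?z $ k *R S k (axis j 1)) + dphi c ?z (L (axis j 1))" for j
		by (simp add: sum.distrib Fl[of "L (axis j 1)"])
	moreover have "dch (%q. P q w) c ?z (axis j 1) = Q (F j ?z) w p" for j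
		unfolding F_def Q_def deriv_along_chart[OF smooth_fun_P c, symmetric]
		by (rule pd_Tan[OF p]) (simp add: Tan_chart[OF c])
	moreover have "(\<Sum>k\<in>UNIV. lift c w ?z $ k *R S k (axis j 1)) = S j (lift c w ?z)" for j
		unfolding sym[of _ j] by (rule linear_vec_expand[OF has_derivative_linear[OF dF], symmetric])
	ultimately have "Q (F j ?z) w p = S j (lift c w ?z) + dphi c ?z (L (axis j 1))" for j by metis
	then have "lift c (Q (F j ?z) w p) ?z $ j = lift c (S j (lift c w ?z)) ?z $ j + L (axis j 1) $ j" for j
		by (simp add: linear_add[OF linear_lift[OF c]] lift_dch[OF c])
	then have "(\<Sum>j\<in>UNIV. L (axis j 1) $ j) + (\<Sum>k\<in>UNIV. lift c (S k (lift c w ?z)) ?z $ k) =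
			(\<Sum>j\<in>UNIV. lift c (Q (F j ?z) w p) ?z $ j)" by (simp add: sum.distrib)
	also have "... = (\<Sum>b\<in>Basis. Q (P p b) w p \<bullet> P p b)"
		unfolding F_def by (rule trace_chart[OF c linear_Q1[OF p]])
	also have "... = w \<bullet> mH p"
		unfolding mH_eq[OF p] inner_sum_right by (intro sum.cong refl) (metis Q_P1[OF p] Q_sym[OF p] inner_commute)
	finally show ?thesis unfolding L_def S_def F_def .
qed

lemma pd_cong_open:
	assumes U: "openM U" "p \<in> U" and eq: "\<And>q. q \<in> U ==> f q = g q"
	shows "pd w f p = pd w g p"
proof -
	have p: "p \<in> M" using U openin_imp_subset by blast
	let ?c = "chart_at A p"
	note c = chart_at_in[OF p] chart_at_mem[OF p]
	have "openin (top_of_set (fst ?c)) (U \<inter> fst ?c)" using U(1) chart_openin[OF c(1)] chart_subset[OF c(1)]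
		by (metis openin_Int openin_subset_trans inf_le2)
	then have "openin (top_of_set (snd ?c ` fst ?c)) (snd ?c ` (U \<inter> fst ?c))"
		using homeomorphism_imp_open_map[OF chart_homeo[OF c(1)]] by blast
	then have op: "open (snd ?c ` (U \<inter> fst ?c))" using chart_open[OF c(1)] openin_open_trans by blast
	have "in_chart ?c f z = in_chart ?c g z" if z: "z \<in> snd ?c ` (U \<inter> fst ?c)" for z
	proof -
		obtain q where q: "q \<in> U" "q \<in> fst ?c" "z = snd ?c q" using z by blast
		show ?thesis unfolding q(3) in_chart_snd[OF c(1) q(2)] by (rule eq[OF q(1)])
	qed
	then have "FD (in_chart ?c f) (coord A p) = FD (in_chart ?c g) (coord A p)"
		by (rule frechet_derivative_cong_open[OF op, rotated]) (use U(2) c(2) in \<open>auto simp: coord_def\<close>)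
	then show ?thesis unfolding pd_def deriv_along_def by simp
qed

lemma compact_closedin: "compact K ==> K \<subseteq> M ==> openM (M - K)"
	using compact_imp_closed by (metis Diff_eq open_Compl openin_open_Int)

text \<open>Multiplied by the volume density, the integrand becomes the Euclidean divergence of the
  product of f, \<open>lift c w\<close> and \<open>vol c\<close>, a field with compact support in
  the chart.\<close>

lemma first_variation_chart:
	assumes c: "c \<in> A" and K: "compact K" "K \<subseteq> fst c"
		and f: "smooth (f :: 'p => real)" "\<And>p. p \<in> M ==> p \<notin> K ==> f p = 0"
	shows "(LINT p|vM. pd w f p + f p * (w \<bullet> mH p)) = 0"
proof -
	let ?Z = "im c"
	note Z = chart_open[OF c]
	have KM: "K \<subseteq> M" using K chart_subset[OF c] by blast
	have pd0: "pd w f p = 0" if p: "p \<in> M" "p \<notin> K" for p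
		using pd_cong_open[OF compact_closedin[OF K(1) KM], of p f "%_. 0" w] p f(2) by simp
	define h where "h j z = in_chart c f z * (lift c w z $ j * vol c z)" for j z
	\<comment> \<open>Extension by zero, smooth on the whole space because \<open>h j\<close> vanishes
	  outside the compact image of K.\<close>
	define g where "g j z = (if z \<in> ?Z then h j z else 0)" for j z
	have CK: "compact (snd c ` K)"
		using K chart_homeo[OF c] by (intro compact_continuous_image) (auto simp: homeomorphism_def intro: continuous_on_subset)
	have f0: "in_chart c f z = 0" if z: "z \<in> ?Z" "z \<notin> snd c ` K" for z
	proof -
		obtain q where q: "q \<in> fst c" "z = snd c q" using z(1) by blast
		then have "q \<notin> K" using z(2) by blast
		then show ?thesis using f(2)[of q] chart_in_M[OF c q(1)] q in_chart_snd[OF c q(1), of f] by simp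
	qed
	have sl: "smooth_on ?Z (%z. lift c w z $ j)" for j
		by (rule smooth_on_linear_compose[OF smooth_on_lift[OF c] Z bounded_linear_vec_nth])
	have sh: "smooth_on ?Z (h j)" for j
		unfolding h_def by (intro smooth_on_mult smooth_fun_chart[OF f(1) c] sl smooth_on_vol[OF c] Z)
	have g0: "g j z = 0" if "z \<notin> snd c ` K" for j z using f0[OF _ that] by (simp add: g_def h_def)
	have sg: "smooth_on UNIV (g j)" for j
	proof (rule smooth_on_locally)
		fix z :: "real ^ 'm::{finite,wellorder}"
		show "\<exists>T. open T \<and> z \<in> T \<and> smooth_on T (g j)"
		proof (cases "z \<in> ?Z")
			case True
			have "smooth_on ?Z (g j)" using sh smooth_on_cong[OF Z, of "g j" "h j"] by (simp add: g_def)
			then show ?thesis using True Z by blast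
		next
			case False
			have op: "open (- (snd c ` K))" using CK by (simp add: compact_imp_closed open_Compl)
			have "smooth_on (- (snd c ` K)) (g j)" using smooth_on_cong[OF op, of "g j" "%_. 0"] g0 by simp
			then show ?thesis using op False K(2) by (intro exI[of _ "- (snd c ` K)"]) auto
		qed
	qed
	have key: "(\<Sum>j\<in>UNIV. FD (g j) z (axis j 1)) =
			indicator ?Z z * (vol c z * in_chart c (%p. pd w f p + f p * (w \<bullet> mH p)) z)" for z
	proof (cases "z \<in> ?Z")
		case True
		then obtain p where p: "p \<in> fst c" "z = snd c p" by blast
		note cp = c p(1)
		define L where "L = FD (lift c w) z"
		define V where "V a = (\<Sum>k\<in>UNIV. lift c (FD (%z. dphi c z (axis k 1)) z a) z $ k)" for a
		have dL: "(lift c w has_derivative L) (at z)"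
			unfolding L_def by (rule smooth_on_has_derivative[OF smooth_on_lift[OF c] Z True])
		have df: "(in_chart c f has_derivative dch f c z) (at z)" by (rule dch_has_derivative[OF f(1) c True])
		have dV: "(vol c has_derivative (%a. vol c z * V a)) (at z)" using vol_has_derivative[OF cp] unfolding V_def p(2) .
		have "FD (g j) z = FD (h j) z" for j
			by (rule frechet_derivative_cong_open[OF Z True]) (simp add: g_def)
		moreover have "(h j has_derivative (%a. in_chart c f z * (lift c w z $ j * (vol c z * V a) + L a $ j * vol c z)
				+ dch f c z a * (lift c w z $ j * vol c z))) (at z)" for j
			unfolding h_def
			by (intro has_derivative_mult df dV bounded_linear.has_derivative[OF bounded_linear_vec_nth dL])
		note hh = frechet_derivative_eqI[OF this]
		ultimately have fg: "FD (g j) z a = in_chart c f z * (lift c w z $ j * (vol c z * V a) + L a $ j * vol c z)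
				+ dch f c z a * (lift c w z $ j * vol c z)" for j a
			by (simp only: hh)
		have lV: "linear (%a. vol c z * V a)" using has_derivative_linear[OF dV] .
		have "(\<Sum>j\<in>UNIV. FD (g j) z (axis j 1)) =
			in_chart c f z * (\<Sum>j\<in>UNIV. lift c w z $ j *R (vol c z * V (axis j 1))) + in_chart c f z * vol c z * (\<Sum>j\<in>UNIV. L (axis j 1) $ j)
			+ vol c z * (\<Sum>j\<in>UNIV. lift c w z $ j *R dch f c z (axis j 1))"
			unfolding fg by (simp add: sum_distrib_left sum.distrib algebra_simps)
		also have "(\<Sum>j\<in>UNIV. lift c w z $ j *R (vol c z * V (axis j 1))) = vol c z * V (lift c w z)"
			by (rule linear_vec_expand[OF lV, symmetric])
		also have "(\<Sum>j\<in>UNIV. lift c w z $ j *R dch f c z (axis j 1)) = dch f c z (lift c w z)"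
			by (rule linear_vec_expand[OF dch_linear[OF f(1) c True], symmetric])
		also have "dch f c z (lift c w z) = pd w f p" using pd_chart[OF f(1) cp] p(2) by simp
		also have "in_chart c f z = f p" unfolding p(2) by (rule in_chart_snd[OF cp])
		also have "f p * (vol c z * V (lift c w z)) + f p * vol c z * (\<Sum>j\<in>UNIV. L (axis j 1) $ j) + vol c z * pd w f p
				= vol c z * (pd w f p + f p * ((\<Sum>j\<in>UNIV. L (axis j 1) $ j) + V (lift c w z)))"
			by (simp add: algebra_simps)
		also have "(\<Sum>j\<in>UNIV. L (axis j 1) $ j) + V (lift c w z) = w \<bullet> mH p"
			unfolding L_def V_def p(2) by (rule lift_divergence[OF cp])
		finally show ?thesis using True p(2) in_chart_snd[OF cp, of "%p. pd w f p + f p * (w \<bullet> mH p)"] by simp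
	next
		case False
		have op: "open (- (snd c ` K))" using CK by (simp add: compact_imp_closed open_Compl)
		have "FD (g j) z = FD (%_. 0) z" for j
			by (rule frechet_derivative_cong_open[OF op]) (use False K(2) g0 in auto)
		then show ?thesis using False by (simp add: frechet_derivative_const)
	qed
	have sm: "smooth (%p. pd w f p + f p * (w \<bullet> mH p))" by (intro smooth_fun_intros f(1) smooth_fun_mH)
	have "(LINT p|vM. pd w f p + f p * (w \<bullet> mH p)) =
			(\<integral>z. (\<Sum>j\<in>UNIV. FD (g j) z (axis j 1)) \<partial>lborel)"
		unfolding key
	proof (rule integral_vM_chart[OF c])
		show "(%p. pd w f p + f p * (w \<bullet> mH p)) \<in> borel_measurable borel_M"
			by (rule borel_measurable_continuous_on_restrict[OF smooth_fun_continuous[OF sm]])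
		show "pd w f p + f p * (w \<bullet> mH p) = 0" if "p \<in> M" "p \<notin> fst c" for p using that pd0 f(2) K(2) by force
	qed
	also have "... = (\<Sum>j\<in>UNIV. \<integral>z. FD (g j) z (axis j 1) \<partial>lborel)"
		by (rule Bochner_Integration.integral_sum) (rule integral_frechet_derivative_eq_0(2)[OF sg CK g0])
	also have "... = 0" using integral_frechet_derivative_eq_0(1)[OF sg CK g0] by simp
	finally show ?thesis .
qed

end


context closed_immersion
begin

subsection \<open>Partitions of unity and integration by parts\<close>

lemma smooth_fun_locally:
	assumes "\<And>p. p \<in> M ==> \<exists>c V. c \<in> A \<and> p \<in> fst c \<and> open V \<and> snd c p \<in> V \<and> V \<subseteq> im c \<and> smooth_on V (in_chart c f)"
	shows "smooth f"
	unfolding smooth_fun_def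
proof
	fix d assume d: "d \<in> A"
	show "smooth_on (snd d ` fst d) (in_chart d f)"
	proof (rule smooth_on_locally)
		fix z assume "z \<in> snd d ` fst d"
		then obtain p where p: "p \<in> fst d" "z = snd d p" by blast
		obtain c V where c: "c \<in> A" "p \<in> fst c" and V: "open V" "snd c p \<in> V" "V \<subseteq> im c" "smooth_on V (in_chart c f)"
			using assms[OF chart_in_M[OF d p(1)]] by blast
		let ?S = "snd d ` (fst d \<inter> fst c)" and ?T = "in_chart d (snd c)"
		note S = chart_inter_open[OF d c(1)] and T = chart_trans[OF d c(1)]
		define W where "W = ?S \<inter> ?T -` V"
		have W: "open W" "W \<subseteq> ?S"
			unfolding W_def using continuous_open_preimage[OF smooth_on_imp_continuous_on[OF T] S V(1)] by auto
		have zW: "z \<in> W" unfolding W_def p(2) using p(1) c(2) V(2) in_chart_snd[OF d p(1), of "snd c"] by auto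
		have eq: "in_chart d f y = in_chart c f (?T y)" if y: "y \<in> W" for y
		proof -
			obtain q where q: "q \<in> fst d" "q \<in> fst c" "y = snd d q" using y W(2) by blast
			show ?thesis unfolding q(3) in_chart_snd[OF d q(1)] in_chart_snd[OF c(1) q(2)] ..
		qed
		have "smooth_on W (%y. in_chart c f (?T y))"
			by (rule smooth_on_compose[OF V(4) smooth_on_subset[OF T W(2)] W(1) V(1)]) (auto simp: W_def)
		then have "smooth_on W (in_chart d f)" by (subst smooth_on_cong[OF W(1) eq])
		then show "\<exists>T. open T \<and> z \<in> T \<and> smooth_on T (in_chart d f)" using W(1) zW by blast
	qed
qed

lemma chart_image_open:
	assumes c: "c \<in> A" and U: "openM U"
	shows "open (snd c ` (U \<inter> fst c))"
proof -
	have "openin (top_of_set (fst c)) (U \<inter> fst c)"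
		using U chart_openin[OF c] chart_subset[OF c] by (metis openin_Int openin_subset_trans inf_le2)
	then have "openin (top_of_set (im c)) (snd c ` (U \<inter> fst c))"
		using homeomorphism_imp_open_map[OF chart_homeo[OF c]] by blast
	then show ?thesis using chart_open[OF c] openin_open_trans by blast
qed

lemma smooth_fun_agree:
	assumes "\<And>p. p \<in> M ==> \<exists>U g. openM U \<and> p \<in> U \<and> smooth g \<and> (\<forall>q\<in>U. f q = g q)"
	shows "smooth f"
proof (rule smooth_fun_locally)
	fix p assume p: "p \<in> M"
	obtain U g where U: "openM U" "p \<in> U" "smooth g" "\<forall>q\<in>U. f q = g q"
		using assms[OF p] by blast
	let ?c = "chart_at A p"
	note c = chart_at_in[OF p] chart_at_mem[OF p]
	let ?V = "snd ?c ` (U \<inter> fst ?c)"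
	note V = chart_image_open[OF c(1) U(1)]
	have eq: "in_chart ?c f z = in_chart ?c g z" if z: "z \<in> ?V" for z
	proof -
		obtain q where q: "q \<in> U" "q \<in> fst ?c" "z = snd ?c q" using z by blast
		show ?thesis unfolding q(3) in_chart_snd[OF c(1) q(2)] using U(4) q(1) by blast
	qed
	have "smooth_on ?V (in_chart ?c g)" by (rule smooth_on_subset[OF smooth_fun_chart[OF U(3) c(1)]]) auto
	then have "smooth_on ?V (in_chart ?c f)" by (subst smooth_on_cong[OF V eq])
	then show "\<exists>c V. c \<in> A \<and> p \<in> fst c \<and> open V \<and> snd c p \<in> V \<and> V \<subseteq> im c \<and> smooth_on V (in_chart c f)"
		using c V U(2) by (intro exI[of _ ?c] exI[of _ ?V]) auto
qed

lemma bump_exists: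
	assumes p: "p \<in> M"
	shows "\<exists>c K \<rho>. c \<in> A \<and> compact K \<and> K \<subseteq> fst c \<and> smooth \<rho> \<and> (\<forall>q\<in>M. 0 \<le> \<rho> q) \<and>
		(\<forall>q\<in>M. q \<notin> K \<longrightarrow> \<rho> q = 0) \<and> (0::real) < \<rho> p"
proof -
	define c where "c = chart_at A p"
	have c: "c \<in> A" "p \<in> fst c" using chart_at_in[OF p] chart_at_mem[OF p] by (auto simp: c_def)
	have z: "snd c p \<in> im c" using c by blast
	obtain e where e: "0 < e" "cball (snd c p) e \<subseteq> im c" using open_contains_cball chart_open[OF c(1)] z by blast
	define K where "K = inv_into (fst c) (snd c) ` cball (snd c p) e"
	have Kc: "K \<subseteq> fst c" unfolding K_def using e(2) chart_inv_in[OF c(1)] by blast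
	have K: "compact K" unfolding K_def using chart_homeo[OF c(1)] e(2)
		by (intro compact_continuous_image compact_cball) (auto simp: homeomorphism_def intro: continuous_on_subset)
	\<comment> \<open>Inside the ball this is exp(-1 / (e^2 - r^2)), outside it is 0; the squared
	  distance keeps it smooth at the centre.\<close>
	define \<beta> where "\<beta> z = flat_exp 0 (e^2 - (z - snd c p) \<bullet> (z - snd c p))" for z
	define \<rho> where "\<rho> q = (if q \<in> fst c then \<beta> (snd c q) else 0)" for q
	have \<beta>0: "\<beta> z = 0" if "z \<notin> cball (snd c p) e" for z
	proof -
		have "e < norm (z - snd c p)" using that by (simp add: dist_norm norm_minus_commute)
		then have "e^2 \<le> (norm (z - snd c p))^2" using e(1) by (intro power_mono) auto
		then show ?thesis by (simp add: \<beta>_def flat_exp_def power2_norm_eq_inner)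
	qed
	have \<beta>s: "smooth_on UNIV \<beta>" unfolding \<beta>_def by (rule smooth_on_compose[OF smooth_on_flat_exp])
			(intro smooth_on_diff smooth_on_inner smooth_on_const smooth_on_id open_UNIV | simp)+
	have 0: "\<rho> q = 0" if q: "q \<in> M" "q \<notin> K" for q
	proof (cases "q \<in> fst c")
		case True
		have "snd c q \<notin> cball (snd c p) e" using q(2) chart_inv[OF c(1) True] unfolding K_def by (metis imageI)
		then show ?thesis using \<beta>0 by (simp add: \<rho>_def)
	qed (simp add: \<rho>_def)
	have "smooth \<rho>"
	proof (rule smooth_fun_locally)
		fix q assume q: "q \<in> M"
		show "\<exists>c V. c \<in> A \<and> q \<in> fst c \<and> open V \<and> snd c q \<in> V \<and> V \<subseteq> im c \<and> smooth_on V (in_chart c \<rho>)"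
		proof (cases "q \<in> fst c")
			case True
			have "in_chart c \<rho> y = \<beta> y" if "y \<in> im c" for y
				using that in_chart_snd[OF c(1), of _ \<rho>] by (auto simp: \<rho>_def)
			then have "smooth_on (im c) (in_chart c \<rho>)"
				using smooth_on_cong[OF chart_open[OF c(1)]] smooth_on_subset[OF \<beta>s] by blast
			then show ?thesis using c(1) True chart_open[OF c(1)] by blast
		next
			case False
			let ?d = "chart_at A q" and ?U = "M - K"
			note d = chart_at_in[OF q] chart_at_mem[OF q]
			have U: "openM ?U" by (rule compact_closedin[OF K]) (use Kc chart_subset[OF c(1)] in blast)
			let ?V = "snd ?d ` (?U \<inter> fst ?d)"
			note V = chart_image_open[OF d(1) U]
			have eq: "in_chart ?d \<rho> y = 0" if y: "y \<in> ?V" for y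
			proof -
				obtain r where r: "r \<in> ?U" "r \<in> fst ?d" "y = snd ?d r" using y by blast
				show ?thesis unfolding r(3) in_chart_snd[OF d(1) r(2)] using 0 r(1) by blast
			qed
			have "smooth_on ?V (in_chart ?d \<rho>)" by (subst smooth_on_cong[OF V eq]) auto
			moreover have "snd ?d q \<in> ?V" using False Kc q d(2) by blast
			ultimately show ?thesis using d V by (intro exI[of _ ?d] exI[of _ ?V]) blast
		qed
	qed
	moreover have "0 < \<rho> p" using c(2) e(1) by (simp add: \<rho>_def \<beta>_def flat_exp_def)
	moreover have "0 \<le> \<rho> q" for q by (simp add: \<rho>_def \<beta>_def flat_exp_nonneg)
	ultimately show ?thesis using c(1) K Kc 0 by blast
qed

lemma smooth_fun_divide:
	fixes f g :: "'p => real"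
	assumes "smooth f" "smooth g" "\<And>p. p \<in> M ==> g p \<noteq> 0"
	shows "smooth (%p. f p / g p)"
proof -
	have "smooth (%p. inverse (g p))"
		by (rule smooth_fun_compose[OF assms(2) smooth_on_inverse]) (use assms(3) in auto)
	then show ?thesis using smooth_fun_mult[OF assms(1)] by (simp add: divide_inverse)
qed

lemma partition_of_unity: obtains I :: "'p set" and c K and \<chi>' :: "'p => 'p => real" where "finite I"
		"\<And>i. i \<in> I ==> c i \<in> A" "\<And>i. i \<in> I ==> compact (K i)" "\<And>i. i \<in> I ==> K i \<subseteq> fst (c i)"
		"\<And>i. i \<in> I ==> smooth (\<chi>' i)" "\<And>i q. i \<in> I ==> q \<in> M ==> q \<notin> K i ==> \<chi>' i q = 0"
		"\<And>q. q \<in> M ==> (\<Sum>i\<in>I. \<chi>' i q) = 1"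
proof -
	obtain c K \<rho> where b: "\<And>p. p \<in> M ==> c p \<in> A \<and> compact (K p) \<and> K p \<subseteq> fst (c p) \<and> smooth (\<rho> p) \<and>
			(\<forall>q\<in>M. 0 \<le> \<rho> p q) \<and> (\<forall>q\<in>M. q \<notin> K p \<longrightarrow> \<rho> p q = 0) \<and> (0::real) < \<rho> p p"
		using bump_exists by metis
	define U where "U p = {q \<in> M. 0 < \<rho> p q}" for p
	have "openM (U p) \<and> p \<in> U p" if p: "p \<in> M" for p
	proof -
		have "U p = M \<inter> \<rho> p -` {0<..}" by (auto simp: U_def)
		moreover have "openM (M \<inter> \<rho> p -` {0<..})"
			using b[OF p] by (intro continuous_openin_preimage_gen smooth_fun_continuous) auto
		ultimately show ?thesis using b[OF p] p by (simp add: U_def)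
	qed
	then obtain I where I: "finite I" "I \<subseteq> M" "M \<subseteq> (\<Union>p\<in>I. U p)" using compact_openin_cover[OF compact_M] by metis
	define \<sigma> where "\<sigma> q = (\<Sum>i\<in>I. \<rho> i q)" for q
	have \<sigma>s: "smooth \<sigma>" unfolding \<sigma>_def[abs_def] using b I(2) by (intro smooth_fun_sum) blast
	have \<sigma>pos: "\<sigma> q > 0" if q: "q \<in> M" for q
	proof -
		obtain i where i: "i \<in> I" "0 < \<rho> i q" using I(3) q by (auto simp: U_def)
		show ?thesis unfolding \<sigma>_def by (rule sum_pos2[OF I(1) i(1), of "%i. \<rho> i q"]) (use b I(2) q i(2) in auto)
	qed
	have nz: "\<sigma> q \<noteq> 0" if "q \<in> M" for q using \<sigma>pos[OF that] by simp
	show ?thesis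
	proof (rule that[of I c K "%i q. \<rho> i q / \<sigma> q"])
		show "(\<Sum>i\<in>I. \<rho> i q / \<sigma> q) = 1" if "q \<in> M" for q
			using nz[OF that] by (simp add: sum_divide_distrib[symmetric]) (simp add: \<sigma>_def)
		show "smooth (%q. \<rho> i q / \<sigma> q)" if "i \<in> I" for i
			by (rule smooth_fun_divide[OF _ \<sigma>s nz]) (use b I(2) that in blast)+
		fix i assume "i \<in> I"
		then have i: "i \<in> M" using I(2) by blast
		show "c i \<in> A" "compact (K i)" "K i \<subseteq> fst (c i)" using b[OF i] by simp_all
		show "\<rho> i q / \<sigma> q = 0" if "q \<in> M" "q \<notin> K i" for q using b[OF i] that by simp
	qed (rule I(1))
qed

theorem first_variation:
	assumes f: "smooth (f :: 'p => real)"
	shows "(LINT p|vM. pd w f p) = - (LINT p|vM. f p * (w \<bullet> mH p))"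
proof -
	obtain I :: "'p set" and c K and \<eta> :: "'p => 'p => real" where I: "finite I"
		"\<And>i. i \<in> I ==> c i \<in> A" "\<And>i. i \<in> I ==> compact (K i)" "\<And>i. i \<in> I ==> K i \<subseteq> fst (c i)"
		"\<And>i. i \<in> I ==> smooth (\<eta> i)" "\<And>i q. i \<in> I ==> q \<in> M ==> q \<notin> K i ==> \<eta> i q = 0"
		"\<And>q. q \<in> M ==> (\<Sum>i\<in>I. \<eta> i q) = 1"
		by (rule partition_of_unity) (rule that; assumption)
	let ?f = "%i q. \<eta> i q * f q"
	have fs: "smooth (?f i)" if "i \<in> I" for i by (rule smooth_fun_mult[OF I(5)[OF that] f])
	have fi: "(LINT p|vM. pd w (?f i) p + ?f i p * (w \<bullet> mH p)) = 0" if i: "i \<in> I" for i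
		using first_variation_chart[OF I(2)[OF i] I(3)[OF i] I(4)[OF i] fs[OF i], of w] I(6)[OF i] by simp
	have s1: "smooth (%p. pd w g p + g p * (w \<bullet> mH p))" if "smooth g" for g :: "'p => real"
		by (intro smooth_fun_intros that smooth_fun_mH)
	have eq: "pd w f p + f p * (w \<bullet> mH p) = (\<Sum>i\<in>I. pd w (?f i) p + ?f i p * (w \<bullet> mH p))" if p: "p \<in> M" for p
	proof -
		have "pd w f p = pd w (%q. \<Sum>i\<in>I. ?f i q) p"
			by (rule pd_cong[OF _ p]) (simp add: sum_distrib_right[symmetric] I(7))
		also have "... = (\<Sum>i\<in>I. pd w (?f i) p)" by (rule pd_sum[OF fs p])
		finally show ?thesis using I(7)[OF p] by (simp add: sum.distrib sum_distrib_right[symmetric])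
	qed
	have "(LINT p|vM. pd w f p + f p * (w \<bullet> mH p)) = (LINT p|vM. (\<Sum>i\<in>I. pd w (?f i) p + ?f i p * (w \<bullet> mH p)))"
		by (rule int_cong) (auto simp: eq)
	also have "... = (\<Sum>i\<in>I. LINT p|vM. pd w (?f i) p + ?f i p * (w \<bullet> mH p))"
		by (rule Bochner_Integration.integral_sum) (rule smooth_integrable[OF s1[OF fs]])
	also have "... = 0" by (simp add: fi)
	finally have "(LINT p|vM. pd w f p + f p * (w \<bullet> mH p)) = 0" .
	moreover have "(LINT p|vM. pd w f p + f p * (w \<bullet> mH p)) = (LINT p|vM. pd w f p) + (LINT p|vM. f p * (w \<bullet> mH p))"
		by (intro Bochner_Integration.integral_add smooth_integrable smooth_fun_intros f smooth_fun_mH)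
	ultimately show ?thesis by simp
qed

text \<open>First variation in each coordinate. X need not be tangent: X = \<phi> yields the
  Minkowski formula, tangent X the usual divergence theorem.\<close>

theorem divergence_theorem:
	assumes X: "smooth (X :: 'p => 'e)"
	shows "(LINT p|vM. (\<Sum>b\<in>Basis. pd b X p \<bullet> b)) = - (LINT p|vM. X p \<bullet> mH p)"
proof -
	have s: "smooth (%p. X p \<bullet> b)" for b by (intro smooth_fun_intros X)
	have "(LINT p|vM. (\<Sum>b\<in>Basis. pd b X p \<bullet> b)) = (LINT p|vM. (\<Sum>b\<in>Basis. pd b (%q. X q \<bullet> b) p))"
		by (rule int_cong) (auto simp: pd_linear[OF X bounded_linear_inner_left])
	also have "... = (\<Sum>b\<in>Basis. LINT p|vM. pd b (%q. X q \<bullet> b) p)"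
		by (rule Bochner_Integration.integral_sum) (intro smooth_integrable smooth_fun_pd s)
	also have "... = (\<Sum>b\<in>Basis. - (LINT p|vM. (X p \<bullet> b) * (b \<bullet> mH p)))"
		by (simp add: first_variation[OF s])
	also have "... = - (LINT p|vM. (\<Sum>b\<in>Basis. (X p \<bullet> b) * (b \<bullet> mH p)))"
		by (subst Bochner_Integration.integral_sum) (auto intro!: smooth_integrable smooth_fun_intros X smooth_fun_mH simp: sum_negf)
	also have "(%p. \<Sum>b\<in>Basis. (X p \<bullet> b) * (b \<bullet> mH p)) = (%p. X p \<bullet> mH p)"
		by (subst euclidean_inner) (simp add: inner_commute)
	finally show ?thesis .
qed

text \<open>The sum of \<open>pd b (pd b f)\<close> is the Laplacian, its first-order part being the
  derivative along the tangential part of \<open>mH\<close>, which is 0. The field g grad f is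
  tangent, so the curvature term disappears.\<close>

lemma green:
	fixes f g :: "'p => real"
	assumes f: "smooth f" and g: "smooth g"
	shows "(LINT p|vM. (\<Sum>b\<in>Basis. pd b g p * pd b f p)) = - (LINT p|vM. g p * (\<Sum>b\<in>Basis. pd b (pd b f) p))"
proof -
	define X where "X p = (\<Sum>b\<in>Basis. (g p * pd b f p) *R b)" for p
	have Xs: "smooth X" unfolding X_def[abs_def] by (intro smooth_fun_intros f g)
	have Xb: "X p \<bullet> b = g p * pd b f p" if "b \<in> Basis" for p b using that by (simp add: X_def inner_sum_left_Basis)
	have XH: "X p \<bullet> mH p = 0" if p: "p \<in> M" for p
	proof -
		have "X p \<bullet> mH p = g p * (\<Sum>b\<in>Basis. (mH p \<bullet> b) *R pd b f p)"
			by (subst euclidean_inner) (simp add: Xb sum_distrib_left mult_ac)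
		also have "(\<Sum>b\<in>Basis. (mH p \<bullet> b) *R pd b f p) = pd (mH p) f p"
			by (rule linear_euclidean_expand[OF linear_pd[OF f p], symmetric])
		also have "pd (mH p) f p = 0" using pd_P[OF p, of "mH p" f] linear_0[OF linear_pd[OF f p]] P_mH[OF p] by simp
		finally show ?thesis by simp
	qed
	have e: "(\<Sum>b\<in>Basis. pd b X p \<bullet> b) = (\<Sum>b\<in>Basis. pd b g p * pd b f p) + g p * (\<Sum>b\<in>Basis. pd b (pd b f) p)" if p: "p \<in> M" for p
	proof -
		have "pd b X p \<bullet> b = pd b g p * pd b f p + g p * pd b (pd b f) p" if b: "b \<in> Basis" for b
		proof -
			have "pd b X p \<bullet> b = pd b (%q. X q \<bullet> b) p" by (rule pd_linear[OF Xs bounded_linear_inner_left p, symmetric])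
			also have "... = pd b (%q. g q * pd b f q) p" by (simp add: Xb[OF b])
			finally show ?thesis by (simp add: pd_mult[OF g smooth_fun_pd[OF f] p])
		qed
		then show ?thesis by (simp add: sum.distrib sum_distrib_left)
	qed
	have "(LINT p|vM. (\<Sum>b\<in>Basis. pd b X p \<bullet> b)) =
		 (LINT p|vM. (\<Sum>b\<in>Basis. pd b g p * pd b f p) + g p * (\<Sum>b\<in>Basis. pd b (pd b f) p))"
		by (rule int_cong) (auto simp: e)
	also have "... = (LINT p|vM. (\<Sum>b\<in>Basis. pd b g p * pd b f p)) + (LINT p|vM. g p * (\<Sum>b\<in>Basis. pd b (pd b f) p))"
		by (intro Bochner_Integration.integral_add smooth_integrable smooth_fun_intros f g)
	moreover have "(LINT p|vM. X p \<bullet> mH p) = (LINT p|vM. 0)"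
		by (rule int_cong) (auto simp: XH)
	ultimately show ?thesis using divergence_theorem[OF Xs] by simp
qed

lemma laplacian_integral:
	fixes f :: "'p => real"
	assumes "smooth f"
	shows "(LINT p|vM. (\<Sum>b\<in>Basis. pd b (pd b f) p)) = 0"
	using green[OF assms smooth_fun_const[of 1]] by simp

lemma locally_constant:
	assumes f: "smooth f" and 0: "\<And>w p. p \<in> M ==> pd w f p = 0" and p: "p \<in> M"
	shows "\<exists>U. openM U \<and> p \<in> U \<and> (\<forall>q\<in>U. f q = f p)"
proof -
	define c where "c = chart_at A p"
	have c: "c \<in> A" "p \<in> fst c" using chart_at_in[OF p] chart_at_mem[OF p] by (auto simp: c_def)
	have z: "snd c p \<in> im c" using c by blast
	obtain e where e: "0 < e" "ball (snd c p) e \<subseteq> im c" using open_contains_ball chart_open[OF c(1)] z by blast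
	have d0: "(in_chart c f has_derivative (%a. 0)) (at y)" if y: "y \<in> im c" for y
	proof -
		obtain q where q: "q \<in> fst c" "y = snd c q" using y by blast
		have qM: "q \<in> M" by (rule chart_in_M[OF c(1) q(1)])
		have "dch f c y a = 0" for a unfolding q(2) deriv_along_chart[OF f c(1) q(1), symmetric]
			by (subst pd_Tan[OF qM]) (auto simp: Tan_chart[OF c(1) q(1)] 0[OF qM])
		then have "dch f c y = (%a. 0)" by auto
		then show ?thesis using dch_has_derivative[OF f c(1) y] by simp
	qed
	define U where "U = inv_into (fst c) (snd c) ` ball (snd c p) e"
	have "openin (top_of_set (im c)) (ball (snd c p) e)" using e(2) by (simp add: openin_open_eq chart_open[OF c(1)])
	moreover have "homeomorphism (im c) (fst c) (inv_into (fst c) (snd c)) (snd c)"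
		using chart_homeo[OF c(1)] homeomorphism_symD by blast
	ultimately have "openin (top_of_set (fst c)) U" unfolding U_def using homeomorphism_imp_open_map by blast
	then have "openM U" using chart_openin[OF c(1)] openin_trans by blast
	moreover have "p \<in> U" unfolding U_def using c e(1) chart_inv[OF c] by (metis centre_in_ball image_eqI)
	moreover have "f q = f p" if q: "q \<in> U" for q
	proof -
		obtain y where y: "y \<in> ball (snd c p) e" "q = inv_into (fst c) (snd c) y" using q unfolding U_def by blast
		have "(in_chart c f has_derivative (%a. 0)) (at x within ball (snd c p) e)" if "x \<in> ball (snd c p) e" for x
			by (rule has_derivative_at_withinI[OF d0]) (use that e(2) in blast)
		then have "in_chart c f y = in_chart c f (snd c p)"
			by (rule has_derivative_zero_unique[OF convex_ball _ y(1)]) (use e(1) in auto)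
		then show ?thesis using y(2) in_chart_snd[OF c, of f] by (simp add: in_chart_def)
	qed
	ultimately show ?thesis by blast
qed

lemma constant_on_connected:
	assumes "connected M" and f: "smooth f" and 0: "\<And>w p. p \<in> M ==> pd w f p = 0" and pq: "p \<in> M" "q \<in> M"
	shows "f p = f q"
proof -
	have "\<exists>T. openM T \<and> a \<in> T \<and> (\<forall>x\<in>T. f x = f a)" if "a \<in> M" for a
		using locally_constant[OF f 0 that] by blast
	then have "f constant_on M" using locally_constant_imp_constant[OF assms(1)] by blast
	then show ?thesis using pq unfolding constant_on_def by metis
qed

end


section \<open>Covectors\<close>

lemma covector_linear: "covector k th ==> length us = k ==> i < k ==> linear (%v. th (us[i := v]))"
	unfolding covector_def by blast

lemma covector_eq_0:
	assumes "covector k th" "length us = k" "i < k" "j < k" "i \<noteq> j" "us ! i = us ! j"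
	shows "th us = 0"
	using assms unfolding covector_def by (metis linorder_neqE_nat)

lemma covector_swap:
	assumes th: "covector k th" and us: "length us = k" and ij: "i < k" "j < k" "i \<noteq> j"
	shows "th (us[i := v, j := w]) = - th (us[i := w, j := v])"
proof -
	have l1: "th (us[i := x + y, j := z]) = th (us[i := x, j := z]) + th (us[i := y, j := z])" for x y z
		using linear_add[OF covector_linear[OF th, of "us[j := z]" i]] us ij
		by (simp add: list_update_swap[of i j])
	have l2: "th (us[i := z, j := x + y]) = th (us[i := z, j := x]) + th (us[i := z, j := y])" for x y z
		using linear_add[OF covector_linear[OF th, of "us[i := z]" j]] us ij by simp
	have a: "th (us[i := x, j := x]) = 0" for x by (rule covector_eq_0[OF th _ ij]) (use us ij in auto)
	have "0 = th (us[i := v + w, j := v + w])" by (simp add: a)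
	also have "... = th (us[i := v, j := w]) + th (us[i := w, j := v])" unfolding l1 l2 by (simp add: a)
	finally show ?thesis by simp
qed

text \<open>Absolute values spare the sign of the permutation; only vanishing is inferred from this
  later.\<close>

lemma covector_permute:
	assumes th: "covector k th" and p: "p permutes {..<k}" and us: "length us = k"
	shows "\<bar>th (map (%i. us ! p i) [0..<k])\<bar> = \<bar>th us\<bar>"
	using p finite_lessThan us
proof (induction p arbitrary: us rule: permutes_induct)
	case id
	have "map (%i. us ! id i) [0..<k] = us" using map_nth[of us] id by simp
	then show ?case by simp
next
	case (swap a b p)
	define us' where "us' = us[a := us ! b, b := us ! a]"
	have eq: "map (%i. us ! (Transposition.transpose a b \<circ> p) i) [0..<k] = map (%i. us' ! p i) [0..<k]"
	proof (rule map_cong[OF refl])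
		fix i assume "i \<in> set [0..<k]"
		then have "p i < k" using permutes_in_image[OF swap.hyps(4)] by auto
		then show "us ! (Transposition.transpose a b \<circ> p) i = us' ! p i"
			using swap.hyps(1-3) swap.prems by (auto simp: us'_def Transposition.transpose_def nth_list_update)
	qed
	have "th us' = - th us"
		using covector_swap[OF th swap.prems, of a b "us ! b" "us ! a"] swap.hyps(1-3) by (simp add: us'_def list_update_id)
	moreover have "length us' = k" using swap.prems by (simp add: us'_def)
	ultimately show ?case unfolding eq using swap.IH[of us'] by simp
qed

text \<open>Multilinear expansion reduces to entries taken from \<open>es\<close>; such a list
  either comes from a repeated index or is a permutation of \<open>es\<close>.\<close>

lemma covector_vanish:
	assumes th: "covector k th" and es: "length es = k" "th es = 0"
		and us: "length us = k" "set us \<subseteq> span (set es)"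
	shows "th us = 0"
proof -
	have base: "th us = 0" if us: "length us = k" "set us \<subseteq> set es" for us
	proof -
		have "\<forall>i<k. \<exists>j<k. us ! i = es ! j" using us es(1) by (metis in_set_conv_nth nth_mem subsetD)
		then obtain f where f: "\<And>i. i < k ==> f i < k \<and> us ! i = es ! f i" by metis
		show ?thesis
		proof (cases "inj_on f {..<k}")
			case True
			define p where "p i = (if i < k then f i else i)" for i
			have "p permutes {..<k}"
			proof (rule bij_imp_permutes)
				have "inj_on p {..<k}" using True by (auto simp: inj_on_def p_def)
				moreover have "p ` {..<k} \<subseteq> {..<k}" using f by (auto simp: p_def)
				ultimately show "bij_betw p {..<k} {..<k}" by (simp add: bij_betw_def endo_inj_surj)
			qed (auto simp: p_def)
			moreover have "us = map (%i. es ! p i) [0..<k]"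
				by (rule nth_equalityI) (use us f in \<open>auto simp: p_def\<close>)
			ultimately show ?thesis using covector_permute[OF th _ es(1)] es(2) by fastforce
		next
			case False
			then obtain i j where "i < k" "j < k" "i \<noteq> j" "f i = f j" by (auto simp: inj_on_def)
			then show ?thesis using covector_eq_0[OF th us(1), of i j] f by auto
		qed
	qed
	\<comment> \<open>Induction on the number j of leading entries that are still arbitrary vectors of
	  the span.\<close>
	have "th us = 0" if "length us = k" "set us \<subseteq> span (set es)" "\<forall>i<k. j \<le> i \<longrightarrow> us ! i \<in> set es" "j \<le> k" for j us
		using that
	proof (induction j arbitrary: us)
		case 0
		then show ?case by (intro base) (auto simp: in_set_conv_nth)
	next
		case (Suc j)
		have j: "j < k" using Suc.prems by simp
		have "us ! j \<in> span (set es)" using Suc.prems j by auto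
		then have "th (us[j := us ! j]) = 0"
		proof (induction rule: span_induct_alt)
			case base
			then show ?case using linear_0[OF covector_linear[OF th Suc.prems(1) j]] by simp
		next
			case (step c x y)
			have "th (us[j := x]) = 0"
			proof (rule Suc.IH)
				show "set (us[j := x]) \<subseteq> span (set es)"
					using Suc.prems(2) step(1) set_update_subset_insert[of us j x] span_base by blast
				show "\<forall>i<k. j \<le> i \<longrightarrow> us[j := x] ! i \<in> set es"
					using Suc.prems step(1) by (auto simp: nth_list_update)
			qed (use Suc.prems in auto)
			then show ?case using step(2) linear_add[OF covector_linear[OF th Suc.prems(1) j]]
					linear_scale[OF covector_linear[OF th Suc.prems(1) j]] by simp
		qed
		then show ?case by simp
	qed
	from this[of us k] us show ?thesis by auto
qed

text \<open>The combination of \<open>th\<close> and \<tau> that vanishes on \<open>es\<close>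
  vanishes on the whole span. This compares values on different frames without determinants.\<close>

lemma covector_proportional:
	assumes th: "covector k th" and \<tau>: "covector k \<tau>" and es: "length es = k"
		and us: "length us = k" "set us \<subseteq> span (set es)"
	shows "th us * \<tau> es = \<tau> us * th es"
proof -
	have "covector k (%vs. \<tau> es * th vs - th es * \<tau> vs)" unfolding covector_def
	proof (intro conjI allI impI)
		fix us :: "'a list" and i assume "length us = k" "i < k"
		then show "linear (%v. \<tau> es * th (us[i := v]) - th es * \<tau> (us[i := v]))"
			using linear_add[OF covector_linear[OF th]] linear_add[OF covector_linear[OF \<tau>]]
				linear_scale[OF covector_linear[OF th]] linear_scale[OF covector_linear[OF \<tau>]]
			by (intro linearI) (auto simp: algebra_simps)
	next
		fix us :: "'a list" and i j assume "length us = k" "i < j" "j < k" "us ! i = us ! j"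
		then show "\<tau> es * th us - th es * \<tau> us = 0"
			using covector_eq_0[OF th, of us i j] covector_eq_0[OF \<tau>, of us i j] by simp
	qed
	from covector_vanish[OF this es _ us] show ?thesis by (simp add: mult.commute)
qed

text \<open>T acting on covectors as a derivation. With T a normal derivative this is the
  first-order sum in \<open>C_integrand\<close>, and being a covector again it can be compared
  between frames.\<close>

definition deriv_cov :: "nat => ('e => 'e) => ('e list => real) => 'e list => real" where
	"deriv_cov k T th us = (\<Sum>i<k. th (us[i := T (us ! i)]))"

lemma covector_deriv_cov:
	assumes th: "covector k th" and T: "linear T"
	shows "covector k (deriv_cov k T th)"
	unfolding covector_def
proof (intro conjI allI impI)
	fix us :: "'a list" and j assume us: "length us = k" and j: "j < k"
	have "linear (%v. th (us[j := v, i := T (us[j := v] ! i)]))" if i: "i < k" for i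
	proof (cases "i = j")
		case True
		then have "(%v. th (us[j := v, i := T (us[j := v] ! i)])) = (%v. th (us[j := v])) \<circ> T"
			using us j by (simp add: fun_eq_iff)
		then show ?thesis using linear_compose[OF T covector_linear[OF th us j]] by simp
	next
		case False
		then have "(%v. th (us[j := v, i := T (us[j := v] ! i)])) = (%v. th (us[i := T (us ! i), j := v]))"
			by (simp add: fun_eq_iff list_update_swap)
		then show ?thesis using covector_linear[OF th, of "us[i := T (us ! i)]" j] us j by simp
	qed
	then show "linear (%v. deriv_cov k T th (us[j := v]))" unfolding deriv_cov_def by (intro linear_compose_sum) auto
next
	fix us :: "'a list" and i j
	assume us: "length us = k" and ij: "i < j" "j < k" and eq: "us ! i = us ! j"
	\<comment> \<open>Only the two terms that alter one of the equal entries survive, and they cancel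
	  by antisymmetry.\<close>
	have "th (us[l := T (us ! l)]) = 0" if "l < k" "l \<noteq> i" "l \<noteq> j" for l
		by (rule covector_eq_0[OF th, of _ i j]) (use us ij eq that in auto)
	then have "deriv_cov k T th us = (\<Sum>l\<in>{i, j}. th (us[l := T (us ! l)]))"
		unfolding deriv_cov_def using ij by (intro sum.mono_neutral_right) auto
	also have "... = th (us[i := T (us ! i), j := us ! i]) + th (us[i := us ! i, j := T (us ! i)])"
	proof -
		have "us[i := T (us ! i), j := us ! i] = us[i := T (us ! i)]" using ij by (subst list_update_swap) (auto simp: eq)
		moreover have "us[i := us ! i, j := T (us ! i)] = us[j := T (us ! j)]" by (simp add: eq[symmetric])
		ultimately show ?thesis using ij by simp
	qed
	also have "... = 0" using covector_swap[OF th us, of i j] ij by simp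
	finally show "deriv_cov k T th us = 0" .
qed

lemma covector_Cons:
	assumes "covector (Suc k) th"
	shows "covector k (%us. th (v # us))"
	unfolding covector_def
proof (intro conjI allI impI)
	fix us :: "'a list" and i assume "length us = k" "i < k"
	then show "linear (%w. th (v # us[i := w]))" using covector_linear[OF assms, of "v # us" "Suc i"] by simp
next
	fix us :: "'a list" and i j assume "length us = k" "i < j" "j < k" "us ! i = us ! j"
	then show "th (v # us) = 0" using covector_eq_0[OF assms, of "v # us" "Suc i" "Suc j"] by simp
qed

lemma covector_append_linear:
	assumes "covector k th" "length xs + length ys + 1 = k"
	shows "linear (%v. th (xs @ v # ys))"
	using covector_linear[OF assms(1), of "xs @ 0 # ys" "length xs"] assms(2) by simp

section \<open>Smooth families of covectors on M\<close>

context closed_immersion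
begin

text \<open>Division is possible near p only, by a function that depends on p; this suits a frame
  fixed at p and extended by projection.\<close>

lemma smooth_fun_local_quotient:
	fixes f :: "'p => real"
	assumes "\<And>p. p \<in> M ==> \<exists>g d. smooth g \<and> smooth d \<and> d p \<noteq> 0 \<and> (\<forall>q\<in>M. d q * f q = g q)"
	shows "smooth f"
proof (rule smooth_fun_locally)
	fix p assume p: "p \<in> M"
	obtain g d where gd: "smooth g" "smooth d" "d p \<noteq> 0" "\<And>q. q \<in> M ==> d q * f q = g q"
		using assms[OF p] by blast
	define U where "U = M \<inter> d -` (- {0})"
	have U: "openM U"
		unfolding U_def by (rule continuous_openin_preimage_gen[OF smooth_fun_continuous[OF gd(2)]]) auto
	let ?c = "chart_at A p"
	note c = chart_at_in[OF p] chart_at_mem[OF p]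
	let ?V = "snd ?c ` (U \<inter> fst ?c)"
	note V = chart_image_open[OF c(1) U]
	have eq: "in_chart ?c f z = in_chart ?c g z / in_chart ?c d z" and nz: "in_chart ?c d z \<noteq> 0" if z: "z \<in> ?V" for z
	proof -
		obtain q where q: "q \<in> U" "q \<in> fst ?c" "z = snd ?c q" using z by blast
		have "q \<in> M" "d q \<noteq> 0" using q(1) by (auto simp: U_def)
		then show "in_chart ?c f z = in_chart ?c g z / in_chart ?c d z" "in_chart ?c d z \<noteq> 0"
			unfolding q(3) in_chart_snd[OF c(1) q(2)] using gd(4)[of q] by (auto simp: field_simps)
	qed
	have "smooth_on ?V (%z. in_chart ?c g z / in_chart ?c d z)" by (rule smooth_on_divide[OF _ _ V nz])
			(rule smooth_on_subset[OF smooth_fun_chart[OF gd(1) c(1)]], blast,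
			 rule smooth_on_subset[OF smooth_fun_chart[OF gd(2) c(1)]], blast)
	then have "smooth_on ?V (in_chart ?c f)" by (subst smooth_on_cong[OF V eq])
	moreover have "snd ?c p \<in> ?V" using p gd(3) c(2) by (auto simp: U_def)
	ultimately show "\<exists>c V. c \<in> A \<and> p \<in> fst c \<and> open V \<and> snd c p \<in> V \<and> V \<subseteq> im c \<and> smooth_on V (in_chart c f)"
		using c V by (intro exI[of _ ?c] exI[of _ ?V]) blast
qed

definition smooth_cov :: "nat => ('p => 'e list => real) => bool" where
	"smooth_cov k \<tau> \<longleftrightarrow> (\<forall>p\<in>M. covector k (\<tau> p)) \<and> (\<forall>us. length us = k \<longrightarrow> smooth (%p. \<tau> p us))"

lemma smooth_cov_eval:
	assumes \<tau>: "smooth_cov k \<tau>" and Xs: "\<And>X. X \<in> set Xs ==> smooth X" "length Xs = k"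
	shows "smooth (%p. \<tau> p (map (%X. X p) Xs))"
proof -
	have "smooth (%p. \<tau> p (map (%X. X p) Xs @ us))"
		if "\<forall>X\<in>set Xs. smooth X" "length Xs + length us = k" for Xs us
		using that
	proof (induction Xs arbitrary: us rule: rev_induct)
		case Nil
		then show ?case using \<tau> by (simp add: smooth_cov_def)
	next
		case (snoc X Xs)
		have "smooth (%p. \<Sum>b\<in>Basis. (X p \<bullet> b) * \<tau> p (map (%X. X p) Xs @ b # us))"
		proof (intro smooth_fun_sum smooth_fun_mult)
			show "smooth (%p. X p \<bullet> b)" for b
				by (rule smooth_fun_inner[OF _ smooth_fun_const]) (use snoc.prems in simp)
			show "smooth (%p. \<tau> p (map (%X. X p) Xs @ b # us))" for b
				by (rule snoc.IH) (use snoc.prems in auto)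
		qed
		moreover have "\<tau> p (map (%X. X p) (Xs @ [X]) @ us) = (\<Sum>b\<in>Basis. (X p \<bullet> b) * \<tau> p (map (%X. X p) Xs @ b # us))"
			if p: "p \<in> M" for p
			using linear_euclidean_expand[OF covector_append_linear[of k "\<tau> p" "map (%X. X p) Xs" us], of "X p"]
				\<tau> p snoc.prems by (simp add: smooth_cov_def)
		ultimately show ?case using smooth_fun_cong[of "%p. \<tau> p (map (%X. X p) (Xs @ [X]) @ us)"
					"%p. \<Sum>b\<in>Basis. (X p \<bullet> b) * \<tau> p (map (%X. X p) Xs @ b # us)"] by blast
	qed
	from this[of Xs "[]"] show ?thesis using Xs by simp
qed

lemma smooth_cov_Cons:
	assumes "smooth_cov (Suc k) \<tau>" "smooth X"
	shows "smooth_cov k (%p us. \<tau> p (X p # us))"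
	unfolding smooth_cov_def
proof (intro conjI ballI allI impI)
	show "covector k (%us. \<tau> p (X p # us))" if "p \<in> M" for p
		using covector_Cons assms(1) that unfolding smooth_cov_def by blast
	fix us :: "'e list" assume "length us = k"
	show "smooth (%p. \<tau> p (X p # us))"
	proof -
		have "smooth (%p. \<tau> p (map (%X. X p) (X # map (%u p. u) us)))"
			by (rule smooth_cov_eval[OF assms(1)]) (use assms(2) \<open>length us = k\<close> in auto)
		then show ?thesis by (simp add: o_def)
	qed
qed

lemma smooth_cov_deriv:
	assumes \<tau>: "smooth_cov k \<tau>" and T: "\<And>p. p \<in> M ==> linear (T p)" "\<And>u. smooth (%p. T p u)"
	shows "smooth_cov k (%p. deriv_cov k (T p) (\<tau> p))"
	unfolding smooth_cov_def
proof (intro conjI ballI allI impI)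
	show "covector k (deriv_cov k (T p) (\<tau> p))" if "p \<in> M" for p
		using covector_deriv_cov T(1) \<tau> that unfolding smooth_cov_def by blast
	fix us :: "'e list" assume us: "length us = k"
	have "smooth (%p. \<tau> p (us[i := T p (us ! i)]))" if "i < k" for i
	proof -
		have "smooth (%p. \<tau> p (map (%X. X p) ((map (%u p. u) us)[i := (%p. T p (us ! i))])))"
		proof (rule smooth_cov_eval[OF \<tau>])
			fix X assume "X \<in> set ((map (%u p. u) us)[i := (%p. T p (us ! i))])"
			then have "X \<in> insert (%p. T p (us ! i)) (set (map (%u p. u) us))"
				by (rule subsetD[OF set_update_subset_insert])
			then show "smooth X" using T(2) by auto
		qed (use us in simp)
		then show ?thesis by (simp add: map_update o_def)
	qed
	then show "smooth (%p. deriv_cov k (T p) (\<tau> p) us)" unfolding deriv_cov_def by (intro smooth_fun_sum) auto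
qed

subsection \<open>Positively oriented frames\<close>

lemma card_less_inj: "inj (%j::'m. card {k. k < j})" and card_less_lt: "card {k. k < (j::'m)} < CARD('m)"
proof -
	have *: "card {k. k < i} < card {k. k < j}" if "i < j" for i j :: 'm by (rule psubset_card_mono) (use that in auto)
	show "inj (%j::'m. card {k. k < j})" by (rule injI) (metis * less_irrefl linorder_less_linear)
	show "card {k. k < (j::'m)} < CARD('m)" by (rule psubset_card_mono) auto
qed

lemma direct_frame_exists:
	assumes p: "p \<in> M"
	shows "\<exists>es. direct_frame A \<phi> p es"
proof -
	obtain es where es: "ortho_frame A \<phi> p es" using ortho_frame_exists[OF p] by blast
	note esD = ortho_frameD[OF es]
	define ix where "ix j = card {k. k < (j::'m)}" for j
	define B where "B es = (\<chi> i j. components A \<phi> p (es ! ix j) $ i)" for es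
	have B: "B es = (\<chi> i j. components A \<phi> p (es ! ix j) $ i)" for es by (simp add: B_def)
	have ixl: "ix j < CARD('m)" for j using card_less_lt by (simp add: ix_def)
	have ixi: "ix i = ix j \<longleftrightarrow> i = j" for i j using card_less_inj by (auto simp: ix_def inj_def)
	have lin: "linear (dmap A \<phi> p)" unfolding dmap_def by (rule dch_linear[OF smooth_phi chart_at_in[OF p] coord_in[OF p]])
	have inj: "inj (dmap A \<phi> p)" unfolding dmap_def coord_def by (rule dch_phi_inj[OF chart_at_in[OF p] chart_at_mem[OF p]])
	have "v = 0" if v: "B es *v v = 0" for v
	proof -
		have "(\<Sum>j\<in>UNIV. v $ j *R components A \<phi> p (es ! ix j)) = B es *v v"
			by (simp add: vec_eq_iff B_def matrix_vector_mult_def mult.commute)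
		then have "dmap A \<phi> p (\<Sum>j\<in>UNIV. v $ j *R components A \<phi> p (es ! ix j)) = 0"
			using v linear_0[OF lin] by simp
		then have s: "(\<Sum>j\<in>UNIV. v $ j *R es ! ix j) = 0"
			using components_in_Tan[OF esD(4)[OF ixl]] by (simp add: linear_sum[OF lin] linear_scale[OF lin])
		have "v $ j = 0" for j
		proof -
			have "0 = (\<Sum>i\<in>UNIV. v $ i *R es ! ix i) \<bullet> es ! ix j" using s by simp
			also have "... = (\<Sum>i\<in>UNIV. if i = j then v $ i else 0)" unfolding inner_sum_left
				by (rule sum.cong[OF refl]) (use esD(1,2) ixl ixi in \<open>auto simp: orthonormal_def\<close>)
			finally show ?thesis by simp
		qed
		then show "v = 0" by (simp add: vec_eq_iff)
	qed
	then have "invertible (B es)" using matrix_left_invertible_ker invertible_left_inverse by blast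
	then have nz: "det (B es) \<noteq> 0" by (simp add: invertible_det_nz)
	show ?thesis
	proof (cases "0 < det (B es)")
		case True
		then show ?thesis using es unfolding direct_frame_def B_def ix_def by blast
	next
		case False
		\<comment> \<open>The least index corresponds to position 0 of the list; negating that vector
		  multiplies the determinant by -1.\<close>
		obtain j0 :: 'm where j0: "ix j0 = 0"
		proof -
			have "ix (LEAST j. True) = 0" unfolding ix_def by (auto dest: not_less_Least)
			then show ?thesis by (rule that)
		qed
		define fs where "fs = es[0 := - (es ! 0)]"
		have len: "0 < length es" using esD(1) by simp
		have nth: "fs ! i = (if i = 0 then - 1 else 1) *R (es ! i)" for i using len by (auto simp: fs_def nth_list_update)
		have on: "orthonormal fs" using esD(2) unfolding orthonormal_def nth by (auto simp: fs_def)
		have "set fs \<subseteq> TM p"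
			using esD(1,4) subspace_scale[OF subspace_Tan[OF p], of _ "- 1"] unfolding in_set_conv_nth subset_iff nth
			by (auto simp: fs_def)
		then have "span (set fs) = TM p"
			using subspace_dim_equal[OF subspace_span subspace_Tan[OF p] span_minimal[OF _ subspace_Tan[OF p]]]
				dim_orthonormal[OF on] dim_Tan[OF p] esD(1) by (simp add: fs_def)
		with on have of: "ortho_frame A \<phi> p fs" using esD(1) unfolding ortho_frame_def by (simp add: fs_def)
		define D where "D = (\<chi> i j. if i = j then if i = j0 then - 1 else 1 else 0 :: real ^ 'm::{finite,wellorder} ^ 'm::{finite,wellorder})"
		have "components A \<phi> p (- u) = - components A \<phi> p u" if "u \<in> TM p" for u
			using components_in_Tan[OF that] inv_f_f[OF inj, of "- components A \<phi> p u"] linear_neg[OF lin]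
			unfolding components_def by metis
		then have "B fs = B es ** D" using esD(4)[of 0] ixi j0
			by (simp add: vec_eq_iff B_def matrix_matrix_mult_def D_def nth if_distrib[of "%x. _ * x"] cong: if_cong) metis
		moreover have "det D = - 1"
		proof -
			have "det D = (\<Prod>i\<in>UNIV. D $ i $ i)" by (rule det_diagonal) (simp add: D_def)
			also have "... = D $ j0 $ j0 * (\<Prod>i\<in>UNIV - {j0}. D $ i $ i)" by (rule prod.remove) auto
			also have "(\<Prod>i\<in>UNIV - {j0}. D $ i $ i) = 1" by (rule prod.neutral) (simp add: D_def)
			finally show ?thesis by (simp add: D_def)
		qed
		ultimately have "0 < det (B fs)" using False nz by (simp add: det_mul)
		then show ?thesis using of unfolding direct_frame_def B_def ix_def by blast
	qed
qed

lemma direct_frame: "p \<in> M ==> direct_frame A \<phi> p (frm p)"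
	unfolding frame_def by (rule someI_ex[OF direct_frame_exists])

lemma frame: "p \<in> M ==> ortho_frame A \<phi> p (frm p)"
	using direct_frame unfolding direct_frame_def by blast

end


section \<open>The operator \<open>C\<^sub>\<Omega>\<close> and stability\<close>

lemma deriv_cov_sum:
	assumes th: "covector k th" and us: "length us = k"
	shows "deriv_cov k (%u. \<Sum>i\<in>I. c i *R T i u) th us = (\<Sum>i\<in>I. c i * deriv_cov k (T i) th us)"
proof -
	have "th (us[j := (\<Sum>i\<in>I. c i *R T i (us ! j))]) = (\<Sum>i\<in>I. c i * th (us[j := T i (us ! j)]))" if "j < k" for j
		unfolding linear_sum[OF covector_linear[OF th us that]]
		by (simp add: linear_scale[OF covector_linear[OF th us that]])
	then show ?thesis unfolding deriv_cov_def sum_distrib_left by (subst sum.swap) simp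
qed

lemma covector_head_expand:
	assumes "covector (Suc k) th" "length us = k"
	shows "th (v # us) = (\<Sum>w\<in>Basis. (v \<bullet> w) * th (w # us))"
	using linear_euclidean_expand[OF covector_append_linear[OF assms(1), of "[]" us], of v] assms(2) by simp

locale calibrated_immersion = closed_immersion M A \<phi>
	for M :: "'p::t2_space set" and A :: "('p, real ^ 'm::{finite,wellorder}) chart set"
		and \<phi> :: "'p => 'e::euclidean_space" +
	fixes \<Omega> :: "'e => 'e list => real" and \<nu> :: "'p => 'e"
	assumes form: "smooth_form (CARD('m) + 1) \<Omega>"
		and ext: "calibrated_extended_tangent M A \<phi> \<Omega> \<nu>"
begin
abbreviation "EN \<equiv> EM A \<phi> \<nu>"
abbreviation "FN \<equiv> Fspace A \<phi> \<nu>"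
abbreviation "xiO \<equiv> xi A \<phi> \<Omega>"
abbreviation "CO \<equiv> C_Omega M A \<phi> \<Omega>"
abbreviation "CI \<equiv> C_integrand A \<phi> \<Omega>"

lemma smooth_nu: "smooth \<nu>" and P_nu: "p \<in> M ==> P p (\<nu> p) = 0" and norm_nu: "p \<in> M ==> norm (\<nu> p) = 1"
	and H_nu: "p \<in> M ==> mcv p \<bullet> \<nu> p = norm (mcv p)"
	and Omega_direct: "p \<in> M ==> direct_frame A \<phi> p es ==> \<Omega> (\<phi> p) (\<nu> p # es) = 1"
	using ext by (auto simp: calibrated_extended_tangent_def normal_section_def P_eq_0_iff)

lemma smooth_cov_Omega: "smooth_cov (Suc CARD('m)) (%p. \<Omega> (\<phi> p))"
	using form smooth_fun_compose[OF smooth_phi, of UNIV "%x. \<Omega> x _"] by (simp add: smooth_cov_def smooth_form_def)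

text \<open>\<tau> and \<Omega>(\<nu>, ...) are proportional on tangent vectors and the latter is 1
  on direct frames, so the value on the discontinuous frame equals a quotient of values on
  projections of constant vectors.\<close>

lemma smooth_frame_eval:
	assumes \<tau>: "smooth_cov CARD('m) \<tau>"
	shows "smooth (%p. \<tau> p (frm p))"
proof (rule smooth_fun_local_quotient)
	fix p assume p: "p \<in> M"
	define Xs where "Xs = map (%e q. P q e) (frm p)"
	note \<nu>c = smooth_cov_Cons[OF smooth_cov_Omega smooth_nu]
	have len: "length Xs = CARD('m)" using ortho_frameD(1)[OF frame[OF p]] by (simp add: Xs_def)
	have Xs: "smooth X" if "X \<in> set Xs" for X using that by (auto simp: Xs_def)
	show "\<exists>g d. smooth g \<and> smooth d \<and> d p \<noteq> 0 \<and> (\<forall>q\<in>M. d q * \<tau> q (frm q) = g q)"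
	proof (intro exI conjI ballI)
		show "smooth (%q. \<tau> q (map (%X. X q) Xs))" by (rule smooth_cov_eval[OF \<tau> Xs len])
		show "smooth (%q. \<Omega> (\<phi> q) (\<nu> q # map (%X. X q) Xs))" by (rule smooth_cov_eval[OF \<nu>c Xs len])
		have "map (%X. X p) Xs = frm p"
			using ortho_frameD(1,4)[OF frame[OF p]] by (auto simp: Xs_def P_id[OF p] intro!: nth_equalityI)
		then show "\<Omega> (\<phi> p) (\<nu> p # map (%X. X p) Xs) \<noteq> 0"
			using Omega_direct[OF p direct_frame[OF p]] by simp
		fix q assume q: "q \<in> M"
		have "set (map (%X. X q) Xs) \<subseteq> span (set (frm q))"
			using P_in[OF q] ortho_frameD(3)[OF frame[OF q]] by (auto simp: Xs_def)
		then have "\<tau> q (map (%X. X q) Xs) * \<Omega> (\<phi> q) (\<nu> q # frm q) =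
				\<Omega> (\<phi> q) (\<nu> q # map (%X. X q) Xs) * \<tau> q (frm q)"
			using \<tau> \<nu>c q len ortho_frameD(1)[OF frame[OF q]]
			by (intro covector_proportional[of "CARD('m)" "\<tau> q" "%us. \<Omega> (\<phi> q) (\<nu> q # us)"]) (auto simp: smooth_cov_def)
		then show "\<Omega> (\<phi> q) (\<nu> q # map (%X. X q) Xs) * \<tau> q (frm q) = \<tau> q (map (%X. X q) Xs)"
			using Omega_direct[OF q direct_frame[OF q]] by simp
	qed
qed

definition nor :: "('p => 'e) => 'p => 'e" where "nor W p = W p - P p (W p)"

lemma smooth_nor: "smooth W ==> smooth (nor W)"
	unfolding nor_def[abs_def] by (intro smooth_fun_diff smooth_fun_P_apply)

lemma P_nor: "p \<in> M ==> P p (nor W p) = 0" by (simp add: nor_def linear_diff[OF linear_P] P_P)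

text \<open>The normal connection, extended by \<open>0\<close> to normal directions.\<close>

definition Dn :: "('p => 'e) => 'p => 'e => 'e" where
	"Dn N p u = pd u N p - P p (pd u N p)"

lemma nabla_perp_eq: "p \<in> M ==> u \<in> TM p ==> nabla_perp A \<phi> N p u = Dn N p u"
	by (simp add: nabla_perp_def perp_eq Dn_def pd_Tan)

lemma linear_Dn: "smooth N ==> p \<in> M ==> linear (Dn N p)" unfolding Dn_def[abs_def]
	by (rule linear_compose_sub[OF linear_pd linear_compose[OF linear_pd linear_P, unfolded o_def]])

lemma smooth_Dn: "smooth N ==> smooth (%p. Dn N p u)"
	unfolding Dn_def by (intro smooth_fun_diff smooth_fun_P_apply smooth_fun_pd)

lemma Dn_P: "p \<in> M ==> Dn N p (P p u) = Dn N p u" by (simp add: Dn_def pd_P)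

lemma nabla_form_linear:
	assumes "length us = Suc CARD('m)"
	shows "linear (%w. nabla_form \<Omega> x w us)"
	unfolding nabla_form_def
	by (rule has_derivative_linear[OF smooth_on_has_derivative[OF _ open_UNIV UNIV_I]])
		(use form assms in \<open>simp add: smooth_form_def\<close>)

lemma covector_nabla_form: "covector (Suc CARD('m)) (nabla_form \<Omega> x w)"
proof -
	have der: "((%y. \<Omega> y us) has_derivative FD (%y. \<Omega> y us) x) (at x)" if "length us = Suc CARD('m)" for us
		by (rule smooth_on_has_derivative[OF _ open_UNIV UNIV_I]) (use form that in \<open>simp add: smooth_form_def\<close>)
	have cov: "covector (Suc CARD('m)) (\<Omega> y)" for y using form by (simp add: smooth_form_def)
	show ?thesis unfolding covector_def
	proof (intro conjI allI impI)
		fix us :: "'e list" and i assume us: "length us = Suc CARD('m)" "i < Suc CARD('m)"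
		note l = covector_linear[OF cov us]
		show "linear (%v. nabla_form \<Omega> x w (us[i := v]))"
		proof
			fix a b r
			have "(%y. \<Omega> y (us[i := a + b])) = (%y. \<Omega> y (us[i := a]) + \<Omega> y (us[i := b]))"
				using linear_add[OF l] by simp
			then show "nabla_form \<Omega> x w (us[i := a + b]) = nabla_form \<Omega> x w (us[i := a]) + nabla_form \<Omega> x w (us[i := b])"
				unfolding nabla_form_def
				using frechet_derivative_eqI[OF has_derivative_add[OF der[of "us[i := a]"] der[of "us[i := b]"]]] us by simp
			have "(%y. \<Omega> y (us[i := r *R a])) = (%y. r * \<Omega> y (us[i := a]))"
				using linear_scale[OF l] by simp
			then show "nabla_form \<Omega> x w (us[i := r *R a]) = r *R nabla_form \<Omega> x w (us[i := a])"
				unfolding nabla_form_def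
				using frechet_derivative_eqI[OF has_derivative_mult_right[OF der[of "us[i := a]"]]] us by simp
		qed
	next
		fix us :: "'e list" and i j assume us: "length us = Suc CARD('m)" "i < j" "j < Suc CARD('m)" "us ! i = us ! j"
		have "(%y. \<Omega> y us) = (%y. 0)" using covector_eq_0[OF cov us(1), of i j] us by auto
		then show "nabla_form \<Omega> x w us = 0" by (simp add: nabla_form_def frechet_derivative_const)
	qed
qed

lemma smooth_cov_nabla:
	assumes X: "smooth X"
	shows "smooth_cov (Suc CARD('m)) (%p. nabla_form \<Omega> (\<phi> p) (X p))"
	unfolding smooth_cov_def
proof (intro conjI ballI allI impI)
	show "covector (Suc CARD('m)) (nabla_form \<Omega> (\<phi> p) (X p))" for p by (rule covector_nabla_form)
	fix us :: "'e list" assume us: "length us = Suc CARD('m)"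
	have "smooth (%p. nabla_form \<Omega> (\<phi> p) w us)" for w unfolding nabla_form_def
		by (rule smooth_fun_compose[OF smooth_phi smooth_on_frechet_derivative[where S=UNIV]])
			(use form us in \<open>auto simp: smooth_form_def\<close>)
	then have "smooth (%p. \<Sum>w\<in>Basis. (X p \<bullet> w) * nabla_form \<Omega> (\<phi> p) w us)"
		by (intro smooth_fun_intros X)
	then show "smooth (%p. nabla_form \<Omega> (\<phi> p) (X p) us)"
		using linear_euclidean_expand[OF nabla_form_linear[OF us], of _ "X _"] by simp
qed

lemma C_integrand_eq:
	assumes W: "smooth W" "smooth W'" and p: "p \<in> M"
	shows "CI W W' p =
		(deriv_cov CARD('m) (Dn (nor W') p) (%us. \<Omega> (\<phi> p) (nor W p # us)) (frm p)
		 + deriv_cov CARD('m) (Dn (nor W) p) (%us. \<Omega> (\<phi> p) (nor W' p # us)) (frm p)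
		 + nabla_form \<Omega> (\<phi> p) (nor W p) (nor W' p # frm p)
		 + nabla_form \<Omega> (\<phi> p) (nor W' p) (nor W p # frm p)) / 2"
proof -
	have pe: "perp A \<phi> p (V p) = nor V p" for V by (simp add: perp_eq[OF p] nor_def)
	have "nabla_perp A \<phi> (%q. perp A \<phi> q (V q)) p (frm p ! i) = Dn (nor V) p (frm p ! i)"
		if V: "i < CARD('m)" for V i
	proof -
		have t: "frm p ! i \<in> TM p" by (rule ortho_frameD(4)[OF frame[OF p] V])
		have "pd (frm p ! i) (%q. perp A \<phi> q (V q)) p = pd (frm p ! i) (nor V) p"
			by (rule pd_cong[OF _ p]) (simp add: perp_eq nor_def)
		then show ?thesis unfolding nabla_perp_eq[OF p t] by (simp add: Dn_def)
	qed
	then show ?thesis unfolding C_integrand_def Let_def pe deriv_cov_def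
		by (simp add: sum_divide_distrib sum.distrib add_divide_distrib)
qed

text \<open>\<open>C_Omega\<close> is defined by choice, so some operator has to be produced.
  Derivatives of W' enter the integrand linearly and are moved onto their coefficients by the first
  variation formula; what remains is an inner product with W'.\<close>

lemma C_operator_exists:
	assumes W: "smooth W"
	shows "\<exists>Z. normal_section M A \<phi> Z \<and>
		(\<forall>W'. smooth W' \<longrightarrow> (LINT p|vM. Z p \<bullet> W' p) = (LINT p|vM. CI W W' p))"
proof -
	define fr where "fr p = frm p" for p
	define N where "N = nor W"
	have N: "smooth N" unfolding N_def by (rule smooth_nor[OF W])
	\<comment> \<open>Elementary endomorphisms into which the normal derivative of N' decomposes, with
	  coefficients \<open>pd a N' p \<bullet> w\<close>; \<open>y\<close> collects what multiplies such
	  a coefficient in the integrand.\<close>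
	define T where "T a w p u = (u \<bullet> a) *R (w - P p w)" for a w :: 'e and p u
	define y where "y a w p = deriv_cov CARD('m) (T a w p) (%us. \<Omega> (\<phi> p) (N p # us)) (fr p)" for a w p
	define g where "g w p = deriv_cov CARD('m) (Dn N p) (%us. \<Omega> (\<phi> p) (w # us)) (fr p)" for w p
	have Tl: "linear (T a w p)" for a w p by (intro linearI) (auto simp: T_def algebra_simps)
	have Ts: "smooth (%p. T a w p u)" for a w u unfolding T_def by (intro smooth_fun_intros smooth_fun_P)
	have ys: "smooth (y a w)" for a w unfolding y_def[abs_def] fr_def
		by (intro smooth_frame_eval smooth_cov_deriv[OF smooth_cov_Cons[OF smooth_cov_Omega N]] Tl Ts)
	have gs: "smooth (g w)" for w unfolding g_def[abs_def] fr_def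
		by (intro smooth_frame_eval smooth_cov_deriv[OF smooth_cov_Cons[OF smooth_cov_Omega smooth_fun_const]]
				linear_Dn[OF N] smooth_Dn[OF N])
	\<comment> \<open>Integration by parts replaces \<open>pd a\<close> acting on N' by minus
	  \<open>pd a\<close> acting on \<open>y\<close>, minus \<open>y\<close> times the curvature factor
	  \<open>a \<bullet> mH p\<close>.\<close>
	define V where "V p = (\<Sum>w\<in>Basis. ((g w p + nabla_form \<Omega> (\<phi> p) (N p) (w # fr p) + nabla_form \<Omega> (\<phi> p) w (N p # fr p)
			- (\<Sum>a\<in>Basis. pd a (y a w) p + y a w p * (a \<bullet> mH p))) / 2) *R w)" for p
	have Vs: "smooth V" unfolding V_def[abs_def] divide_inverse fr_def by (intro smooth_fun_intros gs ys smooth_fun_mH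
				smooth_frame_eval[OF smooth_cov_Cons[OF smooth_cov_nabla[OF N] smooth_fun_const]]
				smooth_frame_eval[OF smooth_cov_Cons[OF smooth_cov_nabla[OF smooth_fun_const] N]])
	have "(LINT p|vM. nor V p \<bullet> W' p) = (LINT p|vM. CI W W' p)" if W': "smooth W'" for W'
	proof -
		define N' where "N' = nor W'"
		have N': "smooth N'" unfolding N'_def by (rule smooth_nor[OF W'])
		have NP: "N' p - P p (N' p) = N' p" "nor V p \<bullet> W' p = V p \<bullet> N' p" if p: "p \<in> M" for p
			using P_sym[OF p, of "V p" "W' p"]
			by (simp_all add: N'_def P_nor[OF p]) (simp add: nor_def inner_diff_left inner_diff_right)
		have bs: "smooth (%p. y a w p * (N' p \<bullet> w))" for a w by (intro smooth_fun_intros ys N')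
		have 1: "deriv_cov CARD('m) (Dn N' p) (%us. \<Omega> (\<phi> p) (N p # us)) (fr p) =
				(\<Sum>w\<in>Basis. \<Sum>a\<in>Basis. y a w p * pd a (%q. N' q \<bullet> w) p)" if p: "p \<in> M" for p
		proof -
			have cov: "covector CARD('m) (%us. \<Omega> (\<phi> p) (N p # us))"
				using smooth_cov_Cons[OF smooth_cov_Omega N] p by (simp add: smooth_cov_def)
			have lf: "length (fr p) = CARD('m)" using ortho_frameD(1)[OF frame[OF p]] by (simp add: fr_def)
			have "Dn N' p u = (\<Sum>i\<in>Basis \<times> Basis. (pd (snd i) N' p \<bullet> fst i) *R T (snd i) (fst i) p u)" for u
			proof -
				have e: "v - P p v = (\<Sum>w\<in>Basis. (v \<bullet> w) *R (w - P p w))" for v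
				proof (rule linear_euclidean_expand)
					show "linear (%v. v - P p v)"
						using linear_add[OF linear_P[OF p]] linear_scale[OF linear_P[OF p]] by (intro linearI) (auto simp: algebra_simps)
				qed
				have "Dn N' p u = (\<Sum>w\<in>Basis. (pd u N' p \<bullet> w) *R (w - P p w))" unfolding Dn_def by (rule e)
				also have "... = (\<Sum>w\<in>Basis. \<Sum>a\<in>Basis. (pd a N' p \<bullet> w) *R T a w p u)"
					by (subst linear_euclidean_expand[OF linear_pd[OF N' p], of u])
						(simp add: T_def inner_sum_left scaleR_sum_left mult.commute)
				finally show ?thesis by (simp add: sum.cartesian_product case_prod_beta)
			qed
			then have "Dn N' p = (%u. \<Sum>i\<in>Basis \<times> Basis. (pd (snd i) N' p \<bullet> fst i) *R T (snd i) (fst i) p u)" by blast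
			then show ?thesis by (simp only: deriv_cov_sum[OF cov lf] y_def[symmetric])
					(simp add: sum.cartesian_product case_prod_beta pd_linear[OF N' bounded_linear_inner_left p] mult.commute)
		qed
		have key: "CI W W' p - nor V p \<bullet> W' p =
				(\<Sum>w\<in>Basis. \<Sum>a\<in>Basis. pd a (%p. y a w p * (N' p \<bullet> w)) p + (y a w p * (N' p \<bullet> w)) * (a \<bullet> mH p)) / 2"
			if p: "p \<in> M" for p
		proof -
			have lf: "length (fr p) = CARD('m)" using ortho_frameD(1)[OF frame[OF p]] by (simp add: fr_def)
			have covO: "covector (Suc CARD('m)) (\<Omega> (\<phi> p))" using smooth_cov_Omega p by (simp add: smooth_cov_def)
			have "deriv_cov CARD('m) (Dn N p) (%us. \<Omega> (\<phi> p) (N' p # us)) (fr p) = (\<Sum>w\<in>Basis. (N' p \<bullet> w) * g w p)"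
				unfolding g_def deriv_cov_def sum_distrib_left
				by (subst sum.swap) (intro sum.cong refl covector_head_expand[OF covO], simp add: lf)
			moreover have "nabla_form \<Omega> (\<phi> p) (N p) (N' p # fr p) = (\<Sum>w\<in>Basis. (N' p \<bullet> w) * nabla_form \<Omega> (\<phi> p) (N p) (w # fr p))"
				by (rule covector_head_expand[OF covector_nabla_form lf])
			moreover have "nabla_form \<Omega> (\<phi> p) (N' p) (N p # fr p) = (\<Sum>w\<in>Basis. (N' p \<bullet> w) * nabla_form \<Omega> (\<phi> p) w (N p # fr p))"
				using linear_euclidean_expand[OF nabla_form_linear, of "N p # fr p" "\<phi> p" "N' p"] lf by simp
			moreover have "pd a (%p. y a w p * (N' p \<bullet> w)) p = y a w p * pd a (%q. N' q \<bullet> w) p + pd a (y a w) p * (N' p \<bullet> w)" for a w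
				by (rule pd_mult[OF ys _ p]) (intro smooth_fun_intros N')
			moreover have "nor V p \<bullet> W' p = (\<Sum>w\<in>Basis. (N' p \<bullet> w) * ((g w p + nabla_form \<Omega> (\<phi> p) (N p) (w # fr p)
					+ nabla_form \<Omega> (\<phi> p) w (N p # fr p) - (\<Sum>a\<in>Basis. pd a (y a w) p + y a w p * (a \<bullet> mH p))) / 2))"
				unfolding NP(2)[OF p] V_def by (simp add: inner_sum_left inner_commute[of "N' p"] mult.commute)
			ultimately show ?thesis unfolding C_integrand_eq[OF W W' p] N_def[symmetric] N'_def[symmetric] fr_def[symmetric] 1[OF p]
				by (simp add: sum.distrib sum_divide_distrib sum_distrib_left sum_subtractf algebra_simps add_divide_distrib diff_divide_distrib)
		qed
		have zero: "(LINT p|vM. pd a (%p. y a w p * (N' p \<bullet> w)) p + (y a w p * (N' p \<bullet> w)) * (a \<bullet> mH p)) = 0" for a w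
		proof -
			have "(LINT p|vM. pd a (%p. y a w p * (N' p \<bullet> w)) p + (y a w p * (N' p \<bullet> w)) * (a \<bullet> mH p)) =
					(LINT p|vM. pd a (%p. y a w p * (N' p \<bullet> w)) p) + (LINT p|vM. (y a w p * (N' p \<bullet> w)) * (a \<bullet> mH p))"
				by (intro Bochner_Integration.integral_add smooth_integrable smooth_fun_pd bs smooth_fun_mult smooth_fun_inner
						smooth_fun_const smooth_fun_mH ys N')
			then show ?thesis using first_variation[OF bs[of a w], of a] by simp
		qed
		have iy: "integrable vM (%p. pd a (%p. y a w p * (N' p \<bullet> w)) p + (y a w p * (N' p \<bullet> w)) * (a \<bullet> mH p))" for a w
			by (intro smooth_integrable smooth_fun_add smooth_fun_pd bs smooth_fun_mult smooth_fun_inner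
						smooth_fun_const smooth_fun_mH ys N')
		define R where "R p = (\<Sum>w\<in>Basis. \<Sum>a\<in>Basis. pd a (%p. y a w p * (N' p \<bullet> w)) p + (y a w p * (N' p \<bullet> w)) * (a \<bullet> mH p)) / 2" for p
		have iR: "integrable vM R" unfolding R_def by (intro integrable_divide Bochner_Integration.integrable_sum iy)
		have R0: "(LINT p|vM. R p) = 0"
			unfolding R_def by (simp add: Bochner_Integration.integral_sum Bochner_Integration.integrable_sum iy zero)
		have iV: "integrable vM (%p. nor V p \<bullet> W' p)" by (intro smooth_integrable smooth_fun_inner smooth_nor Vs W')
		have "(LINT p|vM. CI W W' p) = (LINT p|vM. nor V p \<bullet> W' p + R p)"
		proof (rule int_cong[OF refl])
			fix p assume "p \<in> space vM"
			then show "CI W W' p = nor V p \<bullet> W' p + R p" using key[of p] unfolding R_def by simp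
		qed
		then show ?thesis using R0 by (simp add: Bochner_Integration.integral_add[OF iV iR])
	qed
	moreover have "normal_section M A \<phi> (nor V)" unfolding normal_section_def using smooth_nor[OF Vs] P_nor P_eq_0_iff by blast
	ultimately show ?thesis by blast
qed

lemma C_Omega_props:
	assumes W: "smooth W"
	shows smooth_C_Omega: "smooth (CO W)"
		and integral_C_Omega: "smooth W' ==>
			(LINT p|vM. CO W p \<bullet> W' p) = (LINT p|vM. CI W W' p)"
	using someI_ex[OF C_operator_exists[OF W]] unfolding C_Omega_def normal_section_def by auto

text \<open>A smooth admissible section is the limit of a constant sequence, so the completion can
  be bypassed; the frame sums are then rewritten as ambient traces.\<close>

lemma stability:
	assumes stable: "Omega_stable M A \<phi> \<Omega> \<nu>" and W: "smooth W" "W \<in> variation_space M A \<phi> \<nu>"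
	shows "0 \<le> (LINT p|vM. (\<Sum>b\<in>Basis. Dn W p b \<bullet> Dn W p b) - (\<Sum>b\<in>Basis. \<Sum>a\<in>Basis. (W p \<bullet> Q a (P p b) p)^2)
		+ real CARD('m) * norm (mcv p) * (CO W p \<bullet> W p))"
proof -
	let ?Z = "CO W"
	have meas: "f \<in> borel_measurable vM" if "smooth f" for f :: "'p => 'e"
		by (rule continuous_measurable[OF smooth_fun_continuous[OF that]])
	have L: "L2_limit vM (%_. f) f" if "smooth f" for f :: "'p => 'e"
		unfolding L2_limit_def using meas[OF that] by simp
	have dn: "nabla_perp A \<phi> W p (frm p ! i) = Dn W p (frm p ! i)" if "p \<in> M" "i < CARD('m)" for p i
		by (rule nabla_perp_eq[OF that(1) ortho_frameD(4)[OF frame[OF that(1)] that(2)]])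
	define G where "G p = (if p \<in> M then Dn W p else (%_. 0))" for p
	have "H1_limit M A \<phi> (%_. W) W G" unfolding H1_limit_def
	proof (intro conjI ballI allI)
		show "L2_limit vM (%_. W) W" by (rule L[OF W(1)])
		show "linear (G p)" if "p \<in> M" for p using linear_Dn[OF W(1) that] that by (simp add: G_def)
		show "(%p. G p u) \<in> borel_measurable vM" for u
			using meas[OF smooth_Dn[OF W(1), of u]] by (rule measurable_cong[THEN iffD1, rotated]) (simp add: G_def)
		have "(\<integral>\<^sup>+ p. ennreal (\<Sum>i<CARD('m). (norm (nabla_perp A \<phi> W p (frm p ! i) - G p (frm p ! i)))^2) \<partial>vM) =
				(\<integral>\<^sup>+ p. 0 \<partial>vM)"
			by (rule nn_integral_cong) (simp add: dn G_def)
		then show "(%k. \<integral>\<^sup>+ p. ennreal (\<Sum>i<CARD('m). (norm (nabla_perp A \<phi> W p (frm p ! i) - G p (frm p ! i)))^2) \<partial>vM)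
				\<longlonglongrightarrow> 0" by simp
	qed
	then have "0 \<le> I_Omega M A \<phi> W G ?Z"
		using stable[unfolded Omega_stable_def, rule_format, of "%_. W" W G ?Z] W(2) L[OF smooth_C_Omega[OF W(1)]]
		by simp
	also have "I_Omega M A \<phi> W G ?Z = (LINT p|vM. (\<Sum>b\<in>Basis. Dn W p b \<bullet> Dn W p b)
			- (\<Sum>b\<in>Basis. \<Sum>a\<in>Basis. (W p \<bullet> Q a (P p b) p)^2)
			+ real CARD('m) * norm (mcv p) * (?Z p \<bullet> W p))"
		unfolding I_Omega_def
	proof (rule int_cong[OF refl])
		fix p assume "p \<in> space vM"
		then have p: "p \<in> M" by simp
		note fr = frame[OF p]
		note ld = linear_Dn[OF W(1) p]
		have "(\<Sum>i<CARD('m). (norm (G p (frm p ! i)))^2) = (\<Sum>b\<in>Basis. Dn W p (P p b) \<bullet> Dn W p (P p b))"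
			unfolding power2_norm_eq_inner using p
			by (subst trace_frame[OF fr, of "%a b. Dn W p a \<bullet> Dn W p b", symmetric])
				(auto simp: G_def linear_add[OF ld] linear_scale[OF ld] inner_add_left inner_add_right intro!: linearI)
		then have 1: "(\<Sum>i<CARD('m). (norm (G p (frm p ! i)))^2) = (\<Sum>b\<in>Basis. Dn W p b \<bullet> Dn W p b)"
			by (simp add: Dn_P[OF p])
		let ?w = "%a b. W p \<bullet> Q a b p"
		note q1 = linear_add[OF linear_Q1[OF p]] linear_scale[OF linear_Q1[OF p]]
			and q2 = linear_add[OF linear_Q2[OF p]] linear_scale[OF linear_Q2[OF p]]
		have "(\<Sum>i<CARD('m). \<Sum>j<CARD('m). (W p \<bullet> second_ff A \<phi> p (frm p ! i) (frm p ! j))^2) =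
				(\<Sum>i<CARD('m). \<Sum>j<CARD('m). ?w (frm p ! i) (frm p ! j) * ?w (frm p ! i) (frm p ! j))"
			using ortho_frameD(4)[OF fr] by (intro sum.cong refl) (simp add: second_ff_eq[OF p] power2_eq_square)
		also have "... = (\<Sum>i<CARD('m). \<Sum>b\<in>Basis. ?w (frm p ! i) (P p b) * ?w (frm p ! i) (P p b))"
			by (intro sum.cong refl trace_frame[OF fr, of "%x y. ?w _ x * ?w _ y"] linearI)
				(auto simp: q2 inner_add_right algebra_simps)
		also have "... = (\<Sum>b\<in>Basis. \<Sum>i<CARD('m). ?w (frm p ! i) (P p b) * ?w (frm p ! i) (P p b))"
			by (rule sum.swap)
		also have "... = (\<Sum>b\<in>Basis. \<Sum>a\<in>Basis. ?w (P p a) (P p b) * ?w (P p a) (P p b))"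
			by (intro sum.cong refl trace_frame[OF fr, of "%x y. ?w x _ * ?w y _"] linearI)
				(auto simp: q1 inner_add_right algebra_simps)
		finally have 2: "(\<Sum>i<CARD('m). \<Sum>j<CARD('m). (W p \<bullet> second_ff A \<phi> p (frm p ! i) (frm p ! j))^2) =
				(\<Sum>b\<in>Basis. \<Sum>a\<in>Basis. (W p \<bullet> Q a (P p b) p)^2)"
			by (simp add: Q_P1[OF p] power2_eq_square)
		show "(\<Sum>i<CARD('m). (norm (G p (frm p ! i)))^2)
				- (\<Sum>i<CARD('m). \<Sum>j<CARD('m). (W p \<bullet> second_ff A \<phi> p (frm p ! i) (frm p ! j))^2)
				+ real CARD('m) * norm (mcv p) * (?Z p \<bullet> W p) =
			(\<Sum>b\<in>Basis. Dn W p b \<bullet> Dn W p b) - (\<Sum>b\<in>Basis. \<Sum>a\<in>Basis. (W p \<bullet> Q a (P p b) p)^2)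
				+ real CARD('m) * norm (mcv p) * (?Z p \<bullet> W p)"
			unfolding 1 2 ..
	qed
	finally show ?thesis .
qed

end


section \<open>Stability forces pseudo-umbilicity\<close>

locale stable_immersion = calibrated_immersion M A \<phi> \<Omega> \<nu>
	for M :: "'p::t2_space set" and A :: "('p, real ^ 'm::{finite,wellorder}) chart set"
		and \<phi> :: "'p => 'e::euclidean_space" and \<Omega> :: "'e => 'e list => real" and \<nu> :: "'p => 'e" +
	assumes Omega: "parallel_form (CARD('m) + 1) \<Omega> \<or>
			(\<forall>W. smooth_fun A W \<longrightarrow> (\<forall>p\<in>M. C_Omega M A \<phi> \<Omega> W p = 0))"
		and pmc: "parallel_section M A \<phi> (mean_curvature A \<phi>)"
		and stable: "Omega_stable M A \<phi> \<Omega> \<nu>"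
begin

definition \<kappa> :: "'p => real" where "\<kappa> p = norm (mcv p)"

text \<open>Equality in Cauchy-Schwarz, as \<nu> is a unit vector satisfying
  \<open>H_nu\<close>.\<close>

lemma mean_curvature_nu:
	assumes p: "p \<in> M"
	shows "mcv p = \<kappa> p *R \<nu> p"
proof -
	let ?H = "mcv p"
	have n: "\<nu> p \<bullet> \<nu> p = 1" using norm_nu[OF p] by (simp add: norm_eq_1)
	have h: "?H \<bullet> ?H = \<kappa> p * \<kappa> p" by (simp add: \<kappa>_def power2_norm_eq_inner[symmetric] power2_eq_square[symmetric])
	have "(?H - \<kappa> p *R \<nu> p) \<bullet> (?H - \<kappa> p *R \<nu> p) = 0"
	proof -
		have "?H \<bullet> \<nu> p = \<kappa> p" "\<nu> p \<bullet> ?H = \<kappa> p" using H_nu[OF p] by (simp_all add: \<kappa>_def inner_commute)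
		then show ?thesis using n h by (simp add: inner_diff_left inner_diff_right)
	qed
	then show ?thesis by simp
qed

lemma mH_nu: "p \<in> M ==> mH p = (real CARD('m) * \<kappa> p) *R \<nu> p"
proof -
	assume p: "p \<in> M"
	have "mH p = real CARD('m) *R mcv p" by (simp add: mean_curvature_eq[OF p])
	then show ?thesis by (simp add: mean_curvature_nu[OF p])
qed

lemma nu_nu: "p \<in> M ==> \<nu> p \<bullet> \<nu> p = 1" using norm_nu by (simp add: norm_eq_1)

lemma Tan_nu: "p \<in> M ==> u \<in> TM p ==> u \<bullet> \<nu> p = 0"
	using P_sym[of p u "\<nu> p"] P_nu P_id by (simp add: inner_commute)

lemma pd_nu_nu:
	assumes p: "p \<in> M"
	shows "pd a \<nu> p \<bullet> \<nu> p = 0"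
proof -
	have "pd a (%q. \<nu> q \<bullet> \<nu> q) p = pd a (%q. 1) p" by (rule pd_cong[OF _ p]) (rule nu_nu)
	then show ?thesis by (simp add: pd_inner[OF smooth_nu smooth_nu p] inner_commute)
qed

lemma smooth_H: "smooth (mcv)"
proof -
	have "smooth (%p. (1 / real CARD('m)) *R mH p)" by (intro smooth_fun_scaleR smooth_fun_const smooth_fun_mH)
	then show ?thesis by (rule smooth_fun_cong[THEN iffD2, rotated]) (rule mean_curvature_eq)
qed

lemma smooth_kappa: "smooth \<kappa>"
proof -
	have "smooth (%p. mcv p \<bullet> \<nu> p)" by (intro smooth_fun_inner smooth_H smooth_nu)
	then show ?thesis using smooth_fun_cong[of \<kappa> "%p. mcv p \<bullet> \<nu> p"] H_nu by (simp add: \<kappa>_def)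
qed

lemma pd_H_Tan:
	assumes p: "p \<in> M"
	shows "P p (pd w (mcv) p) = pd w (mcv) p"
proof -
	have "Dn (mcv) p (P p w) = 0"
		using pmc p P_in[OF p] nabla_perp_eq[OF p P_in[OF p]] unfolding parallel_section_def by metis
	then show ?thesis by (simp add: Dn_def pd_P[OF p])
qed

text \<open>H is parallel, so its derivative is tangent, and that of \<nu> is orthogonal to \<nu>.
  Constancy has to wait for connectedness.\<close>

lemma pd_kappa:
	assumes p: "p \<in> M"
	shows "pd w \<kappa> p = 0"
proof -
	have "pd w \<kappa> p = pd w (%q. mcv q \<bullet> \<nu> q) p"
		by (rule pd_cong[OF _ p]) (simp add: \<kappa>_def H_nu)
	also have "... = mcv p \<bullet> pd w \<nu> p + pd w (mcv) p \<bullet> \<nu> p"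
		by (rule pd_inner[OF smooth_H smooth_nu p])
	also have "pd w (mcv) p \<bullet> \<nu> p = 0" using Tan_nu[OF p P_in[OF p]] pd_H_Tan[OF p] by metis
	finally show ?thesis using pd_nu_nu[OF p, of w] by (simp add: mean_curvature_nu[OF p] inner_commute)
qed

lemma trace_P:
	assumes p: "p \<in> M"
	shows "(\<Sum>b\<in>Basis. P p b \<bullet> b) = real CARD('m)"
proof -
	note fr = some_frame[OF p]
	have "(\<Sum>b\<in>Basis. P p b \<bullet> b) = (\<Sum>b\<in>Basis. P p b \<bullet> P p b)"
		by (simp add: P_sym[OF p, symmetric] P_P[OF p])
	also have "... = (\<Sum>i<CARD('m). sfrm p ! i \<bullet> sfrm p ! i)"
		by (rule trace_frame[OF fr, of "%a b. a \<bullet> b", symmetric]) (auto intro!: linearI simp: inner_add_left inner_add_right)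
	also have "... = real CARD('m)" using ortho_frameD(1,2)[OF fr] by (simp add: orthonormal_def)
	finally show ?thesis .
qed

lemma locally_constant_smooth:
	assumes "\<And>p. p \<in> M ==> \<exists>U. openM U \<and> p \<in> U \<and> (\<forall>q\<in>U. f q = f p)"
	shows "smooth f" "p \<in> M ==> pd w f p = 0"
proof -
	show "smooth f"
	proof (rule smooth_fun_agree)
		fix p assume "p \<in> M"
		then obtain U where U: "openM U" "p \<in> U" "\<forall>q\<in>U. f q = f p" using assms by blast
		show "\<exists>U g. openM U \<and> p \<in> U \<and> smooth g \<and> (\<forall>q\<in>U. f q = g q)"
			by (intro exI[of _ U] exI[of _ "%_. f p"] conjI smooth_fun_const U)
	qed
	show "pd w f p = 0" if "p \<in> M"
	proof -
		obtain U where U: "openM U" "p \<in> U" "\<forall>q\<in>U. f q = f p" using assms[OF \<open>p \<in> M\<close>] by blast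
		have "pd w f p = pd w (%_. f p) p" by (rule pd_cong_open[OF U(1,2)]) (rule bspec[OF U(3)])
		then show ?thesis by simp
	qed
qed

text \<open>Where |H| = 0 the field \<phi> has divergence m and no curvature term. That part of M is
  open and closed because |H| is locally constant, so its indicator is a smooth cutoff and the
  divergence theorem rules it out.\<close>

lemma kappa_pos:
	assumes p: "p \<in> M"
	shows "0 < \<kappa> p"
proof (rule ccontr)
	assume "\<not> 0 < \<kappa> p"
	then have k0: "\<kappa> p = 0" by (simp add: \<kappa>_def)
	define f where "f q = (if \<kappa> q = 0 then 1 else 0 :: real)" for q
	have loc: "\<exists>U. openM U \<and> q \<in> U \<and> (\<forall>r\<in>U. f r = f q)" if q: "q \<in> M" for q
	proof -
		obtain U where U: "openM U" "q \<in> U" "\<forall>r\<in>U. \<kappa> r = \<kappa> q"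
			using locally_constant[OF smooth_kappa pd_kappa q] by blast
		have "f r = f q" if "r \<in> U" for r by (simp only: f_def bspec[OF U(3) that])
		then show ?thesis using U(1,2) by blast
	qed
	have fs: "smooth f" by (rule locally_constant_smooth(1)[OF loc])
	have fd: "pd w f q = 0" if "q \<in> M" for w q by (rule locally_constant_smooth(2)[OF loc]) (use that in auto)
	have X: "smooth (%q. f q *R \<phi> q)" by (intro smooth_fun_scaleR fs smooth_phi)
	have "(LINT q|vM. (\<Sum>b\<in>Basis. pd b (%q. f q *R \<phi> q) q \<bullet> b)) = (LINT q|vM. f q * real CARD('m))"
	proof (rule int_cong[OF refl])
		fix q assume "q \<in> space vM"
		then have q: "q \<in> M" by simp
		have "(\<Sum>b\<in>Basis. pd b (%q. f q *R \<phi> q) q \<bullet> b) = (\<Sum>b\<in>Basis. f q * (P q b \<bullet> b))"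
			using fd[OF q] by (simp add: pd_scaleR[OF fs smooth_phi q] pd_phi[OF q])
		then show "(\<Sum>b\<in>Basis. pd b (%q. f q *R \<phi> q) q \<bullet> b) = f q * real CARD('m)"
			by (simp add: sum_distrib_left[symmetric] trace_P[OF q])
	qed
	moreover have "(LINT q|vM. (f q *R \<phi> q) \<bullet> mH q) = (LINT q|vM. 0)"
		by (rule int_cong) (auto simp: f_def mH_nu)
	ultimately have "(LINT q|vM. f q * real CARD('m)) \<le> 0" using divergence_theorem[OF X] by simp
	moreover have "continuous_on M (%q. f q * real CARD('m))"
		by (intro smooth_fun_continuous smooth_fun_mult fs smooth_fun_const)
	ultimately have "f p * real CARD('m) = 0" by (intro integral_nonneg_eq_0[OF _ _ _ p]) (auto simp: f_def)
	then show False using k0 by (simp add: f_def)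
qed

text \<open>\<nu> is H divided by a positive locally constant function, hence parallel like
  H.\<close>

lemma pd_nu_Tan:
	assumes p: "p \<in> M"
	shows "P p (pd w \<nu> p) = pd w \<nu> p"
proof -
	have "pd w (mcv) p = pd w (%q. \<kappa> q *R \<nu> q) p"
		by (rule pd_cong[OF _ p]) (rule mean_curvature_nu)
	then have "pd w (mcv) p = \<kappa> p *R pd w \<nu> p"
		by (simp add: pd_scaleR[OF smooth_kappa smooth_nu p] pd_kappa[OF p])
	then have "\<kappa> p *R P p (pd w \<nu> p) = \<kappa> p *R pd w \<nu> p"
		using pd_H_Tan[OF p, of w] by (simp add: linear_scale[OF linear_P[OF p]])
	then show ?thesis using kappa_pos[OF p] by simp
qed

text \<open>The scalar second fundamental form in direction \<open>\<nu>\<close>, as the derivative of \<open>\<nu>\<close>.\<close>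

lemma Q_nu:
	assumes p: "p \<in> M"
	shows "Q a b p \<bullet> \<nu> p = - (pd a \<nu> p \<bullet> b)"
proof -
	have "pd a (%q. P q b \<bullet> \<nu> q) p = pd a (%q. 0) p" by (rule pd_cong[OF _ p]) (rule Tan_nu[OF _ P_in])
	then have "P p b \<bullet> pd a \<nu> p + Q a b p \<bullet> \<nu> p = 0"
		by (simp add: pd_inner[OF smooth_fun_P smooth_nu p] Q_def)
	moreover have "P p b \<bullet> pd a \<nu> p = pd a \<nu> p \<bullet> b" by (simp only: P_sym[OF p] pd_nu_Tan[OF p] inner_commute[of b])
	ultimately show ?thesis by simp
qed

lemma Q_P_nu: "p \<in> M ==> Q a (P p b) p \<bullet> \<nu> p = - (pd a \<nu> p \<bullet> b)"
	using Q_nu[of p a "P p b"] P_sym[of p "pd a \<nu> p" b] pd_nu_Tan[of p a] by simp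

lemma pd_nu_sym:
	assumes p: "p \<in> M"
	shows "pd a \<nu> p \<bullet> b = pd b \<nu> p \<bullet> a"
proof -
	have "(Q a b p - Q b a p) \<bullet> \<nu> p = 0" by (rule Tan_nu[OF p Q_diff_Tan[OF smooth_phi p]])
	then show ?thesis by (simp add: inner_diff_left Q_nu[OF p])
qed

text \<open>The squared norm of B^\<nu>, since d\<nu> is tangent and equals -B^\<nu>.\<close>

definition N2 :: "'p => real" where "N2 p = (\<Sum>a\<in>Basis. pd a \<nu> p \<bullet> pd a \<nu> p)"

lemma smooth_N2: "smooth N2" unfolding N2_def[abs_def] by (intro smooth_fun_intros smooth_nu)

lemma trace_pd_nu:
	assumes p: "p \<in> M"
	shows "(\<Sum>a\<in>Basis. pd a \<nu> p \<bullet> a) = - (real CARD('m) * \<kappa> p)"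
proof -
	have "mH p \<bullet> \<nu> p = - (\<Sum>a\<in>Basis. pd a \<nu> p \<bullet> a)"
		unfolding mH_def inner_sum_left by (simp add: Q_nu[OF p] sum_negf)
	then show ?thesis using mH_nu[OF p] nu_nu[OF p] by simp
qed

text \<open>The right-hand side is the squared norm of the traceless part of B^\<nu>, as d\<nu> has
  trace -m |H|.\<close>

lemma N2_eq:
	assumes p: "p \<in> M"
	shows "N2 p - real CARD('m) * (\<kappa> p)^2 = (\<Sum>a\<in>Basis. (pd a \<nu> p + \<kappa> p *R P p a) \<bullet> (pd a \<nu> p + \<kappa> p *R P p a))"
proof -
	have "(pd a \<nu> p + \<kappa> p *R P p a) \<bullet> (pd a \<nu> p + \<kappa> p *R P p a) =
			pd a \<nu> p \<bullet> pd a \<nu> p + 2 * \<kappa> p * (pd a \<nu> p \<bullet> a) + (\<kappa> p)^2 * (P p a \<bullet> a)" for a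
	proof -
		have "P p a \<bullet> P p a = P p a \<bullet> a" "pd a \<nu> p \<bullet> P p a = pd a \<nu> p \<bullet> a"
			using P_sym[OF p] P_P[OF p] pd_nu_Tan[OF p] by metis+
		then show ?thesis
			by (simp add: inner_add_left inner_add_right inner_commute[of "P p a" "pd a \<nu> p"] power2_eq_square algebra_simps)
	qed
	then have "(\<Sum>a\<in>Basis. (pd a \<nu> p + \<kappa> p *R P p a) \<bullet> (pd a \<nu> p + \<kappa> p *R P p a)) =
			N2 p + 2 * \<kappa> p * (\<Sum>a\<in>Basis. pd a \<nu> p \<bullet> a) + (\<kappa> p)^2 * (\<Sum>a\<in>Basis. P p a \<bullet> a)"
		by (simp add: N2_def sum.distrib sum_distrib_left)
	then show ?thesis by (simp add: trace_pd_nu[OF p] trace_P[OF p] power2_eq_square algebra_simps)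
qed

lemma N2_ge: "p \<in> M ==> real CARD('m) * (\<kappa> p)^2 \<le> N2 p"
	using N2_eq[of p] sum_nonneg[of Basis "%a. (pd a \<nu> p + \<kappa> p *R P p a) \<bullet> (pd a \<nu> p + \<kappa> p *R P p a)"] by simp

lemma C_integrand_parallel:
	assumes par: "parallel_form (CARD('m) + 1) \<Omega>" and W: "smooth W" "smooth W'" and p: "p \<in> M"
	shows "CI W W' p =
		(deriv_cov CARD('m) (Dn (nor W') p) (%us. \<Omega> (\<phi> p) (nor W p # us)) (frm p)
		 + deriv_cov CARD('m) (Dn (nor W) p) (%us. \<Omega> (\<phi> p) (nor W' p # us)) (frm p)) / 2"
	using par ortho_frameD(1)[OF frame[OF p]] unfolding C_integrand_eq[OF W p] parallel_form_def by simp

lemma covector_Omega: "covector (Suc CARD('m)) (\<Omega> x)" using form by (simp add: smooth_form_def)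

lemma Dn_cong: "(\<And>q. q \<in> M ==> V q = W q) ==> p \<in> M ==> Dn V p u = Dn W p u"
	unfolding Dn_def using pd_cong[of V W p u] by simp

text \<open>The defining identity of \<open>CO\<close> integrates against a section, so the factor
  |H|, not yet known to be constant, is absorbed into that section.\<close>

lemma C_term:
	assumes W: "smooth W"
	shows "(LINT p|vM. real CARD('m) * \<kappa> p * (CO W p \<bullet> W p)) =
		real CARD('m) * (LINT p|vM. CI W (%p. \<kappa> p *R W p) p)"
proof -
	have "smooth (%p. \<kappa> p *R W p)" by (intro smooth_fun_scaleR smooth_kappa W)
	from integral_C_Omega[OF W this] show ?thesis by (simp add: mult.assoc)
qed

lemma Dn_scaled_nu:
	assumes f: "smooth f" and p: "p \<in> M"
	shows "Dn (%q. f q *R \<nu> q) p u = pd u f p *R \<nu> p"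
proof -
	have "pd u (%q. f q *R \<nu> q) p = f p *R pd u \<nu> p + pd u f p *R \<nu> p"
		by (rule pd_scaleR[OF f smooth_nu p])
	then show ?thesis by (simp add: Dn_def linear_add[OF linear_P[OF p]] linear_scale[OF linear_P[OF p]] pd_nu_Tan[OF p] P_nu[OF p])
qed

text \<open>The normal derivative of f \<nu> is a multiple of \<nu>, so for parallel \<Omega> every
  value of \<Omega> in the C-term has \<nu> in two slots and vanishes.\<close>

lemma stability_scaled_nu:
	assumes f: "f \<in> mean_zero M A \<phi>"
	shows "0 \<le> (LINT p|vM. (\<Sum>b\<in>Basis. (pd b f p)^2) - (f p)^2 * N2 p)"
proof -
	have fs: "smooth f" using f by (simp add: mean_zero_def)
	define W where "W p = f p *R \<nu> p" for p
	have Ws: "smooth W" unfolding W_def[abs_def] by (intro smooth_fun_scaleR fs smooth_nu)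
	have Wv: "W \<in> variation_space M A \<phi> \<nu>" unfolding variation_space_def mem_Collect_eq
		by (rule exI[of _ 1], rule exI[of _ "%_. 1"], rule exI[of _ "%_. f"], rule exI[of _ "%_ _. 0"])
			(use f in \<open>simp add: Fspace_def W_def\<close>)
	let ?C = "%p. CO W p \<bullet> W p"
	have Dn: "Dn W p b = pd b f p *R \<nu> p" if "p \<in> M" for p b
		unfolding W_def[abs_def] by (rule Dn_scaled_nu[OF fs that])
	have C0: "(LINT p|vM. real CARD('m) * \<kappa> p * ?C p) = 0" using Omega
	proof
		assume par: "parallel_form (CARD('m) + 1) \<Omega>"
		let ?W = "%p. \<kappa> p *R W p"
		have Ws': "smooth ?W" by (intro smooth_fun_scaleR smooth_kappa Ws)
		have z: "deriv_cov CARD('m) (Dn (nor V) p) (%us. \<Omega> (\<phi> p) (nor V' p # us)) (frm p) = 0"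
			if p: "p \<in> M" and V: "\<And>q. q \<in> M ==> nor V q = g q *R \<nu> q" "smooth g" and V': "nor V' p = r *R \<nu> p"
			for V V' g r p
			unfolding deriv_cov_def
		proof (rule sum.neutral, rule ballI)
			fix i assume i: "i \<in> {..<CARD('m)}"
			let ?fr = "frm p"
			have lf: "length ?fr = CARD('m)" using ortho_frameD(1)[OF frame[OF p]] .
			have D: "Dn (nor V) p (?fr ! i) = pd (?fr ! i) g p *R \<nu> p"
				using Dn_cong[OF V(1) p] Dn_scaled_nu[OF V(2) p] by simp
			have "\<Omega> (\<phi> p) ((\<nu> p # ?fr)[Suc i := \<nu> p]) = 0"
				by (rule covector_eq_0[OF covector_Omega, of _ 0 "Suc i"]) (use i lf in auto)
			then have "\<Omega> (\<phi> p) ((\<nu> p # ?fr)[Suc i := pd (?fr ! i) g p *R \<nu> p]) = 0"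
				using linear_scale[OF covector_linear[OF covector_Omega, of "\<nu> p # ?fr" "Suc i"]] i lf by simp
			then show "\<Omega> (\<phi> p) (nor V' p # ?fr[i := Dn (nor V) p (?fr ! i)]) = 0"
				unfolding D V' using linear_scale[OF covector_append_linear[OF covector_Omega, of "[]" "?fr[i := pd (?fr ! i) g p *R \<nu> p]"]] lf
				by simp
		qed
		have n1: "nor W q = f q *R \<nu> q" and n2: "nor ?W q = (\<kappa> q * f q) *R \<nu> q" if q: "q \<in> M" for q
			by (simp_all add: nor_def W_def linear_scale[OF linear_P[OF q]] P_nu[OF q])
		have kf: "smooth (%q. \<kappa> q * f q)" by (intro smooth_fun_mult smooth_kappa fs)
		have "(LINT p|vM. CI W ?W p) = (LINT p|vM. 0)"
			by (rule int_cong[OF refl])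
				(simp add: C_integrand_parallel[OF par Ws Ws'] z[OF _ n1 fs n2] z[OF _ n2 kf n1])
		then show ?thesis unfolding C_term[OF Ws] by simp
	next
		assume "\<forall>W. smooth W \<longrightarrow> (\<forall>p\<in>M. CO W p = 0)"
		then have "(LINT p|vM. real CARD('m) * \<kappa> p * ?C p) = (LINT p|vM. 0)"
			by (intro int_cong) (use Ws in auto)
		then show ?thesis by simp
	qed
	have eq: "(\<Sum>b\<in>Basis. Dn W p b \<bullet> Dn W p b) - (\<Sum>b\<in>Basis. \<Sum>a\<in>Basis. (W p \<bullet> Q a (P p b) p)^2)
			= (\<Sum>b\<in>Basis. (pd b f p)^2) - (f p)^2 * N2 p" if p: "p \<in> M" for p
	proof -
		have "(\<Sum>b\<in>Basis. \<Sum>a\<in>Basis. (W p \<bullet> Q a (P p b) p)^2) = (\<Sum>a\<in>Basis. \<Sum>b\<in>Basis. (f p)^2 * ((pd a \<nu> p \<bullet> b) * (pd a \<nu> p \<bullet> b)))"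
			by (subst sum.swap) (simp add: W_def inner_commute[of "\<nu> p"] Q_P_nu[OF p] power2_eq_square mult_ac)
		also have "... = (f p)^2 * N2 p"
			unfolding N2_def sum_distrib_left[symmetric] by (simp add: euclidean_inner[symmetric])
		finally show ?thesis by (simp add: Dn[OF p] nu_nu[OF p] power2_eq_square)
	qed
	let ?E = "%p. (\<Sum>b\<in>Basis. (pd b f p)^2) - (f p)^2 * N2 p"
	have "0 \<le> (LINT p|vM. (\<Sum>b\<in>Basis. Dn W p b \<bullet> Dn W p b) - (\<Sum>b\<in>Basis. \<Sum>a\<in>Basis. (W p \<bullet> Q a (P p b) p)^2)
		+ real CARD('m) * norm (mcv p) * ?C p)"
		by (rule stability[OF stable Ws Wv])
	also have "... = (LINT p|vM. ?E p + real CARD('m) * \<kappa> p * ?C p)"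
		by (rule int_cong) (auto simp: eq \<kappa>_def)
	also have "... = (LINT p|vM. ?E p) + (LINT p|vM. real CARD('m) * \<kappa> p * ?C p)"
		unfolding power2_eq_square
		by (intro Bochner_Integration.integral_add smooth_integrable smooth_fun_intros fs smooth_N2 smooth_kappa smooth_C_Omega Ws)
	finally show ?thesis using C0 by simp
qed

lemma N2_pos: "p \<in> M ==> 0 < N2 p"
	using N2_ge[of p] kappa_pos[of p] by (metis less_le_trans mult_pos_pos of_nat_0_less_iff zero_less_card_finite zero_less_power)

text \<open>A locally constant function of mean zero on a disconnected \<open>M\<close> would destabilize \<open>M\<close>.\<close>

lemma connected_M: "connected M"
proof (rule ccontr)
	assume "\<not> connected M"
	then obtain U where U: "openM U" "closedin (top_of_set M) U" "U \<noteq> {}" "U \<noteq> M"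
		unfolding connected_clopen by blast
	define V where "V = M - U"
	have V: "openM V" using U(2) by (simp add: V_def closedin_def)
	have UM: "U \<subseteq> M" by (rule openin_imp_subset[OF U(1)])
	have Vne: "V \<noteq> {}" using UM U(4) by (auto simp: V_def)
	interpret finite_measure vM by (rule finite_measure_vM)
	have mU: "U \<in> sets vM" "V \<in> sets vM" using chart_sets[OF U(1)] chart_sets[OF V] by auto
	have pos: "0 < measure vM U" "0 < measure vM V"
		using open_vM_pos[OF U(1)] open_vM_pos[OF V] U(3) Vne by (auto simp: emeasure_eq_measure)
	\<comment> \<open>Dividing by the measures of the two parts makes the mean zero.\<close>
	define f where "f p = indicator U p / measure vM U - indicator V p / measure vM V" for p
	have loc: "\<exists>T. openM T \<and> q \<in> T \<and> (\<forall>r\<in>T. f r = f q)" if q: "q \<in> M" for q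
	proof (cases "q \<in> U")
		case True
		then show ?thesis using U(1) by (intro exI[of _ U]) (auto simp: f_def V_def)
	next
		case False
		then show ?thesis using V q by (intro exI[of _ V]) (auto simp: f_def V_def)
	qed
	have fs: "smooth f" by (rule locally_constant_smooth(1)[OF loc])
	have fd: "pd w f q = 0" if "q \<in> M" for w q by (rule locally_constant_smooth(2)[OF loc]) (use that in auto)
	have "(LINT p|vM. f p) = 0"
	proof -
		have "U \<inter> M = U" "V \<inter> M = V" using UM by (auto simp: V_def)
		then show ?thesis unfolding f_def using mU pos by (simp add: emeasure_eq_measure)
	qed
	then have "f \<in> mean_zero M A \<phi>" using fs by (simp add: mean_zero_def)
	from stability_scaled_nu[OF this] have "0 \<le> (LINT p|vM. (\<Sum>b\<in>Basis. (pd b f p)^2) - (f p)^2 * N2 p)" .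
	also have "... = (LINT p|vM. - ((f p)^2 * N2 p))"
		by (rule int_cong) (auto simp: fd)
	finally have "(LINT p|vM. (f p)^2 * N2 p) \<le> 0" by simp
	moreover obtain p where p: "p \<in> U" using U(3) by blast
	moreover have "continuous_on M (%p. (f p)^2 * N2 p)"
		unfolding power2_eq_square by (intro smooth_fun_continuous smooth_fun_mult fs smooth_N2)
	ultimately have "(f p)^2 * N2 p = 0"
		using UM by (intro integral_nonneg_eq_0) (auto intro: mult_nonneg_nonneg less_imp_le[OF N2_pos])
	then show False using N2_pos[of p] p UM pos by (auto simp: f_def V_def)
qed

definition k :: real where "k = \<kappa> (SOME p. p \<in> M)"

lemma kappa_eq: "p \<in> M ==> \<kappa> p = k"
	unfolding k_def using constant_on_connected[OF connected_M smooth_kappa pd_kappa] M_nonempty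
	by (metis ex_in_conv someI_ex)

lemma k_pos: "0 < k" using kappa_pos kappa_eq M_nonempty by (metis ex_in_conv)

subsection \<open>The Laplacian of the height function\<close>

text \<open>Codazzi in disguise: the symmetry of d\<nu> and the commutator of derivatives bring out
  the derivative of the trace of d\<nu>, which is constant. The term with \<open>Q w a\<close>
  vanishes because d\<nu> is tangent while \<open>Q w\<close> sends tangent vectors to normal
  ones.\<close>

lemma laplacian_nu:
	assumes p: "p \<in> M"
	shows "(\<Sum>a\<in>Basis. pd a (pd a \<nu>) p) = (\<Sum>a\<in>Basis. Q a (pd a \<nu> p) p)"
proof (rule euclidean_eqI)
	fix w :: 'e
	have s: "smooth (pd a \<nu>)" for a by (rule smooth_fun_pd[OF smooth_nu])
	have 1: "pd a (pd a \<nu>) p \<bullet> w = pd w (pd a \<nu>) p \<bullet> a + pd a \<nu> p \<bullet> (Q a w p - Q w a p)" for a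
	proof -
		have "pd a (pd a \<nu>) p \<bullet> w = pd a (%q. pd a \<nu> q \<bullet> w) p"
			by (rule pd_linear[OF s bounded_linear_inner_left p, symmetric])
		also have "... = pd a (%q. pd w \<nu> q \<bullet> a) p" by (rule pd_cong[OF _ p]) (rule pd_nu_sym)
		also have "... = pd a (pd w \<nu>) p \<bullet> a" by (rule pd_linear[OF s bounded_linear_inner_left p])
		also have "pd a (pd w \<nu>) p = pd w (pd a \<nu>) p + pd (Q a w p - Q w a p) \<nu> p"
			using pd_commute(1)[OF smooth_nu p, of a w] by (simp add: algebra_simps)
		finally show ?thesis using pd_nu_sym[OF p, of "Q a w p - Q w a p" a] by (simp add: inner_add_left)
	qed
	have 2: "(\<Sum>a\<in>Basis. pd w (pd a \<nu>) p \<bullet> a) = 0"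
	proof -
		have "(\<Sum>a\<in>Basis. pd w (pd a \<nu>) p \<bullet> a) = pd w (%q. \<Sum>a\<in>Basis. pd a \<nu> q \<bullet> a) p"
			by (subst pd_sum[OF _ p]) (auto simp: pd_linear[OF s bounded_linear_inner_left p] intro!: smooth_fun_inner s)
		also have "... = pd w (%q. - (real CARD('m) * k)) p" by (rule pd_cong[OF _ p]) (simp add: trace_pd_nu kappa_eq)
		finally show ?thesis by simp
	qed
	have 3: "(\<Sum>a\<in>Basis. pd a \<nu> p \<bullet> Q w a p) = 0"
	proof -
		have L: "linear (%a. pd a \<nu> p)" by (rule linear_pd[OF smooth_nu p])
		have LQ: "linear (%a. Q w (pd a \<nu> p) p)" using linear_compose[OF L linear_Q2[OF p, of w]] by (simp add: o_def)
		have "(\<Sum>a\<in>Basis. pd a \<nu> p \<bullet> Q w a p) = (\<Sum>a\<in>Basis. Q w (pd (P p a) \<nu> p) p \<bullet> a)"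
			by (intro sum.cong refl) (simp add: Q_sym[OF p, of w _ "pd _ \<nu> p"] inner_commute pd_P[OF p])
		also have "... = (\<Sum>a\<in>Basis. Q w (pd a \<nu> p) p \<bullet> P p a)" by (rule trace_swap[OF _ _ P_sym[OF p]])
				(auto intro!: linearI simp: linear_add[OF LQ] linear_scale[OF LQ] inner_add_left inner_add_right)
		also have "... = 0"
		proof (rule sum.neutral, rule ballI)
			fix a :: 'e
			have "P p (Q w (P p (pd a \<nu> p)) p) \<bullet> a = 0" using p by simp
			then show "Q w (pd a \<nu> p) p \<bullet> P p a = 0" by (simp add: P_sym[OF p] pd_nu_Tan[OF p])
		qed
		finally show ?thesis .
	qed
	have "(\<Sum>a\<in>Basis. pd a (pd a \<nu>) p) \<bullet> w = (\<Sum>a\<in>Basis. pd a \<nu> p \<bullet> Q a w p)"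
		using 2 3 by (simp add: inner_sum_left 1 sum.distrib inner_diff_right sum_subtractf)
	also have "... = (\<Sum>a\<in>Basis. Q a (pd a \<nu> p) p) \<bullet> w"
		unfolding inner_sum_left by (intro sum.cong refl) (metis Q_sym[OF p] inner_commute)
	finally show "(\<Sum>a\<in>Basis. pd a (pd a \<nu>) p) \<bullet> w = (\<Sum>a\<in>Basis. Q a (pd a \<nu> p) p) \<bullet> w" .
qed

abbreviation h where "h \<equiv> height \<phi> \<nu>"
abbreviation hS where "hS \<equiv> height_S A \<phi> \<nu>"

lemma proj_Fspace:
	assumes p: "p \<in> M" and w: "P p w = 0"
	shows "proj (FN p) w = w - (w \<bullet> \<nu> p) *R \<nu> p"
proof (rule proj_unique)
	show "subspace (FN p)" by (auto simp: subspace_def Fspace_def inner_add_left)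
	have "\<forall>u\<in>TM p. w \<bullet> u = 0" using w P_eq_0_iff[OF p] by blast
	moreover have "\<forall>u\<in>TM p. \<nu> p \<bullet> u = 0" using P_nu[OF p] P_eq_0_iff[OF p] by blast
	ultimately show "w - (w \<bullet> \<nu> p) *R \<nu> p \<in> FN p"
		by (simp add: Fspace_def inner_diff_left nu_nu[OF p])
	fix v assume "v \<in> FN p"
	then show "(w - (w - (w \<bullet> \<nu> p) *R \<nu> p)) \<bullet> v = 0" by (simp add: Fspace_def inner_commute)
qed

text \<open>B^\<nu> is -d\<nu>, so summing B B^\<nu> gives minus the vector of
  \<open>laplacian_nu\<close>; removing the \<nu>-component from the pairing with \<phi> costs h
  |B^\<nu>|^2.\<close>

lemma height_S_eq:
	assumes p: "p \<in> M"
	shows "hS p = - (\<phi> p \<bullet> (\<Sum>a\<in>Basis. Q a (pd a \<nu> p) p)) - h p * N2 p"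
proof -
	note fr = frame[OF p]
	let ?e = "%i. frm p ! i"
	define g where "g a b c d = (\<phi> p \<bullet> Q a b p - (Q a b p \<bullet> \<nu> p) * h p) * (Q c d p \<bullet> \<nu> p)" for a b c d
	note q = linear_add[OF linear_Q1[OF p]] linear_scale[OF linear_Q1[OF p]]
			linear_add[OF linear_Q2[OF p]] linear_scale[OF linear_Q2[OF p]]
	have "hS p = (\<Sum>i<CARD('m). \<Sum>j<CARD('m). g (?e i) (?e j) (?e i) (?e j))" unfolding height_S_def Let_def
	proof (intro sum.cong refl)
		fix i j assume "i \<in> {..<CARD('m)}" "j \<in> {..<CARD('m)}"
		then have t: "?e i \<in> TM p" "?e j \<in> TM p" using ortho_frameD(4)[OF fr] by auto
		have "P p (Q (?e i) (?e j) p) = 0" using P_Q_P[OF p, of "?e i" "?e j"] P_id[OF p t(2)] by simp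
		then show "(\<phi> p \<bullet> proj (FN p) (second_ff A \<phi> p (?e i) (?e j))) * (second_ff A \<phi> p (?e i) (?e j) \<bullet> \<nu> p)
				= g (?e i) (?e j) (?e i) (?e j)"
			unfolding second_ff_eq[OF p t] by (simp add: proj_Fspace[OF p] g_def inner_diff_right height_def)
	qed
	also have "... = (\<Sum>i<CARD('m). \<Sum>b\<in>Basis. g (?e i) (P p b) (?e i) (P p b))"
		by (intro sum.cong refl trace_frame[OF fr, of "%x y. g _ x _ y"] linearI)
			(auto simp: g_def q inner_add_right inner_add_left algebra_simps)
	also have "... = (\<Sum>b\<in>Basis. \<Sum>i<CARD('m). g (?e i) (P p b) (?e i) (P p b))" by (rule sum.swap)
	also have "... = (\<Sum>b\<in>Basis. \<Sum>a\<in>Basis. g (P p a) (P p b) (P p a) (P p b))"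
		by (intro sum.cong refl trace_frame[OF fr, of "%x y. g x _ y _"] linearI)
			(auto simp: g_def q inner_add_right inner_add_left algebra_simps)
	also have "... = (\<Sum>a\<in>Basis. \<Sum>b\<in>Basis. g (P p a) (P p b) (P p a) (P p b))" by (rule sum.swap)
	also have "... = (\<Sum>a\<in>Basis. - (\<phi> p \<bullet> Q a (pd a \<nu> p) p) - h p * (pd a \<nu> p \<bullet> pd a \<nu> p))"
	proof (rule sum.cong[OF refl])
		fix a :: 'e
		have "Q a (P p (pd a \<nu> p)) p = (\<Sum>b\<in>Basis. (pd a \<nu> p \<bullet> b) *R Q a (P p b) p)"
			using linear_euclidean_expand[OF linear_compose[OF linear_P[OF p] linear_Q2[OF p, of a]], of "pd a \<nu> p"] by (simp add: o_def)
		then have e: "\<phi> p \<bullet> Q a (pd a \<nu> p) p = (\<Sum>b\<in>Basis. (pd a \<nu> p \<bullet> b) * (\<phi> p \<bullet> Q a (P p b) p))"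
			by (simp add: pd_nu_Tan[OF p] inner_sum_right)
		have "(\<Sum>b\<in>Basis. g (P p a) (P p b) (P p a) (P p b)) =
				(\<Sum>b\<in>Basis. - ((pd a \<nu> p \<bullet> b) * (\<phi> p \<bullet> Q a (P p b) p)) - h p * ((pd a \<nu> p \<bullet> b) * (pd a \<nu> p \<bullet> b)))"
			by (intro sum.cong refl) (simp add: g_def Q_P1[OF p] Q_P_nu[OF p] algebra_simps)
		also have "... = - (\<phi> p \<bullet> Q a (pd a \<nu> p) p) - h p * (pd a \<nu> p \<bullet> pd a \<nu> p)"
			unfolding e by (subst (2) euclidean_inner) (simp add: sum_subtractf sum_negf sum_distrib_left)
		finally show "(\<Sum>b\<in>Basis. g (P p a) (P p b) (P p a) (P p b)) = - (\<phi> p \<bullet> Q a (pd a \<nu> p) p) - h p * (pd a \<nu> p \<bullet> pd a \<nu> p)" .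
	qed
	finally show ?thesis by (simp add: N2_def sum_subtractf sum_negf sum_distrib_left inner_sum_right)
qed

lemma smooth_height: "smooth h" unfolding height_def[abs_def] by (intro smooth_fun_inner smooth_phi smooth_nu)

lemma smooth_height_S: "smooth hS"
proof -
	have "smooth (%p. - (\<phi> p \<bullet> (\<Sum>a\<in>Basis. pd a (pd a \<nu>) p)) - h p * N2 p)"
		by (intro smooth_fun_intros smooth_nu smooth_height smooth_N2)
	then show ?thesis
		using smooth_fun_cong[of hS "%p. - (\<phi> p \<bullet> (\<Sum>a\<in>Basis. pd a (pd a \<nu>) p)) - h p * N2 p"] by (simp add: height_S_eq laplacian_nu)
qed

lemma laplacian_height:
	assumes p: "p \<in> M"
	shows "(\<Sum>a\<in>Basis. pd a (pd a h) p) = - (real CARD('m) * k) - hS p - h p * N2 p"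
proof -
	have s: "smooth (pd a \<nu>)" for a by (rule smooth_fun_pd[OF smooth_nu])
	have 1: "pd a h q = \<phi> q \<bullet> pd a \<nu> q" if q: "q \<in> M" for a q
		unfolding height_def[abs_def] by (simp add: pd_inner[OF smooth_phi smooth_nu q] pd_phi[OF q] Tan_nu[OF q P_in[OF q]])
	have "pd a (pd a h) p = \<phi> p \<bullet> pd a (pd a \<nu>) p + pd a \<nu> p \<bullet> a" for a
	proof -
		have "pd a (pd a h) p = pd a (%q. \<phi> q \<bullet> pd a \<nu> q) p" by (rule pd_cong[OF _ p]) (rule 1)
		also have "... = \<phi> p \<bullet> pd a (pd a \<nu>) p + P p a \<bullet> pd a \<nu> p"
			by (simp add: pd_inner[OF smooth_phi s p] pd_phi[OF p])
		also have "P p a \<bullet> pd a \<nu> p = pd a \<nu> p \<bullet> a" by (simp add: P_sym[OF p] pd_nu_Tan[OF p] inner_commute)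
		finally show ?thesis .
	qed
	then have "(\<Sum>a\<in>Basis. pd a (pd a h) p) = \<phi> p \<bullet> (\<Sum>a\<in>Basis. pd a (pd a \<nu>) p) + (\<Sum>a\<in>Basis. pd a \<nu> p \<bullet> a)"
		by (simp add: sum.distrib inner_sum_right)
	then show ?thesis unfolding laplacian_nu[OF p] trace_pd_nu[OF p] using height_S_eq[OF p] kappa_eq[OF p] by simp
qed

text \<open>The position vector has divergence m and pairs with \<open>mH\<close> to m k h. This
  makes 1 + k h an admissible test function.\<close>

lemma minkowski: "(LINT p|vM. 1 + k * h p) = 0"
proof -
	have "(LINT p|vM. (\<Sum>b\<in>Basis. pd b \<phi> p \<bullet> b)) = (LINT p|vM. real CARD('m))"
		by (rule int_cong) (auto simp: pd_phi trace_P)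
	moreover have "(LINT p|vM. \<phi> p \<bullet> mH p) = (LINT p|vM. real CARD('m) * (k * h p))"
		by (rule int_cong) (auto simp: mH_nu kappa_eq height_def)
	ultimately have "(LINT p|vM. real CARD('m)) + (LINT p|vM. real CARD('m) * (k * h p)) = 0"
		using divergence_theorem[OF smooth_phi] by simp
	moreover have "(LINT p|vM. real CARD('m) * (1 + k * h p)) = (LINT p|vM. real CARD('m)) + (LINT p|vM. real CARD('m) * (k * h p))"
		unfolding distrib_left mult_1_right
		by (intro Bochner_Integration.integral_add smooth_integrable smooth_fun_intros smooth_height)
	ultimately show ?thesis by simp
qed

end

section \<open>The second variation at the height function and its equality case\<close>

locale stable_immersion_S = stable_immersion M A \<phi> \<Omega> \<nu>
	for M :: "'p::t2_space set" and A :: "('p, real ^ 'm::{finite,wellorder}) chart set"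
		and \<phi> :: "'p => 'e::euclidean_space" and \<Omega> :: "'e => 'e list => real" and \<nu> :: "'p => 'e" +
	assumes S: "(LINT p|vM. height_S A \<phi> \<nu> p * (2 + height \<phi> \<nu> p * norm (mean_curvature A \<phi> p))) \<le> 0"
begin

text \<open>The test function \<open>1 + \<parallel>H\<parallel> h\<close> turns the second variation into minus the integral of
	\<open>\<parallel>B\<^sup>\<nu>\<parallel>^2 - m \<parallel>H\<parallel>^2\<close>, up to the term controlled by the hypothesis on \<open>S\<close>.\<close>

lemma N2_min:
	assumes p: "p \<in> M"
	shows "N2 p - real CARD('m) * k^2 = 0"
proof (rule integral_nonneg_eq_0[OF _ _ _ p])
	show "continuous_on M (%p. N2 p - real CARD('m) * k^2)"
		by (intro smooth_fun_continuous smooth_fun_diff smooth_N2 smooth_fun_const)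
	show "0 \<le> N2 q - real CARD('m) * k^2" if "q \<in> M" for q using N2_ge[OF that] kappa_eq[OF that] by simp
	let ?m = "real CARD('m)"
	define f where "f p = 1 + k * h p" for p
	define L where "L p = (\<Sum>a\<in>Basis. pd a (pd a h) p)" for p
	have fs: "smooth f" unfolding f_def[abs_def] by (intro smooth_fun_intros smooth_height)
	have Ls: "smooth L" unfolding L_def[abs_def] by (intro smooth_fun_intros smooth_height)
	have fm: "f \<in> mean_zero M A \<phi>" using fs minkowski by (simp add: mean_zero_def f_def[abs_def])
	have f0: "(LINT p|vM. f p) = 0" using fm by (simp add: mean_zero_def)
	have L0: "(LINT p|vM. L p) = 0" unfolding L_def by (rule laplacian_integral[OF smooth_height])
	have pdf: "pd a f q = k * pd a h q" if "q \<in> M" for a q unfolding f_def[abs_def] using that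
		by (simp add: pd_add smooth_fun_intros smooth_height pd_mult)
	have Lf: "(\<Sum>a\<in>Basis. pd a (pd a f) q) = k * L q" if q: "q \<in> M" for q
	proof -
		have "pd a (pd a f) q = k * pd a (pd a h) q" for a
		proof -
			have "pd a (pd a f) q = pd a (%r. k * pd a h r) q" by (rule pd_cong[OF _ q]) (rule pdf)
			then show ?thesis by (simp add: pd_mult smooth_fun_intros smooth_height q)
		qed
		then show ?thesis by (simp add: L_def sum_distrib_left)
	qed
	have i: "integrable vM (%p. (\<Sum>b\<in>Basis. (pd b f p)^2))" "integrable vM (%p. (f p)^2 * N2 p)"
		unfolding power2_eq_square by (intro smooth_integrable smooth_fun_intros fs smooth_N2)+
	have "0 \<le> (LINT p|vM. (\<Sum>b\<in>Basis. (pd b f p)^2)) - (LINT p|vM. (f p)^2 * N2 p)"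
		using stability_scaled_nu[OF fm] i by simp
	also have "(LINT p|vM. (\<Sum>b\<in>Basis. (pd b f p)^2)) = - (LINT p|vM. f p * (\<Sum>b\<in>Basis. pd b (pd b f) p))"
		unfolding power2_eq_square by (rule green[OF fs fs])
	also have "(LINT p|vM. f p * (\<Sum>b\<in>Basis. pd b (pd b f) p)) = (LINT p|vM. f p * (k * L p))"
		by (rule int_cong) (auto simp: Lf)
	also have "- (LINT p|vM. f p * (k * L p)) - (LINT p|vM. (f p)^2 * N2 p) =
			(LINT p|vM. - (f p * (k * L p)) - (f p)^2 * N2 p)"
	proof -
		have "integrable vM (%p. - (f p * (k * L p)))" by (intro smooth_integrable smooth_fun_intros fs Ls)
		then show ?thesis using i(2) by simp
	qed
	\<comment> \<open>The Laplacian of h gives f N2 = N2 - m k^2 - k S - k L. Used for both factors f,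
	  it leaves S with the weight 1 + f = 2 + k h, while f and L integrate to 0.\<close>
	also have "... = (LINT p|vM. (?m * k^2 * f p + k * L p) + (k * (hS p * (2 + h p * k)) - (N2 p - ?m * k^2)))"
	proof (rule int_cong[OF refl])
		fix q assume "q \<in> space vM"
		then have q: "q \<in> M" by simp
		have e: "L q = - (?m * k) - hS q - h q * N2 q" unfolding L_def by (rule laplacian_height[OF q])
		show "- (f q * (k * L q)) - (f q)^2 * N2 q =
				(?m * k^2 * f q + k * L q) + (k * (hS q * (2 + h q * k)) - (N2 q - ?m * k^2))"
			unfolding e f_def by (simp add: power2_eq_square algebra_simps)
	qed
	also have "... = (LINT p|vM. ?m * k^2 * f p + k * L p) + (LINT p|vM. k * (hS p * (2 + h p * k)) - (N2 p - ?m * k^2))"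
		by (intro Bochner_Integration.integral_add smooth_integrable smooth_fun_intros fs Ls smooth_N2 smooth_height smooth_height_S)
	also have "(LINT p|vM. ?m * k^2 * f p + k * L p) = (LINT p|vM. ?m * k^2 * f p) + (LINT p|vM. k * L p)"
		by (intro Bochner_Integration.integral_add smooth_integrable smooth_fun_intros fs Ls)
	also have "(LINT p|vM. k * (hS p * (2 + h p * k)) - (N2 p - ?m * k^2)) =
			(LINT p|vM. k * (hS p * (2 + h p * k))) - (LINT p|vM. N2 p - ?m * k^2)"
		by (intro Bochner_Integration.integral_diff smooth_integrable smooth_fun_intros smooth_N2 smooth_height smooth_height_S)
	also have "(LINT p|vM. k * (hS p * (2 + h p * k))) = k * (LINT p|vM. hS p * (2 + h p * k))" by simp
	also have "(LINT p|vM. hS p * (2 + h p * k)) = (LINT p|vM. hS p * (2 + h p * norm (mcv p)))"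
		by (rule int_cong) (auto simp: kappa_eq[symmetric] \<kappa>_def)
	finally show "(LINT p|vM. N2 p - ?m * k^2) \<le> 0"
		using f0 L0 mult_nonneg_nonpos[OF less_imp_le[OF k_pos] S] by simp
qed

lemma pd_nu:
	assumes p: "p \<in> M"
	shows "pd a \<nu> p = - k *R P p a"
proof -
	have "(\<Sum>a\<in>Basis. (pd a \<nu> p + k *R P p a) \<bullet> (pd a \<nu> p + k *R P p a)) = 0"
		using N2_eq[OF p] N2_min[OF p] kappa_eq[OF p] by simp
	then have b: "pd b \<nu> p + k *R P p b = 0" if "b \<in> Basis" for b
		using that by (subst (asm) sum_nonneg_eq_0_iff) auto
	have l: "linear (%a. pd a \<nu> p + k *R P p a)"
		using linear_compose_add[OF linear_pd[OF smooth_nu p] linear_compose_scale_right[OF linear_P[OF p]]] by simp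
	have "pd a \<nu> p + k *R P p a = 0" by (subst linear_euclidean_expand[OF l]) (simp add: b)
	then show ?thesis by (simp add: add_eq_0_iff)
qed

lemma umbilical: "pseudo_umbilical M A \<phi>" unfolding pseudo_umbilical_def
proof (intro ballI)
	fix p u v assume p: "p \<in> M" and u: "u \<in> TM p" and v: "v \<in> TM p"
	have "second_ff A \<phi> p u v \<bullet> mcv p = k * (Q u v p \<bullet> \<nu> p)"
		by (simp add: second_ff_eq[OF p u v] mean_curvature_nu[OF p] kappa_eq[OF p])
	also have "Q u v p \<bullet> \<nu> p = k * (u \<bullet> v)" by (simp add: Q_nu[OF p] pd_nu[OF p] P_id[OF p u])
	finally show "second_ff A \<phi> p u v \<bullet> mcv p = (norm (mcv p))^2 * (u \<bullet> v)"
		using kappa_eq[OF p] by (simp add: \<kappa>_def power2_eq_square)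
qed

text \<open>With d\<nu> = -k P the first term of \<open>height_S_eq\<close> is k times \<phi>
  \<bullet> \<open>mH\<close>, that is m k^2 h, and cancels h N2.\<close>

lemma height_S_0:
	assumes p: "p \<in> M"
	shows "hS p = 0"
proof -
	have "(\<Sum>a\<in>Basis. Q a (pd a \<nu> p) p) = - k *R mH p"
		unfolding mH_eq[OF p] by (simp add: pd_nu[OF p] linear_neg[OF linear_Q2[OF p]] linear_scale[OF linear_Q2[OF p]] scaleR_sum_right sum_negf)
	then show ?thesis
		unfolding height_S_eq[OF p] using N2_min[OF p] by (simp add: mH_nu[OF p] kappa_eq[OF p] height_def power2_eq_square)
qed

text \<open>Centre of the sphere of radius 1 / k on which \<phi> takes its values.\<close>

definition cen :: 'e where "cen = \<phi> (SOME p. p \<in> M) + (1 / k) *R \<nu> (SOME p. p \<in> M)"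

lemma phi_eq:
	assumes p: "p \<in> M"
	shows "\<phi> p = cen - (1 / k) *R \<nu> p"
proof -
	let ?f = "%p. \<phi> p + (1 / k) *R \<nu> p"
	have s: "smooth ?f" by (intro smooth_fun_intros smooth_nu)
	have "pd w ?f q = 0" if q: "q \<in> M" for w q
		using k_pos by (simp add: pd_add[OF smooth_phi _ q] smooth_fun_intros smooth_nu pd_linear[OF smooth_nu bounded_linear_scaleR_right q] pd_phi[OF q] pd_nu[OF q])
	moreover have "(SOME p. p \<in> M) \<in> M" using M_nonempty by (simp add: some_in_eq)
	ultimately have "?f p = cen" unfolding cen_def by (rule constant_on_connected[OF connected_M s _ p])
	then show ?thesis by (simp add: algebra_simps)
qed

end


section \<open>The cone extension\<close>

lemma second_countable_top_of_set: "second_countable (top_of_set (S :: 'a::second_countable_topology set))"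
proof (rule second_countable_subtopology)
	obtain B :: "'a set set" where "countable B" "\<And>C. C \<in> B ==> open C" "\<And>S. open S ==> \<exists>U. U \<subseteq> B \<and> S = \<Union>U"
		using univ_second_countable by metis
	then show "second_countable (euclidean :: 'a topology)"
		unfolding second_countable_def open_openin[symmetric] by (intro exI[of _ B] conjI allI impI ballI) blast+
qed

lemma second_countable_prod:
	assumes "second_countable X" "second_countable Y"
	shows "second_countable (prod_topology X Y)"
proof -
	obtain B where B: "countable B" "\<And>V. V \<in> B ==> openin X V" "\<And>U x. openin X U ==> x \<in> U ==> \<exists>V\<in>B. x \<in> V \<and> V \<subseteq> U"
		using assms(1) unfolding second_countable_def by meson
	obtain C where C: "countable C" "\<And>V. V \<in> C ==> openin Y V" "\<And>U x. openin Y U ==> x \<in> U ==> \<exists>V\<in>C. x \<in> V \<and> V \<subseteq> U"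
		using assms(2) unfolding second_countable_def by meson
	show ?thesis unfolding second_countable_def
	proof (intro exI conjI allI impI)
		show "countable ((%(U, V). U \<times> V) ` (B \<times> C))" using B(1) C(1) by auto
		show "\<forall>V\<in>(%(U, V). U \<times> V) ` (B \<times> C). openin (prod_topology X Y) V"
			using B(2) C(2) by (auto simp: openin_prod_Times_iff)
		fix W z assume W: "openin (prod_topology X Y) W \<and> z \<in> W"
		then obtain U V where UV: "openin X U" "openin Y V" "fst z \<in> U" "snd z \<in> V" "U \<times> V \<subseteq> W"
			unfolding openin_prod_topology_alt by (metis prod.collapse)
		obtain U' where U': "U' \<in> B" "fst z \<in> U'" "U' \<subseteq> U" using B(3)[OF UV(1,3)] by blast
		obtain V' where V': "V' \<in> C" "snd z \<in> V'" "V' \<subseteq> V" using C(3)[OF UV(2,4)] by blast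
		show "\<exists>S\<in>(%(U, V). U \<times> V) ` (B \<times> C). z \<in> S \<and> S \<subseteq> W"
			using U' V' UV(5) by (intro bexI[of _ "U' \<times> V'"] image_eqI[of _ _ "(U', V')"]) (auto simp: mem_Times_iff)
	qed
qed

context closed_immersion
begin

text \<open>Parameter space of the cone: t = 0 is M, and t = -1 would be the vertex, where the cone
  map ceases to be an immersion. A product is used because \<phi> is only known to be an immersion
  here.\<close>

definition cyl :: "('p \<times> real) set" where "cyl = M \<times> {-1<..}"

definition cyl_chart :: "('p, real ^ 'm::{finite,wellorder}) chart => ('p \<times> real, (real ^ 'm::{finite,wellorder}) \<times> real) chart" where
	"cyl_chart c = (fst c \<times> {-1<..}, %x. (snd c (fst x), snd x))"

definition cyl_atlas :: "('p \<times> real, (real ^ 'm::{finite,wellorder}) \<times> real) chart set" where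
	"cyl_atlas = cyl_chart ` A"

lemma fst_cyl_chart [simp]: "fst (cyl_chart c) = fst c \<times> {-1<..}"
	and snd_cyl_chart [simp]: "snd (cyl_chart c) x = (snd c (fst x), snd x)"
	by (simp_all add: cyl_chart_def)

lemma cyl_chart_image: "snd (cyl_chart c) ` (U \<times> T) = (snd c ` U) \<times> T" by (auto simp: image_iff)

lemma cyl_inv:
	assumes c: "c \<in> A" "z \<in> im c" "-1 < t"
	shows "inv_into (fst (cyl_chart c)) (snd (cyl_chart c)) (z, t) = (inv_into (fst c) (snd c) z, t)"
proof -
	have inj: "inj_on (snd (cyl_chart c)) (fst (cyl_chart c))" using chart_inj[OF c(1)] by (auto simp: inj_on_def)
	have "snd (cyl_chart c) (inv_into (fst c) (snd c) z, t) = (z, t)" using c(2) by (simp add: f_inv_into_f)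
	then show ?thesis using inv_into_f_f[OF inj, of "(inv_into (fst c) (snd c) z, t)"] chart_inv_in[OF c(1,2)] c(3) by simp
qed

lemma in_cyl_chart:
	"c \<in> A ==> z \<in> im c ==> -1 < t ==> in_chart (cyl_chart c) f (z, t) = f (inv_into (fst c) (snd c) z, t)"
	by (simp add: in_chart_def cyl_inv del: fst_cyl_chart snd_cyl_chart)

lemma smooth_on_fst: "open S ==> smooth_on T f ==> open T ==> S \<subseteq> T \<times> UNIV ==> smooth_on S (%x. f (fst x))"
	for f :: "'a::euclidean_space => 'b::euclidean_space" and S :: "('a \<times> 'c::euclidean_space) set"
	by (rule smooth_on_compose[OF _ smooth_on_linear[OF bounded_linear_fst]]) auto

lemma smooth_manifold_cyl: "smooth_manifold cyl cyl_atlas" unfolding smooth_manifold_def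
proof (intro conjI ballI)
	show "cyl \<noteq> {}" using M_nonempty by (auto simp: cyl_def intro: exI[of _ 0])
	show "second_countable (top_of_set cyl)"
		using second_countable_prod[of "top_of_set M" "top_of_set {-1::real<..}"] second_countable_top_of_set[of "{-1::real<..}"] closed
		by (simp add: cyl_def closed_manifold_def smooth_manifold_def)
	show "\<Union> (fst ` cyl_atlas) = cyl" using charts_cover by (auto simp: cyl_def cyl_atlas_def)
	fix c' assume "c' \<in> cyl_atlas"
	then obtain c where c: "c \<in> A" "c' = cyl_chart c" by (auto simp: cyl_atlas_def)
	show "openin (top_of_set cyl) (fst c')" unfolding c(2) cyl_def fst_cyl_chart
		by (rule openin_Times[OF chart_openin[OF c(1)]]) simp
	show op: "open (snd c' ` fst c')" unfolding c(2) fst_cyl_chart cyl_chart_image by (rule open_Times[OF chart_open[OF c(1)]]) simp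
	have h: "continuous_on (fst c) (snd c)" "continuous_on (im c) (inv_into (fst c) (snd c))"
		using chart_homeo[OF c(1)] by (auto simp: homeomorphism_def)
	show "homeomorphism (fst c') (snd c' ` fst c') (snd c') (inv_into (fst c') (snd c'))" unfolding homeomorphism_def
	proof (intro conjI ballI)
		have inj: "inj_on (snd c') (fst c')" using chart_inj[OF c(1)] c(2) by (auto simp: inj_on_def)
		show "inv_into (fst c') (snd c') (snd c' x) = x" if "x \<in> fst c'" for x by (rule inv_into_f_f[OF inj that])
		show "inv_into (fst c') (snd c') ` snd c' ` fst c' = fst c'" by (rule inv_into_image_cancel[OF inj order_refl])
		show "snd c' (inv_into (fst c') (snd c') y) = y" if "y \<in> snd c' ` fst c'" for y by (rule f_inv_into_f[OF that])
		have "continuous_on (fst c \<times> {-1<..}) (%x. (snd c (fst x), snd x))"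
			by (intro continuous_on_Pair continuous_on_compose2[OF h(1)] continuous_intros) auto
		then show "continuous_on (fst c') (snd c')" unfolding c(2) cyl_chart_def by simp
		have "continuous_on ((im c) \<times> {-1<..}) (%x. (inv_into (fst c) (snd c) (fst x), snd x :: real))"
			by (intro continuous_on_Pair continuous_on_compose2[OF h(2)] continuous_intros) auto
		then have "continuous_on ((im c) \<times> {-1<..}) (inv_into (fst c') (snd c'))"
			by (rule continuous_on_eq) (auto simp: c(2) cyl_inv[OF c(1)] simp del: fst_cyl_chart snd_cyl_chart)
		then show "continuous_on (snd c' ` fst c') (inv_into (fst c') (snd c'))" unfolding c(2) fst_cyl_chart cyl_chart_image .
	qed simp
	fix d' assume "d' \<in> cyl_atlas"
	then obtain d where d: "d \<in> A" "d' = cyl_chart d" by (auto simp: cyl_atlas_def)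
	have im: "snd c' ` (fst c' \<inter> fst d') = snd c ` (fst c \<inter> fst d) \<times> {-1<..}"
		using cyl_chart_image[of c "fst c \<inter> fst d" "{-1<..}"] by (simp add: c(2) d(2) Times_Int_Times)
	have o: "open (snd c ` (fst c \<inter> fst d))" by (rule chart_inter_open[OF c(1) d(1)])
	then have o2: "open (snd c ` (fst c \<inter> fst d) \<times> {-1::real<..})" by (intro open_Times) auto
	have "smooth_on (snd c ` (fst c \<inter> fst d) \<times> {-1::real<..}) (%x. (in_chart c (snd d) (fst x), snd x))"
	proof (rule smooth_on_Pair[OF _ _ o2])
		show "smooth_on (snd c ` (fst c \<inter> fst d) \<times> {-1::real<..}) (%x. in_chart c (snd d) (fst x))"
			by (rule smooth_on_fst[OF o2 chart_trans[OF c(1) d(1)] o]) auto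
	qed (rule smooth_on_linear[OF bounded_linear_snd])
	moreover have "(in_chart c (snd d) (fst x), snd x) = in_chart c' (snd d') x"
		if x: "x \<in> snd c ` (fst c \<inter> fst d) \<times> {-1::real<..}" for x
	proof -
		have "fst x \<in> im c" "-1 < snd x" using x by (auto simp: mem_Times_iff)
		from in_cyl_chart[OF c(1) this, of "snd d'"] show ?thesis by (simp add: c(2) d(2) in_chart_def[of c] del: fst_cyl_chart)
	qed
	ultimately show "smooth_on (snd c' ` (fst c' \<inter> fst d')) (in_chart c' (snd d'))"
		unfolding im by (rule smooth_on_cong[OF o2, THEN iffD1, rotated])
qed

lemma smooth_map_cyl: "smooth_map M A cyl cyl_atlas (%p. (p, 0))" unfolding smooth_map_def
proof (intro conjI ballI)
	show "continuous_on M (%p. (p, 0::real))" by (intro continuous_intros)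
	show "(%p. (p, 0)) ` M \<subseteq> cyl" by (auto simp: cyl_def)
	fix c d' assume c: "c \<in> A" and "d' \<in> cyl_atlas"
	then obtain d where d: "d \<in> A" "d' = cyl_chart d" by (auto simp: cyl_atlas_def)
	have im: "fst c \<inter> (%p. (p, 0)) -` fst d' = fst c \<inter> fst d" by (auto simp: d(2))
	have o: "open (snd c ` (fst c \<inter> fst d))" by (rule chart_inter_open[OF c d(1)])
	have "smooth_on (snd c ` (fst c \<inter> fst d)) (%x. (in_chart c (snd d) x, 0::real))"
		by (intro smooth_on_Pair chart_trans c d o smooth_on_const)
	then show "smooth_on (snd c ` (fst c \<inter> (%p. (p, 0)) -` fst d')) (in_chart c (snd d' \<circ> (%p. (p, 0))))"
		unfolding im by (rule smooth_on_cong[OF o, THEN iffD1, rotated]) (simp add: d(2) in_chart_def)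
qed

lemma chart_at_cyl:
	assumes "x \<in> cyl"
	obtains c where "c \<in> A" "fst x \<in> fst c" "chart_at cyl_atlas x = cyl_chart c"
proof -
	have "\<exists>c'. c' \<in> cyl_atlas \<and> x \<in> fst c'"
		using smooth_manifold_cyl assms unfolding smooth_manifold_def by blast
	from someI_ex[OF this] have *: "chart_at cyl_atlas x \<in> cyl_atlas" "x \<in> fst (chart_at cyl_atlas x)"
		by (auto simp: chart_at_def)
	then obtain c where c: "c \<in> A" "chart_at cyl_atlas x = cyl_chart c" by (auto simp: cyl_atlas_def)
	show ?thesis by (rule that[OF c(1) _ c(2)]) (use * c(2) in \<open>simp add: mem_Times_iff\<close>)
qed

end


section \<open>Geometry of the cone\<close>

context stable_immersion_S
begin

abbreviation cone :: "'p \<times> real => 'e" where "cone x \<equiv> cen + (1 + snd x) *R (\<phi> (fst x) - cen)"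

lemma phi_cen: "p \<in> M ==> \<phi> p - cen = - (1 / k) *R \<nu> p" using phi_eq by simp

lemma subspace_EM: "subspace (EN p)" by (simp add: EM_def)

lemma mem_EM: "p \<in> M ==> w \<in> EN p \<longleftrightarrow> (\<exists>s. w - s *R \<nu> p \<in> TM p)"
	by (simp add: EM_def span_insert span_eq_iff[THEN iffD2, OF subspace_Tan])

lemma proj_EM:
	assumes p: "p \<in> M"
	shows "proj (EN p) w = P p w + (w \<bullet> \<nu> p) *R \<nu> p"
proof (rule proj_unique[OF subspace_EM])
	show "P p w + (w \<bullet> \<nu> p) *R \<nu> p \<in> EN p"
		unfolding mem_EM[OF p] by (rule exI[of _ "w \<bullet> \<nu> p"]) (simp add: P_in[OF p])
	fix v assume "v \<in> EN p"
	then obtain s where s: "v - s *R \<nu> p \<in> TM p" unfolding mem_EM[OF p] by blast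
	define u where "u = v - s *R \<nu> p"
	have v: "v = u + s *R \<nu> p" by (simp add: u_def)
	have u: "u \<in> TM p" using s by (simp add: u_def)
	have "(w - P p w) \<bullet> u = 0" by (rule proj_orth[OF subspace_Tan[OF p] u])
	moreover have "\<nu> p \<bullet> u = 0" "P p w \<bullet> \<nu> p = 0" using Tan_nu[OF p u] Tan_nu[OF p P_in[OF p]] by (simp_all add: inner_commute)
	ultimately show "(w - (P p w + (w \<bullet> \<nu> p) *R \<nu> p)) \<bullet> v = 0"
		by (simp add: v inner_add_right inner_diff_left inner_add_left nu_nu[OF p])
qed

lemma parallel_constant:
	assumes "parallel_form (CARD('m) + 1) \<Omega>" "length us = CARD('m) + 1"
	shows "\<Omega> x us = \<Omega> y us"
proof -
	have "FD (%y. \<Omega> y us) x = (%w. 0)" for x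
		using assms by (simp add: parallel_form_def nabla_form_def fun_eq_iff)
	then have "((%x. \<Omega> x us) has_derivative (%w. 0)) (at x within UNIV)" for x
		using smooth_on_has_derivative[of UNIV "%y. \<Omega> y us" x] form assms
		by (simp add: smooth_form_def)
	then have "\<exists>c. \<forall>x\<in>UNIV. \<Omega> x us = c" by (intro has_derivative_zero_constant) auto
	then show ?thesis by auto
qed

text \<open>A parallel \<Omega> has constant coefficients, so the plane calibrated at \<phi> p is
  calibrated at every point x; the tangent plane of the cone is the same along a whole ray.\<close>

lemma calibrated_EM:
	assumes "parallel_form (CARD('m) + 1) \<Omega>" and p: "p \<in> M"
	shows "calibrated_plane (CARD('m) + 1) (\<Omega> x) (EN p)"
	unfolding calibrated_plane_def
proof (intro exI conjI)
	note fr = ortho_frameD[OF frame[OF p]]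
	let ?us = "\<nu> p # frm p"
	show "length ?us = CARD('m) + 1" by (simp add: fr(1))
	show "orthonormal ?us" using fr(2) Tan_nu[OF p fr(4)] nu_nu[OF p] fr(1)
		by (auto simp: orthonormal_def nth_Cons' inner_commute split: if_splits)
	show "\<bar>\<Omega> x ?us\<bar> = 1"
		using parallel_constant[OF assms(1), of ?us x "\<phi> p"] Omega_direct[OF p direct_frame[OF p]] fr(1) by simp
	show "span (set ?us) = EN p" unfolding EM_def fr(3)[symmetric] by (simp add: span_insert span_span)
qed

lemma cone_derivative:
	assumes c: "c \<in> A" and z: "z \<in> im c" "-1 < t"
	shows "(in_chart (cyl_chart c) cone has_derivative
		(%v. (1 + t) *R dphi c z (fst v) + snd v *R (in_chart c \<phi> z - cen))) (at (z, t))"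
proof -
	have o: "open ((im c) \<times> {-1::real<..})" by (intro open_Times chart_open c) simp
	have "((%x. in_chart c \<phi> (fst x)) has_derivative (%v. dphi c z (fst v))) (at (z, t))"
		by (rule has_derivative_compose[of fst fst "(z,t)" UNIV "in_chart c \<phi>" "dphi c z"])
			(use dch_has_derivative[OF smooth_phi c z(1)] in \<open>auto intro: derivative_intros\<close>)
	then have "((%x. cen + (1 + snd x) *R (in_chart c \<phi> (fst x) - cen)) has_derivative
			(%v. (1 + t) *R dphi c z (fst v) + snd v *R (in_chart c \<phi> z - cen))) (at (z, t))"
		by (auto intro!: derivative_eq_intros)
	then show ?thesis
		by (rule has_derivative_transform_within_open[OF _ o]) (use z in \<open>auto simp: in_cyl_chart[OF c] in_chart_def[of c]\<close>)
qed

lemmas cone_frechet = frechet_derivative_eqI[OF cone_derivative]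

lemma smooth_fun_cone: "smooth_fun cyl_atlas cone" unfolding smooth_fun_def
proof
	fix c' assume "c' \<in> cyl_atlas"
	then obtain c where c: "c \<in> A" "c' = cyl_chart c" by (auto simp: cyl_atlas_def)
	have o: "open ((im c) \<times> {-1::real<..})" by (intro open_Times chart_open c) simp
	have "smooth_on ((im c) \<times> {-1<..}) (%x. cen + (1 + snd x) *R (in_chart c \<phi> (fst x) - cen))"
		by (intro smooth_on_add smooth_on_scaleR smooth_on_diff smooth_on_const smooth_on_linear[OF bounded_linear_snd]
				smooth_on_fst[OF o smooth_fun_chart[OF smooth_phi c(1)] chart_open[OF c(1)]] o) auto
	then have "smooth_on ((im c) \<times> {-1<..}) (in_chart c' cone)"
		by (rule smooth_on_cong[OF o, THEN iffD1, rotated]) (auto simp: c(2) in_cyl_chart[OF c(1)] in_chart_def[of c])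
	then show "smooth_on (snd c' ` fst c') (in_chart c' cone)" unfolding c(2) fst_cyl_chart cyl_chart_image .
qed

lemma range_cone:
	assumes c: "c \<in> A" "p \<in> fst c" and t: "-1 < t"
	shows "range (FD (in_chart (cyl_chart c) cone) (snd c p, t)) = EN p" (is "range ?D = _")
proof -
	have p: "p \<in> M" by (rule chart_in_M[OF c])
	have z: "snd c p \<in> im c" using c by auto
	note lin = dch_linear[OF smooth_phi c(1) z]
	have D: "?D v = (1 + t) *R dphi c (snd c p) (fst v) + (- snd v / k) *R \<nu> p" for v
		using c by (simp add: cone_frechet[OF c(1) z t] phi_cen[OF p])
	show ?thesis
	proof (intro subset_antisym subsetI)
		fix w assume "w \<in> range ?D"
		then obtain v where v: "w = ?D v" by blast
		show "w \<in> EN p" unfolding mem_EM[OF p] by (rule exI[of _ "- snd v / k"])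
				(simp add: v D Tan_chart[OF c] linear_scale[OF lin, symmetric])
	next
		fix w assume "w \<in> EN p"
		then obtain s where "w - s *R \<nu> p \<in> TM p" unfolding mem_EM[OF p] by blast
		then obtain a where a: "w - s *R \<nu> p = dphi c (snd c p) a" unfolding Tan_chart[OF c] by blast
		\<comment> \<open>As \<phi> - cen is -\<nu> / k, a component s \<nu> needs the parameter speed -k
		  s.\<close>
		have "?D ((1 / (1 + t)) *R a, - k * s) = w" using t k_pos a by (simp add: D linear_scale[OF lin] flip: a)
		from this[symmetric] show "w \<in> range ?D" by (rule range_eqI)
	qed
qed

lemma immersion_cone: "immersion cyl_atlas cone" unfolding immersion_def
proof (intro conjI ballI)
	show "smooth_fun cyl_atlas cone" by (rule smooth_fun_cone)
	fix c' x assume "c' \<in> cyl_atlas" and x: "x \<in> fst c'"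
	then obtain c where c: "c \<in> A" "c' = cyl_chart c" by (auto simp: cyl_atlas_def)
	have x: "fst x \<in> fst c" "-1 < snd x" using x c(2) by (simp_all add: mem_Times_iff)
	let ?D = "FD (in_chart c' cone) (snd c' x)"
	have p: "fst x \<in> M" by (rule chart_in_M[OF c(1) x(1)])
	have z: "snd c (fst x) \<in> im c" using x by auto
	have D: "?D v = (1 + snd x) *R dphi c (snd c (fst x)) (fst v) + (- snd v / k) *R \<nu> (fst x)" for v
		using c x by (simp add: cone_frechet[OF c(1) z x(2)] phi_cen[OF p])
	have "linear ?D" unfolding c(2) snd_cyl_chart cone_frechet[OF c(1) z x(2)]
		by (rule has_derivative_linear[OF cone_derivative[OF c(1) z x(2)]])
	moreover have "v = 0" if v: "?D v = 0" for v
	proof -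
		have "dphi c (snd c (fst x)) (fst v) \<bullet> \<nu> (fst x) = 0"
			by (rule Tan_nu[OF p]) (simp add: Tan_chart[OF c(1) x(1)])
		then have "snd v = 0"
			using arg_cong[OF v, of "%w. w \<bullet> \<nu> (fst x)"] k_pos by (simp add: D inner_add_left inner_diff_left nu_nu[OF p])
		then have "dphi c (snd c (fst x)) (fst v) = dphi c (snd c (fst x)) 0"
			using v x(2) linear_0[OF dch_linear[OF smooth_phi c(1) z]] by (simp add: D)
		with \<open>snd v = 0\<close> show "v = 0" using injD[OF dch_phi_inj[OF c(1) x(1)]] by (simp add: prod_eq_iff)
	qed
	ultimately show "inj ?D" by (simp add: linear_injective_0)
qed

lemma coord_cyl: "chart_at cyl_atlas x = cyl_chart c ==> coord cyl_atlas x = (snd c (fst x), snd x)"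
	by (simp add: coord_def)

lemma Tan_cone:
	assumes "x \<in> cyl"
	shows "Tan cyl_atlas cone x = EN (fst x)"
proof -
	obtain c where c: "c \<in> A" "fst x \<in> fst c" "chart_at cyl_atlas x = cyl_chart c" by (rule chart_at_cyl[OF assms])
	show ?thesis using range_cone[OF c(1,2), of "snd x"] assms
		by (simp add: Tan_def dmap_def c(3) coord_cyl[OF c(3)] cyl_def mem_Times_iff)
qed

lemma perp_cone:
	assumes "x \<in> cyl"
	shows "perp cyl_atlas cone x w = w - P (fst x) w - (w \<bullet> \<nu> (fst x)) *R \<nu> (fst x)"
proof -
	have "fst x \<in> M" using assms by (auto simp: cyl_def)
	then show ?thesis by (simp add: perp_def Tan_cone[OF assms] proj_perp[OF subspace_EM] proj_EM)
qed

lemma dmap_cone_components: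
	"u \<in> Tan cyl_atlas cone x ==> dmap cyl_atlas cone x (components cyl_atlas cone x u) = u"
	by (simp add: components_def Tan_def f_inv_into_f)

lemma extension_cone: "extension M A \<phi> \<nu> cyl cyl_atlas cone (%p. (p, 0))"
proof -
	have "\<forall>p\<in>M. cone (p, 0) = \<phi> p \<and> Tan cyl_atlas cone (p, 0) = EN p"
		by (auto simp: Tan_cone cyl_def)
	then show ?thesis unfolding extension_def using smooth_manifold_cyl immersion_cone smooth_map_cyl by (simp add: inj_on_def)
qed

lemma calibrated_cone: "parallel_form (CARD('m) + 1) \<Omega> ==> calibrated_submanifold \<Omega> cyl cyl_atlas cone"
	unfolding calibrated_submanifold_def
proof
	fix x assume "parallel_form (CARD('m) + 1) \<Omega>" "x \<in> cyl"
	then show "calibrated_plane DIM((real ^ 'm::{finite,wellorder}) \<times> real) (\<Omega> (cone x)) (Tan cyl_atlas cone x)"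
		using calibrated_EM[of "fst x"] by (simp add: Tan_cone cyl_def mem_Times_iff)
qed

text \<open>Rays are straight and tangent planes are constant along them, so only the tangential
  parts of u and v count, and only the component of B orthogonal to \<nu> is normal to the cone.
  Each argument contributes 1 / (1 + t), the dilated second derivative a factor 1 + t.\<close>

lemma second_ff_cone:
	assumes x: "x \<in> cyl" and uv: "u \<in> EN (fst x)" "v \<in> EN (fst x)"
	shows "second_ff cyl_atlas cone x u v = (1 / (1 + snd x)) *R
		(Q u (P (fst x) v) (fst x) - (Q u (P (fst x) v) (fst x) \<bullet> \<nu> (fst x)) *R \<nu> (fst x))"
proof -
	obtain c where c: "c \<in> A" "fst x \<in> fst c" "chart_at cyl_atlas x = cyl_chart c" by (rule chart_at_cyl[OF x])
	define p t where "p = fst x" and "t = snd x"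
	have p: "p \<in> M" and t: "-1 < t" using x by (auto simp: cyl_def p_def t_def)
	have cp: "p \<in> fst c" using c by (simp add: p_def)
	let ?z = "snd c p"
	have z: "?z \<in> im c" using cp by auto
	have co: "coord cyl_atlas x = (?z, t)" using coord_cyl[OF c(3)] by (simp add: p_def t_def)
	note lP = linear_P[OF p]
	define a b where "a = components cyl_atlas cone x u" and "b = components cyl_atlas cone x v"
	let ?d = "dphi c ?z"
	define B where "B = FD (%z. dphi c z (fst b)) ?z"
	have dP: "P p (?d y) = ?d y" for y by (rule P_id[OF p]) (simp add: Tan_chart[OF c(1) cp])
	have dm: "(1 + t) *R ?d (fst (components cyl_atlas cone x w)) +
			(- snd (components cyl_atlas cone x w) / k) *R \<nu> p = w" if "w \<in> EN p" for w
		using dmap_cone_components[of w x] that Tan_cone[OF x] in_chart_snd[OF c(1) cp, of \<phi>]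
		by (simp add: dmap_def c(3) co cone_frechet[OF c(1) z t] phi_cen[OF p] flip: p_def)
	have Pw: "?d (fst (components cyl_atlas cone x w)) = (1 / (1 + t)) *R P p w" if "w \<in> EN p" for w
		using arg_cong[OF dm[OF that], of "%x. (1 / (1 + t)) *R P p x"] t
		by (simp add: linear_add[OF lP] linear_scale[OF lP] linear_diff[OF lP] P_nu[OF p] dP flip: scaleR_minus_left)
	have o: "open ((im c) \<times> {-1::real<..})" by (intro open_Times chart_open c) simp
	have zt: "(?z, t) \<in> (im c) \<times> {-1::real<..}" using z t by simp
	have dB: "((%z. dphi c z (fst b)) has_derivative B) (at ?z)"
		unfolding B_def by (rule smooth_on_has_derivative[OF smooth_on_dch[OF smooth_phi c(1)] chart_open[OF c(1)] z])
	have d1: "((%y. dphi c (fst y) (fst b)) has_derivative (%v. B (fst v))) (at (?z, t))"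
		by (rule has_derivative_compose[of fst fst "(?z,t)" UNIV]) (use dB in \<open>auto intro: derivative_intros\<close>)
	have d2: "((%y. in_chart c \<phi> (fst y)) has_derivative (%v. ?d (fst v))) (at (?z, t))"
		by (rule has_derivative_compose[of fst fst "(?z,t)" UNIV "in_chart c \<phi>" ?d])
			(use dch_has_derivative[OF smooth_phi c(1) z] in \<open>auto intro: derivative_intros\<close>)
	have "((%y. (1 + snd y) *R dphi c (fst y) (fst b) + snd b *R (in_chart c \<phi> (fst y) - cen)) has_derivative
			(%v. (1 + t) *R B (fst v) + snd v *R ?d (fst b) + snd b *R ?d (fst v))) (at (?z, t))"
		using d1 d2 by (auto intro!: derivative_eq_intros)
	then have "((%y. FD (in_chart (cyl_chart c) cone) y b) has_derivative
			(%v. (1 + t) *R B (fst v) + snd v *R ?d (fst b) + snd b *R ?d (fst v))) (at (?z, t))"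
		by (rule has_derivative_transform_within_open[OF _ o zt]) (auto simp: cone_frechet[OF c(1)])
	from frechet_derivative_eqI[OF this]
	have amb: "ambient_deriv cyl_atlas cone x u v = (1 + t) *R B (fst a) + snd a *R ?d (fst b) + snd b *R ?d (fst a)"
		by (simp add: ambient_deriv_def c(3) co a_def b_def)
	have Q: "B (fst a) - P p (B (fst a)) = (1 / (1 + t)^2) *R Q u (P p v) p"
		unfolding B_def second_derivative_chart[OF c(1) cp] a_def b_def Pw[OF uv(1)[folded p_def]] Pw[OF uv(2)[folded p_def]]
		by (simp add: linear_scale[OF linear_Q1[OF p]] linear_scale[OF linear_Q2[OF p]] Q_P1[OF p] power2_eq_square)
	have dn: "?d y \<bullet> \<nu> p = 0" for y by (rule Tan_nu[OF p]) (simp add: Tan_chart[OF c(1) cp])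
	have Bn: "B (fst a) \<bullet> \<nu> p = (1 / (1 + t)^2) * (Q u (P p v) p \<bullet> \<nu> p)"
		using arg_cong[OF Q, of "%w. w \<bullet> \<nu> p"] Tan_nu[OF p P_in[OF p]] by (simp add: inner_diff_left)
	have "second_ff cyl_atlas cone x u v = (1 + t) *R (B (fst a) - P p (B (fst a))) - ((1 + t) * (B (fst a) \<bullet> \<nu> p)) *R \<nu> p"
		unfolding second_ff_def perp_cone[OF x] amb p_def[symmetric]
		by (simp add: linear_add[OF lP] linear_scale[OF lP] dP inner_add_left dn scaleR_diff_right)
	also have "... = (1 / (1 + t)) *R (Q u (P p v) p - (Q u (P p v) p \<bullet> \<nu> p) *R \<nu> p)"
		unfolding Q Bn using t by (simp add: power2_eq_square scaleR_diff_right)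
	finally show ?thesis by (simp add: p_def t_def)
qed

text \<open>Up to a factor, its mean curvature is the component of \<open>mH\<close> orthogonal to
  \<nu>, and H is a multiple of \<nu>.\<close>

lemma minimal_cone: "minimal cyl cyl_atlas cone" unfolding minimal_def
proof
	fix x assume x: "x \<in> cyl"
	define p where "p = fst x"
	have p: "p \<in> M" using x by (auto simp: cyl_def p_def)
	have TE: "Tan cyl_atlas cone x = EN p" using Tan_cone[OF x] by (simp add: p_def)
	define r where "r u v = Q u (P p v) p - (Q u (P p v) p \<bullet> \<nu> p) *R \<nu> p" for u v
	define T where "T w = w - (w \<bullet> \<nu> p) *R \<nu> p" for w
	have T: "linear T" by (rule linearI) (simp_all add: T_def inner_add_left algebra_simps)
	have r1: "linear (%u. r u v)" for v
		using linear_compose[OF linear_Q1[OF p] T, of "P p v"] by (simp add: r_def T_def o_def)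
	have r2: "linear (r u)" for u
		using linear_compose[OF linear_compose[OF linear_P[OF p] linear_Q2[OF p]] T, of u] by (simp add: r_def[abs_def] T_def o_def)
	have "\<nu> p \<notin> TM p" using Tan_nu[OF p, of "\<nu> p"] nu_nu[OF p] by auto
	then have dimE: "dim (EN p) = CARD('m) + 1"
		using dim_insert[of "\<nu> p" "TM p"] dim_Tan[OF p] span_eq_iff[THEN iffD2, OF subspace_Tan[OF p]] by (simp add: EM_def)
	have fr: "ortho_frame cyl_atlas cone x (some_frame cyl_atlas cone x)" unfolding some_frame_def
	proof (rule someI_ex)
		obtain es where "length es = dim (EN p)" "orthonormal es" "span (set es) = EN p"
			using orthonormal_basis_list[OF subspace_EM] by blast
		then show "\<exists>es. ortho_frame cyl_atlas cone x es" unfolding ortho_frame_def TE dimE by auto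
	qed
	define es where "es = some_frame cyl_atlas cone x"
	have es: "length es = CARD('m) + 1" "orthonormal es" "span (set es) = EN p"
		using fr by (auto simp: ortho_frame_def TE es_def)
	have "(\<Sum>i<CARD('m) + 1. second_ff cyl_atlas cone x (es ! i) (es ! i)) =
			(1 / (1 + snd x)) *R (\<Sum>i<CARD('m) + 1. r (es ! i) (es ! i))"
		unfolding scaleR_sum_right
	proof (rule sum.cong[OF refl])
		fix i assume "i \<in> {..<CARD('m) + 1}"
		then have "es ! i \<in> EN p" using es span_base[of "es ! i" "set es"] by auto
		then show "second_ff cyl_atlas cone x (es ! i) (es ! i) = (1 / (1 + snd x)) *R r (es ! i) (es ! i)"
			using second_ff_cone[OF x, of "es ! i" "es ! i"] by (simp add: r_def p_def)
	qed
	also have "(\<Sum>i<CARD('m) + 1. r (es ! i) (es ! i)) = (\<Sum>b\<in>Basis. r (proj (EN p) b) (proj (EN p) b))"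
		using trace_orthonormal[OF es(2,3) r1 r2] es(1) by simp
	also have "... = (\<Sum>b\<in>Basis. Q b (P p b) p - (Q b (P p b) p \<bullet> \<nu> p) *R \<nu> p)"
	proof (rule sum.cong[OF refl])
		fix b :: 'e
		have "P p (proj (EN p) b) = P p b"
			by (simp add: proj_EM[OF p] linear_add[OF linear_P[OF p]] linear_scale[OF linear_P[OF p]] P_P[OF p] P_nu[OF p])
		then have "Q (proj (EN p) b) c p = Q b c p" for c using Q_P1[OF p] by metis
		then show "r (proj (EN p) b) (proj (EN p) b) = Q b (P p b) p - (Q b (P p b) p \<bullet> \<nu> p) *R \<nu> p"
			using \<open>P p (proj (EN p) b) = P p b\<close> by (simp add: r_def)
	qed
	also have "... = mH p - (mH p \<bullet> \<nu> p) *R \<nu> p"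
		by (simp add: mH_eq[OF p] sum_subtractf inner_sum_left scaleR_sum_left)
	also have "... = 0" by (simp add: mH_nu[OF p] nu_nu[OF p])
	finally show "mean_curvature cyl_atlas cone x = 0" by (simp add: mean_curvature_def es_def)
qed

lemma second_ff_cone_nu: "p \<in> M ==> second_ff cyl_atlas cone (p, 0) (\<nu> p) (\<nu> p) = 0"
	using second_ff_cone[of "(p, 0)" "\<nu> p" "\<nu> p"]
	by (simp add: cyl_def EM_def span_base P_nu linear_0[OF linear_Q2])

text \<open>Radial curvature of a cone: the coordinate field along the ray has derivative 0 in its
  own direction, and its derivative in direction a, a multiple of d\<phi> a, does not depend on t.
  So both iterated Levi-Civita derivatives vanish.\<close>

lemma ricci_cone:
	assumes p: "p \<in> M"
	shows "ricci cyl_atlas cone (p, 0) (\<nu> p) (\<nu> p) = 0"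
proof -
	have x: "(p, 0) \<in> cyl" using p by (simp add: cyl_def)
	obtain c where c: "c \<in> A" "p \<in> fst c" "chart_at cyl_atlas (p, 0) = cyl_chart c" using chart_at_cyl[OF x] by auto
	have co: "coord cyl_atlas (p, 0) = (snd c p, 0)" using coord_cyl[OF c(3)] by simp
	let ?U = "(im c) \<times> {-1::real<..}"
	have o: "open ?U" by (intro open_Times chart_open c) simp
	have zU: "(snd c p, 0) \<in> ?U" using c by auto
	define F where "F = in_chart (cyl_chart c) cone"
	define b where "b = components cyl_atlas cone (p, 0) (\<nu> p)"
	have DF: "FD F y v = (1 + snd y) *R dphi c (fst y) (fst v) + snd v *R (in_chart c \<phi> (fst y) - cen)"
		if "y \<in> ?U" for y v
		using that cone_frechet[OF c(1), of "fst y" "snd y"] by (auto simp: F_def)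
	have "(0, -k) = b"
	proof -
		have z: "snd c p \<in> im c" using c by auto
		have "dmap cyl_atlas cone (p, 0) (0, - k) = \<nu> p"
			using DF[OF zU, of "(0, -k)"] c k_pos linear_0[OF dch_linear[OF smooth_phi c(1) z]]
			by (simp add: dmap_def c(3) co F_def phi_cen[OF p])
		moreover have "inj (dmap cyl_atlas cone (p, 0))"
			using immersion_cone c by (auto simp: immersion_def dmap_def c(3) coord_def cyl_atlas_def)
		ultimately show ?thesis by (simp add: b_def components_def inv_f_eq)
	qed
	then have b: "b = (0, -k)" by simp
	define Y where "Y = (%z. FD F z b)"
	have Y: "FD Y y v = - k *R dphi c (fst y) (fst v)" if y: "y \<in> ?U" for y v
	proof -
		have z: "fst y \<in> im c" using y by auto
		have "((%y. in_chart c \<phi> (fst y)) has_derivative (%v. dphi c (fst y) (fst v))) (at y)"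
			by (rule has_derivative_compose[of fst fst y UNIV "in_chart c \<phi>" "dphi c (fst y)"])
				(use dch_has_derivative[OF smooth_phi c(1) z] in \<open>auto intro: derivative_intros\<close>)
		then have "((%y. - k *R (in_chart c \<phi> (fst y) - cen)) has_derivative (%v. - k *R dphi c (fst y) (fst v))) (at y)"
			by (auto intro!: derivative_eq_intros)
		then have "(Y has_derivative (%v. - k *R dphi c (fst y) (fst v))) (at y)"
			by (rule has_derivative_transform_within_open[OF _ o y]) (auto simp: Y_def DF b linear_0[OF dch_linear[OF smooth_phi c(1)]])
		then show ?thesis by (simp add: frechet_derivative_eqI)
	qed
	have sub: "subspace (range (FD F y))" if "y \<in> ?U" for y
	proof -
		have "linear (FD F y)"
			using that has_derivative_linear[OF cone_derivative[OF c(1), of "fst y" "snd y"]] cone_frechet[OF c(1), of "fst y" "snd y"]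
			by (auto simp: F_def)
		then show ?thesis by (rule linear_subspace_image[OF _ subspace_UNIV])
	qed
	have L1: "levi_civita F b Y y = 0" if y: "y \<in> ?U" for y
	proof -
		have "FD Y y b = 0" using y linear_0[OF dch_linear[OF smooth_phi c(1)], of "fst y"] by (auto simp: Y b)
		then show ?thesis using proj_id[OF sub[OF y] subspace_0[OF sub[OF y]]] by (simp add: levi_civita_def)
	qed
	have L2: "levi_civita F a Y y = - k *R dphi c (fst y) (fst a)" if y: "y \<in> ?U" for y a
	proof -
		have "FD F y ((- k / (1 + snd y)) *R fst a, 0) = - k *R dphi c (fst y) (fst a)"
			using y linear_scale[OF dch_linear[OF smooth_phi c(1)], of "fst y"] linear_neg[OF dch_linear[OF smooth_phi c(1)], of "fst y"]
			by (auto simp: DF)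
		from this[symmetric] have "- k *R dphi c (fst y) (fst a) \<in> range (FD F y)" by (rule range_eqI)
		from proj_id[OF sub[OF y] this] show ?thesis by (simp add: levi_civita_def Y[OF y])
	qed
	have "riemann cyl_atlas cone (p, 0) u (\<nu> p) (\<nu> p) = 0" for u
	proof -
		define a where "a = components cyl_atlas cone (p, 0) u"
		let ?z = "(snd c p, 0::real)"
		have p0: "proj (range (FD F ?z)) 0 = 0" by (rule proj_id[OF sub[OF zU] subspace_0[OF sub[OF zU]]])
		have "FD (levi_civita F b Y) ?z a = 0" using frechet_derivative_cong_open[OF o zU L1] by simp
		then have 1: "levi_civita F a (levi_civita F b Y) ?z = 0" unfolding levi_civita_def[of F a "levi_civita F b Y"] using p0 by simp
		have z: "snd c p \<in> im c" using c by auto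
		have "((%y. dphi c (fst y) (fst a)) has_derivative
				(%v. FD (%z. dphi c z (fst a)) (snd c p) (fst v))) (at ?z)"
			by (rule has_derivative_compose[of fst fst ?z UNIV])
				(use smooth_on_has_derivative[OF smooth_on_dch[OF smooth_phi c(1)] chart_open[OF c(1)] z] in \<open>auto intro: derivative_intros\<close>)
		then have "((%y. - k *R dphi c (fst y) (fst a)) has_derivative
				(%v. - k *R FD (%z. dphi c z (fst a)) (snd c p) (fst v))) (at ?z)"
			by (auto intro!: derivative_eq_intros)
		then have "(levi_civita F a Y has_derivative
				(%v. - k *R FD (%z. dphi c z (fst a)) (snd c p) (fst v))) (at ?z)"
			by (rule has_derivative_transform_within_open[OF _ o zU]) (simp only: L2)
		from fun_cong[OF frechet_derivative_eqI[OF this], of b]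
		have "FD (levi_civita F a Y) ?z b = 0"
			using linear_0[OF has_derivative_linear[OF smooth_on_has_derivative[OF smooth_on_dch[OF smooth_phi c(1), of "fst a"] chart_open[OF c(1)] z]]]
			by (simp add: b)
		then have 2: "levi_civita F b (levi_civita F a Y) ?z = 0" unfolding levi_civita_def[of F b "levi_civita F a Y"] using p0 by simp
		show ?thesis using 1 2 unfolding riemann_def Let_def c(3) co F_def[symmetric] b_def[symmetric] a_def[symmetric] Y_def[symmetric] by simp
	qed
	then show ?thesis by (simp add: ricci_def)
qed

end


section \<open>Trivial normal bundle\<close>

lemma Fspace_iff:
	"w \<in> Fspace A \<phi> \<nu> p \<longleftrightarrow> (\<forall>v \<in> EM A \<phi> \<nu> p. w \<bullet> v = 0)"
proof
	assume w: "w \<in> Fspace A \<phi> \<nu> p"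
	show "\<forall>v \<in> EM A \<phi> \<nu> p. w \<bullet> v = 0"
	proof
		fix v assume "v \<in> EM A \<phi> \<nu> p"
		then show "w \<bullet> v = 0" unfolding EM_def
		proof (induction rule: span_induct)
			case base
			show ?case by (auto simp: subspace_def inner_add_right)
		next
			case (step x)
			then show ?case using w by (auto simp: Fspace_def)
		qed
	qed
next
	assume "\<forall>v \<in> EM A \<phi> \<nu> p. w \<bullet> v = 0"
	then show "w \<in> Fspace A \<phi> \<nu> p" by (auto simp: Fspace_def EM_def span_base)
qed

context stable_immersion_S
begin

text \<open>First variation of the constant 1, as \<open>mH\<close> = m k \<nu>. It makes the
  coordinates of \<nu> admissible multipliers.\<close>

lemma integral_nu: "(LINT p|vM. \<nu> p \<bullet> b) = 0"
proof -
	have "(LINT p|vM. b \<bullet> mH p) = 0" using first_variation[of "%p. 1" b] by simp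
	also have "(LINT p|vM. b \<bullet> mH p) = (LINT p|vM. (real CARD('m) * k) * (\<nu> p \<bullet> b))"
		by (rule int_cong) (auto simp: mH_nu kappa_eq inner_commute)
	finally show ?thesis using k_pos by simp
qed

text \<open>Sections of \<open>F\<close> are admissible variations: the coordinates \<open>x\<^sub>b\<close> of \<open>\<nu>\<close> have mean zero and
	\<open>\<Sum> x\<^sub>b^2 = 1\<close>, so \<open>W = \<Sum> (x\<^sub>b (\<nu> + x\<^sub>b W) - x\<^sub>b (\<nu> + 0))\<close>.\<close>

lemma F_section_variation:
	assumes W: "smooth W" "\<And>p. p \<in> M ==> W p \<in> FN p"
	shows "W \<in> variation_space M A \<phi> \<nu>"
proof -
	obtain b :: "nat => 'e" where b: "bij_betw b {0..<DIM('e)} Basis"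
		using ex_bij_betw_nat_finite[OF finite_Basis] by blast
	\<comment> \<open>Index j stands for coordinate \<open>j div 2\<close>: even j carries the summand
	  with x W and sign 1, odd j the correction with N = 0 and sign -1.\<close>
	define x where "x j p = \<nu> p \<bullet> b j" for j p
	define c :: "nat => real" where "c j = (if even j then 1 else -1)" for j
	define N where "N j p = (if even j then x (j div 2) p *R W p else 0)" for j p
	have xs: "smooth (x j)" for j unfolding x_def[abs_def] by (intro smooth_fun_intros smooth_nu)
	have "x j \<in> mean_zero M A \<phi>" for j using xs integral_nu by (simp add: mean_zero_def x_def[abs_def])
	moreover have "smooth (N j)" for j unfolding N_def[abs_def] by (cases "even j") (simp_all add: smooth_fun_scaleR xs W)
	moreover have "N j p \<in> FN p" if "p \<in> M" for j p using W(2)[OF that] by (auto simp: N_def Fspace_def)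
	moreover have "W p = (\<Sum>j<DIM('e) * 2. c j *R (x (j div 2) p *R (\<nu> p + N j p)))" if p: "p \<in> M" for p
	proof -
		have "(\<Sum>j<DIM('e) * 2. c j *R (x (j div 2) p *R (\<nu> p + N j p))) = (\<Sum>i<DIM('e). (x i p * x i p) *R W p)"
			unfolding sum.nat_group[symmetric]
		proof (rule sum.cong[OF refl])
			fix i
			have "{i * 2..<i * 2 + 2} = {i * 2, Suc (i * 2)}" by auto
			then show "(\<Sum>j = i * 2..<i * 2 + 2. c j *R (x (j div 2) p *R (\<nu> p + N j p))) = (x i p * x i p) *R W p"
				by (simp add: c_def N_def scaleR_add_right)
		qed
		also have "... = (\<Sum>i<DIM('e). x i p * x i p) *R W p" by (simp add: scaleR_sum_left)
		also have "(\<Sum>i<DIM('e). x i p * x i p) = (\<Sum>e\<in>Basis. (\<nu> p \<bullet> e) * (\<nu> p \<bullet> e))"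
			unfolding x_def using sum.reindex_bij_betw[OF b, of "%e. (\<nu> p \<bullet> e) * (\<nu> p \<bullet> e)"] by (simp add: atLeast0LessThan)
		also have "... = 1" using nu_nu[OF p] by (simp add: euclidean_inner[of "\<nu> p" "\<nu> p"])
		finally show ?thesis by simp
	qed
	ultimately show ?thesis unfolding variation_space_def mem_Collect_eq
		by (intro exI[of _ "DIM('e) * 2"] exI[of _ c] exI[of _ "%j. x (j div 2)"] exI[of _ N]) simp
qed

lemma F_section_normal: "p \<in> M ==> w \<in> FN p ==> P p w = 0"
	by (simp add: P_eq_0_iff Fspace_def)

text \<open>The first-order term of \<open>C_integrand\<close> for W' = W normal, where its two
  halves coincide.\<close>

definition Cw :: "('p => 'e) => 'p => real" where
	"Cw W p = deriv_cov CARD('m) (Dn W p) (%us. \<Omega> (\<phi> p) (W p # us)) (frm p)"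

lemma C_term_parallel:
	assumes par: "parallel_form (CARD('m) + 1) \<Omega>" and W: "smooth W" "\<And>p. p \<in> M ==> P p (W p) = 0"
	shows "(LINT p|vM. real CARD('m) * \<kappa> p * (CO W p \<bullet> W p)) = real CARD('m) * k * (LINT p|vM. Cw W p)"
proof -
	let ?W = "%p. \<kappa> p *R W p"
	have Ws': "smooth ?W" by (intro smooth_fun_scaleR smooth_kappa W)
	have n: "nor W q = W q" "nor ?W q = k *R W q" if "q \<in> M" for q
		using W(2)[OF that] that by (simp_all add: nor_def linear_scale[OF linear_P] kappa_eq)
	have "CI W ?W p = k * Cw W p" if p: "p \<in> M" for p
	proof -
		have D: "Dn (nor W) p u = Dn W p u" for u by (rule Dn_cong[OF n(1) p])
		have D': "Dn (nor ?W) p u = k *R Dn W p u" for u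
		proof -
			have "Dn (nor ?W) p u = Dn (%q. k *R W q) p u" by (rule Dn_cong[OF n(2) p])
			then show ?thesis using pd_scaleR[OF smooth_fun_const W(1) p, of u k]
				by (simp add: Dn_def linear_scale[OF linear_P[OF p]] scaleR_diff_right)
		qed
		have lf: "length (frm p) = CARD('m)" using ortho_frameD(1)[OF frame[OF p]] .
		have cv: "covector CARD('m) (%us. \<Omega> (\<phi> p) (W p # us))" by (rule covector_Cons[OF covector_Omega])
		have 1: "deriv_cov CARD('m) (Dn (nor ?W) p) (%us. \<Omega> (\<phi> p) (nor W p # us)) (frm p) = k * Cw W p"
			unfolding deriv_cov_def Cw_def D' n(1)[OF p] sum_distrib_left
			using linear_scale[OF covector_linear[OF cv lf]] by (intro sum.cong) auto
		have 2: "deriv_cov CARD('m) (Dn (nor W) p) (%us. \<Omega> (\<phi> p) (nor ?W p # us)) (frm p) = k * Cw W p"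
			unfolding deriv_cov_def Cw_def D n(2)[OF p] sum_distrib_left
			using linear_scale[OF covector_append_linear[OF covector_Omega, of "[]"]] lf by (intro sum.cong) auto
		show ?thesis unfolding C_integrand_parallel[OF par W(1) Ws' p] 1 2 by simp
	qed
	then have "(LINT p|vM. CI W ?W p) = (LINT p|vM. k * Cw W p)"
		by (intro int_cong) auto
	then show ?thesis unfolding C_term[OF W(1)] by simp
qed

lemma F_stability:
	assumes W: "smooth W" "\<And>p. p \<in> M ==> W p \<in> FN p"
	shows "0 \<le> (LINT p|vM. (\<Sum>b\<in>Basis. Dn W p b \<bullet> Dn W p b) - (\<Sum>b\<in>Basis. \<Sum>a\<in>Basis. (W p \<bullet> Q a (P p b) p)^2))
		+ (LINT p|vM. real CARD('m) * \<kappa> p * (CO W p \<bullet> W p))"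
proof -
	have "integrable vM (%p. (\<Sum>b\<in>Basis. Dn W p b \<bullet> Dn W p b) - (\<Sum>b\<in>Basis. \<Sum>a\<in>Basis. (W p \<bullet> Q a (P p b) p)^2))"
	proof -
		have "smooth (%p. Q a (P p b) p)" for a b
		proof -
			have "smooth (%p. Q a b p - P p (Q a b p))" by (intro smooth_fun_diff smooth_fun_Q smooth_fun_P_apply)
			then show ?thesis by (rule smooth_fun_cong[THEN iffD1, rotated]) (metis Q_P_split add_diff_cancel_right')
		qed
		then show ?thesis unfolding power2_eq_square by (intro smooth_integrable smooth_fun_intros smooth_Dn W)
	qed
	moreover have "integrable vM (%p. real CARD('m) * \<kappa> p * (CO W p \<bullet> W p))"
		by (intro smooth_integrable smooth_fun_intros smooth_kappa smooth_C_Omega W)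
	ultimately show ?thesis using stability[OF stable W(1) F_section_variation[OF W]] by (simp add: \<kappa>_def)
qed

end

section \<open>Constancy of F under a parallel normal frame\<close>

locale stable_immersion_trivial = stable_immersion_S M A \<phi> \<Omega> \<nu>
	for M :: "'p::t2_space set" and A :: "('p, real ^ 'm::{finite,wellorder}) chart set"
		and \<phi> :: "'p => 'e::euclidean_space" and \<Omega> :: "'e => 'e list => real" and \<nu> :: "'p => 'e" +
	assumes trivial: "trivial_normal_bundle M A \<phi>"
begin

text \<open>Constant coefficients in the global parallel frame give a parallel N with N p0 = w. It
  stays in F because N \<bullet> \<nu> is constant, the derivatives of N and \<nu> both being
  tangent.\<close>

lemma parallel_F_section:
	assumes p0: "p0 \<in> M" and w: "w \<in> FN p0"
	shows "\<exists>N. smooth N \<and> (\<forall>p\<in>M. N p \<in> FN p \<and> (\<forall>u. Dn N p u = 0)) \<and> N p0 = w"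
proof -
	let ?n = "DIM('e) - CARD('m)"
	obtain E where E: "\<And>i. i < ?n ==> normal_section M A \<phi> (E i)" "\<And>i. i < ?n ==> parallel_section M A \<phi> (E i)"
		and on: "\<And>p. p \<in> M ==> orthonormal (map (%i. E i p) [0..<?n])"
		using trivial unfolding trivial_normal_bundle_def by auto
	have Es: "smooth (E i)" and En: "p \<in> M ==> P p (E i p) = 0" if "i < ?n" for i p
		using E(1)[OF that] by (auto simp: normal_section_def P_eq_0_iff)
	have Ep: "Dn (E i) p u = 0" if "i < ?n" "p \<in> M" for i p u
		using E(2)[OF that(1)] nabla_perp_eq[OF that(2) P_in[OF that(2)], of "E i" u] P_in[OF that(2)] Dn_P[OF that(2)] that(2)
		unfolding parallel_section_def by metis
	define N where "N p = (\<Sum>i<?n. (w \<bullet> E i p0) *R E i p)" for p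
	have Ns: "smooth N" unfolding N_def[abs_def] by (intro smooth_fun_sum smooth_fun_scaleR smooth_fun_const Es) simp
	have NP: "P p (N p) = 0" if "p \<in> M" for p
		by (simp add: N_def linear_sum[OF linear_P[OF that]] linear_scale[OF linear_P[OF that]] En that)
	have Np: "Dn N p u = 0" if p: "p \<in> M" for p u
	proof -
		have pdN: "pd u N p = (\<Sum>i<?n. (w \<bullet> E i p0) *R pd u (E i) p)"
		proof -
			have "pd u N p = (\<Sum>i<?n. pd u (%q. (w \<bullet> E i p0) *R E i q) p)"
				unfolding N_def[abs_def] by (rule pd_sum[OF _ p]) (simp add: smooth_fun_scaleR Es)
			also have "... = (\<Sum>i<?n. (w \<bullet> E i p0) *R pd u (E i) p)"
				by (rule sum.cong[OF refl]) (use pd_scaleR[OF smooth_fun_const Es p] in simp)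
			finally show ?thesis .
		qed
		have "Dn N p u = (\<Sum>i<?n. (w \<bullet> E i p0) *R Dn (E i) p u)"
			by (simp add: Dn_def pdN linear_sum[OF linear_P[OF p]] linear_scale[OF linear_P[OF p]] sum_subtractf scaleR_diff_right)
		then show ?thesis using Ep p by simp
	qed
	have N0: "N p0 = w"
	proof -
		let ?es = "map (%i. E i p0) [0..<?n]" and ?Z = "{y. \<forall>x\<in>TM p0. orthogonal x y}"
		have Z: "subspace ?Z" by (auto simp: subspace_def orthogonal_def inner_add_right)
		have "set ?es \<subseteq> ?Z" using E(1) p0 by (auto simp: normal_section_def orthogonal_def inner_commute)
		then have sub: "span (set ?es) \<subseteq> ?Z" by (rule span_minimal[OF _ Z])
		\<comment> \<open>By dimension the frame at p0 spans the normal space, so the expansion of w in it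
		  is exact.\<close>
		have "dim ?Z = ?n" using dim_subspace_orthogonal_to_vectors[OF subspace_Tan[OF p0] subspace_UNIV subset_UNIV] dim_Tan[OF p0]
			by simp
		then have "span (set ?es) = ?Z" using subspace_dim_equal[OF subspace_span Z sub] dim_orthonormal[OF on[OF p0]] by simp
		then have "w \<in> span (set ?es)" using w by (auto simp: Fspace_def orthogonal_def inner_commute)
		from proj_id[OF subspace_span this] show ?thesis using orthonormal_proj_expand[OF on[OF p0], of w] by (simp add: N_def)
	qed
	have "N p \<bullet> \<nu> p = 0" if p: "p \<in> M" for p
	proof -
		have "N p \<bullet> \<nu> p = N p0 \<bullet> \<nu> p0"
		proof (rule constant_on_connected[OF connected_M _ _ p p0, of "%p. N p \<bullet> \<nu> p"])
			show "smooth (%p. N p \<bullet> \<nu> p)" by (intro smooth_fun_inner Ns smooth_nu)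
			fix u q assume q: "q \<in> M"
			have "pd u N q = P q (pd u N q)" using Np[OF q, of u] by (simp add: Dn_def)
			then have "pd u N q \<bullet> \<nu> q = 0" using Tan_nu[OF q P_in[OF q]] by metis
			moreover have "N q \<bullet> pd u \<nu> q = 0"
				using P_sym[OF q, of u "N q"] NP[OF q] by (simp add: pd_nu[OF q] inner_commute)
			ultimately show "pd u (%p. N p \<bullet> \<nu> p) q = 0" by (simp add: pd_inner[OF Ns smooth_nu q])
		qed
		then show ?thesis using N0 w by (simp add: Fspace_def)
	qed
	then have "N p \<in> FN p" if "p \<in> M" for p using NP[OF that] that by (auto simp: Fspace_def P_eq_0_iff)
	then show ?thesis using Ns Np N0 by (intro exI[of _ N]) simp
qed

text \<open>Stability applied to a parallel section \<open>N\<close> of \<open>F\<close> leaves only minus the integral of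
	\<open>\<parallel>B\<^sup>N\<parallel>^2\<close>, so that \<open>N\<close> is constant in the ambient space.\<close>

lemma Fspace_subset:
	assumes p0: "p0 \<in> M" and q0: "q0 \<in> M"
	shows "FN p0 \<subseteq> FN q0"
proof
	fix w assume "w \<in> FN p0"
	then obtain N where N: "smooth N" "\<And>p. p \<in> M ==> N p \<in> FN p"
			"\<And>p u. p \<in> M ==> Dn N p u = 0" "N p0 = w"
		using parallel_F_section[OF p0] by metis
	note NP = F_section_normal[OF _ N(2)]
	let ?B = "%p. \<Sum>b\<in>Basis. \<Sum>a\<in>Basis. (N p \<bullet> Q a (P p b) p)^2"
	have C: "(LINT p|vM. real CARD('m) * \<kappa> p * (CO N p \<bullet> N p)) = 0"
		using Omega
	proof
		assume par: "parallel_form (CARD('m) + 1) \<Omega>"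
		have "Cw N p = 0" if p: "p \<in> M" for p unfolding Cw_def deriv_cov_def
		proof (rule sum.neutral, rule ballI)
			have lf: "length (frm p) = CARD('m)" using ortho_frameD(1)[OF frame[OF p]] .
			fix i assume "i \<in> {..<CARD('m)}"
			then show "\<Omega> (\<phi> p) (N p # (frm p)[i := Dn N p (frm p ! i)]) = 0"
				using linear_0[OF covector_linear[OF covector_Cons[OF covector_Omega] lf]] by (simp add: N(3)[OF p])
		qed
		then have "(LINT p|vM. Cw N p) = (LINT p|vM. 0)" by (intro int_cong) auto
		then show ?thesis by (simp add: C_term_parallel[OF par N(1) NP])
	next
		assume "\<forall>W. smooth W \<longrightarrow> (\<forall>p\<in>M. CO W p = 0)"
		then have "(LINT p|vM. real CARD('m) * \<kappa> p * (CO N p \<bullet> N p)) = (LINT p|vM. 0)"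
			by (intro int_cong) (use N in auto)
		then show ?thesis by simp
	qed
	have sQ: "smooth (%p. N p \<bullet> Q a (P p b) p)" for a b
	proof -
		have "smooth (%p. N p \<bullet> (Q a b p - P p (Q a b p)))"
			by (intro smooth_fun_inner smooth_fun_diff smooth_fun_Q smooth_fun_P_apply N(1))
		then show ?thesis by (rule smooth_fun_cong[THEN iffD1, rotated]) (metis Q_P_split add_diff_cancel_right')
	qed
	have sB: "smooth ?B" unfolding power2_eq_square by (intro smooth_fun_sum smooth_fun_mult sQ)
	have "(LINT p|vM. (\<Sum>b\<in>Basis. Dn N p b \<bullet> Dn N p b) - ?B p) = (LINT p|vM. - ?B p)"
		by (rule int_cong) (auto simp: N(3))
	then have "(LINT p|vM. ?B p) \<le> 0" using F_stability[OF N(1,2)] C by simp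
	then have B0: "?B p = 0" if "p \<in> M" for p
		by (rule integral_nonneg_eq_0[OF smooth_fun_continuous[OF sB] _ _ that, rotated]) (auto intro!: sum_nonneg)
	have NQ: "N p \<bullet> Q a b p = 0" if p: "p \<in> M" for a b p
	proof -
		have "N p \<bullet> Q a (P p e) p = 0" if e: "e \<in> Basis" and a: "a \<in> Basis" for e a
		proof -
			have "\<forall>b\<in>Basis. (\<Sum>a\<in>Basis. (N p \<bullet> Q a (P p b) p)^2) = 0"
				using B0[OF p] by (subst (asm) sum_nonneg_eq_0_iff) (auto intro: sum_nonneg)
			then have "(\<Sum>a\<in>Basis. (N p \<bullet> Q a (P p e) p)^2) = 0" using e by blast
			then have "\<forall>a\<in>Basis. (N p \<bullet> Q a (P p e) p)^2 = 0" by (subst (asm) sum_nonneg_eq_0_iff) auto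
			then show ?thesis using a by simp
		qed
		note 1 = this
		have 2: "N p \<bullet> Q a (P p e) p = 0" if e: "e \<in> Basis" for e a
			using linear_euclidean_expand[OF linear_Q1[OF p], of a "P p e"] by (simp add: inner_sum_right 1[OF e])
		have "linear (%b. Q a (P p b) p)" using linear_compose[OF linear_P[OF p] linear_Q2[OF p]] by (simp add: o_def)
		from linear_euclidean_expand[OF this, of b] have "N p \<bullet> Q a (P p b) p = 0" by (simp add: inner_sum_right 2)
		moreover have "N p \<bullet> P p (Q a b p) = 0" using P_sym[OF p, of "N p" "Q a b p"] NP[OF p p] by simp
		ultimately show ?thesis using Q_P_split[OF p, of a b] by (metis add.right_neutral inner_add_right)
	qed
	\<comment> \<open>The tangential part vanishes since B has no component along N, the normal part
	  since N is parallel.\<close>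
	have "pd a N p = 0" if p: "p \<in> M" for a p
	proof -
		have "pd a N p \<bullet> P p b = 0" for b
		proof -
			have "pd a (%q. N q \<bullet> P q b) p = pd a (%q. 0) p"
				by (rule pd_cong[OF _ p]) (simp add: P_sym[symmetric] NP)
			then show ?thesis using NQ[OF p, of a b] by (simp add: pd_inner[OF N(1) smooth_fun_P p] Q_def)
		qed
		then have "P p (pd a N p) \<bullet> b = 0" for b by (simp add: P_sym[OF p])
		then have "P p (pd a N p) = 0" by (metis inner_eq_zero_iff)
		then show ?thesis using N(3)[OF p, of a] by (simp add: Dn_def)
	qed
	then have "N q0 = N p0" by (intro constant_on_connected[OF connected_M N(1) _ q0 p0])
	then show "w \<in> FN q0" using N(2)[OF q0] N(4) by simp
qed

text \<open>The common value of all \<open>EN p\<close>; the choice of the point is immaterial by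
  \<open>EM_eq\<close>.\<close>

definition V0 :: "'e set" where "V0 = EN (SOME p. p \<in> M)"

definition V :: "'e set" where "V = (+) cen ` V0"

lemma some_M: "(SOME p. p \<in> M) \<in> M" using M_nonempty by (simp add: some_in_eq)

lemma mem_EM_iff: "p \<in> M ==> v \<in> EN p \<longleftrightarrow> (\<forall>w\<in>FN p. v \<bullet> w = 0)"
proof
	assume p: "p \<in> M" and v: "\<forall>w\<in>FN p. v \<bullet> w = 0"
	let ?r = "v - proj (EN p) v"
	have "?r \<in> FN p" unfolding Fspace_iff using proj_orth[OF subspace_EM] by blast
	then have "v \<bullet> ?r = 0" "proj (EN p) v \<bullet> ?r = 0"
		using v proj_in[OF subspace_EM] by (auto simp: Fspace_iff inner_commute)
	then have "?r \<bullet> ?r = 0" by (simp add: inner_diff_left)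
	then show "v \<in> EN p" using proj_in[OF subspace_EM, of p v] by simp
qed (auto simp: Fspace_iff inner_commute)

lemma EM_eq: "p \<in> M ==> EN p = V0"
	using Fspace_subset[OF _ some_M] Fspace_subset[OF some_M] mem_EM_iff some_M unfolding V0_def
	by (metis subset_antisym subsetI)

lemma subspace_V0: "subspace V0" by (simp add: V0_def subspace_EM)

lemma dim_EM: "p \<in> M ==> dim (EN p) = CARD('m) + 1"
	using Tan_nu[of p "\<nu> p"] nu_nu[of p] dim_insert[of "\<nu> p" "TM p"] dim_Tan[of p] span_eq_iff[THEN iffD2, OF subspace_Tan[of p]]
	by (auto simp: EM_def)

lemma dim_V0: "dim V0 = CARD('m) + 1" using dim_EM[OF some_M] by (simp add: V0_def)

lemma mem_V: "x \<in> V \<longleftrightarrow> x - cen \<in> V0"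
	by (auto simp: V_def image_iff) (metis add.commute diff_add_cancel)

lemma affine_V: "affine V" and aff_dim_V: "aff_dim V = int (CARD('m) + 1)" and cen_V: "cen \<in> V"
	using subspace_V0 dim_V0 aff_dim_subspace[OF subspace_V0] subspace_imp_affine subspace_0[OF subspace_V0]
	by (simp_all add: V_def aff_dim_translation_eq affine_translation[symmetric]) (auto simp: image_iff)

lemma nu_V0: "p \<in> M ==> \<nu> p \<in> V0" and Tan_V0: "p \<in> M ==> u \<in> TM p ==> u \<in> V0"
	unfolding EM_eq[symmetric] EM_def by (simp_all add: span_base)

lemma phi_V: "p \<in> M ==> \<phi> p \<in> V \<inter> sphere cen (1 / k)"
	using subspace_scale[OF subspace_V0 nu_V0, of p "- (1 / k)"] phi_cen[of p] norm_nu[of p] k_pos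
	by (auto simp: mem_V dist_norm norm_minus_commute[of cen])

end


section \<open>Local homeomorphisms and coverings\<close>

lemma smooth_local_homeomorphism:
	fixes f :: "'a::euclidean_space => 'a"
	assumes f: "smooth_on U f" and U: "open U" "x0 \<in> U" and inj: "inj (FD f x0)"
	obtains U' V g where "open U'" "U' \<subseteq> U" "x0 \<in> U'" "open V" "homeomorphism U' V f g"
proof -
	note d = smooth_on_has_derivative[OF f U(1)]
	define f' where "f' x = Blinfun (FD f x)" for x
	have f': "blinfun_apply (f' x) = FD f x" if "x \<in> U" for x
		unfolding f'_def by (rule bounded_linear_Blinfun_apply[OF has_derivative_bounded_linear[OF d[OF that]]])
	have cont: "continuous_on U f'"
	proof (rule continuous_on_blinfun_componentwise)
		fix i :: 'a
		have "continuous_on U (%x. FD f x i)"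
			by (rule smooth_on_imp_continuous_on[OF smooth_on_frechet_derivative[OF f]])
		then show "continuous_on U (%x. blinfun_apply (f' x) i)" by (rule continuous_on_eq) (simp add: f')
	qed
	have lin: "linear (FD f x0)" by (rule has_derivative_linear[OF d[OF U(2)]])
	obtain h where h: "linear h" "h \<circ> FD f x0 = id"
		using linear_injective_left_inverse[OF lin inj] by blast
	have "Blinfun h o\<^sub>L f' x0 = id_blinfun" by (rule blinfun_eqI)
			(use h(1) fun_cong[OF h(2), unfolded o_apply id_apply] in \<open>simp add: f'[OF U(2)] bounded_linear_Blinfun_apply linear_linear\<close>)
	from inverse_function_theorem[OF U(1) _ cont U(2) this] d f' show thesis using that by (metis (no_types, lifting))
qed

text \<open>The fibre over x is finite by compactness. Disjoint injective neighbourhoods of its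
  points are shrunk to the preimage of a set T' from which the image of the rest of C has been
  removed, so that no further sheet lies over T'.\<close>

lemma compact_local_homeo_covering:
	fixes p :: "'a::t2_space => 'b::t2_space"
	assumes C: "compact C" "continuous_on C p" "p ` C = S"
		and inj: "\<And>z. z \<in> C ==> \<exists>U. openin (top_of_set C) U \<and> z \<in> U \<and> inj_on p U"
		and opn: "\<And>U. openin (top_of_set C) U ==> openin (top_of_set S) (p ` U)"
	shows "covering_space C p S"
	unfolding covering_space_def
proof (intro conjI ballI C)
	fix x assume x: "x \<in> S"
	let ?F = "C \<inter> p -` {x}"
	have cF: "compact ?F" by (rule closedin_compact[OF C(1) continuous_closedin_preimage[OF C(2)]]) simp
	obtain W where W: "\<And>z. z \<in> C ==> openin (top_of_set C) (W z) \<and> z \<in> W z \<and> inj_on p (W z)"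
		using inj by metis
	have "openin (top_of_set ?F) (?F \<inter> W z) \<and> z \<in> ?F \<inter> W z" if z: "z \<in> ?F" for z
	proof -
		obtain T where "open T" "W z = C \<inter> T" using W z by (metis IntD1 openin_open)
		then have "?F \<inter> W z = ?F \<inter> T" by auto
		then show ?thesis using \<open>open T\<close> W z by (metis IntD1 IntI openin_open)
	qed
	from compact_openin_cover[OF cF this] obtain D where D: "finite D" "D \<subseteq> ?F" "?F \<subseteq> (\<Union>z\<in>D. ?F \<inter> W z)" by metis
	\<comment> \<open>By injectivity each \<open>W z\<close> meets the fibre in z only, so a finite
	  subcover exhausts the fibre.\<close>
	have FD: "?F \<subseteq> D"
	proof
		fix y assume y: "y \<in> ?F"
		then obtain z where z: "z \<in> D" "y \<in> W z" using D(3) by blast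
		have "z \<in> W z" "inj_on p (W z)" "p y = p z" using W z(1) D(2) y by auto
		then have "y = z" using z(2) by (metis inj_onD)
		then show "y \<in> D" using z(1) by simp
	qed
	obtain T where T: "\<And>z. z \<in> D ==> z \<in> T z \<and> open (T z)" and dis: "\<And>z y. z \<in> D ==> y \<in> D ==> z \<noteq> y ==> T z \<inter> T y = {}"
	proof -
		\<comment> \<open>Points are separated for every ordered pair; intersecting the choices for both
		  orders makes the neighbourhoods pairwise disjoint.\<close>
		define sep where "sep z y X \<longleftrightarrow> open (fst X) \<and> open (snd X) \<and> z \<in> fst X \<and> y \<in> snd X \<and> fst X \<inter> snd X = {}"
			for z y :: 'a and X
		define X where "X z y = (SOME X. sep z y X)" for z y
		have X': "sep z y (X z y)" if "z \<noteq> y" for z y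
		proof -
			from hausdorff[OF that] obtain U V where "open U" "open V" "z \<in> U" "y \<in> V" "U \<inter> V = {}" by blast
			then have "sep z y (U, V)" by (simp add: sep_def)
			then show ?thesis unfolding X_def by (rule someI)
		qed
		note X = X'[unfolded sep_def]
		show thesis
		proof (rule that[of "%z. \<Inter>y\<in>D - {z}. fst (X z y) \<inter> snd (X y z)"])
			show "z \<in> (\<Inter>y\<in>D - {z}. fst (X z y) \<inter> snd (X y z)) \<and> open (\<Inter>y\<in>D - {z}. fst (X z y) \<inter> snd (X y z))" if "z \<in> D" for z
			proof (intro conjI open_INT INT_I ballI)
				show "finite (D - {z})" using D(1) by simp
				fix y assume "y \<in> D - {z}"
				then have "z \<noteq> y" "y \<noteq> z" by auto
				from X[OF this(1)] X[OF this(2)] show "z \<in> fst (X z y) \<inter> snd (X y z)" "open (fst (X z y) \<inter> snd (X y z))" by auto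
			qed
			show "(\<Inter>w\<in>D - {z}. fst (X z w) \<inter> snd (X w z)) \<inter> (\<Inter>w\<in>D - {y}. fst (X y w) \<inter> snd (X w y)) = {}"
				if "z \<in> D" "y \<in> D" "z \<noteq> y" for z y
				using X[OF that(3)] that by auto
		qed
	qed
	define O' where "O' z = W z \<inter> T z" for z
	have O': "openin (top_of_set C) (O' z)" "z \<in> O' z" "inj_on p (O' z)" if "z \<in> D" for z
	proof -
		have "z \<in> C" using that D(2) by auto
		with W have w: "openin (top_of_set C) (W z)" "z \<in> W z" "inj_on p (W z)" by auto
		show "openin (top_of_set C) (O' z)" unfolding O'_def using w(1) T[OF that] by (auto intro: openin_Int_open)
		show "z \<in> O' z" "inj_on p (O' z)" using w T[OF that] by (auto simp: O'_def intro: inj_on_subset)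
	qed
	define K where "K = C - (\<Union>z\<in>D. O' z)"
	have "closedin (top_of_set C) K" unfolding K_def using O'(1) by (intro closedin_diff openin_Union closedin_subtopology_refl[THEN iffD2]) auto
	then have "compact K" by (rule closedin_compact[OF C(1)])
	then have "compact (p ` K)" by (rule compact_continuous_image[OF continuous_on_subset[OF C(2)], rotated]) (auto simp: K_def)
	then have cK: "closed (p ` K)" by (rule compact_imp_closed)
	define T' where "T' = S \<inter> (\<Inter>z\<in>D. p ` O' z) - p ` K"
	have oT: "openin (top_of_set S) T'"
	proof -
		have "openin (top_of_set S) (S \<inter> (\<Inter>z\<in>D. p ` O' z))"
			using openin_INT[OF D(1), of "top_of_set S" "%z. p ` O' z"] O'(1) opn by (simp add: Int_commute)
		then have "openin (top_of_set S) ((S \<inter> (\<Inter>z\<in>D. p ` O' z)) \<inter> - (p ` K))"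
			by (rule openin_Int_open[OF _ open_Compl[OF cK]])
		then show ?thesis by (simp add: T'_def Diff_eq)
	qed
	have "x \<notin> p ` K"
	proof
		assume "x \<in> p ` K"
		then obtain z where z: "z \<in> K" "x = p z" by blast
		then have "z \<in> D" using FD by (auto simp: K_def)
		then show False using z(1) O'(2) by (auto simp: K_def)
	qed
	moreover have "x \<in> p ` O' z" if "z \<in> D" for z using O'(2)[OF that] D(2) that by (intro image_eqI[of _ _ z]) auto
	ultimately have xT: "x \<in> T'" using x by (simp add: T'_def)
	show "\<exists>T. x \<in> T \<and> openin (top_of_set S) T \<and> (\<exists>v. \<Union> v = C \<inter> p -` T \<and> (\<forall>u\<in>v. openin (top_of_set C) u) \<and>
			pairwise disjnt v \<and> (\<forall>u\<in>v. \<exists>q. homeomorphism u T p q))"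
	proof (intro exI[of _ T'] conjI xT oT exI[of _ "(%z. O' z \<inter> p -` T') ` D"])
		have sub: "O' z \<subseteq> C" if "z \<in> D" for z using openin_imp_subset[OF O'(1)[OF that]] .
		show "\<Union> ((%z. O' z \<inter> p -` T') ` D) = C \<inter> p -` T'" using sub by (auto simp: T'_def K_def)
		have op: "openin (top_of_set C) (O' z \<inter> p -` T')" if "z \<in> D" for z
		proof -
			have "openin (top_of_set C) (C \<inter> p -` T')" using continuous_openin_preimage[OF C(2) _ oT] C(3) by auto
			then have "openin (top_of_set C) (O' z \<inter> (C \<inter> p -` T'))" using O'(1)[OF that] by (rule openin_Int[rotated])
			moreover have "O' z \<inter> (C \<inter> p -` T') = O' z \<inter> p -` T'" using sub[OF that] by auto
			ultimately show ?thesis by simp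
		qed
		then show "\<forall>u\<in>(%z. O' z \<inter> p -` T') ` D. openin (top_of_set C) u" by auto
		show "pairwise disjnt ((%z. O' z \<inter> p -` T') ` D)" using dis by (auto simp: pairwise_def disjnt_def O'_def)
		show "\<forall>u\<in>(%z. O' z \<inter> p -` T') ` D. \<exists>q. homeomorphism u T' p q"
		proof
			fix u assume "u \<in> (%z. O' z \<inter> p -` T') ` D"
			then obtain z where z: "z \<in> D" "u = O' z \<inter> p -` T'" by blast
			have uC: "u \<subseteq> C" using sub[OF z(1)] z(2) by auto
			have im: "p ` u = T'" 
			proof -
				have "p ` u = p ` O' z \<inter> T'" unfolding z(2) by blast
				moreover have "T' \<subseteq> p ` O' z" using z(1) by (auto simp: T'_def)
				ultimately show ?thesis by (simp add: Int_absorb1)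
			qed
			obtain q where "homeomorphism u T' p q"
			proof (rule homeomorphism_injective_open_map[OF continuous_on_subset[OF C(2) uC] im])
				show "inj_on p u" using O'(3)[OF z(1)] by (auto simp: z(2) intro: inj_on_subset)
				fix X assume "openin (top_of_set u) X"
				then have "openin (top_of_set C) X" using openin_trans op[OF z(1)] z(2) by metis
				moreover have "X \<subseteq> u" using \<open>openin (top_of_set u) X\<close> by (rule openin_imp_subset)
				ultimately show "openin (top_of_set T') (p ` X)"
					using opn im oT by (metis image_mono openin_imp_subset openin_subset_trans)
			qed
			then show "\<exists>q. homeomorphism u T' p q" by blast
		qed
	qed
qed

section \<open>The map \<nu> onto the unit sphere of V0\<close>

context stable_immersion_trivial
begin

lemma V0_isometry:
	obtains L G :: "_" where "linear (L :: 'e => (real ^ 'm::{finite,wellorder}) \<times> real)" "linear G" "range G = V0"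
		"\<And>v. v \<in> V0 ==> G (L v) = v" "\<And>y. L (G y) = y" "\<And>y. norm (G y) = norm y"
proof -
	have "dim V0 = dim (UNIV :: ((real ^ 'm::{finite,wellorder}) \<times> real) set)" by (simp add: dim_V0)
	from isometries_subspaces[OF subspace_V0 subspace_UNIV this] show thesis using that by (metis UNIV_I)
qed

abbreviation Sph :: "'e set" where "Sph \<equiv> V0 \<inter> sphere 0 1"

lemma nu_Sph: "p \<in> M ==> \<nu> p \<in> Sph" using nu_V0 norm_nu by simp

text \<open>The inverse function theorem needs equal dimensions, so \<nu> is extended radially by
  the factor 1 + t; comparing norms shows that points of the sphere are reached with t = 0.\<close>

lemma nu_local_homeo:
	assumes p: "p \<in> M" and U: "openM U" "p \<in> U"
	shows "\<exists>W. openM W \<and> p \<in> W \<and> W \<subseteq> U \<and> inj_on \<nu> W \<and> openin (top_of_set Sph) (\<nu> ` W)"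
proof -
	obtain L G where L: "linear (L :: 'e => (real ^ 'm::{finite,wellorder}) \<times> real)" and G: "linear G" "range G = V0"
		"\<And>v. v \<in> V0 ==> G (L v) = v" "\<And>y. L (G y) = y" by (rule V0_isometry) (rule that)
	define c where "c = chart_at A p"
	have c: "c \<in> A" "p \<in> fst c" using chart_at_in[OF p] chart_at_mem[OF p] by (simp_all add: c_def)
	define Z where "Z = snd c ` (U \<inter> fst c)"
	have oZ: "open Z" unfolding Z_def by (rule chart_image_open[OF c(1) U(1)])
	have ZS: "Z \<subseteq> im c" by (auto simp: Z_def)
	define D where "D = Z \<times> {-1::real<..}"
	have oD: "open D" unfolding D_def by (intro open_Times oZ) simp
	define F where "F x = L ((1 + snd x) *R in_chart c \<nu> (fst x))" for x
	have bL: "bounded_linear L" using L by (simp add: linear_linear)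
	have sF: "smooth_on D F" unfolding F_def by (rule smooth_on_linear_compose[OF _ oD bL])
			(intro smooth_on_scaleR smooth_on_add smooth_on_const smooth_on_linear[OF bounded_linear_snd]
				smooth_on_fst[OF oD smooth_on_subset[OF smooth_fun_chart[OF smooth_nu c(1)] ZS] oZ] oD, auto simp: D_def)
	let ?z = "snd c p"
	have zD: "(?z, 0) \<in> D" using c U(2) by (auto simp: D_def Z_def)
	have z: "?z \<in> im c" using c by auto
	have dF: "FD F (?z, 0) = (%v. L (- k *R dphi c ?z (fst v) + snd v *R \<nu> p))"
	proof -
		have d: "dch \<nu> c ?z a = - k *R dphi c ?z a" for a
		proof -
			have T: "dphi c ?z a \<in> TM p" unfolding Tan_chart[OF c] by (rule rangeI)
			have "dch \<nu> c ?z a = deriv_along A \<phi> \<nu> p (dphi c ?z a)" by (rule deriv_along_chart[OF smooth_nu c, symmetric])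
			then show ?thesis using pd_Tan[OF p T, of \<nu>] pd_nu[OF p] P_id[OF p T] by simp
		qed
		have "((%x. in_chart c \<nu> (fst x)) has_derivative (%v. dch \<nu> c ?z (fst v))) (at (?z, 0::real))"
			by (rule has_derivative_compose[of fst fst "(?z,0)" UNIV "in_chart c \<nu>" "dch \<nu> c ?z"])
				(use dch_has_derivative[OF smooth_nu c(1) z] in \<open>auto intro: derivative_intros\<close>)
		then have "((%x. (1 + snd x) *R in_chart c \<nu> (fst x)) has_derivative
				(%v. dch \<nu> c ?z (fst v) + snd v *R in_chart c \<nu> ?z)) (at (?z, 0))"
			by (auto intro!: derivative_eq_intros)
		then have "(F has_derivative (%v. L (dch \<nu> c ?z (fst v) + snd v *R in_chart c \<nu> ?z))) (at (?z, 0))"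
			unfolding F_def by (rule bounded_linear.has_derivative[OF bL])
		then show ?thesis using c by (simp add: frechet_derivative_eqI d)
	qed
	have "inj (FD F (?z, 0))"
	proof -
		have lin: "linear (FD F (?z, 0))"
			by (rule has_derivative_linear[OF smooth_on_has_derivative[OF sF oD zD]])
		have "v = 0" if v: "FD F (?z, 0) v = 0" for v
		proof -
			have T: "dphi c ?z (fst v) \<in> TM p" unfolding Tan_chart[OF c] by (rule rangeI)
			have "- k *R dphi c ?z (fst v) + snd v *R \<nu> p \<in> V0"
				by (intro subspace_add subspace_scale subspace_V0 nu_V0 Tan_V0[OF p T] p)
			then have e: "- k *R dphi c ?z (fst v) + snd v *R \<nu> p = 0"
				using v G(3) linear_0[OF G(1)] unfolding dF by metis
			from arg_cong[OF e, of "%w. w \<bullet> \<nu> p"] have s: "snd v = 0"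
				using Tan_nu[OF p T] by (simp add: inner_add_left inner_diff_left nu_nu[OF p])
			then have "dphi c ?z (fst v) = dphi c ?z 0" using e k_pos linear_0[OF dch_linear[OF smooth_phi c(1) z]] by simp
			then show "v = 0" using s injD[OF dch_phi_inj[OF c]] by (simp add: prod_eq_iff)
		qed
		then show ?thesis using lin by (simp add: linear_injective_0)
	qed
	from smooth_local_homeomorphism[OF sF oD zD this]
	obtain U' V' g where U': "open U'" "U' \<subseteq> D" "(?z, 0) \<in> U'" "open V'" "homeomorphism U' V' F g" by metis
	define W where "W = {q \<in> U \<inter> fst c. (snd c q, 0) \<in> U'}"
	have F0: "F (snd c q, 0) = L (\<nu> q)" if "q \<in> W" for q using that c(1) by (simp add: F_def W_def)
	have injF: "inj_on F U'" using U'(5) by (auto simp: homeomorphism_def intro: inj_on_inverseI)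
	have WM: "W \<subseteq> M" using openin_imp_subset[OF U(1)] by (auto simp: W_def)
	have "openM W"
	proof -
		have "continuous_on (U \<inter> fst c) (%q. (snd c q, 0::real))"
			using chart_homeo[OF c(1)] by (intro continuous_intros) (auto simp: homeomorphism_def intro: continuous_on_subset)
		then have "openin (top_of_set (U \<inter> fst c)) ((U \<inter> fst c) \<inter> (%q. (snd c q, 0)) -` U')"
			by (rule continuous_openin_preimage_gen[OF _ U'(1)])
		moreover have "openM (U \<inter> fst c)" by (intro openin_Int U(1) chart_openin c(1))
		moreover have "(U \<inter> fst c) \<inter> (%q. (snd c q, 0)) -` U' = W" by (auto simp: W_def)
		ultimately show ?thesis using openin_trans by metis
	qed
	moreover have "inj_on \<nu> W"
	proof (rule inj_onI)
		fix q q' assume q: "q \<in> W" "q' \<in> W" and e: "\<nu> q = \<nu> q'"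
		then have "F (snd c q, 0) = F (snd c q', 0)" by (simp add: F0)
		then have "snd c q = snd c q'" using inj_onD[OF injF] q by (auto simp: W_def)
		then show "q = q'" using inj_onD[OF chart_inj[OF c(1)]] q by (auto simp: W_def)
	qed
	moreover have "\<nu> ` W = Sph \<inter> L -` V'"
	proof (intro subset_antisym subsetI)
		fix s assume "s \<in> \<nu> ` W"
		then obtain q where q: "q \<in> W" "s = \<nu> q" by blast
		have "F (snd c q, 0) \<in> V'" using U'(5) q(1) by (auto simp: homeomorphism_def W_def)
		then show "s \<in> Sph \<inter> L -` V'" using q F0 nu_Sph WM by auto
	next
		fix s assume s: "s \<in> Sph \<inter> L -` V'"
		then obtain x where x: "x \<in> U'" "L s = F x" using U'(5) by (auto simp: homeomorphism_def)
		have xD: "fst x \<in> Z" "-1 < snd x" using x(1) U'(2) by (auto simp: D_def)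
		then obtain q where q: "q \<in> U \<inter> fst c" "fst x = snd c q" by (auto simp: Z_def)
		have qM: "q \<in> M" using q chart_in_M[OF c(1)] by auto
		have Fx: "F x = L ((1 + snd x) *R \<nu> q)" using q c(1) by (simp add: F_def)
		have "(1 + snd x) *R \<nu> q \<in> V0" by (intro subspace_scale subspace_V0 nu_V0 qM)
		then have sx: "s = (1 + snd x) *R \<nu> q" using s x(2) Fx G(3) by (metis IntD1)
		moreover have "norm s = 1" using s by simp
		ultimately have "snd x = 0" using xD(2) norm_nu[OF qM] by simp
		then have "x = (snd c q, 0)" "s = \<nu> q" using q(2) sx by (simp_all add: prod_eq_iff)
		then show "s \<in> \<nu> ` W" using q(1) x(1) by (auto simp: W_def)
	qed
	moreover have "openin (top_of_set Sph) (Sph \<inter> L -` V')"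
		by (intro continuous_openin_preimage_gen linear_continuous_on bL U'(4))
	moreover have "p \<in> W" "W \<subseteq> U" using c U U'(3) by (auto simp: W_def)
	ultimately show ?thesis by auto
qed

lemma continuous_nu: "continuous_on M \<nu>" by (rule smooth_fun_continuous[OF smooth_nu])

lemma nu_open_map:
	assumes U: "openM U"
	shows "openin (top_of_set Sph) (\<nu> ` U)"
proof (subst openin_subopen, rule ballI)
	fix s assume "s \<in> \<nu> ` U"
	then obtain p where p: "p \<in> U" "s = \<nu> p" by blast
	have "p \<in> M" using openin_imp_subset[OF U] p(1) by blast
	from nu_local_homeo[OF this U p(1)] obtain W where "p \<in> W" "W \<subseteq> U" "openin (top_of_set Sph) (\<nu> ` W)" by blast
	then show "\<exists>T. openin (top_of_set Sph) T \<and> s \<in> T \<and> T \<subseteq> \<nu> ` U" using p(2) by (intro exI[of _ "\<nu> ` W"]) auto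
qed

lemma connected_Sph: "connected Sph"
proof -
	obtain G where G: "linear (G :: (real ^ 'm::{finite,wellorder}) \<times> real => 'e)" "range G = V0" "\<And>y. norm (G y) = norm y"
		by (rule V0_isometry) (rule that)
	have "G ` sphere 0 1 = Sph"
	proof (intro subset_antisym subsetI)
		show "s \<in> Sph" if "s \<in> G ` sphere 0 1" for s using that G(2,3) by auto
		fix s assume s: "s \<in> Sph"
		then obtain y where y: "s = G y" using G(2) by blast
		then have "norm y = 1" using s G(3)[of y] by simp
		then show "s \<in> G ` sphere 0 1" using y by simp
	qed
	moreover have "connected (sphere (0 :: (real ^ 'm::{finite,wellorder}) \<times> real) 1)" by (rule connected_sphere) simp
	ultimately show ?thesis
		using connected_continuous_image[OF linear_continuous_on, of G "sphere 0 1"] G(1) by (simp add: linear_linear)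
qed

text \<open>The image is open because \<nu> is an open map, closed because M is compact, and the
  sphere is connected.\<close>

lemma nu_onto: "\<nu> ` M = Sph"
proof (rule ccontr)
	assume ne: "\<nu> ` M \<noteq> Sph"
	have "openin (top_of_set Sph) (\<nu> ` M)" by (rule nu_open_map) simp
	moreover have "closedin (top_of_set Sph) (\<nu> ` M)"
		using nu_Sph by (intro closed_subset compact_imp_closed compact_continuous_image continuous_nu compact_M) auto
	ultimately show False using connected_Sph ne M_nonempty unfolding connected_clopen by blast
qed

lemma phi_image: "\<phi> ` M = V \<inter> sphere cen (1 / k)"
proof (intro subset_antisym subsetI)
	show "x \<in> V \<inter> sphere cen (1 / k)" if "x \<in> \<phi> ` M" for x using that phi_V by auto
	fix x assume x: "x \<in> V \<inter> sphere cen (1 / k)"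
	have "- k *R (x - cen) \<in> Sph"
		using x k_pos subspace_scale[OF subspace_V0, of "x - cen" "-k"] by (auto simp: mem_V dist_norm norm_minus_commute)
	then obtain p where p: "p \<in> M" "- k *R (x - cen) = \<nu> p" unfolding nu_onto[symmetric] by blast
	have "\<phi> p = x" using k_pos by (simp add: phi_eq[OF p(1)] flip: p(2))
	then show "x \<in> \<phi> ` M" using p(1) by blast
qed

end



text \<open>The lifting theorem of the library needs a normed total space, hence the embedding of the
	compact space \<open>C\<close>, by finitely many Urysohn functions, into a function space.\<close>

lemma local_homeo_homotopy_lift:
	fixes p :: "'a::t2_space => 'b::real_normed_vector" and h :: "real \<times> 'c::real_normed_vector => 'b"
	assumes C: "compact C" "continuous_on C p" "p ` C = S"
		and inj: "\<And>z. z \<in> C ==> \<exists>U. openin (top_of_set C) U \<and> z \<in> U \<and> inj_on p U"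
		and opn: "\<And>U. openin (top_of_set C) U ==> openin (top_of_set S) (p ` U)"
		and h: "continuous_on ({0..1} \<times> U) h" "h \<in> ({0..1} \<times> U) \<rightarrow> S" "\<And>y. y \<in> U ==> h (0, y) = p x" and x: "x \<in> C"
	obtains k where "continuous_on ({0..1} \<times> U) k" "k \<in> ({0..1} \<times> U) \<rightarrow> C" "\<And>z. z \<in> {0..1} \<times> U ==> h z = p (k z)"
proof -
	obtain W where W: "\<And>z. z \<in> C ==> openin (top_of_set C) (W z) \<and> z \<in> W z \<and> inj_on p (W z)"
		using inj by metis
	have "Hausdorff_space (top_of_set C)"
		by (rule Hausdorff_space_subtopology) (auto simp: Hausdorff_space_def disjnt_def dest!: hausdorff)
	then have "normal_space (top_of_set C)" using C(1) by (intro compact_Hausdorff_or_regular_imp_normal_space)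
			(auto simp: compact_space_subtopology compactin_euclidean_iff)
	have "\<exists>f. continuous_on C f \<and> f z = (1::real) \<and> (\<forall>y\<in>C. y \<notin> W z \<longrightarrow> f y = 0)" if z: "z \<in> C" for z
	proof -
		have "closedin (top_of_set C) {z}" using z by (intro closed_subset) auto
		moreover have "closedin (top_of_set C) (C - W z)" using W[OF z] by (intro closedin_diff) auto
		moreover have "disjnt {z} (C - W z)" using W[OF z] by (simp add: disjnt_def)
		ultimately obtain f where f: "continuous_map (top_of_set C) euclideanreal f" "f ` {z} \<subseteq> {1}" "f ` (C - W z) \<subseteq> {0::real}"
			using Urysohn_lemma_alt[OF \<open>normal_space (top_of_set C)\<close>] by metis
		then show ?thesis by (intro exI[of _ f]) auto
	qed
	then obtain f where f: "\<And>z. z \<in> C ==> continuous_on C (f z)" "\<And>z. z \<in> C ==> f z z = (1::real)"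
		"\<And>z y. z \<in> C ==> y \<in> C ==> y \<notin> W z ==> f z y = 0" by metis
	have "openin (top_of_set C) (C \<inter> f z -` (- {0})) \<and> z \<in> C \<inter> f z -` (- {0})" if "z \<in> C" for z
		using f(1,2) that by (auto intro: continuous_openin_preimage_gen)
	from compact_openin_cover[OF C(1) this] obtain D where D: "finite D" "D \<subseteq> C" "C \<subseteq> (\<Union>z\<in>D. C \<inter> f z -` (- {0}))" by metis
	obtain d where d: "bij_betw d {0..<card D} D" using ex_bij_betw_nat_finite[OF D(1)] by blast
	have dC: "d n \<in> C" if "n < card D" for n using d that D(2) by (auto simp: bij_betw_def)
	\<comment> \<open>Unit sequences, as bounded continuous functions on the discrete naturals: a
	  normed space with room for any finite number of Urysohn functions.\<close>
	define e :: "nat => nat \<Rightarrow>\<^sub>C real" where "e n = Bcontfun (%i. if i = n then 1 else 0)" for n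
	have e: "apply_bcontfun (e n) i = (if i = n then 1 else 0)" for n i
	proof -
		have "(%i::nat. if i = n then 1 else 0::real) \<in> bcontfun"
			by (auto simp: bcontfun_def bounded_iff intro!: exI[of _ 1])
		then show ?thesis by (simp add: e_def Bcontfun_inverse)
	qed
	\<comment> \<open>The first component makes \<open>fst\<close> play the role of p; the second
	  separates points with equal p, since each Urysohn function is nonzero only where p is
	  injective.\<close>
	define j where "j y = (p y, \<Sum>n<card D. f (d n) y *R e n)" for y
	have je: "apply_bcontfun (snd (j y)) i = f (d i) y" if "i < card D" for i y
	proof -
		have "apply_bcontfun (\<Sum>n<N. f (d n) y *R e n) i = (if i < N then f (d i) y else 0)" for N
			by (induction N) (auto simp: e less_Suc_eq)
		then show ?thesis using that by (simp add: j_def)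
	qed
	have jc: "continuous_on C j" unfolding j_def by (intro continuous_intros C(2) f(1) dC) simp
	have ji: "inj_on j C"
	proof (rule inj_onI)
		fix y z assume yz: "y \<in> C" "z \<in> C" "j y = j z"
		obtain w where w: "w \<in> D" "f w y \<noteq> 0" using D(3) yz(1) by blast
		then have "w \<in> d ` {0..<card D}" using d by (simp add: bij_betw_def)
		then obtain i where i: "i < card D" "w = d i" by auto
		have "f w z \<noteq> 0" using je[OF i(1), of y] je[OF i(1), of z] yz(3) w(2) i(2) by simp
		then have "y \<in> W w" "z \<in> W w" using f(3)[of w] w D(2) yz by blast+
		moreover have "p y = p z" using yz(3) by (simp add: j_def)
		moreover have "inj_on p (W w)" using W w(1) D(2) by blast
		ultimately show "y = z" by (metis inj_onD)
	qed
	obtain j' where j': "homeomorphism C (j ` C) j j'" using homeomorphism_compact[OF C(1) jc refl ji] by blast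
	have preim: "openin (top_of_set C) (C \<inter> j -` X)" if "openin (top_of_set (j ` C)) X" for X
		by (rule continuous_openin_preimage[OF jc _ that]) auto
	have fimg: "fst ` X = p ` (C \<inter> j -` X)" if "X \<subseteq> j ` C" for X
	proof -
		have "X = j ` (C \<inter> j -` X)" using that by blast
		then have "fst ` X = (%y. fst (j y)) ` (C \<inter> j -` X)" by (metis image_image)
		then show ?thesis by (simp add: j_def)
	qed
	have cov: "covering_space (j ` C) fst S"
	proof (rule compact_local_homeo_covering)
		show "compact (j ` C)" by (rule compact_continuous_image[OF jc C(1)])
		show "continuous_on (j ` C) fst" by (intro continuous_intros)
		show "fst ` j ` C = S" using C(3) by (simp add: image_image j_def)
		show "openin (top_of_set S) (fst ` X)" if "openin (top_of_set (j ` C)) X" for X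
			using opn[OF preim[OF that]] fimg[OF openin_imp_subset[OF that]] by simp
		fix y assume "y \<in> j ` C"
		then obtain z where z: "z \<in> C" "y = j z" by blast
		have "openin (top_of_set (j ` C)) (j ` W z)" using homeomorphism_imp_open_map[OF j'] W[OF z(1)] by blast
		moreover have "inj_on fst (j ` W z)" using W[OF z(1)] by (auto simp: inj_on_def j_def)
		ultimately show "\<exists>U. openin (top_of_set (j ` C)) U \<and> y \<in> U \<and> inj_on fst U"
			using W[OF z(1)] z(2) by blast
	qed
	obtain k where k: "continuous_on ({0..1} \<times> U) k" "k \<in> ({0..1} \<times> U) \<rightarrow> j ` C" "\<And>z. z \<in> {0..1} \<times> U ==> h z = fst (k z)"
	proof (rule covering_space_lift_homotopy[OF cov h(1,2), of "%_. j x"])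
		show "h (0, y) = fst (j x)" if "y \<in> U" for y using h(3)[OF that] by (simp add: j_def)
		show "(%_. j x) \<in> U \<rightarrow> j ` C" using x by auto
	qed auto
	show thesis
	proof (rule that[of "%z. j' (k z)"])
		show "continuous_on ({0..1} \<times> U) (%z. j' (k z))"
			by (rule continuous_on_compose2[OF homeomorphism_cont2[OF j'] k(1)]) (use k(2) in \<open>simp add: image_subset_iff_funcset\<close>)
		show "(%z. j' (k z)) \<in> {0..1} \<times> U \<rightarrow> C"
		proof
			fix z assume "z \<in> {0..1::real} \<times> U"
			then have "k z \<in> j ` C" using k(2) by blast
			then show "j' (k z) \<in> C" using homeomorphism_image2[OF j'] by blast
		qed
		fix z assume z: "z \<in> {0..1::real} \<times> U"
		then have "k z \<in> j ` C" using k(2) by blast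
		then have "j (j' (k z)) = k z" by (rule homeomorphism_apply2[OF j'])
		then have "fst (j (j' (k z))) = h z" using k(3)[OF z] by simp
		then show "h z = p (j' (k z))" by (simp add: j_def)
	qed
qed

section \<open>Injectivity of \<nu>\<close>

context stable_immersion_trivial
begin

text \<open>Great circle arcs from y fill the cap; lifted from p, their end points form a section
  over the cap. Its image D is a sheet, open and closed over the cap, and one of p, q lies outside
  it.\<close>

lemma cap_separation:
	assumes pq: "p \<in> M" "q \<in> M" "p \<noteq> q" "\<nu> p = \<nu> q" and y: "y = \<nu> p"
	obtains D p1 p2 where "openM D" "openM ({z \<in> M. - (19/20) < \<nu> z \<bullet> y} - D)"
		"p1 \<in> D" "\<nu> p1 = y" "p2 \<in> M - D" "\<nu> p2 = y"
proof -
	\<comment> \<open>Any bound strictly between -1 and -9/10 would do: the cap must miss the antipode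
	  of y and exceed the support of the cutoff in \<open>nu_inj\<close>.\<close>
	define Cap where "Cap = {x \<in> Sph. - (19/20) < x \<bullet> y}"
	define U where "U = {z \<in> M. - (19/20) < \<nu> z \<bullet> y}"
	have yS: "y \<in> Sph" using nu_Sph[OF pq(1)] y by simp
	then have yy: "y \<bullet> y = 1" by (simp add: norm_eq_1)
	\<comment> \<open>The chord from y to x. It misses 0 because x is not -y, so \<open>sgn\<close>
	  turns it into an arc of the sphere.\<close>
	define g where "g z = (1 - fst z) *R y + fst z *R snd z" for z :: "real \<times> 'e"
	have g0: "g z \<noteq> 0" if z: "z \<in> {0..1::real} \<times> Cap" for z
	proof
		assume g: "g z = 0"
		obtain t x where tx: "z = (t, x)" "0 \<le> t" "t \<le> 1" "x \<in> Sph" "- (19/20) < x \<bullet> y" using z by (auto simp: Cap_def)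
		have xx: "x \<bullet> x = 1" using tx(4) by (simp add: norm_eq_1)
		have 1: "(1 - t) + t * (x \<bullet> y) = 0" using arg_cong[OF g, of "%w. w \<bullet> y"] yy by (simp add: g_def tx(1) inner_add_left)
		have 2: "(1 - t) * (x \<bullet> y) + t = 0"
			using arg_cong[OF g, of "%w. w \<bullet> x"] xx by (simp add: g_def tx(1) inner_add_left inner_commute[of y x])
		have "(1 - t) * (1 + x \<bullet> y) + t * (1 + x \<bullet> y) = 0" using 1 2 by (simp add: algebra_simps)
		then have "1 + x \<bullet> y = 0" by (simp add: algebra_simps)
		then show False using tx(5) by simp
	qed
	obtain k where k: "continuous_on ({0..1::real} \<times> Cap) k" "k \<in> ({0..1::real} \<times> Cap) \<rightarrow> M"
		"\<And>z. z \<in> {0..1::real} \<times> Cap ==> sgn (g z) = \<nu> (k z)"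
	proof (rule local_homeo_homotopy_lift[OF compact_M continuous_nu nu_onto _ nu_open_map _ _ _ pq(1), of Cap "%z. sgn (g z)"])
		show "\<exists>U. openM U \<and> z \<in> U \<and> inj_on \<nu> U" if "z \<in> M" for z
			using nu_local_homeo[OF that _ that] by auto
		show "continuous_on ({0..1::real} \<times> Cap) (%z. sgn (g z))"
			using g0 by (intro continuous_on_sgn) (auto simp: g_def intro!: continuous_intros)
		show "(%z. sgn (g z)) \<in> {0..1::real} \<times> Cap \<rightarrow> Sph"
		proof
			fix z assume z: "z \<in> {0..1::real} \<times> Cap"
			have "g z \<in> V0" unfolding g_def using z yS by (intro subspace_add subspace_scale subspace_V0) (auto simp: Cap_def)
			then have "sgn (g z) \<in> V0" unfolding sgn_div_norm by (rule subspace_scale[OF subspace_V0])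
			then show "sgn (g z) \<in> Sph" using g0[OF z] by (simp add: norm_sgn)
		qed
		show "sgn (g (0, z)) = \<nu> p" if "z \<in> Cap" for z using yS y by (simp add: g_def sgn_div_norm)
	qed (assumption | rule that)+
	define s where "s z = k (1, \<nu> z)" for z
	have nuCap: "\<nu> z \<in> Cap" if "z \<in> U" for z using that nu_Sph by (auto simp: U_def Cap_def)
	have sM: "s z \<in> M" and snu: "\<nu> (s z) = \<nu> z" if "z \<in> U" for z
	proof -
		show "s z \<in> M" using k(2) nuCap[OF that] by (auto simp: s_def)
		have "norm (\<nu> z) = 1" using nuCap[OF that] by (simp add: Cap_def)
		then show "\<nu> (s z) = \<nu> z" using k(3)[of "(1, \<nu> z)"] nuCap[OF that] by (simp add: s_def g_def sgn_div_norm)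
	qed
	have UM: "U \<subseteq> M" by (auto simp: U_def)
	have oU: "openM U"
	proof -
		have "openM (M \<inter> (%z. \<nu> z \<bullet> y) -` {- (19/20)<..})"
			by (intro continuous_openin_preimage_gen continuous_intros continuous_nu)
		moreover have "M \<inter> (%z. \<nu> z \<bullet> y) -` {- (19/20)<..} = U" by (auto simp: U_def)
		ultimately show ?thesis by simp
	qed
	have sc: "continuous_on U s"
		unfolding s_def using nuCap by (intro continuous_on_compose2[OF k(1)] continuous_intros continuous_on_subset[OF continuous_nu UM]) auto
	define D where "D = {z \<in> U. s z = z}"
	have "closedin (top_of_set U) (U \<inter> (%z. (s z, z)) -` {x. \<exists>z. x = (z, z)})"
		by (intro continuous_closedin_preimage continuous_intros sc closed_diagonal)
	moreover have "U \<inter> (%z. (s z, z)) -` {x. \<exists>z. x = (z, z)} = D" by (auto simp: D_def)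
	ultimately have "openin (top_of_set U) (U - D)" by (simp add: openin_diff)
	then have oD': "openM (U - D)" using oU by (rule openin_trans)
	have oD: "openM D"
	proof (subst openin_subopen, rule ballI)
		fix z assume z: "z \<in> D"
		then have zM: "z \<in> M" and zU: "z \<in> U" using UM by (auto simp: D_def)
		obtain W where W: "openM W" "z \<in> W" "W \<subseteq> M" "inj_on \<nu> W"
			using nu_local_homeo[OF zM _ zM] by auto
		obtain T where T: "open T" "W = M \<inter> T" using W(1) by (metis openin_open)
		have "openin (top_of_set U) (U \<inter> s -` T)" by (rule continuous_openin_preimage_gen[OF sc T(1)])
		then have "openM (U \<inter> s -` T)" using oU by (rule openin_trans)
		then have "openM ((U \<inter> s -` T) \<inter> W)" using W(1) by (rule openin_Int)
		moreover have "(U \<inter> s -` T) \<inter> W \<subseteq> D"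
		proof
			fix w assume w: "w \<in> (U \<inter> s -` T) \<inter> W"
			then have "s w \<in> W" "w \<in> W" using sM T(2) by auto
			then have "s w = w" using snu w inj_onD[OF W(4)] by blast
			then show "w \<in> D" using w by (simp add: D_def)
		qed
		moreover have "z \<in> (U \<inter> s -` T) \<inter> W" using z W(2) T(2) by (auto simp: D_def)
		ultimately show "\<exists>T. openM T \<and> z \<in> T \<and> T \<subseteq> D" by blast
	qed
	have fib: "z \<in> U" if "z \<in> M" "\<nu> z = y" for z using that yy by (simp add: U_def)
	have pU: "p \<in> U" and qU: "q \<in> U" using fib pq y by auto
	have "s p = s q" using pq(4) by (simp add: s_def)
	then have sD: "s p \<in> D" using snu[OF pU] fib[OF sM[OF pU]] y unfolding D_def by (simp add: s_def)
	have "\<exists>w\<in>M. w \<notin> D \<and> \<nu> w = y"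
	proof (cases "p \<in> D")
		case True
		then have "q \<notin> D" using pq(3) \<open>s p = s q\<close> by (auto simp: D_def)
		then show ?thesis using pq y by auto
	qed (use pq y in auto)
	then obtain w where w: "w \<in> M - D" "\<nu> w = y" by blast
	have "\<nu> (s p) = y" using snu[OF pU] y by simp
	from that[OF oD oD'[unfolded U_def] sD this w] show thesis .
qed

text \<open>Two sheets over a cap would carry, by cutting off with \<open>G(u) = exp (- 2 / (u + 9/10))\<close>, a function of
	mean zero with Rayleigh quotient below that of the linear functions of \<open>\<nu>\<close>.\<close>

lemma cap_polynomial:
	fixes x u :: real
	assumes x: "0 < x" "u = 2 * x - 9/10" and u: "\<bar>u\<bar> \<le> 1"
	shows "0 < (1 - 2 * x) * (1 - u^2) + x^2 * (4 * x^2 - 2 * u)"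
proof -
	have q: "4 * x^2 - 2 * u = (2 * x - 1)^2 + 4/5" by (simp add: x(2) power2_eq_square algebra_simps)
	have pos: "0 < x^2 * (4 * x^2 - 2 * u)" unfolding q using x(1) by (simp add: add_nonneg_pos)
	have u1: "0 \<le> 1 - u^2" using u by (simp add: abs_square_le_1)
	show ?thesis
	proof (cases "2 * x \<le> 1")
		case True
		then show ?thesis using pos u1 by (simp add: add_nonneg_pos)
	next
		case False
		define t where "t = 2 * x - 1"
		have t: "0 < t" "x = (1 + t) / 2" "u = t + 1/10" using False by (simp_all add: t_def x(2))
		have "4 * ((1 - 2 * x) * (1 - u^2) + x^2 * (4 * x^2 - 2 * u)) = 4/5 - (59/25) * t + (13/5) * t^2 + 6 * t ^ 3 + t ^ 4"
			unfolding q unfolding t(2,3) by (simp add: power2_eq_square power3_eq_cube power4_eq_xxxx field_simps)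
		\<comment> \<open>Completes the square in the quadratic part; the constant 4/5 - (13/5) (59/130)^2
		  left over is positive.\<close>
		also have "4/5 - (59/25) * t + (13/5) * t^2 + 6 * t ^ 3 + t ^ 4 = (13/5) * (t - 59/130)^2 + (4/5 - 3481/16900 * (13/5)) + 6 * t ^ 3 + t ^ 4"
			by (simp add: power2_eq_square field_simps)
		also have "... > 0" using t(1) by (intro add_pos_pos add_nonneg_pos) auto
		finally show ?thesis by simp
	qed
qed

text \<open>The cutoff G has Laplacian plus m k^2 G positive wherever G > 0, m k^2 being both the
  value of N2 and the eigenvalue of the coordinates of \<nu>. Multiples of G with opposite signs on
  D and on the other sheets have mean zero and make the second variation negative.\<close>

lemma nu_inj: "inj_on \<nu> M"
proof (rule ccontr)
	assume "\<not> inj_on \<nu> M"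
	then obtain p q where pq: "p \<in> M" "q \<in> M" "p \<noteq> q" "\<nu> p = \<nu> q" by (auto simp: inj_on_def)
	define y where "y = \<nu> p"
	obtain D p1 p2 where D: "openM D" "openM ({z \<in> M. - (19/20) < \<nu> z \<bullet> y} - D)"
		and p1: "p1 \<in> D" "\<nu> p1 = y" and p2: "p2 \<in> M - D" "\<nu> p2 = y"
		by (rule cap_separation[OF pq y_def])
	have p1M: "p1 \<in> M" using openin_imp_subset[OF D(1)] p1(1) by blast
	have yy: "y \<bullet> y = 1" using nu_nu[OF pq(1)] by (simp add: y_def)
	let ?m = "real CARD('m)"
	define u where "u z = \<nu> z \<bullet> y" for z
	\<comment> \<open>Positive exactly for u > -9/10, so exp(-1 / v) lives on more than a hemisphere,
	  yet inside the cap of \<open>cap_separation\<close>.\<close>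
	define v where "v z = (u z + 9/10) / 2" for z
	have us: "smooth u" unfolding u_def[abs_def] by (intro smooth_fun_intros smooth_nu)
	have vs: "smooth v" unfolding v_def[abs_def] divide_inverse by (intro smooth_fun_intros us)
	have pdv: "pd b v z = - (k / 2) * (P z b \<bullet> y)" if "z \<in> M" for b z
	proof -
		have "pd b u z = - k * (P z b \<bullet> y)"
			unfolding u_def[abs_def] using that by (simp add: pd_inner[OF smooth_nu smooth_fun_const] pd_nu)
		then show ?thesis
			unfolding v_def[abs_def] divide_inverse pd_mult[OF smooth_fun_add[OF us smooth_fun_const] smooth_fun_const that]
				pd_add[OF us smooth_fun_const that] by simp
	qed
	have lapv: "(\<Sum>b\<in>Basis. pd b (pd b v) z) = - (?m * k^2 / 2) * u z" if z: "z \<in> M" for z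
	proof -
		have "pd b (pd b v) z = - (k / 2) * (Q b b z \<bullet> y)" for b
		proof -
			have "pd b (pd b v) z = pd b (%z. - (k / 2) * (P z b \<bullet> y)) z" by (rule pd_cong[OF pdv z])
			also have "... = - (k / 2) * pd b (%z. P z b \<bullet> y) z"
				using pd_mult[OF smooth_fun_const[of "- (k/2)"] smooth_fun_inner[OF smooth_fun_P smooth_fun_const] z] by simp
			finally show ?thesis by (simp add: pd_inner[OF smooth_fun_P smooth_fun_const z] Q_def)
		qed
		then have "(\<Sum>b\<in>Basis. pd b (pd b v) z) = - (k / 2) * (mH z \<bullet> y)"
			by (simp add: mH_def inner_sum_left sum_distrib_left)
		then show ?thesis by (simp add: mH_nu[OF z] kappa_eq[OF z] u_def power2_eq_square)
	qed
	have gradv: "(\<Sum>b\<in>Basis. (pd b v z)^2) = (k^2 / 4) * (1 - (u z)^2)" if z: "z \<in> M" for z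
	proof -
		have "y = P z y + u z *R \<nu> z"
		proof -
			have "y \<in> EN z" using nu_V0[OF pq(1)] EM_eq[OF z] by (simp add: y_def)
			from proj_id[OF subspace_EM this] show ?thesis unfolding proj_EM[OF z] u_def by (simp add: inner_commute[of y])
		qed
		then have "P z y \<bullet> y = 1 - (u z)^2"
			using yy by (metis (no_types, lifting) add_diff_cancel_right' inner_commute inner_diff_left inner_scaleR_left power2_eq_square u_def)
		moreover have "(\<Sum>b\<in>Basis. (P z b \<bullet> y)^2) = P z y \<bullet> P z y"
		proof -
			have "P z b \<bullet> y = P z y \<bullet> b" for b using P_sym[OF z, of b y] by (simp add: inner_commute)
			then show ?thesis by (simp add: power2_eq_square euclidean_inner[of "P z y" "P z y"])
		qed
		moreover have "P z y \<bullet> P z y = P z y \<bullet> y" using P_sym[OF z, of "P z y" y] P_P[OF z] by simp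
		moreover have "(\<Sum>b\<in>Basis. (pd b v z)^2) = (k^2 / 4) * (\<Sum>b\<in>Basis. (P z b \<bullet> y)^2)"
			unfolding sum_distrib_left by (simp add: pdv[OF z] power_mult_distrib power_divide)
		ultimately show ?thesis by simp
	qed
	define G where "G z = flat_exp 0 (v z)" for z
	define G1 where "G1 z = flat_exp 2 (v z)" for z
	define G2 where "G2 z = flat_exp 4 (v z) - 2 * flat_exp 3 (v z)" for z
	have fs: "smooth (%z. flat_exp n (v z))" for n by (rule smooth_fun_compose[OF vs smooth_on_flat_exp]) auto
	have Gs: "smooth G" "smooth G1" "smooth G2"
		unfolding G_def[abs_def] G1_def[abs_def] G2_def[abs_def] by (intro smooth_fun_intros fs)+
	have pdG: "pd b G z = G1 z * pd b v z" "pd b G1 z = G2 z * pd b v z" if z: "z \<in> M" for b z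
		unfolding G_def[abs_def] G1_def[abs_def] G2_def[abs_def]
		using pd_compose_real[OF vs flat_exp_has_derivative[of 0] z] pd_compose_real[OF vs flat_exp_has_derivative[of 2] z]
		by (simp_all add: numeral_eq_Suc)
	have lapG: "(\<Sum>b\<in>Basis. pd b (pd b G) z) = (k^2 / 4) * (G2 z * (1 - (u z)^2) - 2 * ?m * G1 z * u z)" if z: "z \<in> M" for z
	proof -
		have "pd b (pd b G) z = G2 z * (pd b v z)^2 + G1 z * pd b (pd b v) z" for b
		proof -
			have "pd b (pd b G) z = pd b (%z. G1 z * pd b v z) z" by (rule pd_cong[OF pdG(1) z])
			then show ?thesis using z by (simp add: pd_mult Gs vs smooth_fun_pd pdG power2_eq_square)
		qed
		then have "(\<Sum>b\<in>Basis. pd b (pd b G) z) = G2 z * (\<Sum>b\<in>Basis. (pd b v z)^2) + G1 z * (\<Sum>b\<in>Basis. pd b (pd b v) z)"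
			by (simp add: sum.distrib sum_distrib_left)
		then show ?thesis unfolding gradv[OF z] lapv[OF z] by (simp add: algebra_simps)
	qed
	define E where "E z = G z * ((\<Sum>b\<in>Basis. pd b (pd b G) z) + ?m * k^2 * G z)" for z
	have E_pos: "0 < E z" if z: "z \<in> M" and v0: "0 < v z" for z
	proof -
		have e: "G z = exp (- 1 / v z)" "G1 z = G z / (v z)^2" "G2 z = G z / (v z) ^ 4 - 2 * (G z / (v z) ^ 3)"
			using v0 by (simp_all add: G_def G1_def G2_def flat_exp_def)
		have G0: "0 < G z" by (simp add: e(1))
		have "\<bar>u z\<bar> \<le> 1" using Cauchy_Schwarz_ineq2[of "\<nu> z" y] norm_nu[OF z] norm_nu[OF pq(1)] by (simp add: u_def y_def)
		then have c: "0 < (1 - 2 * v z) * (1 - (u z)^2) + (v z)^2 * (4 * (v z)^2 - 2 * u z)"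
			by (intro cap_polynomial v0) (simp_all add: v_def field_simps)
		\<comment> \<open>\<open>cap_polynomial\<close> is the case m = 1; the summand to be multiplied by
		  m is nonnegative, so larger m only increases the expression.\<close>
		have "0 \<le> (v z)^2 * (4 * (v z)^2 - 2 * u z)"
		proof -
			have "4 * (v z)^2 - 2 * u z = (2 * v z - 1)^2 + 4/5" by (simp add: v_def power2_eq_square field_simps)
			then show ?thesis by simp
		qed
		moreover have "1 \<le> ?m" by (simp add: Suc_leI)
		ultimately have "1 * ((v z)^2 * (4 * (v z)^2 - 2 * u z)) \<le> ?m * ((v z)^2 * (4 * (v z)^2 - 2 * u z))"
			by (intro mult_right_mono)
		with c have c': "0 < (1 - 2 * v z) * (1 - (u z)^2) + ?m * ((v z)^2 * (4 * (v z)^2 - 2 * u z))" by linarith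
		have "E z = (G z)^2 * k^2 / (4 * (v z) ^ 4) * ((1 - 2 * v z) * (1 - (u z)^2) + ?m * ((v z)^2 * (4 * (v z)^2 - 2 * u z)))"
			unfolding E_def lapG[OF z] e(2,3) using v0
			by (simp add: field_simps power2_eq_square power3_eq_cube power4_eq_xxxx)
		then show ?thesis using c' G0 k_pos v0 by simp
	qed
	have E0: "E z = 0" if "v z \<le> 0" for z using that by (simp add: E_def G_def flat_exp_def)
	\<comment> \<open>The jump between the factors s and t is harmless: D and the rest are both open
	  over the larger cap, and outside that cap G vanishes.\<close>
	define F where "F s t z = (if z \<in> D then s else t) * G z" for s t :: real and z
	have loc: "\<exists>O'. openM O' \<and> z \<in> O' \<and> (\<forall>w\<in>O'. F s t w = (if z \<in> D then s else t) * G w)"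
		if z: "z \<in> M" for z s t
	proof -
		consider "z \<in> D" | "z \<notin> D" "- (19/20) < u z" | "z \<notin> D" "u z \<le> - (19/20)" by linarith
		then show ?thesis
		proof cases
			case 1
			then show ?thesis using D(1) by (intro exI[of _ D]) (auto simp: F_def)
		next
			case 2
			then show ?thesis using D(2) z by (intro exI[of _ "{z \<in> M. - (19/20) < \<nu> z \<bullet> y} - D"]) (auto simp: F_def u_def)
		next
			case 3
			have "openM (M \<inter> v -` {..<0})"
				by (intro continuous_openin_preimage_gen smooth_fun_continuous vs) simp
			moreover have "z \<in> M \<inter> v -` {..<0}" using z 3 by (simp add: v_def)
			ultimately show ?thesis by (intro exI[of _ "M \<inter> v -` {..<0}"]) (auto simp: F_def G_def flat_exp_def)
		qed
	qed
	have Fs: "smooth (F s t)" for s t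
	proof (rule smooth_fun_agree)
		fix z assume "z \<in> M"
		from loc[OF this, of s t] obtain O' where O': "openM O'" "z \<in> O'"
			"\<forall>w\<in>O'. F s t w = (if z \<in> D then s else t) * G w" by blast
		then show "\<exists>U g. openM U \<and> z \<in> U \<and> smooth g \<and> (\<forall>q\<in>U. F s t q = g q)"
			by (intro exI[of _ O'] exI[of _ "%w. (if z \<in> D then s else t) * G w"] conjI smooth_fun_mult smooth_fun_const Gs) auto
	qed
	have lapF: "pd b (pd b (F s t)) z = (if z \<in> D then s else t) * pd b (pd b G) z" if z: "z \<in> M" for b z s t
	proof -
		let ?c = "if z \<in> D then s else t"
		obtain O' where O': "openM O'" "z \<in> O'" "\<forall>w\<in>O'. F s t w = ?c * G w" using loc[OF z] by blast
		have "pd b (F s t) w = ?c * pd b G w" if w: "w \<in> O'" for w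
		proof -
			have "w \<in> M" using openin_imp_subset[OF O'(1)] w by blast
			moreover have "pd b (F s t) w = pd b (%w. ?c * G w) w" by (rule pd_cong_open[OF O'(1) w]) (use O'(3) in blast)
			ultimately show ?thesis using pd_mult[OF smooth_fun_const[of ?c] Gs(1)] by simp
		qed
		then have "pd b (pd b (F s t)) z = pd b (%w. ?c * pd b G w) z" by (rule pd_cong_open[OF O'(1,2)])
		then show ?thesis using pd_mult[OF smooth_fun_const[of ?c] smooth_fun_pd[OF Gs(1)] z] by simp
	qed
	have Gp: "0 < G z" if "\<nu> z = y" for z using that yy by (simp add: G_def v_def u_def flat_exp_def)
	have Fpos: "0 < (LINT z|vM. F s t z)" if "0 \<le> s" "0 \<le> t" "F s t r \<noteq> 0" "r \<in> M" for s t r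
	proof (rule ccontr)
		assume "\<not> 0 < (LINT z|vM. F s t z)"
		then have "F s t r = 0" by (intro integral_nonneg_eq_0[OF smooth_fun_continuous[OF Fs] _ _ that(4)])
				(use that(1,2) in \<open>auto simp: F_def G_def flat_exp_nonneg\<close>)
		then show False using that(3) by simp
	qed
	\<comment> \<open>a is the integral of G off D and b the one over D, so a G on D together with -b G
	  elsewhere has integral a b - b a = 0.\<close>
	define a where "a = (LINT z|vM. F 0 1 z)"
	define b where "b = (LINT z|vM. F 1 0 z)"
	have a: "0 < a" unfolding a_def by (rule Fpos[of 0 1 p2]) (use p2 Gp[OF p2(2)] in \<open>auto simp: F_def\<close>)
	define f where "f = F a (- b)"
	have ff: "smooth f" unfolding f_def by (rule Fs)
	have "(LINT z|vM. f z) = (LINT z|vM. a * F 1 0 z - b * F 0 1 z)"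
		by (rule int_cong) (auto simp: f_def F_def)
	also have "... = a * b - b * a"
		using smooth_integrable[OF Fs[of 1 0]] smooth_integrable[OF Fs[of 0 1]] by (simp add: a_def b_def)
	finally have fm: "f \<in> mean_zero M A \<phi>" using ff by (simp add: mean_zero_def)
	define L where "L z = (\<Sum>b\<in>Basis. pd b (pd b f) z)" for z
	have Ls: "smooth L" unfolding L_def[abs_def] by (intro smooth_fun_intros ff)
	define R where "R z = f z * L z + ?m * k^2 * (f z * f z)" for z
	have Rs: "smooth R" unfolding R_def[abs_def] by (intro smooth_fun_intros ff Ls)
	have R: "R z = (if z \<in> D then a else - b)^2 * E z" if "z \<in> M" for z
	proof -
		have "L z = (if z \<in> D then a else - b) * (\<Sum>b\<in>Basis. pd b (pd b G) z)"
			unfolding L_def f_def sum_distrib_left by (rule sum.cong[OF refl lapF[OF that]])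
		then show ?thesis unfolding R_def E_def f_def F_def by (simp add: power2_eq_square algebra_simps)
	qed
	have i: "integrable vM (%z. \<Sum>b\<in>Basis. pd b f z * pd b f z)" "integrable vM (%z. ?m * k^2 * (f z * f z))"
			"integrable vM (%z. f z * L z)"
		by (intro smooth_integrable smooth_fun_intros ff Ls)+
	have "0 \<le> (LINT z|vM. (\<Sum>b\<in>Basis. (pd b f z)^2) - (f z)^2 * N2 z)" by (rule stability_scaled_nu[OF fm])
	also have "... = (LINT z|vM. (\<Sum>b\<in>Basis. pd b f z * pd b f z) - ?m * k^2 * (f z * f z))"
		by (rule int_cong[OF refl])
			(use N2_min in \<open>simp add: power2_eq_square eq_diff_eq algebra_simps\<close>)
	also have "... = (LINT z|vM. (\<Sum>b\<in>Basis. pd b f z * pd b f z)) - (LINT z|vM. ?m * k^2 * (f z * f z))"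
		by (rule Bochner_Integration.integral_diff[OF i(1,2)])
	also have "... = - (LINT z|vM. R z)"
		unfolding R_def Bochner_Integration.integral_add[OF i(3,2)] green[OF ff ff] L_def[symmetric] by simp
	finally have "(LINT z|vM. R z) \<le> 0" by simp
	moreover have "0 \<le> R z" if z: "z \<in> M" for z
		using R[OF z] E_pos[OF z] E0[of z] by (cases "0 < v z") (auto intro: mult_nonneg_nonneg)
	ultimately have "R p1 = 0" by (intro integral_nonneg_eq_0[OF smooth_fun_continuous[OF Rs] _ _ p1M])
	moreover have "0 < E p1" by (rule E_pos[OF p1M]) (simp add: v_def u_def p1(2) yy)
	ultimately show False using R[OF p1M] p1(1) a by simp
qed

lemma phi_inj: "inj_on \<phi> M"
proof (rule inj_onI)
	fix p q assume pq: "p \<in> M" "q \<in> M" "\<phi> p = \<phi> q"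
	then have "\<nu> p = \<nu> q" using k_pos by (simp add: phi_eq)
	then show "p = q" using inj_onD[OF nu_inj] pq by blast
qed

end


section \<open>The flat extension\<close>

context stable_immersion_trivial
begin

text \<open>V carries one global affine chart, in which the inclusion has constant derivative and
  hence no second fundamental form. Injectivity of \<phi> lets \<phi> itself serve as
  \<iota>.\<close>

lemma flat_extension: "\<exists>(A' :: ('e, (real ^ 'm::{finite,wellorder}) \<times> real) chart set) \<iota>.
		 extension M A \<phi> \<nu> V A' (%x. x) \<iota> \<and>
		 (parallel_form (CARD('m) + 1) \<Omega> \<longrightarrow> calibrated_submanifold \<Omega> V A' (%x. x)) \<and> minimal V A' (%x. x)"
proof -
	obtain L G where L: "linear (L :: 'e => (real ^ 'm::{finite,wellorder}) \<times> real)" and G: "linear G" "range G = V0"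
		"\<And>v. v \<in> V0 ==> G (L v) = v" "\<And>y. L (G y) = y" by (rule V0_isometry) (rule that)
	have bL: "bounded_linear L" and bG: "bounded_linear G" using L G(1) by (simp_all add: linear_linear)
	define c where "c = (V, %x. L (x - cen))"
	have c [simp]: "fst c = V" "snd c = (%x. L (x - cen))" by (simp_all add: c_def)
	have GV: "cen + G y \<in> V" for y using G(2) by (auto simp: mem_V)
	have im: "(%x. L (x - cen)) ` V = UNIV"
	proof (intro subset_antisym subset_UNIV subsetI)
		fix y show "y \<in> (%x. L (x - cen)) ` V" using GV[of y] G(4) by (intro image_eqI[of _ _ "cen + G y"]) auto
	qed
	have inj: "inj_on (%x. L (x - cen)) V"
		by (rule inj_on_inverseI[of _ "%y. cen + G y"]) (simp add: G(3) mem_V[symmetric])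
	have inv: "inv_into V (%x. L (x - cen)) y = cen + G y" for y using inv_into_f_f[OF inj GV[of y]] by (simp add: G(4))
	have ic: "in_chart c f y = f (cen + G y)" for f :: "'e => 'z" and y by (simp add: in_chart_def inv)
	have mfd: "smooth_manifold V {c}" unfolding smooth_manifold_def
	proof (intro conjI ballI)
		show "V \<noteq> {}" using cen_V by auto
		show "second_countable (top_of_set V)" by (rule second_countable_top_of_set)
		fix d assume "d \<in> {c}"
		then have d: "d = c" by simp
		show "homeomorphism (fst d) (snd d ` fst d) (snd d) (inv_into (fst d) (snd d))"
			unfolding d homeomorphism_def c im inv[abs_def]
		proof (intro conjI ballI)
			show e: "cen + G (L (x - cen)) = x" if "x \<in> V" for x using that G(3) by (simp add: mem_V)
			show "range (%y. cen + G y) = V"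
			proof (intro subset_antisym subsetI)
				show "x \<in> V" if "x \<in> range (%y. cen + G y)" for x using that GV by blast
				show "x \<in> range (%y. cen + G y)" if "x \<in> V" for x by (rule range_eqI) (rule e[OF that, symmetric])
			qed
			show "continuous_on V (%x. L (x - cen))"
				by (rule continuous_on_compose2[OF linear_continuous_on[OF bL]]) (auto intro: continuous_intros)
			show "continuous_on UNIV (%y. cen + G y)" by (intro continuous_intros linear_continuous_on bG)
		qed (simp_all add: G(4) im)
		fix d' assume "d' \<in> {c}"
		then show "smooth_on (snd d ` (fst d \<inter> fst d')) (in_chart d (snd d'))" by (simp add: d ic[abs_def] G(4))
	qed (auto simp: im)
	have der: "FD (in_chart c (%x. x)) y = G" for y unfolding ic[abs_def]
		by (rule frechet_derivative_eqI) (auto intro!: derivative_eq_intros bounded_linear_imp_has_derivative bG)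
	have at: "chart_at {c} x = c" if "x \<in> V" for x unfolding chart_at_def by (rule some_equality) (use that in auto)
	have Tan: "Tan {c} (%x. x) x = V0" if "x \<in> V" for x using G(2) by (simp add: Tan_def dmap_def at[OF that] der)
	have imm: "immersion {c} (%x. x)"
	proof -
		have "smooth_on UNIV (%y. cen + G y)" by (intro smooth_on_add smooth_on_const smooth_on_linear bG) simp
		then show ?thesis
			unfolding immersion_def smooth_fun_def by (auto simp: im ic[abs_def] der[unfolded ic[abs_def]] intro: inj_on_inverseI[of _ L] G(4))
	qed
	have sm: "smooth_map M A V {c} \<phi>" unfolding smooth_map_def
	proof (intro conjI ballI)
		show "continuous_on M \<phi>" by (rule smooth_fun_continuous[OF smooth_phi])
		show V: "\<phi> ` M \<subseteq> V" using phi_V by auto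
		fix b d assume b: "b \<in> A" and "d \<in> {c}"
		then have d: "d = c" by simp
		have eq: "fst b \<inter> \<phi> -` fst d = fst b" using V chart_subset[OF b] by (auto simp: d)
		have "smooth_on (snd b ` fst b) (%z. L (in_chart b \<phi> z - cen))"
			by (intro smooth_on_linear_compose[OF _ _ bL] smooth_on_diff smooth_fun_chart smooth_phi smooth_on_const chart_open b)
		then show "smooth_on (snd b ` (fst b \<inter> \<phi> -` fst d)) (in_chart b (snd d \<circ> \<phi>))"
			unfolding eq by (simp add: d in_chart_def o_def)
	qed
	have "extension M A \<phi> \<nu> V {c} (%x. x) \<phi>"
		unfolding extension_def using mfd imm sm phi_inj phi_V Tan EM_eq by simp
	moreover have "calibrated_submanifold \<Omega> V {c} (%x. x)" if "parallel_form (CARD('m) + 1) \<Omega>"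
		using calibrated_EM[OF that some_M] Tan by (simp add: calibrated_submanifold_def V0_def)
	moreover have "second_ff {c} (%x. x) x u v = 0" if x: "x \<in> V" for x u v
		using proj_id[OF subspace_V0 subspace_0[OF subspace_V0]]
		by (simp add: second_ff_def perp_def Tan[OF x] proj_perp[OF subspace_V0] ambient_deriv_def at[OF x] der)
	then have "minimal V {c} (%x. x)" by (simp add: minimal_def mean_curvature_def)
	ultimately show ?thesis by blast
qed

end


section \<open>The two-forms on the sphere\<close>

lemma covector_move:
	assumes th: "covector k th"
	shows "length (pre @ v # xs @ post) = k ==> th (pre @ v # xs @ post) = (- 1) ^ length xs * th (pre @ xs @ v # post)"
proof (induction xs arbitrary: pre)
	case (Cons x xs)
	have "th (pre @ v # x # xs @ post) = - th (pre @ x # v # xs @ post)"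
		using covector_swap[OF th, of "pre @ v # x # xs @ post" "length pre" "Suc (length pre)" v x] Cons.prems
		by (simp add: list_update_append)
	then show ?case using Cons.IH[of "pre @ [x]"] Cons.prems by simp
qed simp

lemma double_sum_antisymmetric:
	fixes w :: "nat => nat => real"
	assumes "\<And>i j. w i j = - w j i"
	shows "(\<Sum>i<N. \<Sum>j<N. a i * b j * w i j) = (\<Sum>j<N. \<Sum>i<j. w i j * (a i * b j - a j * b i))"
proof (induction N)
	case (Suc N)
	have "w N N = 0" using assms[of N N] by simp
	moreover have "(\<Sum>j<N. a N * b j * w N j) = - (\<Sum>i<N. w i N * (a N * b i))"
		unfolding sum_negf[symmetric] by (rule sum.cong[OF refl]) (use assms[of N] in simp)
	ultimately show ?case using Suc by (simp add: sum.distrib sum_subtractf right_diff_distrib mult_ac)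
qed simp

lemma double_sum_symmetric:
	fixes h :: "nat => nat => real"
	assumes "\<And>i j. h i j = h j i" "\<And>i. h i i = 0"
	shows "(\<Sum>i<N. \<Sum>j<N. h i j) = 2 * (\<Sum>j<N. \<Sum>i<j. h i j)"
proof (induction N)
	case (Suc N)
	have "(\<Sum>j<N. h N j) = (\<Sum>i<N. h i N)" by (rule sum.cong[OF refl assms(1)])
	then show ?case using Suc assms(2) by (simp add: sum.distrib)
qed simp

text \<open>For orthonormal E this is, up to sign, the contraction of \<open>th\<close> with w and
  w', turned into a two-form by the star operator of the span of E. A constant multiple of it
  becomes \<omega>.\<close>

definition eta :: "('e::real_inner list => real) => 'e list => 'e => 'e => 'e => 'e => real" where
	"eta th E w w' a b = (\<Sum>i<length E. \<Sum>j<length E.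
		 if i = j then 0 else (a \<bullet> E ! i) * (b \<bullet> E ! j) * th (E[i := w, j := w']))"

lemma bounded_bilinear_eta: "bounded_bilinear (eta th E w w' :: 'e::euclidean_space => 'e => real)"
	unfolding bilinear_conv_bounded_bilinear[symmetric] bilinear_def
	by (auto intro!: linearI simp: eta_def inner_add_left sum.distrib[symmetric] sum_distrib_left algebra_simps intro!: sum.cong)

lemma eta_swap:
	assumes "covector (length E) th"
	shows "eta th E w w' a b = - eta th E w' w a b" "eta th E w w' a b = - eta th E w w' b a"
proof -
	have s: "th (E[i := w, j := w']) = - th (E[i := w', j := w])" if "i < length E" "j < length E" "i \<noteq> j" for i j
		by (rule covector_swap[OF assms refl that])
	show "eta th E w w' a b = - eta th E w' w a b" unfolding eta_def sum_negf[symmetric] by (intro sum.cong refl) (auto simp: s)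
	have "eta th E w w' b a = (\<Sum>i<length E. \<Sum>j<length E.
		 if j = i then 0 else (b \<bullet> E ! j) * (a \<bullet> E ! i) * th (E[j := w, i := w']))"
		unfolding eta_def by (rule sum.swap)
	also have "... = - eta th E w w' a b"
		unfolding eta_def sum_negf[symmetric] by (intro sum.cong refl) (auto simp: s list_update_swap)
	finally show "eta th E w w' a b = - eta th E w w' b a" by simp
qed

text \<open>Applying the derivations \<open>x \<mapsto> (a \<bullet> x) w\<close> and \<open>x \<mapsto> (b \<bullet> x) w'\<close> to a covector gives a covector again, which is why
	\<^term>\<open>eta\<close> does not depend on the frame.\<close>

lemma eta_deriv_cov:
	fixes th :: "'e::real_inner list => real"
	assumes th: "covector (length E) th" and a: "a \<bullet> w' = 0"
	shows "eta th E w w' a b = deriv_cov (length E) (%x. (b \<bullet> x) *R w') (deriv_cov (length E) (%x. (a \<bullet> x) *R w) th) E"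
proof -
	have "(if i = j then 0 else (a \<bullet> E ! i) * (b \<bullet> E ! j) * th (E[i := w, j := w'])) =
			th (E[j := (b \<bullet> E ! j) *R w', i := (a \<bullet> (E[j := (b \<bullet> E ! j) *R w'] ! i)) *R w])"
		if ij: "i < length E" "j < length E" for i j
	proof (cases "i = j")
		case True
		then show ?thesis using linear_0[OF covector_linear[OF th refl ij(1)]] a ij by simp
	next
		case False
		have "th (E[j := (b \<bullet> E ! j) *R w', i := (a \<bullet> E ! i) *R w]) = (a \<bullet> E ! i) * th (E[i := w, j := (b \<bullet> E ! j) *R w'])"
			using linear_scale[OF covector_linear[OF th, of "E[j := (b \<bullet> E ! j) *R w']" i]] ij False by (simp add: list_update_swap)
		also have "th (E[i := w, j := (b \<bullet> E ! j) *R w']) = (b \<bullet> E ! j) * th (E[i := w, j := w'])"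
			using linear_scale[OF covector_linear[OF th, of "E[i := w]" j]] ij by simp
		finally show ?thesis using False by simp
	qed
	then have "eta th E w w' a b = (\<Sum>i<length E. \<Sum>j<length E.
			th (E[j := (b \<bullet> E ! j) *R w', i := (a \<bullet> (E[j := (b \<bullet> E ! j) *R w'] ! i)) *R w]))"
		unfolding eta_def by (intro sum.cong refl) auto
	also have "... = deriv_cov (length E) (%x. (b \<bullet> x) *R w') (deriv_cov (length E) (%x. (a \<bullet> x) *R w) th) E"
		unfolding deriv_cov_def by (rule sum.swap)
	finally show ?thesis .
qed

section \<open>Gradients and constant two-forms on M\<close>

context closed_immersion
begin

definition grad :: "('p => real) => 'p => 'e" where "grad f p = (\<Sum>b\<in>Basis. pd b f p *R b)"

lemma smooth_grad: "smooth f ==> smooth (grad f)"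
	unfolding grad_def[abs_def] by (intro smooth_fun_intros)

lemma inner_grad: "smooth f ==> p \<in> M ==> a \<bullet> grad f p = pd a f p"
	using linear_euclidean_expand[OF linear_pd, of f p a] by (simp add: grad_def inner_sum_right mult.commute)

lemma P_grad: "smooth f ==> p \<in> M ==> P p (grad f p) = grad f p"
proof (rule vector_eq_ldot[THEN iffD1, rule_format])
	fix a assume "smooth f" "p \<in> M"
	then show "a \<bullet> P p (grad f p) = a \<bullet> grad f p" by (simp add: P_sym[symmetric] inner_grad pd_P)
qed

lemma gradient_eq:
	assumes f: "smooth f" and p: "p \<in> M"
	shows "gradient A \<phi> f p = grad f p" and "(norm_df A \<phi> f p)^2 = grad f p \<bullet> grad f p"
proof -
	note fr = some_frame[OF p]
	have d: "deriv_along A \<phi> f p (sfrm p ! i) = sfrm p ! i \<bullet> grad f p" if "i < CARD('m)" for i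
		using pd_Tan[OF p ortho_frameD(4)[OF fr that]] inner_grad[OF f p] by simp
	have "gradient A \<phi> f p = proj (span (set (sfrm p))) (grad f p)"
		unfolding orthonormal_proj_expand[OF ortho_frameD(2)[OF fr]] ortho_frameD(1)[OF fr]
		by (simp add: gradient_def d inner_commute)
	then show "gradient A \<phi> f p = grad f p" by (simp add: ortho_frameD(3)[OF fr] P_grad[OF f p])
	have lin: "\<And>b. linear (%a. (a \<bullet> grad f p) * (b \<bullet> grad f p))" "\<And>a. linear (%b. (a \<bullet> grad f p) * (b \<bullet> grad f p))"
		by (auto intro!: linearI simp: inner_add_left algebra_simps)
	have "(norm_df A \<phi> f p)^2 = (\<Sum>i<CARD('m). (sfrm p ! i \<bullet> grad f p) * (sfrm p ! i \<bullet> grad f p))"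
		unfolding norm_df_def by (subst real_sqrt_pow2) (auto simp: d power2_eq_square intro: sum_nonneg)
	also have "... = (\<Sum>b\<in>Basis. (P p b \<bullet> grad f p) * (P p b \<bullet> grad f p))" by (rule trace_frame[OF fr lin])
	also have "... = grad f p \<bullet> grad f p"
	proof -
		have "P p b \<bullet> grad f p = grad f p \<bullet> b" for b
			using P_sym[OF p, of b "grad f p"] P_grad[OF f p] by (simp add: inner_commute)
		then show ?thesis using euclidean_inner[of "grad f p" "grad f p"] by simp
	qed
	finally show "(norm_df A \<phi> f p)^2 = grad f p \<bullet> grad f p" .
qed

lemma inner_two_form_eq:
	assumes f: "smooth f" and g: "smooth g" and p: "p \<in> M"
		and \<omega>: "bounded_bilinear (\<omega> p)" "\<And>u v. \<omega> p u v = - \<omega> p v u"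
	shows "inner_two_form A \<phi> \<omega> (wedge_d A \<phi> f g) p = \<omega> p (grad f p) (grad g p)"
proof -
	let ?e = "%i. sfrm p ! i" and ?d = "%f i. deriv_along A \<phi> f p (sfrm p ! i)"
	interpret \<omega>: bounded_bilinear "\<omega> p" by fact
	have "\<omega> p (grad f p) (grad g p) = (\<Sum>i<CARD('m). \<Sum>j<CARD('m). ?d f i * ?d g j * \<omega> p (?e i) (?e j))"
		unfolding gradient_eq(1)[OF f p, symmetric] gradient_eq(1)[OF g p, symmetric] gradient_def
		by (subst sum.swap)
			(simp add: \<omega>.sum_left \<omega>.sum_right \<omega>.scaleR_left \<omega>.scaleR_right sum_distrib_left mult_ac)
	also have "... = (\<Sum>j<CARD('m). \<Sum>i<j. \<omega> p (?e i) (?e j) * (?d f i * ?d g j - ?d f j * ?d g i))"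
		by (rule double_sum_antisymmetric[of "%i j. \<omega> p (?e i) (?e j)"]) (rule \<omega>(2))
	finally show ?thesis by (simp add: inner_two_form_def wedge_d_def Let_def)
qed

lemma two_form_constant:
	assumes h: "bounded_bilinear h" "\<And>u v. h u v = - h v u"
	shows "two_form M A \<phi> (%p u v. (h u v :: real))"
	unfolding two_form_def
proof (intro conjI ballI allI)
	fix p assume p: "p \<in> M"
	have l: "linear (dmap A \<phi> p)" using dch_linear[OF smooth_phi chart_at_in[OF p] coord_in[OF p]] by (simp add: dmap_def)
	have b: "bilinear h" using h(1) by (simp add: bilinear_conv_bounded_bilinear)
	show "bilinear (%a b. h (dmap A \<phi> p a) (dmap A \<phi> p b))"
		using linear_compose[OF l, of "h (dmap A \<phi> p _)"] linear_compose[OF l, of "%x. h x (dmap A \<phi> p _)"] b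
		by (simp add: bilinear_def o_def)
	show "h u u = 0" for u using h(2)[of u u] by simp
next
	fix c a b assume "c \<in> A"
	then show "smooth_on (im c) (%z. h (dphi c z a) (dphi c z b))"
		by (intro smooth_on_bilinear[OF smooth_on_dch[OF smooth_phi] smooth_on_dch[OF smooth_phi] chart_open h(1)])
qed

text \<open>The tangential parts of the second derivatives of \<phi> cancel against the Levi-Civita
  terms; the normal parts, which are \<open>Q\<close>, remain.\<close>

lemma nabla_two_form_constant:
	assumes h: "bounded_bilinear h" and p: "p \<in> M" and T: "u \<in> TM p" "v \<in> TM p" "w \<in> TM p"
	shows "nabla_two_form A \<phi> (%p u v. (h u v :: real)) p u v w = h (Q u v p) w + h v (Q u w p)"
proof -
	interpret h: bounded_bilinear h by fact
	let ?F = "in_chart (chart_at A p) \<phi>" and ?z = "coord A p"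
	define B where "B b = FD (%z. FD ?F z b) ?z" for b
	have d: "((%z. FD ?F z b) has_derivative B b) (at ?z)" for b
		unfolding B_def by (rule smooth_on_has_derivative[OF smooth_on_dch[OF smooth_phi chart_at_in[OF p]]
			chart_open[OF chart_at_in[OF p]] coord_in[OF p]])
	let ?a = "components A \<phi> p u" and ?b = "components A \<phi> p v" and ?c = "components A \<phi> p w"
	have c: "FD ?F ?z (components A \<phi> p x) = x" if "x \<in> TM p" for x
		using components_in_Tan[OF that] by (simp add: dmap_def)
	have am: "ambient_deriv A \<phi> p u x = B (components A \<phi> p x) ?a" for x by (simp add: ambient_deriv_def B_def)
	have q: "B (components A \<phi> p x) ?a - P p (B (components A \<phi> p x) ?a) = Q u x p" if "x \<in> TM p" for x
		using second_ff_eq[OF p T(1) that] by (simp add: second_ff_def perp_eq[OF p] am)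
	have "FD (%z. h (FD ?F z ?b) (FD ?F z ?c)) ?z ?a
			= h v (B ?c ?a) + h (B ?b ?a) w"
		using fun_cong[OF frechet_derivative_eqI[OF h.FDERIV[OF d[of ?b] d[of ?c]]], of ?a] by (simp add: c T)
	then show ?thesis unfolding nabla_two_form_def Let_def am q[OF T(2), symmetric] q[OF T(3), symmetric]
		by (simp add: h.diff_left h.diff_right)
qed

end

context stable_immersion_trivial
begin

definition F0 :: "'e set" where "F0 = {w. \<forall>v\<in>V0. w \<bullet> v = 0}"

lemma F0_Fspace: "p \<in> M ==> FN p = F0"
	using Fspace_iff[of _ A \<phi> \<nu> p] EM_eq[of p] by (auto simp: F0_def)

lemma F0_V: "{w. \<forall>x\<in>V. \<forall>y\<in>V. w \<bullet> (x - y) = 0} = F0"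
proof (intro subset_antisym subsetI CollectI ballI)
	fix w assume w: "w \<in> {w. \<forall>x\<in>V. \<forall>y\<in>V. w \<bullet> (x - y) = 0}"
	show "w \<in> F0" unfolding F0_def
	proof (intro CollectI ballI)
		fix v assume "v \<in> V0"
		then have "cen + v \<in> V" by (simp add: mem_V)
		then show "w \<bullet> v = 0" using w cen_V by force
	qed
next
	fix w x y assume "w \<in> F0" "x \<in> V" "y \<in> V"
	moreover from this have "(x - cen) - (y - cen) \<in> V0" using subspace_diff[OF subspace_V0] by (simp only: mem_V)
	ultimately show "w \<bullet> (x - y) = 0" by (simp add: F0_def)
qed

context
	fixes p assumes p: "p \<in> M"
begin

lemma F0_normal: "w \<in> F0 ==> P p w = 0" "w \<in> F0 ==> w \<bullet> \<nu> p = 0"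
	using F_section_normal[OF p] F0_Fspace[OF p] nu_V0[OF p] by (auto simp: F0_def)

text \<open>A constant w in \<open>F0\<close> satisfies P w = 0 identically, so \<open>Q a w\<close>
  vanishes and B has no component along w. What remains is the umbilical part along \<nu>.\<close>

lemma Q_Tan: "Q a (P p b) p = (k * (P p a \<bullet> b)) *R \<nu> p"
proof -
	let ?q = "Q a (P p b) p"
	have n: "?q \<bullet> \<nu> p = k * (P p a \<bullet> b)" by (simp add: Q_P_nu[OF p] pd_nu[OF p])
	define w where "w = ?q - (?q \<bullet> \<nu> p) *R \<nu> p"
	have wF: "w \<in> F0" unfolding F0_Fspace[OF p, symmetric] Fspace_def
		using nu_nu[OF p] P_Q_P[OF p, of a b] P_nu[OF p] unfolding P_eq_0_iff[OF p]
		by (auto simp: w_def inner_diff_left)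
	have "pd a (%q. P q w) p = pd a (%q. 0) p" by (rule pd_cong[OF _ p]) (use F_section_normal F0_Fspace wF in auto)
	then have "Q a w p = 0" by (simp add: Q_def)
	then have "?q \<bullet> w = 0" using Q_sym[OF p, of a "P p b" w] by simp
	moreover have "\<nu> p \<bullet> w = 0" using n by (simp add: w_def inner_diff_right nu_nu[OF p] inner_commute)
	ultimately have "w \<bullet> w = 0" by (subst (1) w_def) (simp add: inner_diff_left)
	then show ?thesis using n by (simp add: w_def)
qed

text \<open>With B = k g \<nu> the first slot contributes m copies of k \<eta>(\<nu>, u) and the
  second slot removes one. The factor m - 1 vanishes on curves.\<close>

lemma codiff_constant:
	assumes \<eta>: "bounded_bilinear \<eta>" "\<And>u v. \<eta> u v = - \<eta> v u" and u: "u \<in> TM p"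
	shows "codiff A \<phi> (%p u v. (\<eta> u v :: real)) p u = - (k * (real CARD('m) - 1) * \<eta> (\<nu> p) u)"
proof -
	interpret \<eta>: bounded_bilinear \<eta> by fact
	note fr = some_frame[OF p]
	let ?e = "%i. sfrm p ! i"
	have Q: "Q x y p = (k * (x \<bullet> y)) *R \<nu> p" if "x \<in> TM p" "y \<in> TM p" for x y
		using Q_Tan[of x y] P_id[OF p] that by simp
	have "nabla_two_form A \<phi> (%p u v. \<eta> u v) p (?e i) (?e i) u = k * \<eta> (\<nu> p) u - k * \<eta> (\<nu> p) ((u \<bullet> ?e i) *R ?e i)"
		if i: "i < CARD('m)" for i
	proof -
		have e: "?e i \<in> TM p" "?e i \<bullet> ?e i = 1" using ortho_frameD(1,2,4)[OF fr] i by (auto simp: orthonormal_def)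
		show ?thesis unfolding nabla_two_form_constant[OF \<eta>(1) p e(1) e(1) u] Q[OF e(1) e(1)] Q[OF e(1) u]
			using \<eta>(2)[of "?e i" "\<nu> p"] by (simp add: e(2) \<eta>.scaleR_left \<eta>.scaleR_right inner_commute)
	qed
	then have "codiff A \<phi> (%p u v. \<eta> u v) p u = - (\<Sum>i<CARD('m). k * \<eta> (\<nu> p) u - k * \<eta> (\<nu> p) ((u \<bullet> ?e i) *R ?e i))"
		by (simp add: codiff_def)
	also have "... = - (k * real CARD('m) * \<eta> (\<nu> p) u - k * \<eta> (\<nu> p) (\<Sum>i<CARD('m). (u \<bullet> ?e i) *R ?e i))"
		by (simp add: sum_subtractf \<eta>.sum_right sum_distrib_left)
	also have "(\<Sum>i<CARD('m). (u \<bullet> ?e i) *R ?e i) = u"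
		using orthonormal_proj_expand[OF ortho_frameD(2)[OF fr], of u] P_id[OF p u] ortho_frameD(1,3)[OF fr] by simp
	finally show ?thesis by (simp add: algebra_simps)
qed

lemma xi_eq:
	assumes w: "w \<in> F0" "w' \<in> F0"
	shows "xiO w w' p u = (\<Sum>i<CARD('m). (u \<bullet> frm p ! i) * \<Omega> (\<phi> p) (w # (frm p)[i := w']))"
	unfolding xi_def Let_def
proof (rule sum.cong[OF refl])
	fix i assume "i \<in> {..<CARD('m)}"
	then have i: "i < length (frm p)" using ortho_frameD(1)[OF frame[OF p]] by simp
	have "\<Omega> (\<phi> p) (w # w' # take i (frm p) @ drop (Suc i) (frm p)) = (-1) ^ i * \<Omega> (\<phi> p) (w # (frm p)[i := w'])"
		using covector_move[OF covector_Omega, of "[w]" w' "take i (frm p)" "drop (Suc i) (frm p)"] i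
			ortho_frameD(1)[OF frame[OF p]] by (simp add: upd_conv_take_nth_drop)
	then show "(u \<bullet> frm p ! i) * (- 1) ^ i * \<Omega> (\<phi> p) (w # w' # take i (frm p) @ drop (Suc i) (frm p)) =
			(u \<bullet> frm p ! i) * \<Omega> (\<phi> p) (w # (frm p)[i := w'])"
		by (simp flip: power_mult_distrib)
qed

lemma linear_xi: "linear (%u. xiO w w' p u)"
	unfolding xi_def Let_def by (rule linearI) (simp_all add: inner_add_left sum.distrib sum_distrib_left algebra_simps)

lemma xi_swap: "w \<in> F0 ==> w' \<in> F0 ==> xiO w w' p u = - xiO w' w p u"
	unfolding xi_eq sum_negf[symmetric]
	using covector_swap[OF covector_Omega[of "\<phi> p"], of "w # frm p" 0 "Suc _" w w'] ortho_frameD(1)[OF frame[OF p]]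
	by (intro sum.cong) auto

end

end


section \<open>\<xi>, constant two-forms and the second variation on F\<close>

context stable_immersion_trivial
begin

text \<open>Divergence theorem for the field dual to f \<eta>(., grad g). Contracted with the
  antisymmetric \<eta>, the second derivatives of g leave only commutators, worth -k f \<eta>(\<nu>,
  grad g); the normal part of the field accounts for m k f \<eta>(\<nu>, grad g).\<close>

lemma integral_form_grad:
	assumes \<eta>: "bounded_bilinear \<eta>" "\<And>u v. \<eta> u v = - \<eta> v u" and f: "smooth f" and g: "smooth g"
	shows "(LINT p|vM. (\<eta> (grad f p) (grad g p) :: real)) = - (k * (real CARD('m) - 1)) * (LINT p|vM. f p * \<eta> (\<nu> p) (grad g p))"
proof -
	interpret \<eta>: bounded_bilinear \<eta> by fact
	note gs = smooth_grad[OF g]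
	have el: "\<eta> u v = (\<Sum>b\<in>Basis. (u \<bullet> b) * \<eta> b v)" for u v
		using linear_euclidean_expand[OF bounded_linear.linear[OF \<eta>.bounded_linear_left], of u v] by simp
	have s: "smooth (%p. \<eta> (U p) (V p))" if "smooth U" "smooth V" for U V
		by (rule smooth_fun_bilinear[OF that \<eta>(1)])
	define X where "X p = (\<Sum>b\<in>Basis. (f p * \<eta> b (grad g p)) *R b)" for p
	have Xs: "smooth X" unfolding X_def[abs_def] by (intro smooth_fun_intros f s gs)
	have div: "(\<Sum>b\<in>Basis. pd b X p \<bullet> b) = \<eta> (grad f p) (grad g p) - k * (f p * \<eta> (\<nu> p) (grad g p))" if p: "p \<in> M" for p
	proof -
		have 1: "pd b X p \<bullet> b = pd b f p * \<eta> b (grad g p) + f p * \<eta> b (pd b (grad g) p)" if b: "b \<in> Basis" for b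
		proof -
			have "pd b X p \<bullet> b = pd b (%q. X q \<bullet> b) p" using pd_inner[OF Xs smooth_fun_const p, of b b] by simp
			also have "(%q. X q \<bullet> b) = (%q. f q * \<eta> b (grad g q))"
				using b by (simp add: X_def inner_sum_left inner_Basis if_distrib cong: if_cong)
			also have "pd b ... p = f p * pd b (%q. \<eta> b (grad g q)) p + pd b f p * \<eta> b (grad g p)"
				by (rule pd_mult[OF f s[OF smooth_fun_const gs] p])
			also have "pd b (%q. \<eta> b (grad g q)) p = \<eta> b (pd b (grad g) p)"
				by (rule pd_linear[OF gs \<eta>.bounded_linear_right p])
			finally show ?thesis by simp
		qed
		let ?G = "grad g p"
		define D where "D b c = pd b (pd c g) p" for b c
		have pdg: "pd b (grad g) p = (\<Sum>c\<in>Basis. D b c *R c)" for b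
		proof -
			have "pd b (grad g) p = (\<Sum>c\<in>Basis. pd b (%q. pd c g q *R c) p)"
				unfolding grad_def[abs_def] by (rule pd_sum[OF _ p]) (intro smooth_fun_intros g)
			then show ?thesis by (simp add: D_def pd_scaleR[OF smooth_fun_pd[OF g] smooth_fun_const p])
		qed
		have comm: "D b c - D c b = k * ((\<nu> p \<bullet> c) * (?G \<bullet> b) - (\<nu> p \<bullet> b) * (?G \<bullet> c))" for b c
		proof -
			have q: "Q b c p \<bullet> ?G = k * ((\<nu> p \<bullet> c) * (?G \<bullet> b))" for b c
				using Q_sym[OF p, of b c ?G] Q_Tan[OF p, of b ?G] P_grad[OF g p] P_sym[OF p, of b ?G] by (simp add: inner_commute)
			show ?thesis
				unfolding D_def pd_commute(1)[OF g p] inner_grad[OF g p, symmetric] inner_diff_left q by (simp add: right_diff_distrib)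
		qed
		define S where "S = (\<Sum>b\<in>Basis. \<eta> b (pd b (grad g) p))"
		have S: "S = (\<Sum>b\<in>Basis. \<Sum>c\<in>Basis. D b c * \<eta> b c)" by (simp add: S_def pdg \<eta>.sum_right \<eta>.scaleR_right)
		also have "... = (\<Sum>b\<in>Basis. \<Sum>c\<in>Basis. D c b * \<eta> c b)" by (rule sum.swap)
		\<comment> \<open>S is added to itself with b and c exchanged; antisymmetry of \<eta> turns the
		  sum into the commutators \<open>D b c - D c b\<close>.\<close>
		finally have "2 * S = (\<Sum>b\<in>Basis. \<Sum>c\<in>Basis. D b c * \<eta> b c) + (\<Sum>b\<in>Basis. \<Sum>c\<in>Basis. D c b * \<eta> c b)" using S by simp
		also have "... = (\<Sum>b\<in>Basis. \<Sum>c\<in>Basis. (D b c - D c b) * \<eta> b c)"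
		proof -
			have "D b c * \<eta> b c + D c b * \<eta> c b = (D b c - D c b) * \<eta> b c" for b c
				using \<eta>(2)[of c b] by (simp add: algebra_simps)
			then show ?thesis unfolding sum.distrib[symmetric] by (intro sum.cong refl)
		qed
		also have "... = (\<Sum>b\<in>Basis. \<Sum>c\<in>Basis. k * ((?G \<bullet> b) * ((\<nu> p \<bullet> c) * \<eta> b c))) - (\<Sum>b\<in>Basis. \<Sum>c\<in>Basis. k * ((\<nu> p \<bullet> b) * ((?G \<bullet> c) * \<eta> b c)))"
			unfolding comm sum_subtractf[symmetric] by (intro sum.cong refl) (simp add: algebra_simps)
		also have "... = k * \<eta> ?G (\<nu> p) - k * \<eta> (\<nu> p) ?G"
		proof -
			have "(\<Sum>b\<in>Basis. \<Sum>c\<in>Basis. k * ((u \<bullet> b) * ((v \<bullet> c) * \<eta> b c))) = k * \<eta> u v" for u v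
			proof -
				have "(\<Sum>c\<in>Basis. (v \<bullet> c) * \<eta> b c) = \<eta> b v" for b
					using linear_euclidean_expand[OF bounded_linear.linear[OF \<eta>.bounded_linear_right], of b v] by simp
				then show ?thesis by (simp add: sum_distrib_left[symmetric] el[of u])
			qed
			then show ?thesis by simp
		qed
		finally have "S = - (k * \<eta> (\<nu> p) ?G)" using \<eta>(2)[of ?G "\<nu> p"] by simp
		moreover have "grad f p \<bullet> b = pd b f p" for b using inner_grad[OF f p, of b] by (simp add: inner_commute)
		then have "(\<Sum>b\<in>Basis. pd b X p \<bullet> b) = (\<Sum>b\<in>Basis. (grad f p \<bullet> b) * \<eta> b ?G) + f p * S"
			unfolding S_def sum_distrib_left sum.distrib[symmetric] using 1 by simp
		ultimately show ?thesis by (simp add: el[of "grad f p"])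
	qed
	have Xm: "X p \<bullet> mH p = real CARD('m) * (k * (f p * \<eta> (\<nu> p) (grad g p)))" if p: "p \<in> M" for p
		by (simp add: mH_nu[OF p] kappa_eq[OF p] X_def inner_sum_left inner_sum_right el[of "\<nu> p"] sum_distrib_left mult_ac inner_commute)
	have "(LINT p|vM. \<eta> (grad f p) (grad g p) - k * (f p * \<eta> (\<nu> p) (grad g p))) = (LINT p|vM. (\<Sum>b\<in>Basis. pd b X p \<bullet> b))"
		by (rule int_cong) (auto simp: div)
	also have "... = - (LINT p|vM. X p \<bullet> mH p)" by (rule divergence_theorem[OF Xs])
	also have "(LINT p|vM. X p \<bullet> mH p) = (LINT p|vM. real CARD('m) * (k * (f p * \<eta> (\<nu> p) (grad g p))))"
		by (rule int_cong) (auto simp: Xm)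
	finally have "(LINT p|vM. \<eta> (grad f p) (grad g p) - k * (f p * \<eta> (\<nu> p) (grad g p))) =
			- (real CARD('m) * (k * (LINT p|vM. f p * \<eta> (\<nu> p) (grad g p))))" by simp
	moreover have "integrable vM (%p. k * (f p * \<eta> (\<nu> p) (grad g p)))" "integrable vM (%p. \<eta> (grad f p) (grad g p))"
		by (intro smooth_integrable smooth_fun_mult smooth_fun_const f s smooth_nu gs smooth_grad)+
	ultimately have "(LINT p|vM. \<eta> (grad f p) (grad g p)) - k * (LINT p|vM. f p * \<eta> (\<nu> p) (grad g p)) =
			- (real CARD('m) * (k * (LINT p|vM. f p * \<eta> (\<nu> p) (grad g p))))" by simp
	then show ?thesis by (simp add: algebra_simps)
qed

text \<open>The frames (\<nu>, e) at p and p0 both span V0 and have \<Omega> = 1, so the covector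
  behind \<open>eta\<close> takes the same value on both. At p the argument \<nu> p meets only the
  slot of \<nu>.\<close>

lemma xi_eta:
	assumes par: "parallel_form (CARD('m) + 1) \<Omega>" and p: "p \<in> M" "p0 \<in> M" and w: "w \<in> F0" "w' \<in> F0" and u: "u \<in> TM p"
	shows "xiO w w' p u = eta (\<Omega> x) (\<nu> p0 # frm p0) w w' (\<nu> p) u"
proof -
	let ?E = "%p. \<nu> p # frm p" and ?K = "Suc CARD('m)"
	have len: "length (?E q) = ?K" and one: "\<Omega> x (?E q) = 1" and V0: "set (?E q) \<subseteq> V0" "span (set (?E q)) = V0" if q: "q \<in> M" for q
	proof -
		note fr = ortho_frameD[OF frame[OF q]]
		show len: "length (?E q) = ?K" using fr(1) by simp
		show "\<Omega> x (?E q) = 1"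
			using parallel_constant[OF par, of "?E q" x "\<phi> q"] Omega_direct[OF q direct_frame[OF q]] len by simp
		show sp: "span (set (?E q)) = V0"
			unfolding EM_eq[OF q, symmetric] EM_def fr(3)[symmetric] by (simp add: span_insert span_span)
		show "set (?E q) \<subseteq> V0" using span_superset[of "set (?E q)"] unfolding sp .
	qed
	define \<tau> where "\<tau> = deriv_cov ?K (%x. (u \<bullet> x) *R w') (deriv_cov ?K (%x. (\<nu> p \<bullet> x) *R w) (\<Omega> x))"
	have lin: "linear (%x. (a \<bullet> x) *R v)" for a v :: 'e by (rule linearI) (simp_all add: inner_add_right scaleR_add_left)
	have \<tau>: "covector ?K \<tau>" unfolding \<tau>_def by (intro covector_deriv_cov covector_Omega lin)
	have orth: "\<nu> p \<bullet> w' = 0" using w(2) nu_V0[OF p(1)] by (auto simp: F0_def inner_commute)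
	have e: "eta (\<Omega> x) (?E q) w w' (\<nu> p) u = \<tau> (?E q)" if q: "q \<in> M" for q
		using eta_deriv_cov[of "?E q" "\<Omega> x" "\<nu> p" w' w u] covector_Omega len[OF q] orth by (simp add: \<tau>_def)
	have "eta (\<Omega> x) (?E p0) w w' (\<nu> p) u = \<tau> (?E p)"
		using covector_proportional[OF covector_Omega \<tau> len[OF p(2)] len[OF p(1)], of x] V0 p one e[OF p(2)] by simp
	also have "... = eta (\<Omega> x) (?E p) w w' (\<nu> p) u" using e[OF p(1)] by simp
	also have "... = (\<Sum>j<CARD('m). (u \<bullet> frm p ! j) * \<Omega> x (w # (frm p)[j := w']))"
	proof -
		have "\<nu> p \<bullet> frm p ! i = 0" if "i < CARD('m)" for i
			using Tan_nu[OF p(1) ortho_frameD(4)[OF frame[OF p(1)] that]] by (simp add: inner_commute)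
		then show ?thesis using ortho_frameD(1)[OF frame[OF p(1)]]
			by (simp add: eta_def sum.lessThan_Suc_shift nu_nu[OF p(1)] del: sum.lessThan_Suc cong: if_cong)
	qed
	also have "... = xiO w w' p u"
		unfolding xi_eq[OF p(1) w] using parallel_constant[OF par, of "w # _" x "\<phi> p"] ortho_frameD(1)[OF frame[OF p(1)]]
		by (intro sum.cong) auto
	finally show ?thesis by simp
qed

context
	fixes N :: nat and w :: "nat => 'e" and f :: "nat => 'p => real"
	assumes w: "\<And>n. n < N ==> w n \<in> F0" and f: "\<And>n. n < N ==> smooth (f n)"
begin

lemma Dn_combination:
	assumes p: "p \<in> M"
	shows "Dn (%p. \<Sum>n<N. f n p *R w n) p u = (\<Sum>n<N. (u \<bullet> grad (f n) p) *R w n)"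
proof -
	have "pd u (%p. \<Sum>n<N. f n p *R w n) p = (\<Sum>n<N. pd u (%p. f n p *R w n) p)"
		by (rule pd_sum[OF _ p]) (simp add: smooth_fun_scaleR f)
	also have "... = (\<Sum>n<N. (u \<bullet> grad (f n) p) *R w n)"
		by (rule sum.cong[OF refl]) (use pd_scaleR[OF f smooth_fun_const p] inner_grad[OF f p] in simp)
	finally show ?thesis by (simp add: Dn_def linear_sum[OF linear_P[OF p]] linear_scale[OF linear_P[OF p]] F0_normal(1)[OF p w])
qed

lemma Cw_combination:
	assumes p: "p \<in> M"
	shows "Cw (%p. \<Sum>n<N. f n p *R w n) p = (\<Sum>j<N. \<Sum>l<N. f j p * xiO (w j) (w l) p (grad (f l) p))"
proof -
	let ?es = "frm p"
	have lf: "length ?es = CARD('m)" using ortho_frameD(1)[OF frame[OF p]] .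
	have "\<Omega> (\<phi> p) ((\<Sum>n<N. f n p *R w n) # ?es[i := \<Sum>n<N. (?es ! i \<bullet> grad (f n) p) *R w n]) =
			(\<Sum>j<N. \<Sum>l<N. f j p * ((grad (f l) p \<bullet> ?es ! i) * \<Omega> (\<phi> p) (w j # ?es[i := w l])))" if i: "i < CARD('m)" for i
	proof -
		have l1: "linear (%v. \<Omega> (\<phi> p) (v # us))" if "length us = CARD('m)" for us
			using covector_append_linear[OF covector_Omega, of "[]" us] that by simp
		have l2: "linear (%v. \<Omega> (\<phi> p) (y # ?es[i := v]))" for y
			by (rule covector_linear[OF covector_Cons[OF covector_Omega] lf i])
		show ?thesis
			by (simp add: linear_sum[OF l1] linear_scale[OF l1] linear_sum[OF l2] linear_scale[OF l2] lf sum_distrib_left inner_commute)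
				(subst sum.swap, simp add: mult_ac)
	qed
	then have "Cw (%p. \<Sum>n<N. f n p *R w n) p =
			(\<Sum>i<CARD('m). \<Sum>j<N. \<Sum>l<N. f j p * ((grad (f l) p \<bullet> ?es ! i) * \<Omega> (\<phi> p) (w j # ?es[i := w l])))"
		unfolding Cw_def deriv_cov_def Dn_combination[OF p] by (intro sum.cong refl) simp
	also have "... = (\<Sum>j<N. \<Sum>l<N. \<Sum>i<CARD('m). f j p * ((grad (f l) p \<bullet> ?es ! i) * \<Omega> (\<phi> p) (w j # ?es[i := w l])))"
		by (subst sum.swap) (intro sum.cong refl sum.swap)
	finally show ?thesis by (simp add: xi_eq[OF p w w] sum_distrib_left)
qed

text \<open>The vectors \<open>w n\<close> are constant and normal, so the normal derivative falls
  on the coefficients only, and the B-term vanishes by \<open>Q_Tan\<close>.\<close>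

lemma combination_stability:
	assumes par: "parallel_form (CARD('m) + 1) \<Omega>"
		and on: "\<And>j l. j < N ==> l < N ==> w j \<bullet> w l = (if j = l then 1 else 0)"
		and xi: "\<And>j l. j < N ==> l < N ==> smooth (%p. f j p * xiO (w j) (w l) p (grad (f l) p))"
	shows "0 \<le> (\<Sum>n<N. LINT p|vM. grad (f n) p \<bullet> grad (f n) p) + real CARD('m) * k *
		(\<Sum>j<N. \<Sum>l<N. LINT p|vM. f j p * xiO (w j) (w l) p (grad (f l) p))"
proof -
	let ?W = "%p. \<Sum>n<N. f n p *R w n"
	have F0: "?W p \<in> F0" for p using w by (simp add: F0_def inner_sum_left)
	have W: "smooth ?W" "\<And>p. p \<in> M ==> ?W p \<in> FN p"
		using F0 F0_Fspace by (auto intro!: smooth_fun_sum smooth_fun_scaleR f)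
	have D: "(\<Sum>b\<in>Basis. Dn ?W p b \<bullet> Dn ?W p b) = (\<Sum>n<N. grad (f n) p \<bullet> grad (f n) p)" if p: "p \<in> M" for p
	proof -
		have "Dn ?W p b \<bullet> Dn ?W p b = (\<Sum>n<N. (grad (f n) p \<bullet> b) * (grad (f n) p \<bullet> b))" for b
			unfolding Dn_combination[OF p] inner_sum_left inner_sum_right
			by (intro sum.cong refl) (simp add: on inner_commute if_distrib cong: if_cong sum.cong_simp)
		then have "(\<Sum>b\<in>Basis. Dn ?W p b \<bullet> Dn ?W p b) = (\<Sum>b\<in>Basis. \<Sum>n<N. (grad (f n) p \<bullet> b) * (grad (f n) p \<bullet> b))"
			by simp
		also have "... = (\<Sum>n<N. \<Sum>b\<in>Basis. (grad (f n) p \<bullet> b) * (grad (f n) p \<bullet> b))" by (rule sum.swap)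
		finally show ?thesis by (simp add: euclidean_inner[symmetric])
	qed
	have B: "?W p \<bullet> Q a (P p b) p = 0" if "p \<in> M" for p a b using F0_normal(2)[OF that F0[of p]] by (simp add: Q_Tan[OF that])
	have 1: "(LINT p|vM. (\<Sum>b\<in>Basis. Dn ?W p b \<bullet> Dn ?W p b) - (\<Sum>b\<in>Basis. \<Sum>a\<in>Basis. (?W p \<bullet> Q a (P p b) p)^2)) =
			(LINT p|vM. (\<Sum>n<N. grad (f n) p \<bullet> grad (f n) p))"
		by (rule int_cong[OF refl]) (simp add: D B)
	also have "... = (\<Sum>n<N. LINT p|vM. grad (f n) p \<bullet> grad (f n) p)"
		by (rule Bochner_Integration.integral_sum) (simp add: smooth_integrable smooth_fun_inner smooth_grad f)
	finally have 1: "(LINT p|vM. (\<Sum>b\<in>Basis. Dn ?W p b \<bullet> Dn ?W p b) - (\<Sum>b\<in>Basis. \<Sum>a\<in>Basis. (?W p \<bullet> Q a (P p b) p)^2)) =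
			(\<Sum>n<N. LINT p|vM. grad (f n) p \<bullet> grad (f n) p)" .
	have "(LINT p|vM. Cw ?W p) = (LINT p|vM. (\<Sum>j<N. \<Sum>l<N. f j p * xiO (w j) (w l) p (grad (f l) p)))"
		by (rule int_cong[OF refl]) (simp add: Cw_combination)
	also have "... = (\<Sum>j<N. \<Sum>l<N. LINT p|vM. f j p * xiO (w j) (w l) p (grad (f l) p))"
		by (subst Bochner_Integration.integral_sum)
			(auto intro!: sum.cong Bochner_Integration.integral_sum Bochner_Integration.integrable_sum smooth_fun_sum smooth_integrable xi)
	finally show ?thesis using F_stability[OF W] 1 C_term_parallel[OF par W(1) F_section_normal[OF _ W(2)]] by simp
qed

end

text \<open>Write x(g) for \<xi> applied to grad g. Tested on f w and g w', the vanishing of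
  \<open>CO\<close> makes f x(g) - g x(f) + f g S integrate to 0 for all f, g, with the local
  \<open>S\<close>. This forces x = 0, and the coordinates of \<phi> have enough gradients to
  conclude.\<close>

lemma xi_zero:
	assumes C: "\<forall>W. smooth W \<longrightarrow> (\<forall>p\<in>M. CO W p = 0)"
		and w: "w \<in> F0" "w' \<in> F0" and p: "p \<in> M"
	shows "xiO w w' p u = 0"
proof -
	define x where "x g q = xiO w w' q (grad g q)" for g q
	define S where "S q = nabla_form \<Omega> (\<phi> q) w (w' # frm q) + nabla_form \<Omega> (\<phi> q) w' (w # frm q)" for q
	have Ss: "smooth S" unfolding S_def[abs_def]
		by (intro smooth_fun_add smooth_frame_eval smooth_cov_Cons smooth_cov_nabla smooth_fun_const)
	have xs: "smooth (x g)" if g: "smooth g" for g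
	proof -
		have "smooth_cov CARD('m) (%q. deriv_cov CARD('m) (%v. (grad g q \<bullet> v) *R w') (%us. \<Omega> (\<phi> q) (w # us)))"
			by (rule smooth_cov_deriv[OF smooth_cov_Cons[OF smooth_cov_Omega smooth_fun_const]])
				(auto intro!: linearI smooth_fun_scaleR smooth_fun_inner smooth_grad g simp: inner_add_right scaleR_add_left)
		from smooth_frame_eval[OF this] show ?thesis
		proof (rule smooth_fun_cong[THEN iffD1, rotated])
			fix q assume q: "q \<in> M"
			have lf: "length (frm q) = CARD('m)" using ortho_frameD(1)[OF frame[OF q]] .
			show "deriv_cov CARD('m) (%v. (grad g q \<bullet> v) *R w') (%us. \<Omega> (\<phi> q) (w # us)) (frm q) = x g q"
				unfolding x_def xi_eq[OF q w] deriv_cov_def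
				by (intro sum.cong refl) (simp add: linear_scale[OF covector_linear[OF covector_Cons[OF covector_Omega] lf]])
		qed
	qed
	have I: "(LINT q|vM. f q * x g q - g q * x f q + f q * g q * S q) = 0" if f: "smooth f" and g: "smooth g" for f g
	proof -
		let ?W = "%q. f q *R w" and ?W' = "%q. g q *R w'"
		have s: "smooth ?W" "smooth ?W'" by (simp_all add: smooth_fun_scaleR f g)
		have "CI ?W ?W' q = (f q * x g q - g q * x f q + f q * g q * S q) / 2" if q: "q \<in> M" for q
		proof -
			let ?fr = "frm q"
			have lf: "length ?fr = CARD('m)" using ortho_frameD(1)[OF frame[OF q]] .
			have n: "nor (%q. f q *R v) q' = f q' *R v" if "q' \<in> M" "v \<in> F0" for f v q'
				using F0_normal(1)[OF that] by (simp add: nor_def linear_scale[OF linear_P[OF that(1)]])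
			have D: "Dn (nor (%q. f q *R v)) q u = (u \<bullet> grad f q) *R v" if f: "smooth f" and v: "v \<in> F0" for f v u
			proof -
				have "Dn (nor (%q. f q *R v)) q u = Dn (%q. f q *R v) q u" by (rule Dn_cong[OF n[OF _ v] q])
				then show ?thesis using Dn_combination[of 1 "%_. v" "%_. f" q u] v f q by simp
			qed
			have X: "deriv_cov CARD('m) (%u. (u \<bullet> grad g q) *R v') (%us. \<Omega> (\<phi> q) (a *R v # us)) ?fr = a * xiO v v' q (grad g q)"
				if v: "v \<in> F0" "v' \<in> F0" for g a v v'
			proof -
				have "\<Omega> (\<phi> q) (a *R v # ?fr[i := b *R v']) = a * (b * \<Omega> (\<phi> q) (v # ?fr[i := v']))" if "i < CARD('m)" for i b
					using linear_scale[OF covector_append_linear[OF covector_Omega, of "[]"]] lf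
						linear_scale[OF covector_linear[OF covector_Cons[OF covector_Omega] lf that]] by simp
				then show ?thesis
					unfolding deriv_cov_def xi_eq[OF q v] sum_distrib_left by (intro sum.cong refl) (simp add: inner_commute)
			qed
			have nb: "nabla_form \<Omega> (\<phi> q) (a *R v) (b *R v' # ?fr) = a * b * nabla_form \<Omega> (\<phi> q) v (v' # ?fr)" for a b v v'
				using linear_scale[OF nabla_form_linear, of "b *R v' # ?fr"] lf
					linear_scale[OF covector_append_linear[OF covector_nabla_form, of "[]" ?fr]] by simp
			show ?thesis unfolding C_integrand_eq[OF s q] n[OF q w(1)] n[OF q w(2)] nb
				using X[OF w(1,2)] X[OF w(2,1)] D[OF f w(1)] D[OF g w(2)] xi_swap[OF q w(2,1)]
				by (simp add: x_def S_def deriv_cov_def algebra_simps add_divide_distrib diff_divide_distrib)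
		qed
		then have "(LINT q|vM. CI ?W ?W' q) = (LINT q|vM. (f q * x g q - g q * x f q + f q * g q * S q) / 2)"
			by (intro int_cong) auto
		moreover have "(LINT q|vM. CI ?W ?W' q) = (LINT q|vM. 0)"
			unfolding integral_C_Omega[OF s, symmetric] by (rule int_cong) (use C s in auto)
		ultimately show ?thesis by simp
	qed
	have x0: "x f q = 0" if f: "smooth f" and q: "q \<in> M" for f q
	proof -
		note xf = xs[OF f]
		have fg: "smooth (%q. f q * x f q)" by (intro smooth_fun_mult f xf)
		have x1: "x (%q. f q * x f q) r = f r * x (x f) r + x f r * x f r" and x2: "x (%q. 1) r = 0" if r: "r \<in> M" for r
		proof -
			have "grad (%q. f q * x f q) r = f r *R grad (x f) r + x f r *R grad f r"
				using pd_mult[OF f xf r] by (simp add: grad_def scaleR_add_left sum.distrib scaleR_sum_right mult.commute)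
			then show "x (%q. f q * x f q) r = f r * x (x f) r + x f r * x f r"
				using linear_add[OF linear_xi[OF r]] linear_scale[OF linear_xi[OF r]] by (simp add: x_def[of "%q. f q * x f q"] x_def[of "x f"])
					(simp add: x_def)
			show "x (%q. 1) r = 0" using linear_0[OF linear_xi[OF r]] by (simp add: x_def grad_def)
		qed
		\<comment> \<open>The identity for the pairs (f, x f) and (1, f x f): the S-terms and the terms
		  with x (x f) cancel in the difference, leaving 2 (x f)^2.\<close>
		let ?a = "%r. f r * x (x f) r - x f r * x f r + f r * x f r * S r" and
			?b = "%r. 1 * x (%q. f q * x f q) r - (f r * x f r) * x (%q. 1) r + 1 * (f r * x f r) * S r"
		have i: "integrable vM ?a" "integrable vM ?b" by (intro smooth_integrable smooth_fun_intros f xf Ss xs fg)+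
		have "(LINT r|vM. ?b r - ?a r) = 0"
			by (subst Bochner_Integration.integral_diff[OF i(2,1)]) (use I[OF smooth_fun_const fg, of 1] I[OF f xf] in simp)
		also have "(LINT r|vM. ?b r - ?a r) = (LINT r|vM. 2 * (x f r)^2)"
			by (rule int_cong) (auto simp: x1 x2 power2_eq_square)
		finally have "2 * (x f q)^2 = 0"
			by (intro integral_nonneg_eq_0[OF smooth_fun_continuous _ _ q, of "%q. 2 * (x f q)^2"])
				(simp_all add: power2_eq_square smooth_fun_mult xf)
		then show ?thesis by simp
	qed
	have "grad (%q. \<phi> q \<bullet> u) p = P p u"
	proof -
		have "pd b (%q. \<phi> q \<bullet> u) p = P p u \<bullet> b" for b
			using pd_inner[OF smooth_phi smooth_fun_const p, of b u] pd_phi[OF p, of b] P_sym[OF p, of b u] by (simp add: inner_commute)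
		then show ?thesis by (simp add: grad_def euclidean_representation)
	qed
	moreover have "xiO w w' p (P p u) = xiO w w' p u"
	proof -
		have "P p u \<bullet> frm p ! i = u \<bullet> frm p ! i" if "i < CARD('m)" for i
			using P_sym[OF p, of u] P_id[OF p ortho_frameD(4)[OF frame[OF p] that]] by simp
		then show ?thesis by (simp add: xi_def Let_def)
	qed
	ultimately show ?thesis using x0[of "%q. \<phi> q \<bullet> u" p] p by (simp add: x_def smooth_fun_inner smooth_phi)
qed

end


text \<open>Discriminant argument with t = c / a; if a = 0, a large multiple of 1 / c forces c =
  0.\<close>

lemma quadratic_nonneg_imp:
	fixes a b c :: real
	assumes "\<And>t. 2 * t * c \<le> t^2 * a + b" "0 \<le> a" "0 \<le> b"
	shows "c \<le> sqrt a * sqrt b"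
proof -
	have "c^2 \<le> a * b"
	proof (cases "a = 0")
		case True
		have "c = 0"
		proof (rule ccontr)
			assume "c \<noteq> 0"
			then have "2 * ((b + 1) / (2 * c)) * c = b + 1" by simp
			then show False using assms(1)[of "(b + 1) / (2 * c)"] True by simp
		qed
		then show ?thesis using True by simp
	next
		case False
		then have "2 * (c^2 / a) \<le> c^2 / a + b" using assms(1)[of "c / a"] by (simp add: power2_eq_square power_divide)
		then show ?thesis using False assms(2) by (simp add: field_simps)
	qed
	then show ?thesis by (simp add: real_le_rsqrt real_sqrt_mult[symmetric])
qed

section \<open>The forms \<omega> and their inequalities\<close>

context stable_immersion_trivial
begin

lemma forms_eta:
	assumes Ws: "length Ws = N" "orthonormal Ws" "span (set Ws) = {w. \<forall>x\<in>V. \<forall>y\<in>V. w \<bullet> (x - y) = 0}"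
	obtains \<eta> :: "nat => nat => 'e => 'e => real"
	where "\<And>i j. bounded_bilinear (\<eta> i j)" "\<And>i j u v. \<eta> i j u v = - \<eta> i j v u" "\<And>i j u v. \<eta> i j u v = - \<eta> j i u v"
		"\<And>i j p u. i < N ==> j < N ==> 2 \<le> CARD('m) ==> p \<in> M ==> u \<in> TM p ==>
			xiO (Ws ! i) (Ws ! j) p u = codiff A \<phi> (%p. \<eta> i j) p u"
		"\<And>f :: nat => 'p => real. (\<And>l. l < N ==> smooth (f l)) ==> 0 \<le> (\<Sum>l<N. LINT p|vM. grad (f l) p \<bullet> grad (f l) p) +
			real CARD('m) * k * (\<Sum>i<N. \<Sum>j<N. LINT p|vM. \<eta> i j (grad (f i) p) (grad (f j) p))"
proof -
	have w: "Ws ! l \<in> F0" if "l < N" for l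
		using span_superset[of "set Ws"] nth_mem[of l Ws] that Ws(1) unfolding Ws(3) F0_V by blast
	have "2 \<le> CARD('m) ==> parallel_form (CARD('m) + 1) \<Omega> \<or>
			(\<forall>i<N. \<forall>j<N. \<forall>p\<in>M. \<forall>u. xiO (Ws ! i) (Ws ! j) p u = 0)"
		using Omega xi_zero w by blast
	then consider "2 \<le> CARD('m) \<longrightarrow> (\<forall>i<N. \<forall>j<N. \<forall>p\<in>M. \<forall>u. xiO (Ws ! i) (Ws ! j) p u = 0)"
		| "parallel_form (CARD('m) + 1) \<Omega>" "2 \<le> CARD('m)" by blast
	then show thesis
	proof cases
		\<comment> \<open>Either m = 1, where no co-exactness is claimed, or \<xi> = 0; the zero forms
		  serve in both situations.\<close>
		case 1
		have bb: "bounded_bilinear (%(u::'e) (v::'e). 0 :: real)"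
			unfolding bilinear_conv_bounded_bilinear[symmetric] bilinear_def by (simp add: linear_zero)
		show thesis
		proof (rule that[of "%_ _ _ _. 0", OF bb])
			show "xiO (Ws ! i) (Ws ! j) p u = codiff A \<phi> (%p u v. 0) p u"
				if "i < N" "j < N" "2 \<le> CARD('m)" "p \<in> M" "u \<in> TM p" for i j p u
				using codiff_constant[OF that(4) bb _ that(5)] 1 that by simp
		qed (auto intro!: sum_nonneg)
	next
		case 2
		let ?m = "real CARD('m)"
		\<comment> \<open>Undoes the factor -k (m - 1) of \<open>codiff_constant\<close>, nonzero as m >=
		  2.\<close>
		define c where "c = - (1 / (k * (?m - 1)))"
		have c: "- (k * (?m - 1)) * c = 1" using k_pos 2(2) by (simp add: c_def)
		obtain p0 where p0: "p0 \<in> M" using M_nonempty by blast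
		let ?E = "\<nu> p0 # frm p0"
		let ?eta = "%i j. eta (\<Omega> 0) ?E (Ws ! i) (Ws ! j)"
		\<comment> \<open>\<Omega> has constant coefficients, so its value at the origin and the frame at
		  the single point p0 define the form on all of M.\<close>
		define \<eta> where "\<eta> i j = eta (%us. c * \<Omega> 0 us) ?E (Ws ! i) (Ws ! j)" for i j
		have bb: "bounded_bilinear (\<eta> i j)" for i j unfolding \<eta>_def by (rule bounded_bilinear_eta)
		have e: "\<eta> i j u v = c * ?eta i j u v" for i j u v
			unfolding \<eta>_def eta_def sum_distrib_left by (intro sum.cong refl) simp
		have cov: "covector (length ?E) (\<Omega> 0)" using covector_Omega ortho_frameD(1)[OF frame[OF p0]] by simp
		have anti: "\<eta> i j u v = - \<eta> i j v u" "\<eta> i j u v = - \<eta> j i u v" for i j u v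
			unfolding e using eta_swap(2)[OF cov, of "Ws ! i" "Ws ! j" u v] eta_swap(1)[OF cov, of "Ws ! i" "Ws ! j" u v] by simp_all
		have xe: "xiO (Ws ! i) (Ws ! j) p u = - (k * (?m - 1)) * \<eta> i j (\<nu> p) u"
			if "i < N" "j < N" "p \<in> M" "u \<in> TM p" for i j p u
			unfolding e mult.assoc[symmetric] c using xi_eta[OF 2(1) that(3) p0 w[OF that(1)] w[OF that(2)] that(4), of 0] by simp
		have gT: "grad f p \<in> TM p" if "smooth f" "p \<in> M" for f p using P_in[OF that(2)] P_grad[OF that] by metis
		show thesis
		proof (rule that[of \<eta>, OF bb anti])
			show "xiO (Ws ! i) (Ws ! j) p u = codiff A \<phi> (%p. \<eta> i j) p u"
				if "i < N" "j < N" "2 \<le> CARD('m)" "p \<in> M" "u \<in> TM p" for i j p u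
				using codiff_constant[OF that(4) bb anti(1) that(5)] xe[OF that(1,2,4,5)] by simp
			fix f :: "nat => 'p => real" assume f: "\<And>l. l < N ==> smooth (f l)"
			let ?x = "%i j p. f i p * xiO (Ws ! i) (Ws ! j) p (grad (f j) p)"
			have xs: "?x i j p = - (k * (?m - 1)) * (f i p * \<eta> i j (\<nu> p) (grad (f j) p))" if "i < N" "j < N" "p \<in> M" for i j p
				using xe[OF that gT[OF f[OF that(2)] that(3)]] by simp
			have sm: "smooth (?x i j)" if "i < N" "j < N" for i j
			proof -
				have "smooth (%p. - (k * (?m - 1)) * (f i p * \<eta> i j (\<nu> p) (grad (f j) p)))"
					by (intro smooth_fun_mult smooth_fun_const f that smooth_fun_bilinear[OF smooth_nu smooth_grad[OF f[OF that(2)]] bb])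
				then show ?thesis by (rule smooth_fun_cong[THEN iffD1, rotated]) (rule xs[OF that, symmetric])
			qed
			\<comment> \<open>The factor -k (m - 1) of integration by parts is the one in \<open>xe\<close>,
			  so the C-term of stability becomes exactly the integral of \<eta> on gradients.\<close>
			have int: "(LINT p|vM. ?x i j p) = (LINT p|vM. \<eta> i j (grad (f i) p) (grad (f j) p))" if "i < N" "j < N" for i j
			proof -
				have "(LINT p|vM. ?x i j p) = (LINT p|vM. - (k * (?m - 1)) * (f i p * \<eta> i j (\<nu> p) (grad (f j) p)))"
					by (rule int_cong[OF refl]) (simp only: space_vM xs[OF that])
				then show ?thesis unfolding integral_form_grad[OF bb anti(1) f[OF that(1)] f[OF that(2)]] by simp
			qed
			have on: "Ws ! i \<bullet> Ws ! j = (if i = j then 1 else 0)" if "i < N" "j < N" for i j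
				using Ws(1,2) that by (simp add: orthonormal_def)
			have "0 \<le> (\<Sum>l<N. LINT p|vM. grad (f l) p \<bullet> grad (f l) p) + ?m * k * (\<Sum>i<N. \<Sum>j<N. LINT p|vM. ?x i j p)"
				by (rule combination_stability[of N "(!) Ws" f, OF w f 2(1) on sm])
			also have "(\<Sum>i<N. \<Sum>j<N. LINT p|vM. ?x i j p) = (\<Sum>i<N. \<Sum>j<N. LINT p|vM. \<eta> i j (grad (f i) p) (grad (f j) p))"
				by (intro sum.cong refl int) auto
			finally show "0 \<le> (\<Sum>l<N. LINT p|vM. grad (f l) p \<bullet> grad (f l) p) +
					?m * k * (\<Sum>i<N. \<Sum>j<N. LINT p|vM. \<eta> i j (grad (f i) p) (grad (f j) p))" .
		qed
	qed
qed

lemma forms_exist: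
	assumes Ws: "length Ws = N" "orthonormal Ws" "span (set Ws) = {w. \<forall>x\<in>V. \<forall>y\<in>V. w \<bullet> (x - y) = 0}"
	shows "\<exists>(\<omega> :: nat => nat => 'p => 'e => 'e => real) \<kappa>.
		(\<forall>p\<in>M. norm (mcv p) = \<kappa>) \<and>
		(\<forall>i<N. \<forall>j<N. two_form M A \<phi> (\<omega> i j) \<and>
			(2 \<le> CARD('m) \<longrightarrow> (\<forall>p\<in>M. \<forall>u\<in>TM p. xiO (Ws ! i) (Ws ! j) p u = codiff A \<phi> (\<omega> i j) p u))) \<and>
		(\<forall>f :: nat => 'p => real. (\<forall>i<N. smooth (f i)) \<longrightarrow>
			(\<Sum>j<N. \<Sum>i<j. - 2 * real CARD('m) * \<kappa> * (LINT p|vM. inner_two_form A \<phi> (\<omega> i j) (wedge_d A \<phi> (f i) (f j)) p))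
			\<le> (\<Sum>i<N. LINT p|vM. (norm_df A \<phi> (f i) p)^2)) \<and>
		(\<forall>i<N. \<forall>j<N. \<forall>f k. smooth f \<longrightarrow> smooth k \<longrightarrow>
			2 * real CARD('m) * \<kappa> * \<bar>\<integral>p. inner_two_form A \<phi> (\<omega> i j) (wedge_d A \<phi> f k) p \<partial>vM\<bar>
				\<le> (LINT p|vM. (norm_df A \<phi> f p)^2 + (norm_df A \<phi> k p)^2) \<and>
			real CARD('m) * \<kappa> * \<bar>\<integral>p. \<omega> i j p (gradient A \<phi> f p) (gradient A \<phi> k p) \<partial>vM\<bar>
				\<le> sqrt (LINT p|vM. (norm (gradient A \<phi> f p))^2) * sqrt (LINT p|vM. (norm (gradient A \<phi> k p))^2))"
proof -
	obtain \<eta> :: "nat => nat => 'e => 'e => real"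
		where bb: "\<And>i j. bounded_bilinear (\<eta> i j)" and anti: "\<And>i j u v. \<eta> i j u v = - \<eta> i j v u" "\<And>i j u v. \<eta> i j u v = - \<eta> j i u v"
			and xi: "\<And>i j p u. i < N ==> j < N ==> 2 \<le> CARD('m) ==> p \<in> M ==> u \<in> TM p ==>
				xiO (Ws ! i) (Ws ! j) p u = codiff A \<phi> (%p. \<eta> i j) p u"
			and stab: "\<And>f :: nat => 'p => real. (\<And>l. l < N ==> smooth (f l)) ==> 0 \<le> (\<Sum>l<N. LINT p|vM. grad (f l) p \<bullet> grad (f l) p) +
				real CARD('m) * k * (\<Sum>i<N. \<Sum>j<N. LINT p|vM. \<eta> i j (grad (f i) p) (grad (f j) p))"
		proof (rule forms_eta[OF Ws], goal_cases)
			case (1 \<eta>)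
			show ?case by (rule that[OF 1(2-6)])
		qed
	let ?c = "real CARD('m) * k"
	define J where "J i j f g = (LINT p|vM. \<eta> i j (grad f p) (grad g p))" for i j f g
	define E where "E f = (LINT p|vM. grad f p \<bullet> grad f p)" for f
	have J: "(LINT p|vM. inner_two_form A \<phi> (%p. \<eta> i j) (wedge_d A \<phi> f g) p) = J i j f g" if "smooth f" "smooth g" for i j f g
		unfolding J_def by (rule int_cong[OF refl])
			(simp add: inner_two_form_eq[where \<omega>="%p. \<eta> i j", OF that _ bb anti(1)])
	have J': "(LINT p|vM. \<eta> i j (gradient A \<phi> f p) (gradient A \<phi> g p)) = J i j f g" if "smooth f" "smooth g" for i j f g
		unfolding J_def by (rule int_cong) (use that in \<open>auto simp: gradient_eq(1)\<close>)
	have E: "(LINT p|vM. (norm_df A \<phi> f p)^2) = E f" "(LINT p|vM. (norm (gradient A \<phi> f p))^2) = E f" if "smooth f" for f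
		unfolding E_def by (rule int_cong; use that in \<open>simp add: gradient_eq power2_norm_eq_inner\<close>)+
	have E2: "(LINT p|vM. (norm_df A \<phi> f p)^2 + (norm_df A \<phi> g p)^2) = E f + E g" if "smooth f" "smooth g" for f g
	proof -
		have "(LINT p|vM. (norm_df A \<phi> f p)^2 + (norm_df A \<phi> g p)^2) = (LINT p|vM. grad f p \<bullet> grad f p + grad g p \<bullet> grad g p)"
			by (rule int_cong) (use that in \<open>auto simp: gradient_eq(2)\<close>)
		then show ?thesis unfolding E_def using that by (simp add: smooth_integrable smooth_fun_inner smooth_grad)
	qed
	have E0: "0 \<le> E f" for f unfolding E_def by (rule Bochner_Integration.integral_nonneg) simp
	have Jsym: "J i j f g = J j i g f" for i j f g
		unfolding J_def by (rule int_cong[OF refl]) (metis anti)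
	have J0: "J i i f g = 0" for i f g
	proof -
		have "\<eta> i i u v = 0" for u v using anti(2)[of i i u v] by simp
		then show ?thesis by (simp add: J_def)
	qed
	have gs: "grad (%q. t * f q) p = t *R grad f p" if "smooth f" "p \<in> M" for t f p
		using pd_mult[OF smooth_fun_const that] by (simp add: grad_def scaleR_sum_right)
	have Js: "J i j (%q. t * f q) g = t * J i j f g" and Es: "E (%q. t * f q) = t^2 * E f" if f: "smooth f" for i j t f g
	proof -
		have "J i j (%q. t * f q) g = (LINT p|vM. t * \<eta> i j (grad f p) (grad g p))"
			unfolding J_def by (rule int_cong) (auto simp: gs[OF f] bounded_bilinear.scaleR_left[OF bb])
		then show "J i j (%q. t * f q) g = t * J i j f g" by (simp add: J_def)
		have "E (%q. t * f q) = (LINT p|vM. t^2 * (grad f p \<bullet> grad f p))"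
			unfolding E_def by (rule int_cong) (auto simp: gs[OF f] power2_eq_square)
		then show "E (%q. t * f q) = t^2 * E f" by (simp add: E_def)
	qed
	have two: "- 2 * ?c * J i j f g \<le> E f + E g"
		if ab: "i < N" "j < N" and fg: "smooth f" "smooth g" for i j f g
	proof (cases "i = j")
		case True
		then show ?thesis using E0[of f] E0[of g] by (simp add: J0)
	next
		case False
		\<comment> \<open>Stability for a section with at most two nonzero coefficients isolates a single
		  pair of indices.\<close>
		define F where "F l = (if l = i then f else if l = j then g else (%_. 0))" for l :: nat
		have g0: "grad (F l) p = 0" if "l \<notin> {i, j}" for l p using that by (simp add: F_def grad_def)
		have sub: "{i, j} \<subseteq> {..<N}" using ab by simp
		have r: "(\<Sum>l<N. h' l) = h' i + h' j" if "\<And>l. l \<notin> {i, j} ==> h' l = 0" for h' :: "nat => real"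
			using sum.mono_neutral_right[OF _ sub, of h'] that False by auto
		have z: "J l n (F l) (F n) = 0" if "l \<notin> {i, j} \<or> n \<notin> {i, j}" for l n
			using that g0 bounded_bilinear.zero_left[OF bb] bounded_bilinear.zero_right[OF bb] unfolding J_def by auto
		have "0 \<le> (\<Sum>l<N. E (F l)) + ?c * (\<Sum>l<N. \<Sum>n<N. J l n (F l) (F n))"
			unfolding E_def J_def using fg by (intro stab) (auto simp: F_def)
		also have "(\<Sum>l<N. E (F l)) = E f + E g"
			using r[of "%l. E (F l)"] False by (simp add: E_def g0) (simp add: F_def)
		also have "(\<Sum>l<N. \<Sum>n<N. J l n (F l) (F n)) = J i j f g + J j i g f"
		proof -
			have "(\<Sum>n<N. J l n (F l) (F n)) = J l i (F l) (F i) + J l j (F l) (F j)" for l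
				by (rule r) (simp add: z)
			then have "(\<Sum>l<N. \<Sum>n<N. J l n (F l) (F n)) = (\<Sum>l<N. J l i (F l) (F i) + J l j (F l) (F j))" by simp
			also have "... = (J i i (F i) (F i) + J i j (F i) (F j)) + (J j i (F j) (F i) + J j j (F j) (F j))"
				by (rule r) (simp add: z)
			finally show ?thesis using False by (simp add: J0 F_def)
		qed
		finally show ?thesis using Jsym[of j i g f] by (simp add: algebra_simps)
	qed
	\<comment> \<open>The bound \<open>two\<close> for f and for -f.\<close>
	have abs: "2 * ?c * \<bar>J i j f g\<bar> \<le> E f + E g"
		if "i < N" "j < N" "smooth f" "smooth g" for i j f g
		using two[OF that] two[OF that(1,2) smooth_fun_mult[OF smooth_fun_const that(3)] that(4), of "-1"] Js[OF that(3), of i j "-1" g]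
			Es[OF that(3), of "-1"] by (simp add: abs_if)
	\<comment> \<open>The bound \<open>abs\<close> for t f and g, optimised over t.\<close>
	have prod: "?c * \<bar>J i j f g\<bar> \<le> sqrt (E f) * sqrt (E g)"
		if ab: "i < N" "j < N" and fg: "smooth f" "smooth g" for i j f g
	proof (rule quadratic_nonneg_imp[OF _ E0 E0])
		fix t :: real
		have "2 * ?c * (\<bar>t\<bar> * \<bar>J i j f g\<bar>) \<le> t^2 * E f + E g"
			using abs[OF ab smooth_fun_mult[OF smooth_fun_const fg(1), of t] fg(2)] by (simp add: Js[OF fg(1)] Es[OF fg(1)] abs_mult)
		moreover have "2 * t * (?c * \<bar>J i j f g\<bar>) \<le> 2 * ?c * (\<bar>t\<bar> * \<bar>J i j f g\<bar>)"
			using mult_right_mono[OF abs_ge_self[of t], of "2 * ?c * \<bar>J i j f g\<bar>"] k_pos by (simp add: mult_ac)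
		ultimately show "2 * t * (?c * \<bar>J i j f g\<bar>) \<le> t^2 * E f + E g" by linarith
	qed
	have sum: "(\<Sum>j<N. \<Sum>i<j. - 2 * real CARD('m) * k * J i j (f i) (f j)) \<le> (\<Sum>i<N. E (f i))"
		if f: "\<forall>i<N. smooth (f i)" for f
	proof -
		have "0 \<le> (\<Sum>l<N. E (f l)) + ?c * (\<Sum>i<N. \<Sum>j<N. J i j (f i) (f j))"
			unfolding E_def J_def using f by (intro stab) auto
		also have "(\<Sum>i<N. \<Sum>j<N. J i j (f i) (f j)) = 2 * (\<Sum>j<N. \<Sum>i<j. J i j (f i) (f j))"
			by (rule double_sum_symmetric) (rule Jsym, rule J0)
		finally show ?thesis unfolding sum_distrib_left[symmetric] by simp
	qed
	show ?thesis
	proof (intro exI[of _ "%i j p. \<eta> i j"] exI[of _ k] conjI allI impI ballI)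
		show "norm (mcv p) = k" if "p \<in> M" for p using kappa_eq[OF that] by (simp add: \<kappa>_def)
		show "two_form M A \<phi> (%p. \<eta> i j)" for i j by (rule two_form_constant[OF bb anti(1)])
		show "xiO (Ws ! i) (Ws ! j) p u = codiff A \<phi> (%p. \<eta> i j) p u"
			if "i < N" "j < N" "2 \<le> CARD('m)" "p \<in> M" "u \<in> TM p" for i j p u by (rule xi[OF that])
		fix f :: "nat => 'p => real" assume f: "\<forall>i<N. smooth (f i)"
		have "(\<Sum>j<N. \<Sum>i<j. - 2 * real CARD('m) * k * (LINT p|vM. inner_two_form A \<phi> (%p. \<eta> i j) (wedge_d A \<phi> (f i) (f j)) p)) =
				(\<Sum>j<N. \<Sum>i<j. - 2 * real CARD('m) * k * J i j (f i) (f j))"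
			by (intro sum.cong refl) (use f J in auto)
		moreover have "(\<Sum>i<N. LINT p|vM. (norm_df A \<phi> (f i) p)^2) = (\<Sum>i<N. E (f i))"
			by (intro sum.cong refl) (use f E in auto)
		ultimately show "(\<Sum>j<N. \<Sum>i<j. - 2 * real CARD('m) * k *
				(LINT p|vM. inner_two_form A \<phi> (%p. \<eta> i j) (wedge_d A \<phi> (f i) (f j)) p)) \<le> (\<Sum>i<N. LINT p|vM. (norm_df A \<phi> (f i) p)^2)"
			using sum[OF f] by simp
	next
		fix i j and f g :: "'p => real" assume a: "i < N" "j < N" and fg: "smooth f" "smooth g"
		show "2 * real CARD('m) * k * \<bar>\<integral>p. inner_two_form A \<phi> (%p. \<eta> i j) (wedge_d A \<phi> f g) p \<partial>vM\<bar>
				\<le> (LINT p|vM. (norm_df A \<phi> f p)^2 + (norm_df A \<phi> g p)^2)"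
			unfolding J[OF fg] E2[OF fg] using abs[OF a fg] by (simp add: mult.assoc)
		show "real CARD('m) * k * \<bar>\<integral>p. \<eta> i j (gradient A \<phi> f p) (gradient A \<phi> g p) \<partial>vM\<bar>
				\<le> sqrt (LINT p|vM. (norm (gradient A \<phi> f p))^2) * sqrt (LINT p|vM. (norm (gradient A \<phi> g p))^2)"
			unfolding J'[OF fg] E(2)[OF fg(1)] E(2)[OF fg(2)] by (rule prod[OF a fg])
	qed
qed


end

theorem theorem4p2:
  fixes M :: "'p::t2_space set"
    and A :: "('p, real ^ 'm::{finite,wellorder}) chart set"
    and \<phi> \<nu> :: "'p \<Rightarrow> 'e::euclidean_space"
    and \<Omega> :: "'e \<Rightarrow> 'e list \<Rightarrow> real"
    and n :: nat
  assumes dim: "DIM('e) = CARD('m) + n"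
    and precal: "pre_calibration (CARD('m) + 1) \<Omega>"
    and Omega: "parallel_form (CARD('m) + 1) \<Omega> \<or>
                (\<forall>W. smooth_fun A W \<longrightarrow> (\<forall>p\<in>M. C_Omega M A \<phi> \<Omega> W p = 0))"
    and M: "closed_manifold M A" "oriented_atlas A" "immersion A \<phi>"
    and pmc: "parallel_section M A \<phi> (mean_curvature A \<phi>)"
    and ext: "calibrated_extended_tangent M A \<phi> \<Omega> \<nu>"
    and stable: "Omega_stable M A \<phi> \<Omega> \<nu>"
    and S: "(\<integral>p. height_S A \<phi> \<nu> p * (2 + height \<phi> \<nu> p * norm (mean_curvature A \<phi> p)) \<partial>dM M A \<phi>) \<le> 0"
  shows
    "pseudo_umbilical M A \<phi> \<and>
     (\<exists>(M' :: ('p \<times> real) set) (A' :: ('p \<times> real, (real ^ 'm::{finite,wellorder}) \<times> real) chart set) \<psi> \<iota>.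
        extension M A \<phi> \<nu> M' A' \<psi> \<iota> \<and>
        (parallel_form (CARD('m) + 1) \<Omega> \<longrightarrow> calibrated_submanifold \<Omega> M' A' \<psi>) \<and>
        minimal M' A' \<psi> \<and>
        (\<forall>p\<in>M. ricci A' \<psi> (\<iota> p) (\<nu> p) (\<nu> p) = - (norm (second_ff A' \<psi> (\<iota> p) (\<nu> p) (\<nu> p)))\<^sup>2 \<and>
               - (norm (second_ff A' \<psi> (\<iota> p) (\<nu> p) (\<nu> p)))\<^sup>2 = 0)) \<and>
     (\<forall>p\<in>M. height_S A \<phi> \<nu> p = 0) \<and>
     (trivial_normal_bundle M A \<phi> \<longrightarrow>
       (\<exists>V c r. affine V \<and> aff_dim V = int (CARD('m) + 1) \<and>
          (\<exists>(A' :: ('e, (real ^ 'm::{finite,wellorder}) \<times> real) chart set) \<iota>.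
             extension M A \<phi> \<nu> V A' (\<lambda>x. x) \<iota> \<and>
             (parallel_form (CARD('m) + 1) \<Omega> \<longrightarrow> calibrated_submanifold \<Omega> V A' (\<lambda>x. x)) \<and>
             minimal V A' (\<lambda>x. x)) \<and>
          c \<in> V \<and> 0 < r \<and> inj_on \<phi> M \<and> \<phi> ` M = V \<inter> sphere c r \<and>
            (\<forall>Ws. length Ws = n - 1 \<and> orthonormal Ws \<and>
                  span (set Ws) = {w. \<forall>x\<in>V. \<forall>y\<in>V. w \<bullet> (x - y) = 0} \<longrightarrow>
              (\<exists>(\<omega> :: nat \<Rightarrow> nat \<Rightarrow> 'p \<Rightarrow> 'e \<Rightarrow> 'e \<Rightarrow> real) \<kappa>.
                 (\<forall>p\<in>M. norm (mean_curvature A \<phi> p) = \<kappa>) \<and>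
                 (\<forall>\<alpha><n - 1. \<forall>\<beta><n - 1. two_form M A \<phi> (\<omega> \<alpha> \<beta>) \<and>
                    (2 \<le> CARD('m) \<longrightarrow> (\<forall>p\<in>M. \<forall>u\<in>Tan A \<phi> p.
                       xi A \<phi> \<Omega> (Ws ! \<alpha>) (Ws ! \<beta>) p u = codiff A \<phi> (\<omega> \<alpha> \<beta>) p u))) \<and>
                 (\<forall>f :: nat \<Rightarrow> 'p \<Rightarrow> real. (\<forall>\<alpha><n - 1. smooth_fun A (f \<alpha>)) \<longrightarrow>
                    (\<Sum>\<beta><n - 1. \<Sum>\<alpha><\<beta>. - 2 * real CARD('m) * \<kappa> *
                        (\<integral>p. inner_two_form A \<phi> (\<omega> \<alpha> \<beta>) (wedge_d A \<phi> (f \<alpha>) (f \<beta>)) p \<partial>dM M A \<phi>))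
                    \<le> (\<Sum>\<alpha><n - 1. \<integral>p. (norm_df A \<phi> (f \<alpha>) p)\<^sup>2 \<partial>dM M A \<phi>)) \<and>
                 (\<forall>\<alpha><n - 1. \<forall>\<beta><n - 1. \<forall>f k. smooth_fun A f \<longrightarrow> smooth_fun A k \<longrightarrow>
                    2 * real CARD('m) * \<kappa> *
                      \<bar>\<integral>p. inner_two_form A \<phi> (\<omega> \<alpha> \<beta>) (wedge_d A \<phi> f k) p \<partial>dM M A \<phi>\<bar>
                      \<le> (\<integral>p. (norm_df A \<phi> f p)\<^sup>2 + (norm_df A \<phi> k p)\<^sup>2 \<partial>dM M A \<phi>) \<and>
                    real CARD('m) * \<kappa> *
                      \<bar>\<integral>p. \<omega> \<alpha> \<beta> p (gradient A \<phi> f p) (gradient A \<phi> k p) \<partial>dM M A \<phi>\<bar>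
                      \<le> sqrt (\<integral>p. (norm (gradient A \<phi> f p))\<^sup>2 \<partial>dM M A \<phi>) *
                        sqrt (\<integral>p. (norm (gradient A \<phi> k p))\<^sup>2 \<partial>dM M A \<phi>))))))"
proof -
	interpret stable_immersion_S M A \<phi> \<Omega> \<nu>
		by unfold_locales (use assms in \<open>simp_all add: pre_calibration_def\<close>)
	show ?thesis
	proof (intro conjI umbilical ballI height_S_0 impI, goal_cases)
		case 1
		show ?case by (rule exI[of _ cyl], rule exI[of _ cyl_atlas],
					rule exI[of _ "\<lambda>x. cen + (1 + snd x) *\<^sub>R (\<phi> (fst x) - cen)"], rule exI[of _ "\<lambda>p. (p, 0)"])
				(intro conjI extension_cone impI calibrated_cone minimal_cone ballI; simp add: ricci_cone second_ff_cone_nu)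
	next
		case 3
		then interpret stable_immersion_trivial M A \<phi> \<Omega> \<nu> by unfold_locales
		have "0 < 1 / k" using k_pos by simp
		then show ?case
			by (intro exI[of _ V] exI[of _ cen] exI[of _ "1 / k"] conjI affine_V aff_dim_V flat_extension cen_V phi_inj phi_image
					allI impI forms_exist) simp_all
	qed
qed

end
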